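(* Let $(X,Y,x_0,d,\mathfrak p)$ and $(X',Y',x'_0,d',\mathfrak p')$ be pointed pairs of metric subanalytic germs. (1) Let $f,g:(X,Y,x_0,d,\mathfrak p)\to(X',Y',x_0',d',\mathfrak p')$ be l.v.a. subanalytic maps of pointed pairs such that there exists a continuous subanalytic mapping $H:(X,Y)\times I\to(X',Y')$ with $H_0=f$ and $H_1=g$ satisfying that there exists a uniform constant $K>0$ such that for every $s$ the mapping $H_s=H(-,s)$ is l.v.a. for the constant $K$. Then $f_k^\infty,g_k^\infty:MD\pi_k^\infty(X,Y,\mathfrak p)\to MD\pi_k^\infty(X',Y',\mathfrak p')$ are the same map for any $k$. (2) Moreover, if $f$ and $g$ are metrically homotopic, then $f_k^b,g_k^b:MD\pi_k^b(X,Y,\mathfrak p)\to MD\pi_k^b(X',Y',\mathfrak p')$ are equal for any $k$ and any $b\in(0,\infty]$.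
   Context: Germs. "Subanalytic" means globally subanalytic. A metric subanalytic germ $(X,x_0,d)$ is the germ at $x_0$ of a bounded subanalytic set $X\subset\mathbb R^m$ with $x_0\in\overline X$ (possibly $x_0\notin X$), together with a subanalytic metric $d$ on $X$ inducing the Euclidean topology (metrics bi-Lipschitz equivalent to such are also allowed). Subanalytic map germs are continuous and extend continuously and subanalytically to the vertex. A map germ $f:(X,x_0)\to(Y,y_0)$ is l.v.a. (linearly vertex approaching) with constant $K$ if $\frac1K\|x-x_0\|\le\|f(x)-y_0\|\le K\|x-x_0\|$ near $x_0$. A point in $X$ is a continuous l.v.a. subanalytic map germ $\mathfrak p:(0,\epsilon)\to X$. For $b\in(0,\infty)$, $\mathfrak p\sim_b\mathfrak q$ ($b$-equivalent) if $\lim_{t\to0}d(\mathfrak p(t),\mathfrak q(t))/t^b=0$; for $b=\infty$ this is read as equality of germs. A pointed pair $(X,Y,x_0,d,\mathfrak p)$ consists of $(X,x_0,d)$, a subanalytic subgerm $Y\subset X$ with the restricted metric, and a point $\mathfrak p$ in $Y$; maps of pointed pairs send $Y$ to $Y'$ and satisfy $f\circ\mathfrak p=\mathfrak p'$. Metric homotopy. Let $f,g$ be Lipschitz l.v.a. subanalytic maps of pointed pairs. A metric homotopy between them is a continuous subanalytic map $H:X\times I\to X'$ with $H_0=f$ and $H_1=g$ for which there is a uniform constant $K\ge0$ such that for any $s$ the map $H_s=H(-,s):(X,Y,x_0,d,\mathfrak p)\to(X',Y',x'_0,d',\mathfrak p')$ is a Lipschitz l.v.a. subanalytic map of pointed pairs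 with Lipschitz and l.v.a. constant $K$. If such $H$ exists, $f$ and $g$ are metrically homotopic. Weak $b$-maps. $I=[0,1]$; $C(I^n)=\{(tx,t):x\in I^n,t>0\}$ as a germ at the origin; $(y,t)$ denotes $(ty,t)$; $C(A)$ is the analogous cone over $A\subset I^n$. A point of $C(I^n)$ is normal if it has the form $t\mapsto(\alpha(t),t)$. For $b<\infty$, a weak $b$-map from a subanalytic germ $Z$ to $X$ is a finite collection $\{(C_j,f_j)\}$ with $\{C_j\}$ a finite closed subanalytic cover of $Z$ and $f_j:C_j\to X$ continuous l.v.a. subanalytic maps with $f_{j_1}\circ\mathfrak q\sim_b f_{j_2}\circ\mathfrak q$ for every point $\mathfrak q$ in $C_{j_1}\cap C_{j_2}$; two collections are identified if $f_j\circ\mathfrak q\sim_b f'_k\circ\mathfrak q$ for every point $\mathfrak q$ in $C_j\cap C'_k$. For $b=\infty$ it is a continuous l.v.a. subanalytic map germ. Loops and classes. $MD\Gamma_n^b(X,Y,\mathfrak p)$ is the set of weak $b$-maps $\varphi:C(I^n)\to X$ such that $\varphi\circ\mathfrak q$ is $b$-equivalent to a point of $Y$ for every point $\mathfrak q$ in $C(\partial I^n)$, and $\varphi\circ\mathfrak q\sim_b\mathfrak p$ for every normal point $\mathfrak q$ in $C(\partial I^n\setminus(I^{n-1}\times\{1\}))$. A weak $b$-homotopy from $\varphi_0$ to $\varphi_1$ is a weak $b$-map $H$ from $C(I^{n+1})$ restricting to $\varphi_s$ on $y_{n+1}=s$, $s=0,1$; with $\rho$ forgetting $y_{n+1}$,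 it is relative to $W$ if $H\circ\mathfrak q\sim_b\varphi_0\circ\rho\circ\mathfrak q$ for points $\mathfrak q$ in $\rho^{-1}(W)$. $MD\pi_n^b(X,Y,\mathfrak p)$ is the quotient of $MD\Gamma_n^b(X,Y,\mathfrak p)$ by weak $b$-homotopies relative to $C(\partial I^n\setminus(I^{n-1}\times\{1\}))$ sending every point of $\rho^{-1}(C(\partial I^n))$ to a point $b$-equivalent to a point of $Y$. A map $f$ (l.v.a. subanalytic if $b=\infty$, and also Lipschitz if $b<\infty$) of pointed pairs induces $f_n^b:[\{(C_j,f_j)\}]\mapsto[\{(C_j,f\circ f_j)\}]$.
   Formalization: In (1) the homotopy is also required to fix the base point (H_s∘p = p' for all s), and in (1) and (2) the conditions on the H_s hold on one neighbourhood of x_0 common to all s; without these the claim fails, e.g. when the base point runs around a loop in Y'. *)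

theory Defs
  imports "HOL-Analysis.Analysis"
begin

text \<open>
  Euclidean space of dimension \<open>n\<close> is the library's \<open>Euclidean_space n\<close>: sequences
  \<open>x :: nat \<Rightarrow> real\<close> with \<open>x i = 0\<close> for \<open>i \<ge> n\<close>.  Its topology is the usual one, but the
  metric-space instance on \<open>nat \<Rightarrow> real\<close> is not the Euclidean distance (and makes every set
  \<open>bounded\<close>), so distance and boundedness are spelled out below.
\<close>

type_synonym vec = "nat \<Rightarrow> real"

abbreviation Rn :: "nat \<Rightarrow> vec set" where
  "Rn n \<equiv> topspace (Euclidean_space n)"

abbreviation origin :: vec where
  "origin \<equiv> (\<lambda>_. 0)"

definition edist :: "nat \<Rightarrow> vec \<Rightarrow> vec \<Rightarrow> real" where
  "edist n x y = L2_set (\<lambda>i. x i - y i) {..<n}"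

definition ebounded :: "nat \<Rightarrow> vec set \<Rightarrow> bool" where
  "ebounded n A \<longleftrightarrow> (\<exists>r. \<forall>x\<in>A. edist n x origin \<le> r)"

definition nbd :: "nat \<Rightarrow> vec \<Rightarrow> real \<Rightarrow> vec set \<Rightarrow> vec set" where
  "nbd n a e A = {x \<in> A. edist n x a < e}"

text \<open>\<open>single\<close> identifies the real line with \<open>Rn 1\<close>; \<open>join m\<close> identifies
  \<open>Rn m \<times> Rn n\<close> with \<open>Rn (m + n)\<close>.\<close>

definition single :: "real \<Rightarrow> vec" where
  "single t = (\<lambda>i. if i = 0 then t else 0)"

definition join :: "nat \<Rightarrow> vec \<Rightarrow> vec \<Rightarrow> vec" where
  "join m x y = (\<lambda>i. if i < m then x i else y (i - m))"

definition proj :: "nat \<Rightarrow> vec \<Rightarrow> vec" where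
  "proj n x = (\<lambda>i. if i < n then x i else 0)"

definition graph :: "nat \<Rightarrow> (vec \<Rightarrow> vec) \<Rightarrow> vec set \<Rightarrow> vec set" where
  "graph m f D = (\<lambda>x. join m x (f x)) ` D"

definition real_analytic_at :: "nat \<Rightarrow> (vec \<Rightarrow> real) \<Rightarrow> vec \<Rightarrow> bool" where
  "real_analytic_at n f a \<longleftrightarrow>
     (\<exists>(c :: (nat \<Rightarrow> nat) \<Rightarrow> real) r. r > 0 \<and>
        (\<forall>x\<in>nbd n a r (Rn n).
           ((\<lambda>\<alpha>. c \<alpha> * (\<Prod>i<n. (x i - a i) ^ \<alpha> i)) has_sum f x) {\<alpha>. \<forall>i\<ge>n. \<alpha> i = 0}))"

definition semianalytic :: "nat \<Rightarrow> vec set \<Rightarrow> bool" where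
  "semianalytic n S \<longleftrightarrow> S \<subseteq> Rn n \<and>
     (\<forall>a\<in>Rn n. \<exists>U. openin (Euclidean_space n) U \<and> a \<in> U \<and>
        (\<exists>\<D>. finite \<D> \<and>
           (\<forall>(E, P)\<in>\<D>. finite E \<and> finite P \<and>
              (\<forall>h\<in>E \<union> P. \<forall>x\<in>U. real_analytic_at n h x)) \<and>
           S \<inter> U = (\<Union>(E, P)\<in>\<D>. {x \<in> U. (\<forall>h\<in>E. h x = 0) \<and> (\<forall>h\<in>P. h x > 0)})))"

definition subanalytic :: "nat \<Rightarrow> vec set \<Rightarrow> bool" where
  "subanalytic n S \<longleftrightarrow> S \<subseteq> Rn n \<and>
     (\<forall>a\<in>Rn n. \<exists>U. openin (Euclidean_space n) U \<and> a \<in> U \<and>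
        (\<exists>p A. semianalytic (n + p) A \<and> ebounded (n + p) A \<and> S \<inter> U = proj n ` A))"

text \<open>A set is globally subanalytic if it is subanalytic after compactifying the ambient space
  by the semialgebraic diffeomorphism \<open>x\<^sub>i \<mapsto> x\<^sub>i / sqrt (1 + x\<^sub>i\<^sup>2)\<close> onto an open cube.\<close>

definition globally_subanalytic :: "nat \<Rightarrow> vec set \<Rightarrow> bool" where
  "globally_subanalytic n S \<longleftrightarrow> S \<subseteq> Rn n \<and>
     subanalytic n ((\<lambda>x i. x i / sqrt (1 + (x i)\<^sup>2)) ` S)"

definition subanalytic_map ::
  "nat \<Rightarrow> vec set \<Rightarrow> nat \<Rightarrow> vec set \<Rightarrow> (vec \<Rightarrow> vec) \<Rightarrow> bool" where
  "subanalytic_map m D m' D' f \<longleftrightarrow> f ` D \<subseteq> D' \<and>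
     continuous_map (subtopology (Euclidean_space m) D) (Euclidean_space m') f \<and>
     globally_subanalytic (m + m') (graph m f D)"

definition lva_on ::
  "nat \<Rightarrow> vec set \<Rightarrow> vec \<Rightarrow> nat \<Rightarrow> vec \<Rightarrow> real \<Rightarrow> (vec \<Rightarrow> vec) \<Rightarrow> bool" where
  "lva_on m D x0 m' x0' K f \<longleftrightarrow> K > 0 \<and>
     (\<forall>x\<in>D. 1 / K * edist m x x0 \<le> edist m' (f x) x0' \<and> edist m' (f x) x0' \<le> K * edist m x x0)"

text \<open>Germs are handled through representatives: \<open>f\<close> is any total function, and the conditions
  are imposed on some neighbourhood of the vertex.  The upper l.v.a. bound forces the (continuous
  and subanalytic) extension to the vertex, so it is not a separate condition.\<close>

definition lva_germ ::
  "nat \<Rightarrow> vec set \<Rightarrow> vec \<Rightarrow> nat \<Rightarrow> vec set \<Rightarrow> vec \<Rightarrow> (vec \<Rightarrow> vec) \<Rightarrow> bool" where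
  "lva_germ m X x0 m' X' x0' f \<longleftrightarrow>
     (\<exists>e>0. \<exists>K. subanalytic_map m (nbd m x0 e X) m' X' f \<and> lva_on m (nbd m x0 e X) x0 m' x0' K f)"

definition is_point :: "nat \<Rightarrow> vec set \<Rightarrow> vec \<Rightarrow> (real \<Rightarrow> vec) \<Rightarrow> bool" where
  "is_point m X x0 q \<longleftrightarrow> lva_germ 1 (single ` {0<..}) origin m X x0 (\<lambda>z. q (z 0))"

definition b_equiv ::
  "ereal \<Rightarrow> (vec \<Rightarrow> vec \<Rightarrow> real) \<Rightarrow> (real \<Rightarrow> vec) \<Rightarrow> (real \<Rightarrow> vec) \<Rightarrow> bool" where
  "b_equiv b d p q \<longleftrightarrow>
     (if b = \<infinity> then \<forall>\<^sub>F t in at_right 0. p t = q t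
      else ((\<lambda>t. d (p t) (q t) / t powr real_of_ereal b) \<longlongrightarrow> 0) (at_right 0))"

definition subanalytic_metric :: "nat \<Rightarrow> vec set \<Rightarrow> (vec \<Rightarrow> vec \<Rightarrow> real) \<Rightarrow> bool" where
  "subanalytic_metric m X d \<longleftrightarrow> Metric_space X d \<and>
     globally_subanalytic (m + (m + 1)) {join m x (join m y (single (d x y))) | x y. x \<in> X \<and> y \<in> X} \<and>
     Metric_space.mtopology X d = subtopology (Euclidean_space m) X"

definition metric_germ :: "nat \<Rightarrow> vec set \<Rightarrow> vec \<Rightarrow> (vec \<Rightarrow> vec \<Rightarrow> real) \<Rightarrow> bool" where
  "metric_germ m X x0 d \<longleftrightarrow> globally_subanalytic m X \<and> ebounded m X \<and>
     x0 \<in> Euclidean_space m closure_of X \<and> Metric_space X d \<and>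
     (\<exists>d0 L. subanalytic_metric m X d0 \<and> L > 0 \<and>
        (\<forall>x\<in>X. \<forall>y\<in>X. 1 / L * d0 x y \<le> d x y \<and> d x y \<le> L * d0 x y))"

record pgerm =
  gdim :: nat
  gX :: "vec set"
  gY :: "vec set"
  vertex :: vec
  gdist :: "vec \<Rightarrow> vec \<Rightarrow> real"
  basept :: "real \<Rightarrow> vec"

definition pointed_pair :: "pgerm \<Rightarrow> bool" where
  "pointed_pair P \<longleftrightarrow> metric_germ (gdim P) (gX P) (vertex P) (gdist P) \<and>
     gY P \<subseteq> gX P \<and> globally_subanalytic (gdim P) (gY P) \<and>
     is_point (gdim P) (gY P) (vertex P) (basept P)"

definition lva_pair_map :: "pgerm \<Rightarrow> pgerm \<Rightarrow> (vec \<Rightarrow> vec) \<Rightarrow> bool" where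
  "lva_pair_map P P' f \<longleftrightarrow>
     lva_germ (gdim P) (gX P) (vertex P) (gdim P') (gX P') (vertex P') f \<and>
     (\<exists>e>0. f ` nbd (gdim P) (vertex P) e (gY P) \<subseteq> gY P') \<and>
     (\<forall>\<^sub>F t in at_right 0. f (basept P t) = basept P' t)"

definition lipschitz_pair_map :: "pgerm \<Rightarrow> pgerm \<Rightarrow> (vec \<Rightarrow> vec) \<Rightarrow> bool" where
  "lipschitz_pair_map P P' f \<longleftrightarrow> lva_pair_map P P' f \<and>
     (\<exists>e>0. \<exists>L. \<forall>x\<in>nbd (gdim P) (vertex P) e (gX P). \<forall>y\<in>nbd (gdim P) (vertex P) e (gX P).
        gdist P' (f x) (f y) \<le> L * gdist P x y)"

definition cylinder :: "nat \<Rightarrow> vec set \<Rightarrow> vec set" where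
  "cylinder m U = {join m x (single s) | x s. x \<in> U \<and> s \<in> {0..1}}"

definition level :: "nat \<Rightarrow> (vec \<Rightarrow> vec) \<Rightarrow> real \<Rightarrow> vec \<Rightarrow> vec" where
  "level m H s = (\<lambda>x. H (join m x (single s)))"

text \<open>\<open>H\<close> is a germ along \<open>{x\<^sub>0} \<times> I\<close>: one neighbourhood of the vertex, of radius \<open>e\<close>, serves all
  parameters \<open>s\<close>.  Every \<open>H\<^sub>s\<close> is a map of pointed pairs; if the base point could move in \<open>Y'\<close>,
  the two induced maps could differ by the action of the loop it describes.\<close>

definition lva_homotopy ::
  "pgerm \<Rightarrow> pgerm \<Rightarrow> (vec \<Rightarrow> vec) \<Rightarrow> (vec \<Rightarrow> vec) \<Rightarrow> real \<Rightarrow> real \<Rightarrow> (vec \<Rightarrow> vec) \<Rightarrow> bool" where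
  "lva_homotopy P P' f g e K H \<longleftrightarrow>
     (let m = gdim P; m' = gdim P'; U = nbd m (vertex P) e (gX P) in
        e > 0 \<and> subanalytic_map (m + 1) (cylinder m U) m' (gX P') H \<and>
        (\<forall>x\<in>U. level m H 0 x = f x \<and> level m H 1 x = g x) \<and>
        (\<forall>s\<in>{0..1}. lva_on m U (vertex P) m' (vertex P') K (level m H s)) \<and>
        (\<forall>s\<in>{0..1}. level m H s ` (U \<inter> gY P) \<subseteq> gY P') \<and>
        (\<forall>\<^sub>F t in at_right 0. \<forall>s\<in>{0..1}. level m H s (basept P t) = basept P' t))"

definition lva_homotopic :: "pgerm \<Rightarrow> pgerm \<Rightarrow> (vec \<Rightarrow> vec) \<Rightarrow> (vec \<Rightarrow> vec) \<Rightarrow> bool" where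
  "lva_homotopic P P' f g \<longleftrightarrow> (\<exists>e K H. lva_homotopy P P' f g e K H)"

definition metrically_homotopic :: "pgerm \<Rightarrow> pgerm \<Rightarrow> (vec \<Rightarrow> vec) \<Rightarrow> (vec \<Rightarrow> vec) \<Rightarrow> bool" where
  "metrically_homotopic P P' f g \<longleftrightarrow>
     lipschitz_pair_map P P' f \<and> lipschitz_pair_map P P' g \<and>
     (\<exists>e K H. lva_homotopy P P' f g e K H \<and>
        (\<forall>s\<in>{0..1}. \<forall>x\<in>nbd (gdim P) (vertex P) e (gX P). \<forall>y\<in>nbd (gdim P) (vertex P) e (gX P).
           gdist P' (level (gdim P) H s x) (level (gdim P) H s y) \<le> K * gdist P x y))"

definition cube :: "nat \<Rightarrow> vec set" where
  "cube n = {y \<in> Rn n. \<forall>i<n. 0 \<le> y i \<and> y i \<le> 1}"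

definition cube_boundary :: "nat \<Rightarrow> vec set" where
  "cube_boundary n = {y \<in> cube n. \<exists>i<n. y i = 0 \<or> y i = 1}"

definition top_face :: "nat \<Rightarrow> vec set" where
  "top_face n = {y \<in> cube n. \<exists>j. n = Suc j \<and> y j = 1}"

text \<open>The boundary minus \<open>I\<^sup>n\<^sup>-\<^sup>1 \<times> {1}\<close>; empty for \<open>n = 0\<close>, as is \<open>cube_boundary 0\<close>.\<close>

definition open_box :: "nat \<Rightarrow> vec set" where
  "open_box n = cube_boundary n - top_face n"

definition germ_cone :: "nat \<Rightarrow> vec set \<Rightarrow> vec set" where
  "germ_cone n A = {join n (\<lambda>i. t * y i) (single t) | y t. y \<in> A \<and> t > 0}"

text \<open>A point of a germ in \<open>Rn (n + 1)\<close> with vertex the origin.\<close>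

definition cone_point :: "nat \<Rightarrow> vec set \<Rightarrow> (real \<Rightarrow> vec) \<Rightarrow> bool" where
  "cone_point n C q \<longleftrightarrow> is_point (n + 1) C origin q"

definition normal_point :: "nat \<Rightarrow> vec set \<Rightarrow> (real \<Rightarrow> vec) \<Rightarrow> bool" where
  "normal_point n C q \<longleftrightarrow> cone_point n C q \<and> (\<forall>\<^sub>F t in at_right 0. q t n = t)"

text \<open>\<open>forget n\<close> is \<open>(ty, ty\<^sub>n\<^sub>+\<^sub>1, t) \<mapsto> (ty, t)\<close>, and \<open>insert_level n s\<close> is
  \<open>(ty, t) \<mapsto> (ty, ts, t)\<close>.\<close>

definition forget :: "nat \<Rightarrow> vec \<Rightarrow> vec" where
  "forget n z = join n z (single (z (n + 1)))"

definition insert_level :: "nat \<Rightarrow> real \<Rightarrow> vec \<Rightarrow> vec" where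
  "insert_level n s z = join n z (join 1 (single (s * z n)) (single (z n)))"

definition over :: "nat \<Rightarrow> vec set \<Rightarrow> vec set" where
  "over n W = {z \<in> germ_cone (n + 1) (cube (n + 1)). forget n z \<in> W}"

text \<open>A weak \<open>b\<close>-map is represented by a finite set of pairs \<open>(C\<^sub>j, f\<^sub>j)\<close>; for \<open>b = \<infinity>\<close> it is a
  single map germ on \<open>Z\<close>, represented by \<open>{(Z, f)}\<close>.  A statement about \<open>\<phi> \<circ> q\<close> is read as the
  statement about \<open>f\<^sub>j \<circ> q\<close> for every \<open>j\<close> such that \<open>q\<close> is a point in \<open>C\<^sub>j\<close>.\<close>

type_synonym wmap = "(vec set \<times> (vec \<Rightarrow> vec)) set"

definition agree ::
  "ereal \<Rightarrow> nat \<Rightarrow> (vec \<Rightarrow> vec \<Rightarrow> real) \<Rightarrow> wmap \<Rightarrow> wmap \<Rightarrow> bool" where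
  "agree b n d F G \<longleftrightarrow> (\<forall>(C, f)\<in>F. \<forall>(C', f')\<in>G.
     if b = \<infinity> then \<exists>e>0. \<forall>z\<in>nbd (n + 1) origin e (C \<inter> C'). f z = f' z
     else \<forall>q. cone_point n (C \<inter> C') q \<longrightarrow> b_equiv b d (f \<circ> q) (f' \<circ> q))"

definition closed_subanalytic_cover :: "nat \<Rightarrow> vec set \<Rightarrow> vec set set \<Rightarrow> bool" where
  "closed_subanalytic_cover n Z \<C> \<longleftrightarrow> finite \<C> \<and>
     (\<exists>e>0. nbd (n + 1) origin e Z = (\<Union>C\<in>\<C>. nbd (n + 1) origin e C) \<and>
        (\<forall>C\<in>\<C>. globally_subanalytic (n + 1) (nbd (n + 1) origin e C) \<and>
           closedin (subtopology (Euclidean_space (n + 1)) (nbd (n + 1) origin e Z))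
             (nbd (n + 1) origin e C)))"

definition weak_map :: "ereal \<Rightarrow> nat \<Rightarrow> vec set \<Rightarrow> pgerm \<Rightarrow> wmap \<Rightarrow> bool" where
  "weak_map b n Z P F \<longleftrightarrow> finite F \<and> closed_subanalytic_cover n Z (fst ` F) \<and>
     (\<forall>(C, f)\<in>F. lva_germ (n + 1) C origin (gdim P) (gX P) (vertex P) f) \<and>
     agree b n (gdist P) F F \<and>
     (b = \<infinity> \<longrightarrow> (\<exists>f. F = {(Z, f)}))"

definition sends_to_Y :: "ereal \<Rightarrow> nat \<Rightarrow> vec set \<Rightarrow> pgerm \<Rightarrow> wmap \<Rightarrow> bool" where
  "sends_to_Y b n W P F \<longleftrightarrow> (\<forall>(C, f)\<in>F. \<forall>q. cone_point n (C \<inter> W) q \<longrightarrow>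
     (\<exists>r. is_point (gdim P) (gY P) (vertex P) r \<and> b_equiv b (gdist P) (f \<circ> q) r))"

definition MDGamma :: "ereal \<Rightarrow> nat \<Rightarrow> pgerm \<Rightarrow> wmap set" where
  "MDGamma b n P = {F. weak_map b n (germ_cone n (cube n)) P F \<and>
     sends_to_Y b n (germ_cone n (cube_boundary n)) P F \<and>
     (\<forall>(C, f)\<in>F. \<forall>q. normal_point n (C \<inter> germ_cone n (open_box n)) q \<longrightarrow>
        b_equiv b (gdist P) (f \<circ> q) (basept P))}"

definition restrict_level :: "nat \<Rightarrow> real \<Rightarrow> wmap \<Rightarrow> wmap" where
  "restrict_level n s H =
     (\<lambda>(C, h). ({z \<in> germ_cone n (cube n). insert_level n s z \<in> C}, h \<circ> insert_level n s)) ` H"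

definition weak_homotopy :: "ereal \<Rightarrow> nat \<Rightarrow> pgerm \<Rightarrow> wmap \<Rightarrow> wmap \<Rightarrow> wmap \<Rightarrow> bool" where
  "weak_homotopy b n P F0 F1 H \<longleftrightarrow>
     weak_map b (n + 1) (germ_cone (n + 1) (cube (n + 1))) P H \<and>
     agree b n (gdist P) (restrict_level n 0 H) F0 \<and>
     agree b n (gdist P) (restrict_level n 1 H) F1"

definition relative_on :: "ereal \<Rightarrow> nat \<Rightarrow> pgerm \<Rightarrow> vec set \<Rightarrow> wmap \<Rightarrow> wmap \<Rightarrow> bool" where
  "relative_on b n P W F0 H \<longleftrightarrow> (\<forall>(C, h)\<in>H. \<forall>(D, f)\<in>F0. \<forall>q.
     cone_point (n + 1) (C \<inter> over n (W \<inter> D)) q \<longrightarrow>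
       b_equiv b (gdist P) (h \<circ> q) (f \<circ> forget n \<circ> q))"

definition homotopic :: "ereal \<Rightarrow> nat \<Rightarrow> pgerm \<Rightarrow> wmap \<Rightarrow> wmap \<Rightarrow> bool" where
  "homotopic b n P F0 F1 \<longleftrightarrow> F0 \<in> MDGamma b n P \<and> F1 \<in> MDGamma b n P \<and>
     (\<exists>H. weak_homotopy b n P F0 F1 H \<and> relative_on b n P (germ_cone n (open_box n)) F0 H \<and>
        sends_to_Y b (n + 1) (over n (germ_cone n (cube_boundary n))) P H)"

text \<open>The quotient is taken by the equivalence relation generated by \<open>homotopic\<close>.  Collections
  representing the same weak \<open>b\<close>-map (those that \<open>agree\<close>) are \<open>homotopic\<close> through the constant
  homotopy, so passing to the quotient on representatives also performs that identification.\<close>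

definition homotopy_rel :: "ereal \<Rightarrow> nat \<Rightarrow> pgerm \<Rightarrow> (wmap \<times> wmap) set" where
  "homotopy_rel b n P = {(F, G). F \<in> MDGamma b n P \<and> G \<in> MDGamma b n P \<and>
     equivclp (homotopic b n P) F G}"

definition MDpi :: "ereal \<Rightarrow> nat \<Rightarrow> pgerm \<Rightarrow> wmap set set" where
  "MDpi b n P = MDGamma b n P // homotopy_rel b n P"

definition push :: "(vec \<Rightarrow> vec) \<Rightarrow> wmap \<Rightarrow> wmap" where
  "push f F = (\<lambda>(C, h). (C, f \<circ> h)) ` F"

text \<open>The union over all representatives of a class is the class of any one of them.\<close>

definition induced :: "ereal \<Rightarrow> nat \<Rightarrow> pgerm \<Rightarrow> (vec \<Rightarrow> vec) \<Rightarrow> wmap set \<Rightarrow> wmap set" where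
  "induced b n P' f c = (\<Union>F\<in>c. homotopy_rel b n P' `` {push f F})"

end

theory Submission
  imports "HOL-Complex_Analysis.Complex_Analysis" "Jordan_Normal_Form.Determinant" Defs
begin

text \<open>
  Given a loop \<open>\<phi>\<close>, the homotopy is \<open>(y, s, t) \<mapsto> H\<^sub>s (\<phi> (y, t))\<close>. The uniform l.v.a. constant of the
  \<open>H\<^sub>s\<close> makes it an l.v.a. map on the cone over the larger cube, and for finite \<open>b\<close> the uniform Lipschitz
  constant transports \<open>b\<close>-equivalence along points with varying \<open>s\<close>.

  The loop is only known to be trivial on \<^emph>\<open>normal\<close> points over the open box, whereas relativity of the
  homotopy speaks about arbitrary points \<open>q\<close>. Every such point is a reparametrization of a normal one:
  its height \<open>\<tau>\<close> is a one-variable subanalytic function with \<open>t / c \<le> \<tau> t \<le> c t\<close>, and it is injective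
  near \<open>0\<close>, because the set of \<open>t\<close> at which \<open>\<tau>\<close> takes a value again further right is subanalytic in one
  variable, hence contains or avoids a whole interval \<open>(0, \<delta>)\<close>. That dichotomy for one-dimensional projections
  of semianalytic sets rests on Weierstrass preparation: a point of the set close to \<open>0\<close> is
  continued to a curve over \<open>(0, \<delta>)\<close> along which no defining function changes sign.
\<close>

section \<open>Holomorphic functions on polydiscs\<close>

text \<open>Weierstrass polynomials do not appear. Over each base point the roots in the last
  variable are collected by the argument principle into power sums weighted by multiplicity. These
  are holomorphic in the base, and their Hankel determinants detect the number of distinct roots.
  Feeding the determinants into the induction on the number of variables keeps that number constant
  along the base curve. Roots then move continuously, conjugation symmetry keeps real roots real,
  and a point between two consecutive real roots follows at a fixed proportion.

  The curves are parametrized by the first coordinate, so every change of variables has to preserve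
  it. A function vanishing on the hyperplane where that coordinate is zero would leave no admissible
  direction for the last axis, hence powers of the first coordinate are divided out beforehand.

  On the side of the homotopy, cone coordinates store \<open>t * s\<close>, so \<open>s\<close> is a
  ratio of two coordinates. It stays in the unit interval but does not extend continuously to the
  vertex; only bounds uniform in \<open>s\<close> control the composite there.\<close>

definition polydisc :: "nat \<Rightarrow> real \<Rightarrow> (nat \<Rightarrow> complex) set" where
  "polydisc N \<rho> = {z. \<forall>i<N. norm (z i) < \<rho>}"

definition cline :: "(nat \<Rightarrow> complex) \<Rightarrow> (nat \<Rightarrow> complex) \<Rightarrow> complex \<Rightarrow> nat \<Rightarrow> complex" where
  "cline a v \<zeta> = (\<lambda>i. a i + \<zeta> * v i)"

text \<open>Holomorphy in several variables in Gateaux form: continuity plus holomorphy along every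
  complex line. Points are infinite sequences, so the last clause makes the value depend on the
  first \<open>N\<close> coordinates only; functions in different numbers of variables thus share
  one type.\<close>

definition chol :: "nat \<Rightarrow> real \<Rightarrow> ((nat \<Rightarrow> complex) \<Rightarrow> complex) \<Rightarrow> bool" where
  "chol N \<rho> F \<longleftrightarrow> continuous_on (polydisc N \<rho>) F \<and>
     (\<forall>a v. (\<lambda>\<zeta>. F (cline a v \<zeta>)) holomorphic_on {\<zeta>. cline a v \<zeta> \<in> polydisc N \<rho>}) \<and>
     (\<forall>z\<in>polydisc N \<rho>. \<forall>z'. (\<forall>i<N. z i = z' i) \<longrightarrow> F z = F z')"

text \<open>Conjugation symmetry is the trace of real coefficients: values at real points are real,
  and over a real base point the roots in one further variable form a conjugation-invariant
  set.\<close>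

definition rhol :: "nat \<Rightarrow> real \<Rightarrow> ((nat \<Rightarrow> complex) \<Rightarrow> complex) \<Rightarrow> bool" where
  "rhol N \<rho> F \<longleftrightarrow> chol N \<rho> F \<and> (\<forall>z\<in>polydisc N \<rho>. F (\<lambda>i. cnj (z i)) = cnj (F z))"

lemma continuous_on_coord [continuous_intros]: "continuous_on S (\<lambda>z. z i)"
  by (rule continuous_on_subset[OF continuous_on_product_coordinates]) simp

lemma continuous_on_cline [continuous_intros]: "continuous_on S (cline a v)"
  unfolding cline_def by (intro continuous_intros)

lemma continuous_on_fun_upd [continuous_intros]:
  fixes f :: "'a::topological_space \<Rightarrow> nat \<Rightarrow> complex"
  assumes "continuous_on S f" "continuous_on S g"
  shows "continuous_on S (\<lambda>x. (f x)(k := g x))"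
proof (rule continuous_on_coordinatewise_then_product)
  fix i show "continuous_on S (\<lambda>x. ((f x)(k := g x)) i)"
    using assms continuous_on_product_then_coordinatewise[OF assms(1)] by (cases "i = k") auto
qed

lemma open_polydisc [simp]: "open (polydisc N \<rho>)"
proof -
  have "polydisc N \<rho> = (\<Inter>i\<in>{..<N}. {z. norm (z i) < \<rho>})"
    by (auto simp: polydisc_def)
  also have "open \<dots>"
    by (intro open_INT ballI open_Collect_less continuous_intros finite_lessThan)
  finally show ?thesis .
qed

lemma open_cline [simp]: "open {\<zeta>. cline a v \<zeta> \<in> polydisc N \<rho>}"
  using open_vimage[OF open_polydisc[of N \<rho>] continuous_on_cline[of UNIV a v]]
  by (simp add: vimage_def)

text \<open>Convexity makes the parameter domain of a line connected, as the identity theorem along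
  that line requires.\<close>

lemma polydisc_cline_convex: "convex {\<zeta>. cline a v \<zeta> \<in> polydisc N \<rho>}"
proof -
  have "{\<zeta>. cline a v \<zeta> \<in> polydisc N \<rho>} = (\<Inter>i\<in>{..<N}. {\<zeta>. a i + \<zeta> * v i \<in> ball 0 \<rho>})"
    by (auto simp: polydisc_def cline_def)
  also have "convex \<dots>"
  proof (intro convex_INT)
    fix i
    have "{\<zeta>. a i + \<zeta> * v i \<in> ball 0 \<rho>} = (\<lambda>\<zeta>. \<zeta> * v i) -` ((\<lambda>w. - a i + w) ` ball 0 \<rho>)"
      by (force simp: image_iff algebra_simps)
    moreover have "convex ((\<lambda>\<zeta>. \<zeta> * v i) -` ((\<lambda>w. - a i + w) ` ball 0 \<rho>))"
      by (intro convex_linear_vimage convex_translation convex_ball)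
         (auto intro: linearI simp: algebra_simps scaleR_conv_of_real)
    ultimately show "convex {\<zeta>. a i + \<zeta> * v i \<in> ball 0 \<rho>}" by simp
  qed
  finally show ?thesis .
qed

lemma polydisc_mono: "\<rho>' \<le> \<rho> \<Longrightarrow> polydisc N \<rho>' \<subseteq> polydisc N \<rho>"
  by (force simp: polydisc_def)

lemma cholI:
  assumes "continuous_on (polydisc N \<rho>) F"
    and "\<And>a v. (\<lambda>\<zeta>. F (cline a v \<zeta>)) holomorphic_on {\<zeta>. cline a v \<zeta> \<in> polydisc N \<rho>}"
    and "\<And>z z'. z \<in> polydisc N \<rho> \<Longrightarrow> z' \<in> polydisc N \<rho> \<Longrightarrow> \<forall>i<N. z i = z' i \<Longrightarrow> F z = F z'"
  shows "chol N \<rho> F"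
proof -
  have "z' \<in> polydisc N \<rho>" if "z \<in> polydisc N \<rho>" "\<forall>i<N. z i = z' i" for z z'
    using that by (auto simp: polydisc_def)
  then show ?thesis unfolding chol_def using assms by blast
qed

lemma cholD:
  assumes "chol N \<rho> F"
  shows "continuous_on (polydisc N \<rho>) F"
    and "(\<lambda>\<zeta>. F (cline a v \<zeta>)) holomorphic_on {\<zeta>. cline a v \<zeta> \<in> polydisc N \<rho>}"
    and "z \<in> polydisc N \<rho> \<Longrightarrow> \<forall>i<N. z i = z' i \<Longrightarrow> F z = F z'"
  using assms unfolding chol_def by blast+

lemma chol_mono:
  assumes "chol N \<rho> F" "\<rho>' \<le> \<rho>" shows "chol N \<rho>' F"
proof (rule cholI)
  note sub = polydisc_mono[OF assms(2), of N]
  show "continuous_on (polydisc N \<rho>') F"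
    using continuous_on_subset[OF cholD(1)[OF assms(1)] sub] .
  show "(\<lambda>\<zeta>. F (cline a v \<zeta>)) holomorphic_on {\<zeta>. cline a v \<zeta> \<in> polydisc N \<rho>'}" for a v
    by (rule holomorphic_on_subset[OF cholD(2)[OF assms(1)]]) (use sub in blast)
  show "F z = F z'" if "z \<in> polydisc N \<rho>'" "\<forall>i<N. z i = z' i" for z z'
    using cholD(3)[OF assms(1)] that sub by blast
qed

lemma rhol_mono: "rhol N \<rho> F \<Longrightarrow> \<rho>' \<le> \<rho> \<Longrightarrow> rhol N \<rho>' F"
  unfolding rhol_def using chol_mono polydisc_mono by blast

lemma chol_const: "chol N \<rho> (\<lambda>z. c)"
  by (rule cholI) auto

lemma chol_coord: "i < N \<Longrightarrow> chol N \<rho> (\<lambda>z. z i)"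
  by (rule cholI) (auto simp: cline_def intro!: continuous_intros holomorphic_intros)

lemma chol_add: 
  assumes "chol N \<rho> F" "chol N \<rho> G" shows "chol N \<rho> (\<lambda>z. F z + G z)"
  by (rule cholI; (intro continuous_intros holomorphic_intros cholD(1,2) assms)?)
     (metis cholD(3)[OF assms(1)] cholD(3)[OF assms(2)])

lemma chol_diff: 
  assumes "chol N \<rho> F" "chol N \<rho> G" shows "chol N \<rho> (\<lambda>z. F z - G z)"
  by (rule cholI; (intro continuous_intros holomorphic_intros cholD(1,2) assms)?)
     (metis cholD(3)[OF assms(1)] cholD(3)[OF assms(2)])

lemma chol_mult: 
  assumes "chol N \<rho> F" "chol N \<rho> G" shows "chol N \<rho> (\<lambda>z. F z * G z)"
  by (rule cholI; (intro continuous_intros holomorphic_intros cholD(1,2) assms)?)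
     (metis cholD(3)[OF assms(1)] cholD(3)[OF assms(2)])

lemma chol_divide:
  assumes "chol N \<rho> F" "chol N \<rho> G" and nz: "\<And>z. z \<in> polydisc N \<rho> \<Longrightarrow> G z \<noteq> 0"
  shows "chol N \<rho> (\<lambda>z. F z / G z)"
proof (rule cholI)
  show "continuous_on (polydisc N \<rho>) (\<lambda>z. F z / G z)"
    by (intro continuous_intros cholD(1) assms) (use nz in auto)
  show "(\<lambda>\<zeta>. F (cline a v \<zeta>) / G (cline a v \<zeta>)) holomorphic_on {\<zeta>. cline a v \<zeta> \<in> polydisc N \<rho>}" for a v
    by (intro holomorphic_intros cholD(2) assms) (use nz in auto)
qed (metis cholD(3)[OF assms(1)] cholD(3)[OF assms(2)])

lemma chol_sum: "(\<And>i. i \<in> A \<Longrightarrow> chol N \<rho> (F i)) \<Longrightarrow> chol N \<rho> (\<lambda>z. \<Sum>i\<in>A. F i z)"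
  by (induction A rule: infinite_finite_induct) (auto intro: chol_const chol_add)

lemma chol_prod: "(\<And>i. i \<in> A \<Longrightarrow> chol N \<rho> (F i)) \<Longrightarrow> chol N \<rho> (\<lambda>z. \<Prod>i\<in>A. F i z)"
  by (induction A rule: infinite_finite_induct) (auto intro: chol_const chol_mult)

text \<open>The hypothesis \<open>aff\<close> asks that \<open>L\<close> send complex lines to
  complex lines, possibly degenerate ones. Substituting a constant for a coordinate and linear
  changes of variables satisfy it, and line-wise holomorphy passes to the composite.\<close>

lemma chol_compose:
  assumes F: "chol N \<rho> F" and L: "\<And>z. z \<in> polydisc M \<sigma> \<Longrightarrow> L z \<in> polydisc N \<rho>"
    and cont: "continuous_on UNIV L"
    and aff: "\<And>a v. \<exists>a' v'. \<forall>\<zeta>. L (cline a v \<zeta>) = cline a' v' \<zeta>"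
    and dep: "\<And>z z'. \<forall>i<M. z i = z' i \<Longrightarrow> \<forall>i<N. L z i = L z' i"
  shows "chol M \<sigma> (\<lambda>z. F (L z))"
proof (rule cholI)
  show "continuous_on (polydisc M \<sigma>) (\<lambda>z. F (L z))"
    by (rule continuous_on_compose2[OF cholD(1)[OF F] continuous_on_subset[OF cont]]) (use L in auto)
  show "(\<lambda>\<zeta>. F (L (cline a v \<zeta>))) holomorphic_on {\<zeta>. cline a v \<zeta> \<in> polydisc M \<sigma>}" for a v
  proof -
    obtain a' v' where eq: "\<And>\<zeta>. L (cline a v \<zeta>) = cline a' v' \<zeta>" using aff by meson
    have "{\<zeta>. cline a v \<zeta> \<in> polydisc M \<sigma>} \<subseteq> {\<zeta>. cline a' v' \<zeta> \<in> polydisc N \<rho>}"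
      using L by (auto simp flip: eq)
    then show ?thesis
      unfolding eq using holomorphic_on_subset[OF cholD(2)[OF F]] by blast
  qed
  show "F (L z) = F (L z')" if "z \<in> polydisc M \<sigma>" "\<forall>i<M. z i = z' i" for z z'
    using cholD(3)[OF F L[OF that(1)] dep[OF that(2)]] .
qed

section \<open>One-variable slices and Cauchy integrals with parameters\<close>

lemma chol_holomorphic_slice:
  assumes F: "chol N \<rho> F" and z: "z \<in> polydisc N \<rho>"
  shows "(\<lambda>w. F (z(j := w))) holomorphic_on ball 0 \<rho>"
proof -
  have eq: "z(j := w) = cline (z(j := 0)) (\<lambda>i. if i = j then 1 else 0) w" for w
    by (auto simp: cline_def)
  have "(\<lambda>\<zeta>. F (cline (z(j := 0)) (\<lambda>i. if i = j then 1 else 0) \<zeta>)) holomorphic_on ball 0 \<rho>"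
    by (rule holomorphic_on_subset) (use F z in \<open>auto simp: chol_def polydisc_def cline_def\<close>)
  then show ?thesis by (subst eq)
qed

text \<open>Cauchy's formula writes the derivative \<open>D x s\<close> as a contour integral, hence
  it is jointly continuous in \<open>x\<close> and \<open>s\<close>; that continuity is what the
  Leibniz rule for the integral over \<open>s\<close> asks for.\<close>

lemma holomorphic_parameter_integral:
  fixes g :: "complex \<Rightarrow> real \<Rightarrow> complex"
  assumes U: "open U" and cont: "continuous_on (U \<times> {0..1}) (\<lambda>(x, s). g x s)"
    and hol: "\<And>s. s \<in> {0..1} \<Longrightarrow> (\<lambda>x. g x s) holomorphic_on U"
  shows "(\<lambda>x. integral {0..1} (g x)) holomorphic_on U"
proof -
  have "(\<lambda>x. integral {0..1} (g x)) field_differentiable (at x0)" if x0: "x0 \<in> U" for x0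
  proof -
    obtain R where R: "R > 0" "cball x0 R \<subseteq> U"
      using U x0 open_contains_cball_eq by blast
    define D where "D = (\<lambda>x s. 1 / (2 * of_real pi * \<i>) *
        contour_integral (circlepath x0 R) (\<lambda>u. g u s / (u - x)\<^sup>2))"
    have D: "((\<lambda>x. g x s) has_field_derivative D x s) (at x)" if "s \<in> {0..1}" "x \<in> ball x0 R" for x s
      unfolding D_def
    proof (rule Cauchy_derivative_integral_circlepath(2))
      show "continuous_on (cball x0 R) (\<lambda>x. g x s)"
        using hol[OF that(1)] R(2) holomorphic_on_imp_continuous_on holomorphic_on_subset by blast
      show "(\<lambda>x. g x s) holomorphic_on ball x0 R"
        using hol[OF that(1)] R(2) holomorphic_on_subset ball_subset_cball by blast
    qed (use that in auto)
    have img: "circlepath x0 R u \<in> sphere x0 R" for u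
      using \<open>R > 0\<close> by (auto simp: circlepath dist_norm norm_mult simp flip: of_real_mult)
    have "continuous_on (ball x0 R \<times> {0..1::real}) (\<lambda>(x, s). D x s)"
    proof -
      have c1: "continuous_on ((ball x0 R \<times> {0..1::real}) \<times> cbox 0 (1::real))
          (\<lambda>(p, u). g (circlepath x0 R u) (snd p) / (circlepath x0 R u - fst p)\<^sup>2 *
             vector_derivative (circlepath x0 R) (at u))"
      proof -
        have c2: "continuous_on ((ball x0 R \<times> {0..1::real}) \<times> cbox 0 (1::real)) (\<lambda>q. circlepath x0 R (snd q))"
          unfolding circlepath by (intro continuous_intros)
        have c3: "continuous_on ((ball x0 R \<times> {0..1::real}) \<times> cbox 0 (1::real))
           ((\<lambda>(x, s). g x s) \<circ> (\<lambda>q::(complex \<times> real) \<times> real. (circlepath x0 R (snd q), snd (fst q))))"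
        proof (rule continuous_on_compose)
          show "continuous_on ((ball x0 R \<times> {0..1::real}) \<times> cbox 0 (1::real))
             (\<lambda>q::(complex \<times> real) \<times> real. (circlepath x0 R (snd q), snd (fst q)))"
            by (intro continuous_intros c2)
          show "continuous_on ((\<lambda>q::(complex \<times> real) \<times> real. (circlepath x0 R (snd q), snd (fst q))) `
              ((ball x0 R \<times> {0..1::real}) \<times> cbox 0 (1::real))) (\<lambda>(x, s). g x s)"
          proof (rule continuous_on_subset[OF cont], safe)
            fix u
            have "circlepath x0 R u \<in> cball x0 R" using img[of u] by simp
            then show "circlepath x0 R (snd (x, u)) \<in> U" for x :: "complex \<times> real" using R by auto
          qed auto
        qed
        have ne: "\<forall>q\<in>(ball x0 R \<times> {0..1::real}) \<times> cbox 0 1. (circlepath x0 R (snd q) - fst (fst q))\<^sup>2 \<noteq> 0"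
        proof
          fix q :: "(complex \<times> real) \<times> real" assume "q \<in> (ball x0 R \<times> {0..1::real}) \<times> cbox 0 1"
          then show "(circlepath x0 R (snd q) - fst (fst q))\<^sup>2 \<noteq> 0"
            using img[of "snd q"] by (auto simp: mem_Times_iff)
        qed
        have c4: "continuous_on ((ball x0 R \<times> {0..1::real}) \<times> cbox 0 (1::real))
            (\<lambda>q. vector_derivative (circlepath x0 R) (at (snd q)))"
          unfolding vector_derivative_circlepath by (intro continuous_intros)
        have c5: "continuous_on ((ball x0 R \<times> {0..1::real}) \<times> cbox 0 (1::real)) (\<lambda>q. (circlepath x0 R (snd q) - fst (fst q))\<^sup>2)"
          by (intro continuous_intros c2)
        show ?thesis
          using continuous_on_mult[OF continuous_on_divide[OF c3 c5 ne] c4]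
          by (simp add: case_prod_unfold o_def)
      qed
      have "continuous_on (ball x0 R \<times> {0..1::real}) (\<lambda>p. integral (cbox 0 1) (\<lambda>u.
          g (circlepath x0 R u) (snd p) / (circlepath x0 R u - fst p)\<^sup>2 *
             vector_derivative (circlepath x0 R) (at u)))"
        by (rule integral_continuous_on_param[OF c1])
      from continuous_on_mult_left[OF this, of "1 / (2 * of_real pi * \<i>)"] show ?thesis
        unfolding D_def contour_integral_integral case_prod_unfold by simp
    qed
    then have contD: "continuous_on (ball x0 R \<times> cbox 0 (1::real)) (\<lambda>(x, s). D x s)" by simp
    have "(\<lambda>x. integral (cbox 0 1) (g x)) holomorphic_on ball x0 R"
    proof (rule leibniz_rule_holomorphic[where fx = D, OF _ _ contD])
      show "((\<lambda>x. g x s) has_field_derivative D x s) (at x within ball x0 R)"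
        if "x \<in> ball x0 R" "s \<in> cbox 0 1" for x s
        using D that by (auto intro: has_field_derivative_at_within)
      show "g x integrable_on cbox 0 1" if "x \<in> ball x0 R" for x
      proof (rule integrable_continuous)
        have "continuous_on (cbox 0 1) ((\<lambda>(x, s). g x s) \<circ> (\<lambda>s. (x, s)))"
          by (intro continuous_on_compose continuous_on_subset[OF cont] continuous_intros)
             (use that R in auto)
        then show "continuous_on (cbox 0 1) (g x)" by (simp add: o_def)
      qed
    qed auto
    then show ?thesis
      using \<open>R > 0\<close> by (auto simp: holomorphic_on_open field_differentiable_def)
  qed
  then show ?thesis
    using U by (auto simp: holomorphic_on_open field_differentiable_def)
qed

text \<open>The contour integral over the circle of radius \<open>r\<close>, divided by
  \<open>2 * pi * \<i>\<close>. On the circle \<open>w = r * exp (2 * pi * \<i> * s)\<close> the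
  differential contributes \<open>2 * pi * \<i> * w\<close>, so only the factor \<open>w\<close>
  remains.\<close>

definition cint :: "real \<Rightarrow> (complex \<Rightarrow> complex) \<Rightarrow> complex" where
  "cint r K = integral {0..1} (\<lambda>s. K (circlepath 0 r s) * circlepath 0 r s)"

lemma contour_integral_eq_cint: "contour_integral (circlepath 0 r) K = 2 * pi * \<i> * cint r K"
  unfolding contour_integral_integral cint_def vector_derivative_circlepath
  by (subst integral_mult_right[symmetric]) (simp add: circlepath mult_ac)

lemma has_contour_integral_cint:
  "(K has_contour_integral c) (circlepath 0 r) \<Longrightarrow> cint r K = c / (2 * pi * \<i>)"
  using contour_integral_unique[of K c] contour_integral_eq_cint[of r K] by simp

lemma circlepath_mem_sphere: "r > 0 \<Longrightarrow> circlepath 0 r s \<in> sphere 0 r"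
  by (auto simp: circlepath norm_mult simp flip: of_real_mult)

text \<open>Conjugation runs through the circle backwards, \<open>s\<close> becoming
  \<open>1 - s\<close>, and a substitution undoes the reflection. No sign appears because the factor
  \<open>2 * pi * \<i>\<close> has been divided out.\<close>

lemma cnj_cint: "cnj (cint r K) = cint r (\<lambda>w. cnj (K (cnj w)))"
proof -
  have c: "cnj (circlepath 0 r s) = circlepath 0 r (1 - s)" for s
    by (simp add: circlepath exp_cnj algebra_simps exp_diff exp_minus field_simps)
  define h where "h = (\<lambda>s. cnj (K (cnj (circlepath 0 r s))) * circlepath 0 r s)"
  have "cnj (cint r K) = integral {0..1} (\<lambda>s. h (1 - s))"
    unfolding cint_def Henstock_Kurzweil_Integration.integral_cnj h_def by (simp add: c[symmetric])
  also have "\<dots> = integral {-1..-0} (\<lambda>s. h (1 + s))"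
    using Henstock_Kurzweil_Integration.integral_reflect_real[of 1 0 "\<lambda>s. h (1 - s)"] by simp
  also have "\<dots> = integral {0..1} h"
    using integral_shift_Icc_real[of "-1" 0 h 1] by (simp add: o_def add.commute)
  finally show ?thesis unfolding h_def cint_def .
qed

lemma chol_cint:
  assumes r: "r > 0"
    and hol: "\<And>w. w \<in> sphere 0 r \<Longrightarrow> chol N \<rho> (K w)"
    and cont: "continuous_on (sphere 0 r \<times> polydisc N \<rho>) (\<lambda>(w, z). K w z)"
  shows "chol N \<rho> (\<lambda>z. cint r (\<lambda>w. K w z))"
proof -
  note img = circlepath_mem_sphere[OF r]
  have cont2: "continuous_on (polydisc N \<rho> \<times> cbox 0 (1::real))
      (\<lambda>(z, s). K (circlepath 0 r s) z * circlepath 0 r s)"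
  proof -
    have c2: "continuous_on (polydisc N \<rho> \<times> cbox 0 (1::real)) (\<lambda>q. circlepath 0 r (snd q))"
      unfolding circlepath by (intro continuous_intros)
    have "continuous_on (polydisc N \<rho> \<times> cbox 0 (1::real))
         ((\<lambda>(w, z). K w z) \<circ> (\<lambda>q. (circlepath 0 r (snd q), fst q)))"
      by (intro continuous_on_compose continuous_intros c2 continuous_on_subset[OF cont])
         (use img in auto)
    from continuous_on_mult[OF this c2] show ?thesis
      by (simp add: case_prod_unfold o_def)
  qed
  have "continuous_on (polydisc N \<rho>) (\<lambda>z. cint r (\<lambda>w. K w z))"
    using integral_continuous_on_param[OF cont2] by (simp add: cint_def)
  moreover have "(\<lambda>\<zeta>. cint r (\<lambda>w. K w (cline a v \<zeta>))) holomorphic_on {\<zeta>. cline a v \<zeta> \<in> polydisc N \<rho>}" for a v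
    unfolding cint_def
  proof (rule holomorphic_parameter_integral)
    have "continuous_on ({\<zeta>. cline a v \<zeta> \<in> polydisc N \<rho>} \<times> {0..1})
       ((\<lambda>(z, s). K (circlepath 0 r s) z * circlepath 0 r s) \<circ> (\<lambda>q. (cline a v (fst q), snd q)))"
      by (intro continuous_on_compose continuous_intros continuous_on_subset[OF cont2]
            continuous_on_compose2[OF continuous_on_cline[of UNIV a v]]) auto
    then show "continuous_on ({\<zeta>. cline a v \<zeta> \<in> polydisc N \<rho>} \<times> {0..1})
        (\<lambda>(\<zeta>, s). K (circlepath 0 r s) (cline a v \<zeta>) * circlepath 0 r s)"
      by (simp add: case_prod_unfold o_def)
    show "(\<lambda>\<zeta>. K (circlepath 0 r s) (cline a v \<zeta>) * circlepath 0 r s)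
        holomorphic_on {\<zeta>. cline a v \<zeta> \<in> polydisc N \<rho>}" for s
      by (intro holomorphic_intros cholD(2)[OF hol[OF img[of s]]])
  qed simp
  moreover have "cint r (\<lambda>w. K w z) = cint r (\<lambda>w. K w z')"
    if "z \<in> polydisc N \<rho>" "\<forall>i<N. z i = z' i" for z z'
  proof -
    have "K (circlepath 0 r s) z = K (circlepath 0 r s) z'" for s
      using hol[OF img[of s]] that unfolding chol_def by blast
    then show ?thesis by (simp add: cint_def)
  qed
  ultimately show ?thesis unfolding chol_def by blast
qed

lemma rhol_cint:
  assumes r: "r > 0"
    and hol: "\<And>w. w \<in> sphere 0 r \<Longrightarrow> chol N \<rho> (K w)"
    and cont: "continuous_on (sphere 0 r \<times> polydisc N \<rho>) (\<lambda>(w, z). K w z)"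
    and sym: "\<And>w z. w \<in> sphere 0 r \<Longrightarrow> z \<in> polydisc N \<rho> \<Longrightarrow> K (cnj w) (\<lambda>i. cnj (z i)) = cnj (K w z)"
  shows "rhol N \<rho> (\<lambda>z. cint r (\<lambda>w. K w z))"
  unfolding rhol_def
proof (intro conjI ballI chol_cint assms)
  fix z assume z: "z \<in> polydisc N \<rho>"
  have "cint r (\<lambda>w. K w (\<lambda>i. cnj (z i))) = cint r (\<lambda>w. cnj (K (cnj w) z))"
    unfolding cint_def
  proof (intro integral_cong)
    fix s
    have "cnj (circlepath 0 r s) \<in> sphere 0 r" using circlepath_mem_sphere[OF r, of s] by simp
    then show "K (circlepath 0 r s) (\<lambda>i. cnj (z i)) * circlepath 0 r s =
        cnj (K (cnj (circlepath 0 r s)) z) * circlepath 0 r s"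
      using sym[of "cnj (circlepath 0 r s)" z] z by simp
  qed
  then show "cint r (\<lambda>w. K w (\<lambda>i. cnj (z i))) = cnj (cint r (\<lambda>w. K w z))"
    by (simp add: cnj_cint)
qed auto

section \<open>Neighbourhoods, zero-free circles and density of real points\<close>

lemma tendsto_coordinatewise:
  fixes f :: "'a \<Rightarrow> nat \<Rightarrow> 'b::topological_space"
  assumes "\<And>i. ((\<lambda>n. f n i) \<longlongrightarrow> l i) F"
  shows "(f \<longlongrightarrow> l) F"
proof -
  have "limitin (product_topology (\<lambda>i. euclidean) UNIV) f l F"
    using assms by (auto simp: limitin_componentwise)
  then show ?thesis by (simp add: euclidean_product_topology limitin_canonical_iff)
qed

lemma rhol_chol: "rhol N \<rho> F \<Longrightarrow> chol N \<rho> F"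
  by (simp add: rhol_def)

lemma rhol_cnj: "rhol N \<rho> F \<Longrightarrow> z \<in> polydisc N \<rho> \<Longrightarrow> F (\<lambda>i. cnj (z i)) = cnj (F z)"
  by (simp add: rhol_def)

lemma rhol_const: "rhol N \<rho> (\<lambda>z. of_real c)"
  by (simp add: rhol_def chol_const)

lemma rhol_mult: "rhol N \<rho> F \<Longrightarrow> rhol N \<rho> G \<Longrightarrow> rhol N \<rho> (\<lambda>z. F z * G z)"
  by (simp add: rhol_def chol_mult)

lemma rhol_sum: "(\<And>i. i \<in> A \<Longrightarrow> rhol N \<rho> (F i)) \<Longrightarrow> rhol N \<rho> (\<lambda>z. \<Sum>i\<in>A. F i z)"
  by (simp add: rhol_def chol_sum)

lemma rhol_prod: "(\<And>i. i \<in> A \<Longrightarrow> rhol N \<rho> (F i)) \<Longrightarrow> rhol N \<rho> (\<lambda>z. \<Prod>i\<in>A. F i z)"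
  by (simp add: rhol_def chol_prod)

text \<open>Convergence in the infinite product concerns all coordinates, while the box restricts
  only the first \<open>N\<close>. A bad sequence is therefore replaced by one that agrees with
  \<open>z0\<close> beyond \<open>N\<close>; it converges to \<open>z0\<close>, and \<open>F\<close>
  takes the same values on it.\<close>

lemma chol_box:
  assumes F: "chol N \<rho> F" and z0: "z0 \<in> polydisc N \<rho>" and V: "open V" "F z0 \<in> V"
  obtains e where "e > 0" "\<And>z. \<forall>i<N. norm (z i - z0 i) < e \<Longrightarrow> z \<in> polydisc N \<rho> \<and> F z \<in> V"
proof -
  have "\<exists>e>0. \<forall>z. (\<forall>i<N. norm (z i - z0 i) < e) \<longrightarrow> z \<in> polydisc N \<rho> \<and> F z \<in> V"
  proof (rule ccontr)
    assume "\<not> ?thesis"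
    then have "\<forall>n. \<exists>z. (\<forall>i<N. norm (z i - z0 i) < 1 / real (Suc n)) \<and> \<not> (z \<in> polydisc N \<rho> \<and> F z \<in> V)"
      by (metis of_nat_0_less_iff zero_less_Suc zero_less_divide_1_iff)
    then obtain z where z: "\<And>n i. i < N \<Longrightarrow> norm (z n i - z0 i) < 1 / real (Suc n)"
      and bad: "\<And>n. \<not> (z n \<in> polydisc N \<rho> \<and> F (z n) \<in> V)"
      by metis
    define y where "y n = (\<lambda>i. if i < N then z n i else z0 i)" for n
    have "y \<longlonglongrightarrow> z0"
    proof (rule tendsto_coordinatewise)
      fix i
      have "norm (y n i - z0 i) \<le> 1 / real (Suc n)" for n
        using z[of i n] by (auto simp: y_def intro: less_imp_le)
      then have "(\<lambda>n. y n i - z0 i) \<longlonglongrightarrow> 0"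
        by (intro Lim_null_comparison[OF _ LIMSEQ_inverse_real_of_nat])
           (auto simp: inverse_eq_divide)
      then show "(\<lambda>n. y n i) \<longlonglongrightarrow> z0 i" by (simp add: LIM_zero_iff)
    qed
    moreover have "open (F -` V \<inter> polydisc N \<rho>)"
      using cholD(1)[OF F] V(1) continuous_on_open_vimage[OF open_polydisc] by blast
    ultimately have "\<forall>\<^sub>F n in sequentially. y n \<in> F -` V \<inter> polydisc N \<rho>"
      using z0 V(2) by (intro topological_tendstoD) auto
    then obtain n where n: "y n \<in> F -` V \<inter> polydisc N \<rho>"
      by (auto dest: eventually_happens'[rotated])
    then have "F (y n) = F (z n)" by (intro cholD(3)[OF F]) (auto simp: y_def)
    moreover have "z n \<in> polydisc N \<rho>" using n by (auto simp: polydisc_def y_def)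
    ultimately show False using n bad[of n] by auto
  qed
  then show ?thesis using that by blast
qed

text \<open>The circle is compact: zeros with \<open>norm w = r\<close> over base points tending to
  the origin would accumulate at a zero over the origin itself.\<close>

lemma chol_nonzero_tube:
  assumes f: "chol (Suc N) \<rho> f" and r: "r < \<rho>"
    and nz: "\<And>w. norm w = r \<Longrightarrow> f ((\<lambda>_. 0)(N := w)) \<noteq> 0"
  obtains e where "e > 0" "\<And>z w. z \<in> polydisc N e \<Longrightarrow> norm w = r \<Longrightarrow> f (z(N := w)) \<noteq> 0"
proof -
  have "\<exists>e>0. \<forall>z w. z \<in> polydisc N e \<longrightarrow> norm w = r \<longrightarrow> f (z(N := w)) \<noteq> 0"
  proof (rule ccontr)
    assume c: "\<not> ?thesis"
    have "\<exists>z w. z \<in> polydisc N (1 / real (Suc n)) \<and> norm w = r \<and> f (z(N := w)) = 0" for n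
    proof -
      have "1 / real (Suc n) > 0" by simp
      then show ?thesis using c by blast
    qed
    then obtain z w where z: "\<And>n. z n \<in> polydisc N (1 / real (Suc n))"
      and w: "\<And>n. norm (w n) = r" and zero: "\<And>n. f ((z n)(N := w n)) = 0"
      by metis
    have r0: "r \<ge> 0" using w[of 0] by (metis norm_ge_zero)
    have "compact (sphere 0 r :: complex set)" by simp
    then obtain l \<sigma> where l: "l \<in> sphere 0 r" "strict_mono \<sigma>" "(w \<circ> \<sigma>) \<longlonglongrightarrow> l"
      using w unfolding compact_def by (metis dist_0_norm mem_sphere)
    define y where "y n = (\<lambda>i. if i < N then z (\<sigma> n) i else 0)(N := w (\<sigma> n))" for n
    define y0 where "y0 = (\<lambda>_. 0)(N := l)"
    have y0: "y0 \<in> polydisc (Suc N) \<rho>" using l(1) r r0 by (auto simp: polydisc_def y0_def)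
    have "y \<longlonglongrightarrow> y0"
    proof (rule tendsto_coordinatewise)
      fix i
      show "(\<lambda>n. y n i) \<longlonglongrightarrow> y0 i"
      proof (cases "i = N")
        case True then show ?thesis using l(3) by (simp add: y_def y0_def o_def)
      next
        case False
        have "norm (y n i) \<le> 1 / real (Suc n)" for n
        proof -
          have "norm (z (\<sigma> n) i) < 1 / real (Suc (\<sigma> n))" if "i < N"
            using z[of "\<sigma> n"] that by (auto simp: polydisc_def)
          moreover have "1 / real (Suc (\<sigma> n)) \<le> 1 / real (Suc n)"
            using seq_suble[OF l(2), of n] by (simp add: divide_simps)
          ultimately show ?thesis using False by (auto simp: y_def)
        qed
        then have "(\<lambda>n. y n i) \<longlonglongrightarrow> 0"
          by (intro Lim_null_comparison[OF _ LIMSEQ_inverse_real_of_nat])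
             (auto simp: inverse_eq_divide)
        then show ?thesis using False by (simp add: y0_def)
      qed
    qed
    then have lim: "(\<lambda>n. f (y n)) \<longlonglongrightarrow> f y0"
      using cholD(1)[OF f] y0 open_polydisc
      by (metis continuous_on_eq_continuous_at isCont_tendsto_compose)
    have "\<forall>\<^sub>F n in sequentially. f (y n) = 0"
    proof -
      have "\<forall>\<^sub>F n in sequentially. y n \<in> polydisc (Suc N) \<rho>"
        using \<open>y \<longlonglongrightarrow> y0\<close> y0 topological_tendstoD open_polydisc by blast
      then show ?thesis
      proof eventually_elim
        case (elim n)
        have "f (y n) = f ((z (\<sigma> n))(N := w (\<sigma> n)))"
          by (rule cholD(3)[OF f elim]) (auto simp: y_def)
        then show ?case using zero by simp
      qed
    qed
    then have "f y0 = 0" by (intro LIMSEQ_unique[OF lim] tendsto_eventually)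
    then show False using nz[of l] l(1) by (simp add: y0_def)
  qed
  then show ?thesis using that by blast
qed

text \<open>Coordinates are made real one at a time. The slice in the current coordinate is
  holomorphic and not identically zero, so its zeros are isolated and some real value close to
  \<open>x0 j\<close> avoids them.\<close>

lemma chol_real_nonzero_dense:
  fixes x0 :: "nat \<Rightarrow> real"
  assumes G: "chol N \<rho> G" and w: "w \<in> polydisc N \<rho>" "G w \<noteq> 0"
    and x0: "\<And>i. i < N \<Longrightarrow> \<bar>x0 i\<bar> < \<rho>" and e: "e > 0"
  shows "\<exists>x::nat\<Rightarrow>real. (\<forall>i<N. \<bar>x i - x0 i\<bar> < e) \<and> (\<lambda>i. of_real (x i)) \<in> polydisc N \<rho> \<and>
           G (\<lambda>i. of_real (x i)) \<noteq> 0"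
proof -
  have "\<exists>z x. z \<in> polydisc N \<rho> \<and> G z \<noteq> 0 \<and> (\<forall>i<j. z i = of_real (x i) \<and> \<bar>x i - x0 i\<bar> < e)"
    if "j \<le> N" for j
    using that
  proof (induction j)
    case 0 then show ?case using w by auto
  next
    case (Suc j)
    then obtain z and x :: "nat \<Rightarrow> real" where z: "z \<in> polydisc N \<rho>" "G z \<noteq> 0"
      and x: "\<And>i. i < j \<Longrightarrow> z i = of_real (x i) \<and> \<bar>x i - x0 i\<bar> < e" by auto
    have j: "j < N" using Suc by auto
    note hol = chol_holomorphic_slice[OF G z(1), of j]
    have "\<exists>u::real. \<bar>u - x0 j\<bar> < e \<and> \<bar>u\<bar> < \<rho> \<and> G (z(j := of_real u)) \<noteq> 0"
    proof (cases "G (z(j := of_real (x0 j))) = 0")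
      case False then show ?thesis using x0[OF j] e by (intro exI[of _ "x0 j"]) auto
    next
      case True
      obtain s where s: "s > 0" "ball (complex_of_real (x0 j)) s \<subseteq> ball 0 \<rho>"
        "\<And>u. u \<in> ball (complex_of_real (x0 j)) s - {of_real (x0 j)} \<Longrightarrow> G (z(j := u)) \<noteq> 0"
        by (rule isolated_zeros[OF hol, of "of_real (x0 j)" "z j"])
           (use True z j x0[OF j] in \<open>auto simp: polydisc_def\<close>)
      define u where "u = x0 j + min s e / 2"
      have d: "0 < u - x0 j" "u - x0 j < s" "u - x0 j < e" using s(1) e by (auto simp: u_def min_def)
      have "dist (complex_of_real (x0 j)) (of_real u) < s"
        using d unfolding dist_of_real dist_real_def by linarith
      then have "of_real u \<in> ball (complex_of_real (x0 j)) s - {of_real (x0 j)}"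
        using d by auto
      then have "G (z(j := of_real u)) \<noteq> 0" "complex_of_real u \<in> ball 0 \<rho>" using s by blast+
      then show ?thesis using d by (intro exI[of _ u]) auto
    qed
    then obtain u :: real where u: "\<bar>u - x0 j\<bar> < e" "\<bar>u\<bar> < \<rho>" "G (z(j := of_real u)) \<noteq> 0" by blast
    have "z(j := of_real u) \<in> polydisc N \<rho>" using z(1) u by (auto simp: polydisc_def)
    moreover have "\<forall>i<Suc j. (z(j := of_real u)) i = of_real ((x(j := u)) i) \<and> \<bar>(x(j := u)) i - x0 i\<bar> < e"
      using x u by (auto simp: less_Suc_eq)
    ultimately show ?case using u(3) by blast
  qed
  from this[of N] obtain z x where z: "z \<in> polydisc N \<rho>" "G z \<noteq> 0"
    "\<forall>i<N. z i = of_real (x i) \<and> \<bar>x i - x0 i\<bar> < e" by auto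
  have "G z = G (\<lambda>i. of_real (x i))" by (rule cholD(3)[OF G z(1)]) (use z in auto)
  moreover have "(\<lambda>i. of_real (x i)) \<in> polydisc N \<rho>" using z by (auto simp: polydisc_def)
  ultimately show ?thesis using z by auto
qed

text \<open>The product of the functions treated so far stays non-zero on a neighbourhood of
  \<open>x\<close>, and the next function is made non-zero inside it. Half of \<open>e\<close> is
  spent on reaching \<open>x\<close>, the other half on the correction.\<close>

lemma chol_real_nonzero_dense_finite:
  fixes x0 :: "nat \<Rightarrow> real"
  assumes "finite A" "\<And>G. G \<in> A \<Longrightarrow> chol N \<rho> G" "\<And>G. G \<in> A \<Longrightarrow> \<exists>w\<in>polydisc N \<rho>. G w \<noteq> 0"
    and x0: "\<And>i. i < N \<Longrightarrow> \<bar>x0 i\<bar> < \<rho>" and "e > 0"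
  shows "\<exists>x::nat\<Rightarrow>real. (\<forall>i<N. \<bar>x i - x0 i\<bar> < e) \<and> (\<lambda>i. of_real (x i)) \<in> polydisc N \<rho> \<and>
           (\<forall>G\<in>A. G (\<lambda>i. of_real (x i)) \<noteq> 0)"
  using assms(1,2,3,5)
proof (induction A arbitrary: e)
  case empty
  then show ?case using x0 by (intro exI[of _ x0]) (auto simp: polydisc_def)
next
  case (insert G A)
  have "\<exists>x::nat\<Rightarrow>real. (\<forall>i<N. \<bar>x i - x0 i\<bar> < e / 2) \<and> (\<lambda>i. of_real (x i)) \<in> polydisc N \<rho> \<and>
           (\<forall>G\<in>A. G (\<lambda>i. of_real (x i)) \<noteq> 0)"
    by (rule insert.IH) (use insert.prems in auto)
  then obtain x :: "nat \<Rightarrow> real" where x: "\<And>i. i < N \<Longrightarrow> \<bar>x i - x0 i\<bar> < e / 2"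
    "(\<lambda>i. of_real (x i)) \<in> polydisc N \<rho>" "\<forall>G\<in>A. G (\<lambda>i. of_real (x i)) \<noteq> 0"
    by blast
  have "chol N \<rho> (\<lambda>z. \<Prod>G\<in>A. G z)" by (intro chol_prod) (use insert.prems in auto)
  moreover have "(\<Prod>G\<in>A. G (\<lambda>i. of_real (x i))) \<in> - {0}" using x(3) insert.hyps by auto
  ultimately obtain d where d: "d > 0"
    "\<And>z. \<forall>i<N. norm (z i - of_real (x i)) < d \<Longrightarrow> z \<in> polydisc N \<rho> \<and> (\<Prod>G\<in>A. G z) \<in> - {0}"
    using x(2) chol_box[of N \<rho> "\<lambda>z. \<Prod>G\<in>A. G z" "\<lambda>i. of_real (x i)" "- {0}"] by blast
  obtain w where w: "w \<in> polydisc N \<rho>" "G w \<noteq> 0" using insert.prems by blast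
  obtain y :: "nat \<Rightarrow> real" where y: "\<And>i. i < N \<Longrightarrow> \<bar>y i - x i\<bar> < min d (e / 2)"
    "(\<lambda>i. of_real (y i)) \<in> polydisc N \<rho>" "G (\<lambda>i. of_real (y i)) \<noteq> 0"
    using chol_real_nonzero_dense[OF insert.prems(1)[OF insertI1] w, of x "min d (e / 2)"]
      x(2) d(1) \<open>e > 0\<close> by (auto simp: polydisc_def)
  have "norm (complex_of_real (y i) - of_real (x i)) < d" if "i < N" for i
    using y(1)[OF that] by (metis min_less_iff_conj norm_of_real of_real_diff)
  then have "(\<Prod>G\<in>A. G (\<lambda>i. of_real (y i))) \<noteq> 0" using d(2)[of "\<lambda>i. of_real (y i)"] by auto
  moreover have "\<bar>y i - x0 i\<bar> < e" if "i < N" for i using x(1)[OF that] y(1)[OF that] by linarith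
  ultimately show ?case using y insert.hyps by auto
qed

text \<open>Taylor expansion in the first coordinate: \<open>k\<close> is the least order whose
  coefficient function does not vanish identically. The quotient is a Cauchy integral, so it is
  holomorphic also where \<open>z 0 = 0\<close>, and it no longer vanishes identically on that
  hyperplane.\<close>

lemma rhol_divide_first_power:
  assumes F: "rhol N \<rho> F" and \<rho>: "\<rho> > 0" and N: "N > 0"
  defines "\<sigma> \<equiv> \<rho> / 4"
  shows "(\<forall>z\<in>polydisc N \<sigma>. F z = 0) \<or>
     (\<exists>k G. rhol N \<sigma> G \<and> (\<forall>z\<in>polydisc N \<sigma>. F z = z 0 ^ k * G z) \<and> (\<exists>x\<in>polydisc N \<sigma>. G (x(0 := 0)) \<noteq> 0))"
proof -
  note C = rhol_chol[OF F]
  define r where "r = \<rho> / 2"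
  have r: "0 < r" "r < \<rho>" "\<sigma> < r" "\<sigma> < \<rho>" using \<rho> by (auto simp: r_def \<sigma>_def)
  have sub: "polydisc N \<sigma> \<subseteq> polydisc N \<rho>" using r by (intro polydisc_mono) auto
  have upd: "z(0 := w) \<in> polydisc N \<rho>" if "z \<in> polydisc N \<sigma>" "w \<in> cball 0 r" for z w
    using that r by (auto simp: polydisc_def)
  have hol: "(\<lambda>w. F (z(0 := w))) holomorphic_on ball 0 \<rho>" if "z \<in> polydisc N \<sigma>" for z
    using chol_holomorphic_slice[OF C] that sub by blast
  have holr: "(\<lambda>w. F (z(0 := w))) holomorphic_on ball 0 r"
       "continuous_on (cball 0 r) (\<lambda>w. F (z(0 := w)))" if "z \<in> polydisc N \<sigma>" for z
    using hol[OF that] r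
    by (force intro: holomorphic_on_subset holomorphic_on_imp_continuous_on continuous_on_subset)+
  define c where "c j z = cint r (\<lambda>w. F (z(0 := w)) / w ^ Suc j)" for j z
  define G where "G k z = cint r (\<lambda>w. F (z(0 := w)) / (w ^ k * (w - z 0)))" for k z
  have c: "((\<lambda>w. F (z(0 := w)) / w ^ Suc j) has_contour_integral 2 * pi * \<i> * c j z) (circlepath 0 r)"
    and cd: "c j z = (deriv ^^ j) (\<lambda>w. F (z(0 := w))) 0 / fact j"
    if "z \<in> polydisc N \<sigma>" for j z
  proof -
    have *: "((\<lambda>w. F (z(0 := w)) / (w - 0) ^ Suc j) has_contour_integral
        (2 * pi * \<i>) / fact j * (deriv ^^ j) (\<lambda>w. F (z(0 := w))) 0) (circlepath 0 r)"
      by (rule Cauchy_has_contour_integral_higher_derivative_circlepath)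
         (use holr[OF that] r in auto)
    then show "c j z = (deriv ^^ j) (\<lambda>w. F (z(0 := w))) 0 / fact j"
      unfolding c_def by (subst has_contour_integral_cint) auto
    then have "(2 * pi * \<i>) / fact j * (deriv ^^ j) (\<lambda>w. F (z(0 := w))) 0 = 2 * pi * \<i> * c j z" by simp
    with * show "((\<lambda>w. F (z(0 := w)) / w ^ Suc j) has_contour_integral 2 * pi * \<i> * c j z) (circlepath 0 r)"
      by (simp only: diff_zero)
  qed
  have rG: "rhol N \<sigma> (G k)" for k
    unfolding G_def
  proof (rule rhol_cint[OF r(1)])
    fix w :: complex assume w: "w \<in> sphere 0 r"
    have "chol N \<sigma> (\<lambda>z. F (z(0 := w)))"
    proof (rule chol_compose[OF C, where L = "\<lambda>z. z(0 := w)"])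
      show "z(0 := w) \<in> polydisc N \<rho>" if "z \<in> polydisc N \<sigma>" for z using upd that w by auto
      show "continuous_on UNIV (\<lambda>z::nat\<Rightarrow>complex. z(0 := w))"
        by (rule continuous_on_fun_upd[OF continuous_on_id continuous_on_const])
      show "\<exists>a' v'. \<forall>\<zeta>. (cline a v \<zeta>)(0 := w) = cline a' v' \<zeta>" for a v
        by (intro exI[of _ "a(0 := w)"] exI[of _ "v(0 := 0)"]) (auto simp: cline_def)
    qed auto
    then show "chol N \<sigma> (\<lambda>z. F (z(0 := w)) / (w ^ k * (w - z 0)))"
      using w r N by (intro chol_divide chol_mult chol_const chol_diff chol_coord) (auto simp: polydisc_def)
  next
    have "continuous_on (sphere 0 r \<times> polydisc N \<sigma>) (\<lambda>p. F ((snd p)(0 := fst p)))"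
      by (rule continuous_on_compose2[OF cholD(1)[OF C]]) (use upd in \<open>auto intro!: continuous_on_fun_upd continuous_on_fst continuous_on_snd continuous_on_id\<close>)
    moreover have "continuous_on (sphere 0 r \<times> polydisc N \<sigma>) (\<lambda>p. fst p ^ k * (fst p - snd p 0))"
      by (intro continuous_intros continuous_on_product_then_coordinatewise)
    moreover have "\<forall>p\<in>sphere 0 r \<times> polydisc N \<sigma>. fst p ^ k * (fst p - snd p 0) \<noteq> 0"
      using r N by (auto simp: polydisc_def)
    ultimately have "continuous_on (sphere 0 r \<times> polydisc N \<sigma>)
        (\<lambda>p. F ((snd p)(0 := fst p)) / (fst p ^ k * (fst p - snd p 0)))"
      by (rule continuous_on_divide)
    then show "continuous_on (sphere 0 r \<times> polydisc N \<sigma>)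
        (\<lambda>(w, z). F (z(0 := w)) / (w ^ k * (w - z 0)))"
      by (simp add: case_prod_unfold)
  next
    fix w z assume "w \<in> sphere (0::complex) r" "z \<in> polydisc N \<sigma>"
    then have "F (\<lambda>i. cnj ((z(0 := w)) i)) = cnj (F (z(0 := w)))"
      by (intro rhol_cnj[OF F] upd) auto
    moreover have "(\<lambda>i. cnj ((z(0 := w)) i)) = (\<lambda>i. cnj (z i))(0 := cnj w)" by auto
    ultimately show "F ((\<lambda>i. cnj (z i))(0 := cnj w)) / (cnj w ^ k * (cnj w - cnj (z 0))) =
        cnj (F (z(0 := w)) / (w ^ k * (w - z 0)))" by simp
  qed
  have key: "F z = z 0 ^ k * G k z" if z: "z \<in> polydisc N \<sigma>" and c0: "\<And>j. j < k \<Longrightarrow> c j z = 0" for z k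
  proof (cases "z 0 = 0")
    case True
    have "c 0 z = F (z(0 := 0))" using cd[OF z, of 0] by simp
    moreover have "z(0 := 0) = z" using True by auto
    moreover have "G 0 z = c 0 z" unfolding G_def c_def using True by simp
    ultimately show ?thesis using True c0[of 0] by (cases k) auto
  next
    case False
    define t where "t = z 0"
    have t: "t \<noteq> 0" "norm t < r" using z False N r by (auto simp: t_def polydisc_def)
    \<comment> \<open>Partial fractions: the kernel is \<open>1 / (w - t)\<close> minus the first
      \<open>k\<close> terms of its geometric expansion in \<open>t / w\<close>, divided by
      \<open>t ^ k\<close>. The subtracted terms integrate to Taylor coefficients, which vanish
      below order \<open>k\<close>.\<close>
    have pf: "F (z(0 := w)) / (w ^ k * (w - t)) =
       (F (z(0 := w)) / (w - t) - (\<Sum>j<k. t ^ j * (F (z(0 := w)) / w ^ Suc j))) / t ^ k" if "w \<in> sphere 0 r" for w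
    proof -
      have w: "w \<noteq> 0" "w \<noteq> t" using that t r by auto
      have ps: "t ^ k / (w ^ k * (w - t)) = 1 / (w - t) - (\<Sum>j<k. t ^ j / w ^ Suc j)"
      proof (induction k)
        case (Suc k)
        have "t ^ Suc k / (w ^ Suc k * (w - t)) = t ^ k / (w ^ k * (w - t)) - t ^ k / w ^ Suc k"
          using w by (simp add: divide_simps) (simp add: algebra_simps)
        then show ?case using Suc by simp
      qed simp
      have "F (z(0 := w)) * (t ^ k / (w ^ k * (w - t))) =
         F (z(0 := w)) * (1 / (w - t)) - F (z(0 := w)) * (\<Sum>j<k. t ^ j / w ^ Suc j)"
        unfolding ps by (rule right_diff_distrib)
      also have "\<dots> = F (z(0 := w)) / (w - t) - (\<Sum>j<k. t ^ j * (F (z(0 := w)) / w ^ Suc j))"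
        by (simp add: sum_distrib_left mult.commute)
      finally have "F (z(0 := w)) * (t ^ k / (w ^ k * (w - t))) =
         F (z(0 := w)) / (w - t) - (\<Sum>j<k. t ^ j * (F (z(0 := w)) / w ^ Suc j))" .
      then show ?thesis using t by (simp add: eq_divide_eq mult.commute)
    qed
    have ci: "((\<lambda>w. F (z(0 := w)) / (w - t)) has_contour_integral 2 * pi * \<i> * F (z(0 := t))) (circlepath 0 r)"
      using Cauchy_integral_circlepath[OF holr(2)[OF z] holr(1)[OF z], of t] t by simp
    have "((\<lambda>w. (F (z(0 := w)) / (w - t) - (\<Sum>j<k. t ^ j * (F (z(0 := w)) / w ^ Suc j))) / t ^ k)
        has_contour_integral (2 * pi * \<i> * F (z(0 := t)) - (\<Sum>j<k. t ^ j * (2 * pi * \<i> * c j z))) / t ^ k)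
        (circlepath 0 r)"
      by (intro has_contour_integral_div has_contour_integral_diff has_contour_integral_sum
           has_contour_integral_lmul c[OF z] ci) auto
    then have "((\<lambda>w. F (z(0 := w)) / (w ^ k * (w - t))) has_contour_integral
       (2 * pi * \<i> * F (z(0 := t))) / t ^ k) (circlepath 0 r)"
      using c0 by (intro has_contour_integral_eq[OF _ pf[symmetric]]) (use r in auto)
    then have "G k z = F (z(0 := t)) / t ^ k"
      unfolding G_def t_def by (subst has_contour_integral_cint) auto
    moreover have "z(0 := t) = z" by (auto simp: t_def)
    ultimately show ?thesis using t by (simp add: t_def)
  qed
  show ?thesis
  proof (cases "\<exists>k. \<exists>x\<in>polydisc N \<sigma>. c k x \<noteq> 0")
    case False
    have "F z = 0" if z: "z \<in> polydisc N \<sigma>" for z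
    proof -
      have "(deriv ^^ j) (\<lambda>w. F (z(0 := w))) 0 = 0" for j
        using False z cd[OF z, of j] by simp
      then have "F (z(0 := w)) = 0" if "w \<in> ball 0 r" for w
        using holomorphic_fun_eq_0_on_ball[OF holr(1)[OF z] that] by blast
      moreover have "z 0 \<in> ball 0 r" using z r N by (auto simp: polydisc_def)
      ultimately have "F (z(0 := z 0)) = 0" by blast
      then show ?thesis by simp
    qed
    then show ?thesis by blast
  next
    case True
    define k where "k = (LEAST k. \<exists>x\<in>polydisc N \<sigma>. c k x \<noteq> 0)"
    obtain x where x: "x \<in> polydisc N \<sigma>" "c k x \<noteq> 0"
      using LeastI_ex[OF True] unfolding k_def by blast
    have "c j z = 0" if "j < k" "z \<in> polydisc N \<sigma>" for j z
      using not_less_Least[OF that(1)[unfolded k_def]] that(2) by blast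
    then have "\<forall>z\<in>polydisc N \<sigma>. F z = z 0 ^ k * G k z" using key by blast
    moreover have "G k (x(0 := 0)) = c k x" by (simp add: G_def c_def mult.commute)
    ultimately show ?thesis using rG x by metis
  qed
qed

section \<open>Hankel determinants of power sums count distinct nodes\<close>

lemma hankel_mult_vec:
  fixes \<mu> :: "complex \<Rightarrow> complex" and v :: "complex Matrix.vec"
  assumes v: "v \<in> carrier_vec j" and a: "a < j"
    and s: "\<And>k. s k = (\<Sum>p\<in>Z. \<mu> p * p ^ k)"
  shows "Matrix.vec_index (Matrix.mat j j (\<lambda>(a, b). s (a + b)) *\<^sub>v v) a =
    (\<Sum>p\<in>Z. \<mu> p * p ^ a * poly (\<Sum>i<j. monom (Matrix.vec_index v i) i) p)"
proof -
  \<comment> \<open>The vector is read as the coefficients of a polynomial. Exchanging the two sums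
    turns the matrix product into a weighted sum of the values of that polynomial at the
    nodes.\<close>
  have "Matrix.vec_index (Matrix.mat j j (\<lambda>(a, b). s (a + b)) *\<^sub>v v) a = (\<Sum>b<j. s (a + b) * Matrix.vec_index v b)"
    using v a by (simp add: scalar_prod_def lessThan_atLeast0)
  also have "\<dots> = (\<Sum>b<j. \<Sum>p\<in>Z. \<mu> p * p ^ a * (p ^ b * Matrix.vec_index v b))"
    by (simp add: s sum_distrib_left power_add mult_ac)
  also have "\<dots> = (\<Sum>p\<in>Z. \<mu> p * p ^ a * (\<Sum>b<j. p ^ b * Matrix.vec_index v b))"
    by (subst sum.swap) (simp add: sum_distrib_left)
  finally show ?thesis by (simp add: poly_sum poly_monom mult.commute)
qed

text \<open>The monic polynomial with the nodes as simple roots has degree \<open>card Z\<close>,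
  below \<open>j\<close>, so its coefficients form a non-zero kernel vector.\<close>

lemma hankel_det_eq_0:
  fixes \<mu> :: "complex \<Rightarrow> complex"
  assumes Z: "finite Z" "card Z < j" and s: "\<And>k. s k = (\<Sum>p\<in>Z. \<mu> p * p ^ k)"
  shows "Determinant.det (Matrix.mat j j (\<lambda>(a, b). s (a + b))) = 0"
proof -
  define P where "P = (\<Prod>p\<in>Z. [:- p, 1:])"
  have deg: "degree P = card Z" unfolding P_def by (subst degree_prod_sum_eq) auto
  have "lead_coeff P = 1" unfolding P_def lead_coeff_prod by simp
  define v where "v = Matrix.vec j (coeff P)"
  have v: "v \<in> carrier_vec j" by (simp add: v_def)
  have "Matrix.vec_index v (card Z) = 1" using Z deg \<open>lead_coeff P = 1\<close> by (simp add: v_def)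
  then have "v \<noteq> 0\<^sub>v j" using Z by auto
  have "(\<Sum>i<j. monom (Matrix.vec_index v i) i) = P"
    using deg Z(2) by (intro poly_eqI) (auto simp: v_def coeff_sum coeff_eq_0)
  moreover have "poly P p = 0" if "p \<in> Z" for p
    using that Z by (auto simp: P_def poly_prod)
  ultimately have "Matrix.mat j j (\<lambda>(a, b). s (a + b)) *\<^sub>v v = 0\<^sub>v j"
    using hankel_mult_vec[OF v _ s] by (intro eq_vecI) auto
  then show ?thesis
    using v \<open>v \<noteq> 0\<^sub>v j\<close> by (subst det_0_iff_vec_prod_zero_field[of _ j]) auto
qed

text \<open>A kernel vector gives a polynomial \<open>P\<close> of degree below \<open>j\<close>
  that is orthogonal, with weights \<open>\<mu>\<close>, to all polynomials of degree below
  \<open>j\<close>. Testing against the product over all nodes but one shows that \<open>P\<close>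
  vanishes at each node, and \<open>j\<close> roots force \<open>P = 0\<close>. With
  \<open>hankel_det_eq_0\<close>, the largest size with non-zero determinant is the number of
  nodes.\<close>

lemma hankel_det_neq_0:
  fixes \<mu> :: "complex \<Rightarrow> complex"
  assumes Z: "finite Z" "card Z = j" and \<mu>: "\<And>p. p \<in> Z \<Longrightarrow> \<mu> p \<noteq> 0"
    and s: "\<And>k. s k = (\<Sum>p\<in>Z. \<mu> p * p ^ k)"
  shows "Determinant.det (Matrix.mat j j (\<lambda>(a, b). s (a + b))) \<noteq> 0"
proof
  assume "Determinant.det (Matrix.mat j j (\<lambda>(a, b). s (a + b))) = 0"
  then obtain v where v: "v \<in> carrier_vec j" "v \<noteq> 0\<^sub>v j"
    and Hv: "Matrix.mat j j (\<lambda>(a, b). s (a + b)) *\<^sub>v v = 0\<^sub>v j"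
    by (subst (asm) det_0_iff_vec_prod_zero_field[of _ j]) auto
  define P where "P = (\<Sum>i<j. monom (Matrix.vec_index v i) i)"
  have cP: "coeff P i = (if i < j then Matrix.vec_index v i else 0)" for i
    by (auto simp: P_def coeff_sum)
  have z: "(\<Sum>p\<in>Z. \<mu> p * p ^ a * poly P p) = 0" if "a < j" for a
    using hankel_mult_vec[OF v(1) that s] Hv that by (simp add: P_def)
  have zQ: "(\<Sum>p\<in>Z. \<mu> p * poly Q p * poly P p) = 0" if "degree Q < j" for Q
  proof -
    have "(\<Sum>p\<in>Z. \<mu> p * poly Q p * poly P p) =
      (\<Sum>p\<in>Z. \<Sum>i\<le>degree Q. coeff Q i * (\<mu> p * p ^ i * poly P p))"
      by (simp add: poly_altdef sum_distrib_left sum_distrib_right mult_ac)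
    also have "\<dots> = (\<Sum>i\<le>degree Q. coeff Q i * (\<Sum>p\<in>Z. \<mu> p * p ^ i * poly P p))"
      by (subst sum.swap) (simp add: sum_distrib_left)
    also have "\<dots> = 0" using z that by (intro sum.neutral) auto
    finally show ?thesis .
  qed
  have root: "poly P q = 0" if q: "q \<in> Z" for q
  proof -
    define Q where "Q = (\<Prod>p\<in>Z-{q}. [:- p, 1:])"
    have "degree Q = card (Z - {q})" unfolding Q_def by (subst degree_prod_sum_eq) auto
    also have "\<dots> < j" using Z q by (metis card_Diff1_less)
    finally have "degree Q < j" .
    from zQ[OF this] have "(\<Sum>p\<in>Z. \<mu> p * poly Q p * poly P p) = 0" .
    moreover have "(\<Sum>p\<in>Z-{q}. \<mu> p * poly Q p * poly P p) = 0"
      using Z by (intro sum.neutral) (auto simp: Q_def poly_prod)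
    ultimately have "\<mu> q * poly Q q * poly P q = 0"
      using sum.remove[OF Z(1) q, of "\<lambda>p. \<mu> p * poly Q p * poly P p"] by simp
    moreover have "poly Q q \<noteq> 0" using Z by (auto simp: Q_def poly_prod)
    ultimately show ?thesis using \<mu>[OF q] by auto
  qed
  have "P = 0"
  proof (rule ccontr)
    assume "P \<noteq> 0"
    have "degree P < j"
    proof -
      have "coeff P (degree P) \<noteq> 0" using \<open>P \<noteq> 0\<close> by simp
      then show ?thesis using cP by metis
    qed
    moreover have "card Z \<le> card {x. poly P x = 0}"
      using root \<open>P \<noteq> 0\<close> poly_roots_finite by (intro card_mono) auto
    ultimately show False using card_poly_roots_bound[OF \<open>P \<noteq> 0\<close>] Z by linarith
  qed
  then have "v = 0\<^sub>v j" using cP v(1) by (intro eq_vecI) (auto, metis coeff_0)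
  then show False using v by simp
qed

lemma continuous_on_cint:
  assumes r: "r > 0" and cont: "continuous_on (sphere 0 r \<times> S) (\<lambda>(w, x). K w x)"
  shows "continuous_on S (\<lambda>x. cint r (\<lambda>w. K w x))"
proof -
  note img = circlepath_mem_sphere[OF r]
  have c2: "continuous_on (S \<times> cbox 0 (1::real)) (\<lambda>q. circlepath 0 r (snd q))"
    unfolding circlepath by (intro continuous_intros)
  have "continuous_on (S \<times> cbox 0 (1::real)) ((\<lambda>(w, x). K w x) \<circ> (\<lambda>q. (circlepath 0 r (snd q), fst q)))"
    by (intro continuous_on_compose continuous_intros c2 continuous_on_subset[OF cont])
       (use img in auto)
  from continuous_on_mult[OF this c2]
  have "continuous_on (S \<times> cbox 0 (1::real)) (\<lambda>(x, s). K (circlepath 0 r s) x * circlepath 0 r s)"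
    by (simp add: case_prod_unfold o_def)
  from integral_continuous_on_param[OF this] show ?thesis by (simp add: cint_def)
qed

lemma holomorphic_finite_zeros_cball:
  assumes f: "f holomorphic_on ball 0 \<rho>" and r: "r < \<rho>" and nz: "w \<in> ball 0 \<rho>" "f w \<noteq> (0::complex)"
  shows "finite {w \<in> cball 0 r. f w = 0}"
proof (rule ccontr)
  assume inf: "infinite {w \<in> cball 0 r. f w = 0}"
  have "compact (cball 0 r :: complex set)" by simp
  then obtain x where x: "x \<in> cball 0 r" "x islimpt {w \<in> cball 0 r. f w = 0}"
    using inf Heine_Borel_imp_Bolzano_Weierstrass[of "cball 0 r" "{w \<in> cball 0 r. f w = 0}"] by blast
  have "f w = 0"
    by (rule analytic_continuation[OF f _ _ _ _ x(2)]) (use x r nz in auto)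
  then show False using nz by simp
qed

lemma chol_update_last:
  assumes f: "chol (Suc N) \<rho> f" and e: "e \<le> \<rho>" and u: "norm u < \<rho>"
  shows "chol N e (\<lambda>z. f (z(N := u)))"
proof (rule chol_compose[OF f, where L = "\<lambda>z. z(N := u)"])
  show "z(N := u) \<in> polydisc (Suc N) \<rho>" if "z \<in> polydisc N e" for z
    using that e u by (auto simp: polydisc_def less_Suc_eq)
  show "continuous_on UNIV (\<lambda>z::nat\<Rightarrow>complex. z(N := u))"
    by (rule continuous_on_fun_upd[OF continuous_on_id continuous_on_const])
  show "\<exists>a' v'. \<forall>\<zeta>. (cline a v \<zeta>)(N := u) = cline a' v' \<zeta>" for a v
    by (intro exI[of _ "a(N := u)"] exI[of _ "v(N := 0)"]) (auto simp: cline_def)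
qed (auto simp: less_Suc_eq)

text \<open>Argument principle with weight \<open>w ^ k\<close>: integrating the logarithmic
  derivative times \<open>w ^ k\<close> over the circle collects \<open>p ^ k\<close> at each root
  \<open>p\<close> in the disc, with multiplicity. No root meets the circle, so the integrand
  depends holomorphically on the base point.\<close>

lemma power_sums_rhol:
  assumes f: "rhol (Suc N) \<rho> f" and r: "0 < r" "r < \<rho>" and e: "e \<le> \<rho>"
    and nz: "\<And>z w. z \<in> polydisc N e \<Longrightarrow> norm w = r \<Longrightarrow> f (z(N := w)) \<noteq> 0"
  defines "Z \<equiv> \<lambda>z. {w. norm w < r \<and> f (z(N := w)) = 0}"
  obtains s where "\<And>k. rhol N e (s k)" "\<And>z. z \<in> polydisc N e \<Longrightarrow> finite (Z z)"
    "\<And>z k. z \<in> polydisc N e \<Longrightarrow> s k z = (\<Sum>p\<in>Z z. of_int (zorder (\<lambda>w. f (z(N := w))) p) * p ^ k)"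
    "\<And>z p. z \<in> polydisc N e \<Longrightarrow> p \<in> Z z \<Longrightarrow> zorder (\<lambda>w. f (z(N := w))) p > 0"
proof -
  note C = rhol_chol[OF f]
  define r2 where "r2 = (r + \<rho>) / 2"
  have r2: "0 < r2" "r < r2" "r2 < \<rho>" using r by (auto simp: r2_def)
  \<comment> \<open>The derivative in the last variable, as a Cauchy integral over the larger circle
    of radius \<open>r2\<close>; in this form its holomorphy in the base point is an instance of
    \<open>chol_cint\<close>.\<close>
  define D where "D w z = cint r2 (\<lambda>u. f (z(N := u)) / (u - w)\<^sup>2)" for w z
  define s where "s k z = cint r (\<lambda>w. D w z * w ^ k / f (z(N := w)))" for k z
  have upd: "z(N := u) \<in> polydisc (Suc N) \<rho>" if "z \<in> polydisc N e" "norm u < \<rho>" for z u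
    using that e by (auto simp: polydisc_def less_Suc_eq)
  have hol: "(\<lambda>w. f (z(N := w))) holomorphic_on ball 0 \<rho>" if "z \<in> polydisc N e" for z
  proof -
    have "(\<lambda>w. f ((z(N := 0))(N := w))) holomorphic_on ball 0 \<rho>"
      by (rule chol_holomorphic_slice[OF C]) (use upd[OF that, of 0] r in auto)
    then show ?thesis by simp
  qed
  have Dcont: "continuous_on (sphere (0::complex) r \<times> polydisc N e) (\<lambda>p. D (fst p) (snd p))"
    unfolding D_def
  proof (rule continuous_on_cint[OF r2(1)])
    have "continuous_on (sphere (0::complex) r2 \<times> (sphere (0::complex) r \<times> polydisc N e)) (\<lambda>q. f ((snd (snd q))(N := fst q)))"
      by (rule continuous_on_compose2[OF cholD(1)[OF C]])
         (use upd r2 in \<open>auto intro!: continuous_on_fun_upd continuous_on_fst continuous_on_snd continuous_on_id\<close>)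
    moreover have "continuous_on (sphere (0::complex) r2 \<times> (sphere (0::complex) r \<times> polydisc N e)) (\<lambda>q. (fst q - fst (snd q))\<^sup>2)"
      by (intro continuous_intros)
    moreover have "\<forall>q\<in>sphere (0::complex) r2 \<times> (sphere (0::complex) r \<times> polydisc N e). (fst q - fst (snd q))\<^sup>2 \<noteq> 0"
      using r2 by auto
    ultimately have "continuous_on (sphere (0::complex) r2 \<times> (sphere (0::complex) r \<times> polydisc N e))
       (\<lambda>q. f ((snd (snd q))(N := fst q)) / (fst q - fst (snd q))\<^sup>2)"
      by (rule continuous_on_divide)
    then show "continuous_on (sphere (0::complex) r2 \<times> (sphere (0::complex) r \<times> polydisc N e))
       (\<lambda>(u, p). f ((snd p)(N := u)) / (u - fst p)\<^sup>2)"
      by (simp add: case_prod_unfold)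
  qed
  have Dchol: "chol N e (D w)" if w: "w \<in> sphere 0 r" for w
    unfolding D_def
  proof (rule chol_cint[OF r2(1)])
    fix u :: complex assume "u \<in> sphere 0 r2"
    then show "chol N e (\<lambda>z. f (z(N := u)) / (u - w)\<^sup>2)"
      using r2 w by (intro chol_divide chol_update_last[OF C e] chol_const) auto
  next
    have "continuous_on (sphere (0::complex) r2 \<times> polydisc N e) (\<lambda>q. f ((snd q)(N := fst q)))"
      by (rule continuous_on_compose2[OF cholD(1)[OF C]])
         (use upd r2 in \<open>auto intro!: continuous_on_fun_upd continuous_on_fst continuous_on_snd continuous_on_id\<close>)
    moreover have "continuous_on (sphere (0::complex) r2 \<times> polydisc N e) (\<lambda>q. (fst q - w)\<^sup>2)"
      by (intro continuous_intros)
    moreover have "\<forall>q\<in>sphere (0::complex) r2 \<times> polydisc N e. (fst q - w)\<^sup>2 \<noteq> 0"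
      using r2 w by auto
    ultimately have "continuous_on (sphere (0::complex) r2 \<times> polydisc N e) (\<lambda>q. f ((snd q)(N := fst q)) / (fst q - w)\<^sup>2)"
      by (rule continuous_on_divide)
    then show "continuous_on (sphere (0::complex) r2 \<times> polydisc N e) (\<lambda>(u, z). f (z(N := u)) / (u - w)\<^sup>2)"
      by (simp add: case_prod_unfold)
  qed
  have fsym: "f ((\<lambda>i. cnj (z i))(N := cnj u)) = cnj (f (z(N := u)))"
    if "z \<in> polydisc N e" "norm u < \<rho>" for z u
  proof -
    have "(\<lambda>i. cnj (z i))(N := cnj u) = (\<lambda>i. cnj ((z(N := u)) i))" by auto
    then show ?thesis using rhol_cnj[OF f upd[OF that]] by simp
  qed
  have Dsym: "D (cnj w) (\<lambda>i. cnj (z i)) = cnj (D w z)" if z: "z \<in> polydisc N e" for w z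
  proof -
    have "D (cnj w) (\<lambda>i. cnj (z i)) = cint r2 (\<lambda>u. cnj (f (z(N := cnj u)) / (cnj u - w)\<^sup>2))"
      unfolding D_def cint_def
    proof (intro integral_cong)
      fix t
      define u where "u = circlepath 0 r2 t"
      have "norm (cnj u) < \<rho>" using circlepath_mem_sphere[OF r2(1), of t] r2 by (simp add: u_def)
      from fsym[OF z this]
      show "f ((\<lambda>i. cnj (z i))(N := circlepath 0 r2 t)) / (circlepath 0 r2 t - cnj w)\<^sup>2 * circlepath 0 r2 t =
         cnj (f (z(N := cnj (circlepath 0 r2 t))) / (cnj (circlepath 0 r2 t) - w)\<^sup>2) * circlepath 0 r2 t"
        by (simp add: u_def)
    qed
    then show ?thesis by (simp add: cnj_cint D_def)
  qed
  have rs: "rhol N e (s k)" for k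
    unfolding s_def
  proof (rule rhol_cint[OF r(1)])
    fix w :: complex assume w: "w \<in> sphere 0 r"
    then show "chol N e (\<lambda>z. D w z * w ^ k / f (z(N := w)))"
      using r nz by (intro chol_divide chol_mult Dchol chol_const chol_update_last[OF C e]) auto
  next
    have "continuous_on (sphere (0::complex) r \<times> polydisc N e) (\<lambda>q. f ((snd q)(N := fst q)))"
      by (rule continuous_on_compose2[OF cholD(1)[OF C]])
         (use upd r in \<open>auto intro!: continuous_on_fun_upd continuous_on_fst continuous_on_snd continuous_on_id\<close>)
    moreover have "\<forall>q\<in>sphere (0::complex) r \<times> polydisc N e. f ((snd q)(N := fst q)) \<noteq> 0"
      using nz by auto
    moreover have "continuous_on (sphere (0::complex) r \<times> polydisc N e) (\<lambda>q. D (fst q) (snd q) * fst q ^ k)"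
      by (intro continuous_on_mult Dcont continuous_intros)
    ultimately have "continuous_on (sphere (0::complex) r \<times> polydisc N e)
        (\<lambda>q. D (fst q) (snd q) * fst q ^ k / f ((snd q)(N := fst q)))"
      by (intro continuous_on_divide)
    then show "continuous_on (sphere (0::complex) r \<times> polydisc N e) (\<lambda>(w, z). D w z * w ^ k / f (z(N := w)))"
      by (simp add: case_prod_unfold)
  next
    fix w z assume "w \<in> sphere (0::complex) r" "z \<in> polydisc N e"
    then show "D (cnj w) (\<lambda>i. cnj (z i)) * cnj w ^ k / f ((\<lambda>i. cnj (z i))(N := cnj w)) =
        cnj (D w z * w ^ k / f (z(N := w)))"
      using r by (simp add: Dsym fsym)
  qed
  have root: "finite (Z z) \<and> (\<forall>k. s k z = (\<Sum>p\<in>Z z. of_int (zorder (\<lambda>w. f (z(N := w))) p) * p ^ k)) \<and>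
     (\<forall>p\<in>Z z. zorder (\<lambda>w. f (z(N := w))) p > 0)" if z: "z \<in> polydisc N e" for z
  proof -
    define g where "g w = f (z(N := w))" for w
    have g: "g holomorphic_on ball 0 \<rho>" using hol[OF z] by (simp add: g_def[abs_def])
    have gnz: "g w \<noteq> 0" if "norm w = r" for w using nz[OF z that] by (simp add: g_def)
    \<comment> \<open>Any point of the circle of radius \<open>r\<close> shows that \<open>g\<close>
      is not identically zero. The argument principle is applied on \<open>ball 0 r2\<close> and
      asks for finitely many zeros there, including those outside the circle.\<close>
    have fin: "finite {w \<in> cball 0 r2. g w = 0}"
      by (rule holomorphic_finite_zeros_cball[OF g r2(3), of "of_real r"]) (use r gnz in auto)
    have pz: "{w \<in> ball 0 r2. g w = 0 \<or> w \<in> {}} \<subseteq> {w \<in> cball 0 r2. g w = 0}" by auto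
    have finZ: "finite (Z z)"
      by (rule finite_subset[OF _ fin]) (use r2 in \<open>auto simp: Z_def g_def\<close>)
    have out: "winding_number (circlepath 0 r) w = 0" if "norm w > r" for w
      by (rule winding_number_zero_outside[of _ "cball 0 r"]) (use that r in auto)
    have ins: "winding_number (circlepath 0 r) w = 1" if "norm w < r" for w
      by (rule winding_number_circlepath) (use that in simp)
    have sk: "s k z = (\<Sum>p\<in>Z z. of_int (zorder g p) * p ^ k)" for k
    proof -
      have deriv: "deriv g w = D w z" if "norm w = r" for w
      proof -
        have "(g has_field_derivative (1 / (2 * of_real pi * \<i>) *
            contour_integral (circlepath 0 r2) (\<lambda>u. g u / (u - w)^2))) (at w)"
          by (rule Cauchy_derivative_integral_circlepath(2))
             (use g r2 that in \<open>auto intro: holomorphic_on_subset holomorphic_on_imp_continuous_on continuous_on_subset\<close>)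
        then show ?thesis
          unfolding contour_integral_eq_cint by (auto simp: D_def g_def[abs_def] dest!: DERIV_imp_deriv)
      qed
      have "contour_integral (circlepath 0 r) (\<lambda>x. deriv g x * x ^ k / g x) = 2 * pi * \<i> *
          (\<Sum>p\<in>{w \<in> ball 0 r2. g w = 0 \<or> w \<in> {}}. winding_number (circlepath 0 r) p * p ^ k * of_int (zorder g p))"
        by (rule argument_principle)
           (use g r r2 gnz out finite_subset[OF pz fin] in
             \<open>auto intro: holomorphic_on_subset intro!: holomorphic_intros\<close>)
      \<comment> \<open>Roots outside the circle have winding number zero and drop out of the sum;
        those inside have winding number one.\<close>
      also have "(\<Sum>p\<in>{w \<in> ball 0 r2. g w = 0 \<or> w \<in> {}}. winding_number (circlepath 0 r) p * p ^ k * of_int (zorder g p)) =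
          (\<Sum>p\<in>Z z. of_int (zorder g p) * p ^ k)"
      proof (rule sum.mono_neutral_cong_right)
        show "finite {w \<in> ball 0 r2. g w = 0 \<or> w \<in> {}}" using finite_subset[OF pz fin] .
        show "Z z \<subseteq> {w \<in> ball 0 r2. g w = 0 \<or> w \<in> {}}" using r2 by (auto simp: Z_def g_def)
        show "\<forall>p\<in>{w \<in> ball 0 r2. g w = 0 \<or> w \<in> {}} - Z z.
            winding_number (circlepath 0 r) p * p ^ k * of_int (zorder g p) = 0"
        proof
          fix p assume p: "p \<in> {w \<in> ball 0 r2. g w = 0 \<or> w \<in> {}} - Z z"
          then have "norm p > r" using gnz[of p] by (force simp: Z_def g_def)
          then show "winding_number (circlepath 0 r) p * p ^ k * of_int (zorder g p) = 0" by (simp add: out)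
        qed
      qed (auto simp: Z_def ins)
      finally have "cint r (\<lambda>x. deriv g x * x ^ k / g x) = (\<Sum>p\<in>Z z. of_int (zorder g p) * p ^ k)"
        by (simp add: contour_integral_eq_cint)
      moreover have "s k z = cint r (\<lambda>x. deriv g x * x ^ k / g x)"
        unfolding s_def cint_def
        by (intro integral_cong) (use circlepath_mem_sphere[OF r(1)] deriv in \<open>auto simp: g_def\<close>)
      ultimately show ?thesis by simp
    qed
    moreover have "zorder g p > 0" if "p \<in> Z z" for p
    proof -
      have "if g p = 0 then zorder g p > 0 else zorder g p = 0"
        using zorder_exist_zero[OF g open_ball connected_ball, of p] that r gnz[of "of_real r"]
        by (force simp: Z_def)
      then show ?thesis using that by (simp add: Z_def g_def)
    qed
    ultimately show ?thesis using finZ by (simp add: g_def[abs_def])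
  qed
  show ?thesis using that[of s] rs root by blast
qed

section \<open>Real roots moving continuously along an interval\<close>

lemma locally_constant_on_interval:
  fixes P :: "real \<Rightarrow> 'a"
  assumes loc: "\<And>t. t \<in> {0<..<\<delta>} \<Longrightarrow> \<forall>\<^sub>F u in at t. P u = P t"
    and ab: "a \<in> {0<..<\<delta>}" "b \<in> {0<..<\<delta>}"
  shows "P b = P a"
proof (rule connected_induction_simple[of "{0<..<\<delta>}" a b "\<lambda>x. P x = P a"])
  fix t assume t: "t \<in> {0<..<\<delta>}"
  obtain S where S: "open S" "t \<in> S" "\<And>u. u \<in> S \<Longrightarrow> u \<noteq> t \<Longrightarrow> P u = P t"
    using loc[OF t] unfolding eventually_at_topological by auto
  then have const: "P u = P t" if "u \<in> S" for u using that by (cases "u = t") auto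
  have "\<forall>x\<in>S \<inter> {0<..<\<delta>}. \<forall>y\<in>S \<inter> {0<..<\<delta>}. P x = P a \<longrightarrow> P y = P a"
    by (simp add: const)
  moreover have "openin (top_of_set {0<..<\<delta>}) (S \<inter> {0<..<\<delta>})"
    using openin_open_Int[OF S(1), of "{0<..<\<delta>}"] by (subst Int_commute)
  ultimately show "\<exists>T. openin (top_of_set {0<..<\<delta>}) T \<and> t \<in> T \<and> (\<forall>x\<in>T. \<forall>y\<in>T. P x = P a \<longrightarrow> P y = P a)"
    using t S(2) by blast
qed (use ab in auto)

lemma sorted_list_of_set_strict_mono_image:
  fixes w :: "real \<Rightarrow> real"
  assumes "finite A" "strict_mono_on A w"
  shows "sorted_list_of_set (w ` A) = map w (sorted_list_of_set A)"
proof -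
  have "sorted_wrt (<) (map w (sorted_list_of_set A))"
    unfolding sorted_wrt_map
  proof (rule sorted_wrt_mono_rel)
    show "sorted_wrt (<) (sorted_list_of_set A)" by simp
    show "w x < w y" if "x \<in> set (sorted_list_of_set A)" "y \<in> set (sorted_list_of_set A)" "x < y" for x y
      using that assms by (auto dest: strict_mono_onD)
  qed
  moreover have "card (w ` A) = card A"
    using assms by (intro card_image strict_mono_on_imp_inj_on)
  ultimately show ?thesis
    using assms sorted_list_of_set_unique[of "w ` A" "map w (sorted_list_of_set A)"] by simp
qed

text \<open>Near each root at \<open>t0\<close> there is one at \<open>t\<close>, and equal
  cardinality makes this a bijection. The root near a real one has its conjugate equally near, so by
  uniqueness it is real; non-real roots are kept off the axis by their distance to it. Hence real
  roots correspond to real roots, in the same order.\<close>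

lemma roots_local:
  fixes R :: "real \<Rightarrow> complex set"
  assumes fin0: "finite (R t0)"
    and ev: "\<forall>\<^sub>F t in at t0. finite (R t) \<and> card (R t) = card (R t0) \<and> cnj ` R t \<subseteq> R t"
    and lhc: "\<And>\<zeta> \<eta>. \<zeta> \<in> R t0 \<Longrightarrow> \<eta> > 0 \<Longrightarrow> \<forall>\<^sub>F t in at t0. R t \<inter> ball \<zeta> \<eta> \<noteq> {}"
  defines "A \<equiv> \<lambda>t. {x::real. complex_of_real x \<in> R t}"
  shows "\<exists>\<eta>0>0. \<forall>\<eta>. 0 < \<eta> \<and> \<eta> \<le> \<eta>0 \<longrightarrow> (\<forall>\<^sub>F t in at t0.
     \<exists>v. A t = v ` A t0 \<and> strict_mono_on (A t0) v \<and>
       (\<forall>x\<in>A t0. \<bar>v x - x\<bar> < \<eta> \<and> R t \<inter> ball (of_real x) \<eta>0 \<subseteq> {of_real (v x)}))"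
proof -
  have "\<exists>d>0. (\<forall>\<zeta>\<in>R t0. \<forall>\<xi>\<in>R t0. \<zeta> \<noteq> \<xi> \<longrightarrow> d \<le> dist \<zeta> \<xi>) \<and> (\<forall>\<zeta>\<in>R t0. Im \<zeta> \<noteq> 0 \<longrightarrow> d \<le> \<bar>Im \<zeta>\<bar>)"
  proof -
    \<comment> \<open>All positive distances between roots and from roots to the real axis; the
      element \<open>1\<close> keeps the set non-empty when there are none.\<close>
    define B where "B = insert 1 ((\<lambda>(\<zeta>, \<xi>). dist \<zeta> \<xi>) ` (R t0 \<times> R t0) \<union> (\<lambda>\<zeta>. \<bar>Im \<zeta>\<bar>) ` R t0) - {0}"
    have B: "finite B" "B \<noteq> {}" "\<And>b. b \<in> B \<Longrightarrow> b > 0"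
      using fin0 by (auto simp: B_def)
    have "Min B > 0" using B by simp
    moreover have "Min B \<le> dist \<zeta> \<xi>" if "\<zeta> \<in> R t0" "\<xi> \<in> R t0" "\<zeta> \<noteq> \<xi>" for \<zeta> \<xi>
      using that B(1) by (intro Min_le) (auto simp: B_def)
    moreover have "Min B \<le> \<bar>Im \<zeta>\<bar>" if "\<zeta> \<in> R t0" "Im \<zeta> \<noteq> 0" for \<zeta>
      using that B(1) by (intro Min_le) (auto simp: B_def)
    ultimately show ?thesis by blast
  qed
  then obtain d where d: "d > 0" "\<And>\<zeta> \<xi>. \<zeta> \<in> R t0 \<Longrightarrow> \<xi> \<in> R t0 \<Longrightarrow> \<zeta> \<noteq> \<xi> \<Longrightarrow> d \<le> dist \<zeta> \<xi>"
    "\<And>\<zeta>. \<zeta> \<in> R t0 \<Longrightarrow> Im \<zeta> \<noteq> 0 \<Longrightarrow> d \<le> \<bar>Im \<zeta>\<bar>" by blast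
  \<comment> \<open>A quarter of the separation: discs of this radius around distinct roots are
    disjoint, and moving roots by less than it neither exchanges two real roots nor brings a
    non-real root to the axis.\<close>
  define \<eta>0 where "\<eta>0 = d / 4"
  have \<eta>0: "\<eta>0 > 0" using d by (simp add: \<eta>0_def)
  show ?thesis
  proof (intro exI[of _ \<eta>0] conjI allI impI \<eta>0)
    fix \<eta> assume \<eta>: "0 < \<eta> \<and> \<eta> \<le> \<eta>0"
    have "\<forall>\<^sub>F t in at t0. \<forall>\<zeta>\<in>R t0. R t \<inter> ball \<zeta> \<eta> \<noteq> {}"
      using lhc \<eta> fin0 by (intro eventually_ball_finite) auto
    with ev show "\<forall>\<^sub>F t in at t0. \<exists>v. A t = v ` A t0 \<and> strict_mono_on (A t0) v \<and>
       (\<forall>x\<in>A t0. \<bar>v x - x\<bar> < \<eta> \<and> R t \<inter> ball (of_real x) \<eta>0 \<subseteq> {of_real (v x)})"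
    proof eventually_elim
      case (elim t)
      have "\<exists>w. w \<in> R t \<and> dist \<zeta> w < \<eta>" if "\<zeta> \<in> R t0" for \<zeta>
      proof -
        have "R t \<inter> ball \<zeta> \<eta> \<noteq> {}" using elim that by blast
        then show ?thesis by (auto simp: ball_def)
      qed
      then obtain w where w: "\<And>\<zeta>. \<zeta> \<in> R t0 \<Longrightarrow> w \<zeta> \<in> R t \<and> dist \<zeta> (w \<zeta>) < \<eta>"
        using bchoice[of "R t0" "\<lambda>\<zeta> w. w \<in> R t \<and> dist \<zeta> w < \<eta>"] by blast
      have near: "\<zeta> = \<xi>" if "\<zeta> \<in> R t0" "\<xi> \<in> R t0" "dist \<zeta> u < \<eta>0" "dist \<xi> u < \<eta>0" for \<zeta> \<xi> u
      proof (rule ccontr)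
        assume "\<zeta> \<noteq> \<xi>"
        then have "d \<le> dist \<zeta> \<xi>" using d that by blast
        moreover have "dist \<zeta> \<xi> \<le> dist \<zeta> u + dist \<xi> u" by (rule dist_triangle2)
        ultimately show False using that \<eta>0 unfolding \<eta>0_def by linarith
      qed
      have "inj_on w (R t0)"
      proof (rule inj_onI)
        fix \<zeta> \<xi> assume a: "\<zeta> \<in> R t0" "\<xi> \<in> R t0" "w \<zeta> = w \<xi>"
        then show "\<zeta> = \<xi>" using near[of \<zeta> \<xi> "w \<zeta>"] w[OF a(1)] w[OF a(2)] \<eta> by auto
      qed
      then have wR: "w ` R t0 = R t"
        using w elim by (intro card_subset_eq) (auto simp: card_image)
      have uniq: "u = w \<zeta>" if "\<zeta> \<in> R t0" "u \<in> R t" "dist \<zeta> u < \<eta>0" for u \<zeta>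
      proof -
        have "u \<in> w ` R t0" using that(2) unfolding wR .
        then obtain \<xi> where \<xi>: "\<xi> \<in> R t0" "u = w \<xi>" by (rule imageE)
        then show ?thesis using near[of \<zeta> \<xi> u] that w[OF \<xi>(1)] \<eta> by auto
      qed
      have re: "w (of_real x) = of_real (Re (w (of_real x)))" if "x \<in> A t0" for x
      proof -
        have x: "complex_of_real x \<in> R t0" using that by (simp add: A_def)
        have "cnj (w (of_real x)) \<in> R t" using w[OF x] elim by auto
        moreover have "dist (of_real x) (cnj (w (of_real x))) = dist (of_real x) (w (of_real x))"
          unfolding dist_norm using complex_mod_cnj[of "of_real x - w (of_real x)"] by simp
        ultimately have "cnj (w (of_real x)) = w (of_real x)"
          using uniq[OF x, of "cnj (w (of_real x))"] w[OF x] \<eta> by auto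
        then show ?thesis by (metis Reals_cnj_iff complex_is_Real_iff of_real_Re)
      qed
      define v where "v x = Re (w (of_real x))" for x
      have close: "\<bar>v x - x\<bar> < \<eta>" if "x \<in> A t0" for x
      proof -
        have "complex_of_real x \<in> R t0" using that by (simp add: A_def)
        then have "dist (complex_of_real x) (of_real (v x)) < \<eta>" using w re[OF that] by (simp add: v_def)
        then show ?thesis unfolding dist_of_real dist_real_def by linarith
      qed
      have "A t = v ` A t0"
      proof
        show "v ` A t0 \<subseteq> A t"
        proof
          fix y assume "y \<in> v ` A t0"
          then obtain x where x: "x \<in> A t0" "y = v x" by blast
          then have "w (of_real x) \<in> R t" using w by (auto simp: A_def)
          then show "y \<in> A t" using re[OF x(1)] x by (simp add: A_def v_def)
        qed
        show "A t \<subseteq> v ` A t0"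
        proof
          fix y assume "y \<in> A t"
          then have "of_real y \<in> w ` R t0" unfolding wR A_def by simp
          then obtain \<zeta> where \<zeta>: "\<zeta> \<in> R t0" "w \<zeta> = of_real y" by (metis imageE)
          have "Im \<zeta> = 0"
          proof (rule ccontr)
            assume "Im \<zeta> \<noteq> 0"
            have "\<bar>Im \<zeta>\<bar> \<le> dist \<zeta> (w \<zeta>)"
              using abs_Im_le_cmod[of "\<zeta> - w \<zeta>"] \<zeta>(2) by (simp add: dist_norm)
            then show False using d(3)[OF \<zeta>(1) \<open>Im \<zeta> \<noteq> 0\<close>] w[OF \<zeta>(1)] \<eta> d(1) unfolding \<eta>0_def by linarith
          qed
          then have "\<zeta> = of_real (Re \<zeta>)" by (simp add: complex_eq_iff)
          then have "Re \<zeta> \<in> A t0" "v (Re \<zeta>) = y" using \<zeta> by (auto simp: A_def v_def)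
          then show "y \<in> v ` A t0" by blast
        qed
      qed
      moreover have "strict_mono_on (A t0) v"
      proof (rule strict_mono_onI)
        fix x y assume xy: "x \<in> A t0" "y \<in> A t0" "x < y"
        then have "d \<le> dist (complex_of_real x) (of_real y)" by (intro d(2)) (auto simp: A_def)
        then have "d \<le> y - x" using xy unfolding dist_of_real dist_real_def by linarith
        then show "v x < v y" using close[OF xy(1)] close[OF xy(2)] \<eta> d(1) unfolding \<eta>0_def by linarith
      qed
      moreover have "R t \<inter> ball (of_real x) \<eta>0 \<subseteq> {of_real (v x)}" if "x \<in> A t0" for x
        using uniq[of "of_real x"] re[OF that] that by (auto simp: A_def v_def)
      ultimately show ?case using close by blast
    qed
  qed
qed

text \<open>If \<open>z0\<close> is a root, the root with the same index in the sorted list of real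
  roots is followed; otherwise the curve keeps a fixed proportion between the neighbouring real
  roots, with \<open>- r\<close> and \<open>r\<close> as outermost bounds. The clause with
  \<open>\<eta>\<close> records that a followed root is the only root within a radius valid for all
  nearby parameters.\<close>

lemma root_section:
  fixes R :: "real \<Rightarrow> complex set"
  assumes fin: "\<And>t. t \<in> {0<..<\<delta>} \<Longrightarrow> finite (R t)"
    and card: "\<And>t. t \<in> {0<..<\<delta>} \<Longrightarrow> card (R t) = m"
    and cnj: "\<And>t. t \<in> {0<..<\<delta>} \<Longrightarrow> cnj ` R t \<subseteq> R t"
    and bd: "\<And>t w. t \<in> {0<..<\<delta>} \<Longrightarrow> w \<in> R t \<Longrightarrow> norm w < r"
    and lhc: "\<And>t \<zeta> \<eta>. t \<in> {0<..<\<delta>} \<Longrightarrow> \<zeta> \<in> R t \<Longrightarrow> \<eta> > 0 \<Longrightarrow> \<forall>\<^sub>F u in at t. R u \<inter> ball \<zeta> \<eta> \<noteq> {}"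
    and t0: "t0 \<in> {0<..<\<delta>}" and z0: "\<bar>z0\<bar> < r"
  shows "\<exists>z::real\<Rightarrow>real. continuous_on {0<..<\<delta>} z \<and> z t0 = z0 \<and> (\<forall>t\<in>{0<..<\<delta>}. \<bar>z t\<bar> < r) \<and>
     ((\<forall>t\<in>{0<..<\<delta>}. of_real (z t) \<in> R t \<and>
          (\<exists>\<eta>>0. \<forall>\<^sub>F u in at t. R u \<inter> ball (of_real (z t)) \<eta> \<subseteq> {of_real (z u)})) \<or>
      (\<forall>t\<in>{0<..<\<delta>}. of_real (z t) \<notin> R t))"
proof -
  define I where "I = {0<..<\<delta>}"
  define A where "A t = {x::real. complex_of_real x \<in> R t}" for t
  define L where "L t = sorted_list_of_set (A t)" for t
  have finA: "finite (A t)" if "t \<in> I" for t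
  proof -
    have "finite (of_real -` R t :: real set)"
      using fin that by (intro finite_vimageI) (auto simp: I_def inj_def)
    then show ?thesis by (simp add: A_def vimage_def)
  qed
  have evI: "\<forall>\<^sub>F u in at t. u \<in> I" if "t \<in> I" for t
    using that eventually_at_in_open'[of I t] by (simp add: I_def)
  have loc: "\<exists>\<eta>0>0. \<forall>\<eta>. 0 < \<eta> \<and> \<eta> \<le> \<eta>0 \<longrightarrow> (\<forall>\<^sub>F u in at t.
     \<exists>v. A u = v ` A t \<and> strict_mono_on (A t) v \<and>
       (\<forall>x\<in>A t. \<bar>v x - x\<bar> < \<eta> \<and> R u \<inter> ball (of_real x) \<eta>0 \<subseteq> {of_real (v x)}))" if t: "t \<in> I" for t
    unfolding A_def
  proof (rule roots_local)
    show "\<forall>\<^sub>F u in at t. finite (R u) \<and> card (R u) = card (R t) \<and> cnj ` R u \<subseteq> R u"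
      using evI[OF t] by eventually_elim (use fin card cnj t in \<open>auto simp: I_def\<close>)
  qed (use fin lhc t in \<open>auto simp: I_def\<close>)
  have loc2: "\<exists>\<eta>0>0. \<forall>\<eta>>0. \<forall>\<^sub>F u in at t. length (L u) = length (L t) \<and>
      (\<forall>k<length (L t). \<bar>L u ! k - L t ! k\<bar> < \<eta> \<and> R u \<inter> ball (of_real (L t ! k)) \<eta>0 \<subseteq> {of_real (L u ! k)})"
    if t: "t \<in> I" for t
  proof -
    obtain \<eta>0 where \<eta>0: "\<eta>0 > 0" and H: "\<And>\<eta>. 0 < \<eta> \<and> \<eta> \<le> \<eta>0 \<Longrightarrow> (\<forall>\<^sub>F u in at t.
       \<exists>v. A u = v ` A t \<and> strict_mono_on (A t) v \<and>
       (\<forall>x\<in>A t. \<bar>v x - x\<bar> < \<eta> \<and> R u \<inter> ball (of_real x) \<eta>0 \<subseteq> {of_real (v x)}))"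
      using loc[OF t] by blast
    show ?thesis
    proof (intro exI[of _ \<eta>0] conjI allI impI \<eta>0)
      fix \<eta> :: real assume "\<eta> > 0"
      then have "0 < min \<eta> \<eta>0 \<and> min \<eta> \<eta>0 \<le> \<eta>0" using \<eta>0 by auto
      from H[OF this] show "\<forall>\<^sub>F u in at t. length (L u) = length (L t) \<and>
      (\<forall>k<length (L t). \<bar>L u ! k - L t ! k\<bar> < \<eta> \<and> R u \<inter> ball (of_real (L t ! k)) \<eta>0 \<subseteq> {of_real (L u ! k)})"
      proof eventually_elim
        case (elim u)
        then obtain v where v: "A u = v ` A t" "strict_mono_on (A t) v"
           "\<And>x. x \<in> A t \<Longrightarrow> \<bar>v x - x\<bar> < min \<eta> \<eta>0 \<and> R u \<inter> ball (of_real x) \<eta>0 \<subseteq> {of_real (v x)}"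
          by blast
        have "L u = map v (L t)"
          unfolding L_def v(1) using finA[OF t] v(2) by (rule sorted_list_of_set_strict_mono_image)
        moreover have "L t ! k \<in> A t" if "k < length (L t)" for k
          using nth_mem[OF that] finA[OF t] by (simp add: L_def)
        ultimately show ?case using v(3) by force
      qed
    qed
  qed
  define l where "l = length (L t0)"
  have len: "length (L t) = l" if "t \<in> I" for t
    unfolding l_def
  proof (rule locally_constant_on_interval[of \<delta> "\<lambda>t. length (L t)"])
    fix t assume "t \<in> {0<..<\<delta>}"
    then obtain \<eta>0 where H: "\<forall>\<eta>>0. \<forall>\<^sub>F u in at t. length (L u) = length (L t) \<and>
      (\<forall>k<length (L t). \<bar>L u ! k - L t ! k\<bar> < \<eta> \<and> R u \<inter> ball (of_real (L t ! k)) \<eta>0 \<subseteq> {of_real (L u ! k)})"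
      using loc2[of t] unfolding I_def by blast
    show "\<forall>\<^sub>F u in at t. length (L u) = length (L t)"
      by (rule eventually_mono[OF H[rule_format, of 1]]) auto
  qed (use t0 that in \<open>auto simp: I_def\<close>)
  have sorted: "sorted_wrt (<) (L t)" for t by (simp add: L_def)
  have setL: "set (L t) = A t" if "t \<in> I" for t using finA[OF that] by (simp add: L_def)
  have contL: "continuous_on I (\<lambda>t. L t ! k)" if k: "k < l" for k
    unfolding continuous_on_def
  proof
    fix t assume t: "t \<in> I"
    have "((\<lambda>u. L u ! k) \<longlongrightarrow> L t ! k) (at t)"
    proof (rule tendstoI)
      fix \<eta> :: real assume "\<eta> > 0"
      then obtain \<eta>0 where "\<forall>\<^sub>F u in at t. length (L u) = length (L t) \<and>
      (\<forall>k<length (L t). \<bar>L u ! k - L t ! k\<bar> < \<eta> \<and> R u \<inter> ball (of_real (L t ! k)) \<eta>0 \<subseteq> {of_real (L u ! k)})"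
        using loc2[OF t] by blast
      then show "\<forall>\<^sub>F u in at t. dist (L u ! k) (L t ! k) < \<eta>"
        by eventually_elim (use k len[OF t] in \<open>auto simp: dist_real_def\<close>)
    qed
    then show "((\<lambda>u. L u ! k) \<longlongrightarrow> L t ! k) (at t within I)"
      by (rule tendsto_within_subset) simp
  qed
  have bdL: "\<bar>L t ! k\<bar> < r" if "t \<in> I" "k < l" for t k
  proof -
    have "L t ! k \<in> A t" using setL[OF that(1)] len[OF that(1)] that(2) nth_mem by metis
    then show ?thesis using bd[of t "of_real (L t ! k)"] that by (auto simp: A_def I_def)
  qed
  show ?thesis
  proof (cases "z0 \<in> A t0")
    case True
    then obtain k where k: "k < l" "L t0 ! k = z0"
      using setL[of t0] t0 unfolding l_def I_def by (metis in_set_conv_nth)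
    have "of_real (L t ! k) \<in> R t \<and> (\<exists>\<eta>>0. \<forall>\<^sub>F u in at t. R u \<inter> ball (of_real (L t ! k)) \<eta> \<subseteq> {of_real (L u ! k)})"
      if t: "t \<in> I" for t
    proof
      have "L t ! k \<in> A t" using setL[OF t] len[OF t] k nth_mem by metis
      then show "of_real (L t ! k) \<in> R t" by (simp add: A_def)
      obtain \<eta>0 where \<eta>0: "\<eta>0 > 0" and H: "\<forall>\<eta>>0. \<forall>\<^sub>F u in at t. length (L u) = length (L t) \<and>
        (\<forall>k<length (L t). \<bar>L u ! k - L t ! k\<bar> < \<eta> \<and> R u \<inter> ball (of_real (L t ! k)) \<eta>0 \<subseteq> {of_real (L u ! k)})"
        using loc2[OF t] by blast
      have "\<forall>\<^sub>F u in at t. R u \<inter> ball (of_real (L t ! k)) \<eta>0 \<subseteq> {of_real (L u ! k)}"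
        by (rule eventually_mono[OF H[rule_format, of 1]]) (use k len[OF t] in auto)
      then show "\<exists>\<eta>>0. \<forall>\<^sub>F u in at t. R u \<inter> ball (of_real (L t ! k)) \<eta> \<subseteq> {of_real (L u ! k)}"
        using \<eta>0 by blast
    qed
    then show ?thesis using k contL[OF k(1)] bdL by (intro exI[of _ "\<lambda>t. L t ! k"]) (auto simp: I_def)
  next
    case False
    \<comment> \<open>The rank of \<open>z0\<close> at \<open>t0\<close>: exactly the real roots
      with index below \<open>k\<close> lie below \<open>z0\<close>. The gap between the roots with
      index \<open>k - 1\<close> and \<open>k\<close> is the one to stay in.\<close>
    define k where "k = card {y \<in> A t0. y < z0}"
    have t0I: "t0 \<in> I" using t0 by (simp add: I_def)
    have below: "i < k \<longleftrightarrow> L t0 ! i < z0" if "i < l" for i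
    proof -
      have inj: "inj_on (\<lambda>i. L t0 ! i) {..<l}"
        using sorted[of t0] by (auto simp: l_def strict_sorted_iff inj_on_def nth_eq_iff_index_eq)
      have eq: "{y \<in> A t0. y < z0} = (\<lambda>i. L t0 ! i) ` {j. j < l \<and> L t0 ! j < z0}"
        using setL[OF t0I] by (auto simp: l_def in_set_conv_nth simp flip: setL[OF t0I])
      have kc: "k = card {j. j < l \<and> L t0 ! j < z0}"
        unfolding k_def eq by (intro card_image inj_on_subset[OF inj]) auto
      show ?thesis
      proof
        assume "L t0 ! i < z0"
        have "{..i} \<subseteq> {j. j < l \<and> L t0 ! j < z0}"
        proof
          fix j assume "j \<in> {..i}"
          then have "L t0 ! j \<le> L t0 ! i"
            using that sorted_wrt_nth_less[OF sorted[of t0], of j i] unfolding l_def by (cases "j = i") auto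
          then show "j \<in> {j. j < l \<and> L t0 ! j < z0}"
            using that \<open>j \<in> {..i}\<close> \<open>L t0 ! i < z0\<close> by auto
        qed
        then have "card {..i} \<le> k" unfolding kc by (intro card_mono) auto
        then show "i < k" by simp
      next
        assume ik: "i < k"
        show "L t0 ! i < z0"
        proof (rule ccontr)
          assume n: "\<not> L t0 ! i < z0"
          have "{j. j < l \<and> L t0 ! j < z0} \<subseteq> {..<i}"
          proof
            fix j assume j: "j \<in> {j. j < l \<and> L t0 ! j < z0}"
            show "j \<in> {..<i}"
            proof (rule ccontr)
              assume "j \<notin> {..<i}"
              then have "L t0 ! i \<le> L t0 ! j"
                using j that sorted_wrt_nth_less[OF sorted[of t0], of i j] unfolding l_def
                by (cases "i = j") auto
              then show False using j n by auto
            qed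
          qed
          then have "k \<le> card {..<i}" unfolding kc by (intro card_mono) auto
          then show False using ik by simp
        qed
      qed
    qed
    have "k \<le> card (A t0)" unfolding k_def using finA[OF t0I] by (intro card_mono) auto
    then have kl: "k \<le> l" by (simp add: l_def L_def)
    define lo where "lo t = (if k = 0 then - r else L t ! (k - 1))" for t
    define hi where "hi t = (if k = l then r else L t ! k)" for t
    have lohi: "lo t < hi t" if "t \<in> I" for t
      using bdL[OF that, of "k - 1"] bdL[OF that, of k] kl z0 len[OF that]
        sorted_wrt_nth_less[OF sorted[of t], of "k - 1" k]
      unfolding lo_def hi_def by (cases "k = 0"; cases "k = l") (auto simp: abs_less_iff)
    have lo0: "lo t0 < z0"
      using below[of "k - 1"] kl z0 by (auto simp: lo_def)
    have hi0: "z0 < hi t0"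
    proof (cases "k = l")
      case f: False
      then have "\<not> L t0 ! k < z0" using below[of k] kl by simp
      moreover have "L t0 ! k \<noteq> z0" using False setL[OF t0I] nth_mem[of k "L t0"] f kl by (auto simp: l_def)
      ultimately show ?thesis using f by (auto simp: hi_def)
    qed (use z0 in \<open>auto simp: hi_def\<close>)
    have contlo: "continuous_on I lo"
      unfolding lo_def using contL[of "k - 1"] kl by (cases "k = 0") auto
    have conthi: "continuous_on I hi"
      unfolding hi_def using contL[of k] kl by (cases "k = l") auto
    \<comment> \<open>The relative position of \<open>z0\<close> in its gap. Keeping it constant
      makes the curve continuous and strictly interior to the gap, hence free of roots.\<close>
    define \<theta> where "\<theta> = (z0 - lo t0) / (hi t0 - lo t0)"
    have \<theta>: "0 < \<theta>" "\<theta> < 1" using lo0 hi0 by (auto simp: \<theta>_def)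
    define z where "z t = lo t + \<theta> * (hi t - lo t)" for t
    have between: "lo t < z t" "z t < hi t" if "t \<in> I" for t
    proof -
      have "0 < \<theta> * (hi t - lo t)" using lohi[OF that] \<theta> by simp
      moreover have "\<theta> * (hi t - lo t) < 1 * (hi t - lo t)"
        by (rule mult_strict_right_mono) (use lohi[OF that] \<theta> in auto)
      ultimately show "lo t < z t" "z t < hi t" by (auto simp: z_def)
    qed
    have notin: "of_real (z t) \<notin> R t" if t: "t \<in> I" for t
    proof
      assume "of_real (z t) \<in> R t"
      then have "z t \<in> set (L t)" using setL[OF t] by (simp add: A_def)
      then obtain j where j: "j < l" "z t = L t ! j" using len[OF t] by (auto simp: in_set_conv_nth)
      show False
      proof (cases "j < k")
        case True
        then have "L t ! j \<le> L t ! (k - 1)"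
          using sorted_nth_mono[OF strict_sorted_imp_sorted[OF sorted[of t]], of j "k - 1"] kl len[OF t] by auto
        then show False using between(1)[OF t] j True by (auto simp: lo_def)
      next
        case False
        then have "L t ! k \<le> L t ! j" "k \<noteq> l"
          using sorted_nth_mono[OF strict_sorted_imp_sorted[OF sorted[of t]], of k j] j kl len[OF t] by auto
        then show False using between(2)[OF t] j by (auto simp: hi_def)
      qed
    qed
    have "\<bar>z t\<bar> < r" if t: "t \<in> I" for t
    proof -
      have "- r \<le> lo t"
      proof (cases "k = 0")
        case False
        then have "\<bar>L t ! (k - 1)\<bar> < r" using kl by (intro bdL[OF t]) arith
        then show ?thesis using False by (simp add: lo_def abs_less_iff)
      qed (simp add: lo_def)
      moreover have "hi t \<le> r" using bdL[OF t, of k] kl unfolding hi_def by (cases "k = l") auto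
      ultimately show ?thesis using between[OF t] by (auto simp: abs_less_iff)
    qed
    moreover have "continuous_on I z" unfolding z_def by (intro continuous_intros contlo conthi)
    moreover have "z t0 = z0" using lo0 hi0 by (simp add: z_def \<theta>_def)
    ultimately show ?thesis using notin unfolding I_def by blast
  qed
qed

text \<open>Hurwitz' theorem by the maximum principle: without a root in the disc at time
  \<open>t\<close>, the reciprocal of \<open>\<psi>\<close> would be bounded there by its values on
  the circle, that is by \<open>2 / m\<close>, whereas at the centre it exceeds
  \<open>2 / m\<close>. The point \<open>wn\<close> ensures that \<open>g\<close> is not identically
  zero on the fibre over \<open>t0\<close>.\<close>

lemma root_persists:
  fixes Y :: "real \<Rightarrow> nat \<Rightarrow> real"
  assumes g: "chol (Suc N) \<sigma> g" and T: "open T" "t0 \<in> T"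
    and Y: "\<And>i. continuous_on T (\<lambda>t. Y t i)" "\<And>t. t \<in> T \<Longrightarrow> (\<lambda>i. of_real (Y t i)) \<in> polydisc N \<sigma>"
    and \<zeta>: "norm \<zeta> < \<sigma>" "g ((\<lambda>i. of_real (Y t0 i))(N := \<zeta>)) = 0"
    and nz: "norm wn < \<sigma>" "g ((\<lambda>i. of_real (Y t0 i))(N := wn)) \<noteq> 0" and \<eta>: "\<eta> > 0"
  shows "\<forall>\<^sub>F t in at t0. \<exists>w\<in>ball \<zeta> \<eta>. g ((\<lambda>i. of_real (Y t i))(N := w)) = 0"
proof -
  define \<psi> where "\<psi> p = g ((\<lambda>i. of_real (Y (fst p) i))(N := snd p))" for p
  have upd: "(\<lambda>i. of_real (Y t i))(N := w) \<in> polydisc (Suc N) \<sigma>" if "t \<in> T" "norm w < \<sigma>" for t w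
    using Y(2)[OF that(1)] that(2) by (auto simp: polydisc_def less_Suc_eq)
  have c0: "continuous_on (T \<times> ball 0 \<sigma>) (\<lambda>p. (\<lambda>i. complex_of_real (Y (fst p) i))(N := snd p))"
  proof (rule continuous_on_fun_upd[OF continuous_on_coordinatewise_then_product])
    show "continuous_on (T \<times> ball 0 \<sigma>) (\<lambda>p. complex_of_real (Y (fst p) i))" for i
      by (intro continuous_on_of_real continuous_on_compose2[OF Y(1)] continuous_on_fst continuous_on_id) auto
  qed (intro continuous_intros)
  have cont: "continuous_on (T \<times> ball 0 \<sigma>) \<psi>"
    unfolding \<psi>_def by (rule continuous_on_compose2[OF cholD(1)[OF g] c0]) (use upd in auto)
  have hol: "(\<lambda>w. \<psi> (t, w)) holomorphic_on ball 0 \<sigma>" if "t \<in> T" for t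
  proof -
    have "(\<lambda>w. g (((\<lambda>i. of_real (Y t i))(N := 0))(N := w))) holomorphic_on ball 0 \<sigma>"
      by (rule chol_holomorphic_slice[OF g upd[OF that]]) (use \<zeta>(1) le_less_trans[OF norm_ge_zero] in auto)
    then show ?thesis by (simp add: \<psi>_def)
  qed
  obtain s where s: "s > 0" "ball \<zeta> s \<subseteq> ball 0 \<sigma>" "\<And>w. w \<in> ball \<zeta> s - {\<zeta>} \<Longrightarrow> \<psi> (t0, w) \<noteq> 0"
    by (rule isolated_zeros[OF hol[OF T(2)], of \<zeta> wn]) (use \<zeta> nz in \<open>auto simp: \<psi>_def\<close>)
  define \<epsilon> where "\<epsilon> = min s \<eta> / 2"
  have \<epsilon>: "0 < \<epsilon>" "\<epsilon> < s" "\<epsilon> < \<eta>" using s \<eta> by (auto simp: \<epsilon>_def min_def)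
  have "cball \<zeta> \<epsilon> \<subseteq> ball \<zeta> s" using \<epsilon> by auto
  then have sub: "cball \<zeta> \<epsilon> \<subseteq> ball 0 \<sigma>" using s(2) by (rule subset_trans)
  have ct0: "continuous_on (sphere \<zeta> \<epsilon>) (\<lambda>w. norm (\<psi> (t0, w)))"
    using hol[OF T(2)] sub sphere_cball
    by (intro continuous_on_norm holomorphic_on_imp_continuous_on[THEN continuous_on_subset]) blast+
  have "sphere \<zeta> \<epsilon> \<noteq> {}" using \<epsilon> by simp
  then obtain wm where wm: "wm \<in> sphere \<zeta> \<epsilon>" "\<And>w. w \<in> sphere \<zeta> \<epsilon> \<Longrightarrow> norm (\<psi> (t0, wm)) \<le> norm (\<psi> (t0, w))"
    using continuous_attains_inf[OF compact_sphere _ ct0] by blast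
  define m where "m = norm (\<psi> (t0, wm))"
  have m: "m > 0" using s(3)[of wm] wm(1) \<epsilon> by (auto simp: m_def)
  define W where "W = (T \<times> ball 0 \<sigma>) \<inter> \<psi> -` {w. m / 2 < norm w}"
  have W: "open W"
    unfolding W_def using T
    by (intro continuous_open_preimage[OF cont] open_Times open_ball open_Collect_less continuous_intros)
  have "{t0} \<times> sphere \<zeta> \<epsilon> \<subseteq> W"
  proof
    fix p assume "p \<in> {t0} \<times> sphere \<zeta> \<epsilon>"
    then obtain w where w: "p = (t0, w)" "w \<in> sphere \<zeta> \<epsilon>" by auto
    have "w \<in> ball 0 \<sigma>" using w(2) sub sphere_cball by blast
    moreover have "m / 2 < norm (\<psi> (t0, w))" using wm(2)[OF w(2)] m unfolding m_def by linarith
    ultimately show "p \<in> W" using w T by (simp add: W_def)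
  qed
  \<comment> \<open>Compactness of the circle turns the bound \<open>m / 2\<close> at the single
    time \<open>t0\<close> into one valid for all nearby times.\<close>
  from Elementary_Topology.tube_lemma[OF compact_sphere W this]
  obtain X0 where X0: "t0 \<in> X0" "open X0" "X0 \<times> sphere \<zeta> \<epsilon> \<subseteq> W" by (elim exE conjE)
  have cn: "continuous_on T (\<lambda>t. norm (\<psi> (t, \<zeta>)))"
    by (intro continuous_on_norm continuous_on_compose2[OF cont] continuous_intros) (use \<zeta> in auto)
  have "\<forall>\<^sub>F t in at t0. norm (\<psi> (t, \<zeta>)) < m / 2"
  proof -
    have "isCont (\<lambda>t. norm (\<psi> (t, \<zeta>))) t0"
      using cn T continuous_on_eq_continuous_at by blast
    moreover have "norm (\<psi> (t0, \<zeta>)) < m / 2" using \<zeta> m by (simp add: \<psi>_def)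
    ultimately show ?thesis unfolding isCont_def using order_tendstoD(2) by blast
  qed
  moreover have "\<forall>\<^sub>F t in at t0. t \<in> X0 \<inter> T"
    using X0 T by (intro eventually_at_in_open') auto
  ultimately show ?thesis
  proof eventually_elim
    case (elim t)
    show ?case
    proof (rule ccontr)
      assume "\<not> ?thesis"
      then have nz': "\<psi> (t, w) \<noteq> 0" if "w \<in> ball \<zeta> \<eta>" for w using that by (auto simp: \<psi>_def)
      have nz2: "\<psi> (t, w) \<noteq> 0" if "w \<in> cball \<zeta> \<epsilon>" for w using nz'[of w] that \<epsilon> by auto
      have h: "(\<lambda>w. \<psi> (t, w)) holomorphic_on cball \<zeta> \<epsilon>"
        using hol[of t] elim sub holomorphic_on_subset by blast
      have h': "(\<lambda>w. 1 / \<psi> (t, w)) holomorphic_on cball \<zeta> \<epsilon>"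
        using nz2 by (intro holomorphic_intros h)
      have "norm (1 / \<psi> (t, \<zeta>)) \<le> 2 / m"
      proof (rule maximum_modulus_frontier[of "\<lambda>w. 1 / \<psi> (t, w)" "cball \<zeta> \<epsilon>"])
        show "(\<lambda>w. 1 / \<psi> (t, w)) holomorphic_on interior (cball \<zeta> \<epsilon>)"
          using h' holomorphic_on_subset interior_subset by blast
        show "continuous_on (closure (cball \<zeta> \<epsilon>)) (\<lambda>w. 1 / \<psi> (t, w))"
          using h' holomorphic_on_imp_continuous_on by (simp add: closure_closed)
        fix w assume "w \<in> frontier (cball \<zeta> \<epsilon>)"
        then have "w \<in> sphere \<zeta> \<epsilon>" by (simp add: frontier_cball)
        then have "(t, w) \<in> W" using X0(3) elim by auto
        then have "m / 2 < norm (\<psi> (t, w))" by (simp add: W_def)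
        then show "norm (1 / \<psi> (t, w)) \<le> 2 / m"
          using m by (simp add: norm_divide divide_simps)
      qed (use \<epsilon> in auto)
      moreover have "\<psi> (t, \<zeta>) \<noteq> 0" using nz2[of \<zeta>] \<epsilon> by simp
      ultimately have "m / 2 \<le> norm (\<psi> (t, \<zeta>))"
        using m by (simp add: norm_divide divide_simps)
      then show False using elim by linarith
    qed
  qed
qed

text \<open>The product over \<open>A\<close> has a constant number of distinct roots, so
  \<open>root_section\<close> applies to it. Along a followed root each factor vanishes everywhere
  or nowhere: a zero of one factor persists by \<open>root_persists\<close>, the persisting zero is
  a root of the product, and the isolation clause places it on the curve.\<close>

lemma rhol_root_section:
  fixes Y :: "real \<Rightarrow> nat \<Rightarrow> real"
  assumes A: "finite A" "\<And>G. G \<in> A \<Longrightarrow> rhol (Suc N) \<sigma> G" and r: "0 < r" "r < \<sigma>" and e: "e \<le> \<sigma>"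
    and nz: "\<And>z w. z \<in> polydisc N e \<Longrightarrow> norm w = r \<Longrightarrow> (\<Prod>G\<in>A. G (z(N := w))) \<noteq> 0"
    and Y: "\<And>i. continuous_on {0<..<\<delta>} (\<lambda>t. Y t i)"
      "\<And>t. t \<in> {0<..<\<delta>} \<Longrightarrow> (\<lambda>i. of_real (Y t i)) \<in> polydisc N e"
    and fin: "\<And>t. t \<in> {0<..<\<delta>} \<Longrightarrow> finite {w. norm w < r \<and> (\<Prod>G\<in>A. G ((\<lambda>i. of_real (Y t i))(N := w))) = 0}"
    and card: "\<And>t. t \<in> {0<..<\<delta>} \<Longrightarrow> card {w. norm w < r \<and> (\<Prod>G\<in>A. G ((\<lambda>i. of_real (Y t i))(N := w))) = 0} = m"
    and t0: "t0 \<in> {0<..<\<delta>}" and z0: "\<bar>z0\<bar> < r"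
  shows "\<exists>z::real\<Rightarrow>real. continuous_on {0<..<\<delta>} z \<and> z t0 = z0 \<and> (\<forall>t\<in>{0<..<\<delta>}. \<bar>z t\<bar> < r) \<and>
     (\<forall>G\<in>A. (\<forall>t\<in>{0<..<\<delta>}. G (\<lambda>i. of_real (((Y t)(N := z t)) i)) = 0) \<or>
             (\<forall>t\<in>{0<..<\<delta>}. G (\<lambda>i. of_real (((Y t)(N := z t)) i)) \<noteq> 0))"
proof -
  define I where "I = {0<..<\<delta>}"
  define f where "f z = (\<Prod>G\<in>A. G z)" for z
  have f: "rhol (Suc N) \<sigma> f" unfolding f_def using A by (intro rhol_prod) auto
  define R where "R t = {w. norm w < r \<and> f ((\<lambda>i. of_real (Y t i))(N := w)) = 0}" for t
  have Ye: "(\<lambda>i. of_real (Y t i)) \<in> polydisc N \<sigma>" if "t \<in> I" for t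
    using Y(2)[of t] that polydisc_mono[OF e, of N] by (auto simp: I_def)
  have nzr: "norm (complex_of_real r) = r" using r by simp
  have lhc: "\<forall>\<^sub>F u in at t. \<exists>w\<in>ball \<zeta> \<eta>. norm w < r \<and> G ((\<lambda>i. of_real (Y u i))(N := w)) = 0"
    if t: "t \<in> I" and \<zeta>: "norm \<zeta> < r" "G ((\<lambda>i. of_real (Y t i))(N := \<zeta>)) = 0" and \<eta>: "\<eta> > 0"
      and G: "chol (Suc N) \<sigma> G" "\<And>z w. z \<in> polydisc N e \<Longrightarrow> norm w = r \<Longrightarrow> G (z(N := w)) \<noteq> 0"
    for t \<zeta> \<eta> G
  proof -
    have "\<forall>\<^sub>F u in at t. \<exists>w\<in>ball \<zeta> (min \<eta> (r - norm \<zeta>)). G ((\<lambda>i. of_real (Y u i))(N := w)) = 0"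
    proof (rule root_persists[OF G(1), where T = I and wn = "of_real r"])
      show "open I" "t \<in> I" using t by (auto simp: I_def)
      show "continuous_on I (\<lambda>t. Y t i)" for i using Y(1) by (simp add: I_def)
      show "(\<lambda>i. of_real (Y t i)) \<in> polydisc N \<sigma>" if "t \<in> I" for t using Ye[OF that] .
      show "G ((\<lambda>i. of_real (Y t i))(N := of_real r)) \<noteq> 0"
        using G(2)[OF Y(2)[of t] nzr] t by (auto simp: I_def)
    qed (use \<zeta> r \<eta> in auto)
    then show ?thesis
    proof eventually_elim
      case (elim u)
      then obtain w where w: "w \<in> ball \<zeta> (min \<eta> (r - norm \<zeta>))" "G ((\<lambda>i. of_real (Y u i))(N := w)) = 0" by blast
      have "norm w \<le> norm \<zeta> + dist \<zeta> w" by (metis dist_norm norm_triangle_sub norm_minus_commute)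
      then have "norm w < r" using w(1) by auto
      then show ?case using w by auto
    qed
  qed
  have "\<exists>z::real\<Rightarrow>real. continuous_on {0<..<\<delta>} z \<and> z t0 = z0 \<and> (\<forall>t\<in>{0<..<\<delta>}. \<bar>z t\<bar> < r) \<and>
     ((\<forall>t\<in>{0<..<\<delta>}. of_real (z t) \<in> R t \<and>
          (\<exists>\<eta>>0. \<forall>\<^sub>F u in at t. R u \<inter> ball (of_real (z t)) \<eta> \<subseteq> {of_real (z u)})) \<or>
      (\<forall>t\<in>{0<..<\<delta>}. of_real (z t) \<notin> R t))"
  proof (rule root_section[where m = m])
    fix t assume t: "t \<in> {0<..<\<delta>}"
    show "finite (R t)" "card (R t) = m" using fin[OF t] card[OF t] by (simp_all add: R_def f_def)
    show "cnj ` R t \<subseteq> R t"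
    proof
      fix w assume "w \<in> cnj ` R t"
      then obtain u where u: "u \<in> R t" "w = cnj u" by blast
      have "(\<lambda>i. of_real (Y t i))(N := u) \<in> polydisc (Suc N) \<sigma>"
        using Ye[of t] t u r by (auto simp: polydisc_def less_Suc_eq R_def I_def)
      from rhol_cnj[OF f this]
      have "f (\<lambda>i. cnj (((\<lambda>i. of_real (Y t i))(N := u)) i)) = 0" using u by (simp add: R_def)
      moreover have "(\<lambda>i. cnj (((\<lambda>i. of_real (Y t i))(N := u)) i)) = (\<lambda>i. of_real (Y t i))(N := cnj u)" by auto
      ultimately show "w \<in> R t" using u by (simp add: R_def)
    qed
    show "norm w < r" if "w \<in> R t" for w using that by (simp add: R_def)
    fix \<zeta> :: complex and \<eta> :: real assume \<zeta>: "\<zeta> \<in> R t" and \<eta>: "\<eta> > 0"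
    have "\<forall>\<^sub>F u in at t. \<exists>w\<in>ball \<zeta> \<eta>. norm w < r \<and> f ((\<lambda>i. of_real (Y u i))(N := w)) = 0"
      by (rule lhc[OF _ _ _ \<eta> rhol_chol[OF f]]) (use \<zeta> t nz in \<open>auto simp: R_def I_def f_def\<close>)
    then show "\<forall>\<^sub>F u in at t. R u \<inter> ball \<zeta> \<eta> \<noteq> {}"
      by eventually_elim (auto simp: R_def)
  qed (use t0 z0 in auto)
  then obtain z :: "real \<Rightarrow> real" where z: "continuous_on I z" "z t0 = z0" "\<And>t. t \<in> I \<Longrightarrow> \<bar>z t\<bar> < r"
    and alt: "(\<forall>t\<in>I. of_real (z t) \<in> R t \<and>
          (\<exists>\<eta>>0. \<forall>\<^sub>F u in at t. R u \<inter> ball (of_real (z t)) \<eta> \<subseteq> {of_real (z u)})) \<or>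
      (\<forall>t\<in>I. of_real (z t) \<notin> R t)" unfolding I_def by blast
  have eq: "(\<lambda>i. complex_of_real (((Y t)(N := z t)) i)) = (\<lambda>i. of_real (Y t i))(N := of_real (z t))" for t
    by auto
  have "(\<forall>t\<in>I. G ((\<lambda>i. of_real (Y t i))(N := of_real (z t))) = 0) \<or>
        (\<forall>t\<in>I. G ((\<lambda>i. of_real (Y t i))(N := of_real (z t))) \<noteq> 0)" if G: "G \<in> A" for G
    using alt
  proof
    assume "\<forall>t\<in>I. of_real (z t) \<notin> R t"
    then show ?thesis using z(3) A(1) G by (auto simp: R_def f_def)
  next
    assume root: "\<forall>t\<in>I. of_real (z t) \<in> R t \<and>
          (\<exists>\<eta>>0. \<forall>\<^sub>F u in at t. R u \<inter> ball (of_real (z t)) \<eta> \<subseteq> {of_real (z u)})"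
    define h where "h t = G ((\<lambda>i. of_real (Y t i))(N := of_real (z t)))" for t
    have conth: "continuous_on I h"
    proof -
      have "continuous_on I (\<lambda>t. (\<lambda>i. complex_of_real (Y t i))(N := of_real (z t)))"
        by (intro continuous_on_fun_upd continuous_on_coordinatewise_then_product continuous_on_of_real z(1))
           (use Y(1) in \<open>simp add: I_def\<close>)
      then show ?thesis
        unfolding h_def
      proof (rule continuous_on_compose2[OF cholD(1)[OF rhol_chol[OF A(2)[OF G]]]])
        show "(\<lambda>t. (\<lambda>i. complex_of_real (Y t i))(N := of_real (z t))) ` I \<subseteq> polydisc (Suc N) \<sigma>"
        proof
          fix x assume "x \<in> (\<lambda>t. (\<lambda>i. complex_of_real (Y t i))(N := of_real (z t))) ` I"
          then obtain t where t: "t \<in> I" "x = (\<lambda>i. complex_of_real (Y t i))(N := of_real (z t))" by blast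
          then show "x \<in> polydisc (Suc N) \<sigma>"
            using Ye[of t] z(3)[of t] r by (auto simp: polydisc_def less_Suc_eq)
        qed
      qed
    qed
    have loc: "\<forall>\<^sub>F u in at t. (h u = 0) = (h t = 0)" if t: "t \<in> {0<..<\<delta>}" for t
    proof (cases "h t = 0")
      case False
      have "isCont h t"
        using conth t continuous_on_eq_continuous_at[of I h] by (auto simp: I_def)
      then have "\<forall>\<^sub>F u in at t. h u \<noteq> 0"
        unfolding isCont_def using False tendsto_imp_eventually_ne by blast
      then show ?thesis using False by simp
    next
      case True
      obtain \<eta> where \<eta>: "\<eta> > 0" "\<forall>\<^sub>F u in at t. R u \<inter> ball (of_real (z t)) \<eta> \<subseteq> {of_real (z u)}"
        using root t unfolding I_def by blast
      have "\<forall>\<^sub>F u in at t. \<exists>w\<in>ball (of_real (z t)) \<eta>. norm w < r \<and> G ((\<lambda>i. of_real (Y u i))(N := w)) = 0"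
      proof (rule lhc[OF _ _ _ \<eta>(1) rhol_chol[OF A(2)[OF G]]])
        show "G (x(N := w)) \<noteq> 0" if "x \<in> polydisc N e" "norm w = r" for x w
          using nz[OF that] A(1) G by auto
      qed (use True t z(3)[of t] in \<open>auto simp: h_def I_def\<close>)
      with \<eta>(2) show ?thesis
      proof eventually_elim
        case (elim u)
        then obtain w where w: "w \<in> ball (of_real (z t)) \<eta>" "norm w < r" "G ((\<lambda>i. of_real (Y u i))(N := w)) = 0"
          by blast
        then have "w \<in> R u" using A(1) G by (auto simp: R_def f_def)
        then have "w = of_real (z u)" using elim w by blast
        then show ?case using w True by (simp add: h_def)
      qed
    qed
    have "(h b = 0) = (h t0 = 0)" if "b \<in> I" for b
      using locally_constant_on_interval[of \<delta> "\<lambda>t. h t = 0" t0 b] loc t0 that by (auto simp: I_def)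
    then show ?thesis unfolding h_def by blast
  qed
  then show ?thesis
    using z unfolding I_def by (intro exI[of _ z]) (auto simp: eq[unfolded fun_upd_def] fun_upd_def)
qed

section \<open>Curve sections of germs of real analytic varieties\<close>

lemma holomorphic_eventually_nonzero:
  assumes f: "f holomorphic_on S" "open S" "connected S" "\<xi> \<in> S" "\<beta> \<in> S" "f \<beta> \<noteq> (0::complex)"
  shows "\<forall>\<^sub>F w in at \<xi>. f w \<noteq> 0"
proof (cases "f \<xi> = 0")
  case True
  obtain r where r: "0 < r" "ball \<xi> r \<subseteq> S" "\<And>z. z \<in> ball \<xi> r - {\<xi>} \<Longrightarrow> f z \<noteq> 0"
    by (rule isolated_zeros[OF f(1-4) True f(5,6)]) blast
  show ?thesis unfolding eventually_at using r by (intro exI[of _ r]) (auto simp: dist_commute)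
next
  case False
  have "isCont f \<xi>" using f holomorphic_on_imp_continuous_on continuous_on_eq_continuous_at by blast
  then show ?thesis unfolding isCont_def using False tendsto_imp_eventually_ne by blast
qed

lemma rhol_compose:
  assumes F: "rhol N \<rho> F" and L: "\<And>z. z \<in> polydisc M \<sigma> \<Longrightarrow> L z \<in> polydisc N \<rho>"
    and cont: "continuous_on UNIV L"
    and aff: "\<And>a v. \<exists>a' v'. \<forall>\<zeta>. L (cline a v \<zeta>) = cline a' v' \<zeta>"
    and dep: "\<And>z z'. \<forall>i<M. z i = z' i \<Longrightarrow> \<forall>i<N. L z i = L z' i"
    and cnj: "\<And>z. L (\<lambda>i. cnj (z i)) = (\<lambda>i. cnj (L z i))"
  shows "rhol M \<sigma> (\<lambda>z. F (L z))"
  unfolding rhol_def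
  using chol_compose[OF rhol_chol[OF F] L cont aff dep] rhol_cnj[OF F L] by (simp add: cnj)

lemma rhol_det_hankel:
  assumes "\<And>k. rhol N e (s k)"
  shows "rhol N e (\<lambda>z. Determinant.det (Matrix.mat j j (\<lambda>(a, b). s (a + b) z)))"
proof -
  have eq: "Determinant.det (Matrix.mat j j (\<lambda>(a, b). s (a + b) z)) =
     (\<Sum>p\<in>{p. p permutes {0..<j}}. of_real (of_int (sign p)) * (\<Prod>i = 0..<j. s (i + p i) z))" for z
    unfolding Determinant.det_def
    by (auto intro!: sum.cong prod.cong simp: permutes_in_image)
  show ?thesis
    unfolding eq by (intro rhol_sum rhol_mult rhol_const rhol_prod assms)
qed

text \<open>Induction on the number of variables. After division by powers of the first coordinate
  and a linear change, the functions have finitely many roots in the last variable over each base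
  point. The base curve from the induction hypothesis keeps their number constant, and
  \<open>rhol_root_section\<close> lifts it. The bound \<open>\<delta>\<close> comes before
  \<open>x0\<close>: all small starting points share one interval.\<close>

lemma curve_sections:
  fixes A :: "((nat \<Rightarrow> complex) \<Rightarrow> complex) set"
  assumes "finite A" "\<And>F. F \<in> A \<Longrightarrow> rhol (Suc n) \<rho> F" "\<rho> > 0"
  shows "\<exists>\<delta>>0. \<forall>x0::nat\<Rightarrow>real. 0 < x0 0 \<and> (\<forall>i<Suc n. \<bar>x0 i\<bar> < \<delta>) \<longrightarrow>
    (\<exists>x::real\<Rightarrow>nat\<Rightarrow>real. (\<forall>i. continuous_on {0<..<\<delta>} (\<lambda>t. x t i)) \<and> (\<forall>i<Suc n. x (x0 0) i = x0 i) \<and>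
       (\<forall>t\<in>{0<..<\<delta>}. x t 0 = t \<and> (\<forall>i<Suc n. \<bar>x t i\<bar> < \<rho>)) \<and>
       (\<forall>F\<in>A. (\<forall>t\<in>{0<..<\<delta>}. F (\<lambda>i. of_real (x t i)) = 0) \<or> (\<forall>t\<in>{0<..<\<delta>}. F (\<lambda>i. of_real (x t i)) \<noteq> 0)))"
  using assms
proof (induction n arbitrary: A \<rho>)
  case 0
  \<comment> \<open>With one variable there is only the curve \<open>x t 0 = t\<close>, and a
    holomorphic function of one variable is identically zero or has no zero in a punctured
    neighbourhood of \<open>0\<close>.\<close>
  define x where "x t = (\<lambda>i::nat. if i = 0 then t else 0)" for t :: real
  define \<phi> where "\<phi> F t = F (\<lambda>i. complex_of_real (x t i))" for F :: "(nat \<Rightarrow> complex) \<Rightarrow> complex" and t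
  have dich: "(\<forall>\<^sub>F t in at_right 0. \<phi> F t = 0) \<or> (\<forall>\<^sub>F t in at_right 0. \<phi> F t \<noteq> 0)" if F: "F \<in> A" for F
  proof -
    define h where "h w = F ((\<lambda>_. 0)(0 := w))" for w
    have h: "h holomorphic_on ball 0 \<rho>"
      unfolding h_def
      by (rule chol_holomorphic_slice[OF rhol_chol[OF 0(2)[OF F]]]) (use 0(3) in \<open>auto simp: polydisc_def\<close>)
    have hx: "\<phi> F t = h (of_real t)" for t
    proof -
      have "(\<lambda>i. complex_of_real (x t i)) = (\<lambda>_. 0)(0 := of_real t)" by (auto simp: x_def)
      then show ?thesis by (simp add: \<phi>_def h_def)
    qed
    show ?thesis
    proof (cases "\<forall>w\<in>ball 0 \<rho>. h w = 0")
      case True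
      have "\<forall>\<^sub>F t in at_right 0. t \<in> {0<..<\<rho>}" using 0(3) eventually_at_right_real by blast
      then have "\<forall>\<^sub>F t in at_right 0. \<phi> F t = 0"
        by eventually_elim (use True in \<open>auto simp: hx\<close>)
      then show ?thesis ..
    next
      case False
      then have "\<forall>\<^sub>F w in at 0. h w \<noteq> 0"
        using holomorphic_eventually_nonzero[OF h] 0(3) by auto
      then obtain d where d: "d > 0" "\<And>w. w \<noteq> 0 \<Longrightarrow> norm w < d \<Longrightarrow> h w \<noteq> 0"
        unfolding eventually_at by auto
      have "\<forall>\<^sub>F t in at_right 0. t \<in> {0<..<d}" using d(1) eventually_at_right_real by blast
      then have "\<forall>\<^sub>F t in at_right 0. \<phi> F t \<noteq> 0"
        by eventually_elim (use d in \<open>auto simp: hx\<close>)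
      then show ?thesis ..
    qed
  qed
  define Z where "Z F \<longleftrightarrow> (\<forall>\<^sub>F t in at_right 0. \<phi> F t = 0)" for F
  have "\<forall>\<^sub>F t in at_right 0. \<forall>F\<in>A. if Z F then \<phi> F t = 0 else \<phi> F t \<noteq> 0"
  proof (intro eventually_ball_finite[OF 0(1)] ballI)
    fix F assume "F \<in> A"
    show "\<forall>\<^sub>F t in at_right 0. if Z F then \<phi> F t = 0 else \<phi> F t \<noteq> 0"
    proof (cases "Z F")
      case True
      then have "\<forall>\<^sub>F t in at_right 0. \<phi> F t = 0" by (simp only: Z_def)
      then show ?thesis using True by simp
    next
      case False
      then have "\<forall>\<^sub>F t in at_right 0. \<phi> F t \<noteq> 0" using dich[OF \<open>F \<in> A\<close>] unfolding Z_def by blast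
      then show ?thesis using False by simp
    qed
  qed
  then obtain b where b: "b > 0" "\<And>t. 0 < t \<Longrightarrow> t < b \<Longrightarrow> \<forall>F\<in>A. if Z F then \<phi> F t = 0 else \<phi> F t \<noteq> 0"
    unfolding eventually_at_right_field by auto
  have "continuous_on S (\<lambda>t. x t i)" for i S unfolding x_def by (cases "i = 0") auto
  moreover have "(\<forall>t\<in>{0<..<min b \<rho>}. \<phi> F t = 0) \<or> (\<forall>t\<in>{0<..<min b \<rho>}. \<phi> F t \<noteq> 0)" if "F \<in> A" for F
    using b(2) that by (cases "Z F") auto
  ultimately show ?case
    using b(1) 0(3) by (intro exI[of _ "min b \<rho>"] conjI allI impI exI[of _ x]) (auto simp: x_def \<phi>_def)
next
  case (Suc n)
  define N where "N = Suc n"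
  define \<sigma> where "\<sigma> = \<rho> / 4"
  have \<sigma>: "\<sigma> > 0" "\<sigma> < \<rho>" using Suc.prems by (auto simp: \<sigma>_def)
  have A: "finite A" "\<And>F. F \<in> A \<Longrightarrow> rhol (Suc N) \<rho> F" using Suc.prems by (auto simp: N_def)
  \<comment> \<open>Functions that vanish on the whole polydisc satisfy the alternative along every
    curve and are set aside.\<close>
  define A1 where "A1 = {F\<in>A. \<not> (\<forall>z\<in>polydisc (Suc N) \<sigma>. F z = 0)}"
  have finA1: "finite A1" using A by (simp add: A1_def)
  define Q where "Q F kG \<longleftrightarrow> rhol (Suc N) \<sigma> (snd kG) \<and> (\<forall>z\<in>polydisc (Suc N) \<sigma>. F z = z 0 ^ fst kG * snd kG z) \<and>
      (\<exists>x\<in>polydisc (Suc N) \<sigma>. snd kG (x(0 := 0)) \<noteq> 0)" for F and kG :: "nat \<times> ((nat \<Rightarrow> complex) \<Rightarrow> complex)"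
  have "\<forall>F\<in>A1. \<exists>kG. Q F kG"
  proof
    fix F assume F1: "F \<in> A1"
    then have "F \<in> A" by (simp add: A1_def)
    from rhol_divide_first_power[OF A(2)[OF this] Suc.prems(3)] F1
    obtain k G where "rhol (Suc N) \<sigma> G" "\<forall>z\<in>polydisc (Suc N) \<sigma>. F z = z 0 ^ k * G z"
      "\<exists>x\<in>polydisc (Suc N) \<sigma>. G (x(0 := 0)) \<noteq> 0"
      unfolding A1_def \<sigma>_def by blast
    then have "Q F (k, G)" by (simp add: Q_def)
    then show "\<exists>kG. Q F kG" by blast
  qed
  from bchoice[OF this] obtain kG where kG: "\<And>F. F \<in> A1 \<Longrightarrow> Q F (kG F)" by blast
  define G where "G F = snd (kG F)" for F
  define k where "k F = fst (kG F)" for F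
  have G: "\<And>F. F \<in> A1 \<Longrightarrow> rhol (Suc N) \<sigma> (G F)"
    "\<And>F z. F \<in> A1 \<Longrightarrow> z \<in> polydisc (Suc N) \<sigma> \<Longrightarrow> F z = z 0 ^ k F * G F z"
    "\<And>F. F \<in> A1 \<Longrightarrow> \<exists>x\<in>polydisc (Suc N) \<sigma>. G F (x(0 := 0)) \<noteq> 0"
    using kG unfolding Q_def G_def k_def by blast+
  \<comment> \<open>\<open>v\<close> is the direction of the new last axis. Its first entry is zero,
    so the parameter coordinate is preserved; its last entry is non-zero, so it completes the other
    axes to a basis; and no \<open>G F\<close> vanishes at \<open>v\<close>, hence none vanishes
    identically along that axis.\<close>
  obtain v :: "nat \<Rightarrow> real" where v: "v 0 = 0" "v N \<noteq> 0" "\<And>i. i < Suc N \<Longrightarrow> \<bar>v i\<bar> < \<sigma>"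
    and Gv: "\<And>F. F \<in> A1 \<Longrightarrow> G F (\<lambda>i. of_real (v i)) \<noteq> 0"
  proof -
    define B where "B = insert (\<lambda>z. z N) ((\<lambda>F z. G F (z(0 := 0))) ` A1)"
    have cB: "chol (Suc N) \<sigma> H" if "H \<in> B" for H
    proof -
      have "chol (Suc N) \<sigma> (\<lambda>z. G F (z(0 := 0)))" if "F \<in> A1" for F
      proof (rule chol_compose[OF rhol_chol[OF G(1)[OF that]], where L = "\<lambda>z. z(0 := 0)"])
        show "z(0 := 0) \<in> polydisc (Suc N) \<sigma>" if "z \<in> polydisc (Suc N) \<sigma>" for z
          using that \<sigma> by (auto simp: polydisc_def)
        show "continuous_on UNIV (\<lambda>z::nat\<Rightarrow>complex. z(0 := 0))"
          by (rule continuous_on_fun_upd[OF continuous_on_id continuous_on_const])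
        show "\<exists>a' v'. \<forall>\<zeta>. (cline a v \<zeta>)(0 := 0) = cline a' v' \<zeta>" for a v
          by (intro exI[of _ "a(0 := 0)"] exI[of _ "v(0 := 0)"]) (auto simp: cline_def)
      qed auto
      then show ?thesis using that by (auto simp: B_def intro: chol_coord)
    qed
    have nB: "\<exists>w\<in>polydisc (Suc N) \<sigma>. H w \<noteq> 0" if "H \<in> B" for H
    proof -
      have "(\<lambda>_. of_real (\<sigma> / 2)) \<in> polydisc (Suc N) \<sigma>" using \<sigma> by (auto simp: polydisc_def)
      moreover have "complex_of_real (\<sigma> / 2) \<noteq> 0" using \<sigma> by simp
      ultimately have "\<exists>w\<in>polydisc (Suc N) \<sigma>. w N \<noteq> 0"
        by (intro bexI[of _ "\<lambda>_. of_real (\<sigma> / 2)"]) auto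
      then show ?thesis using that G(3) by (auto simp: B_def)
    qed
    have "finite B" using finA1 by (simp add: B_def)
    from chol_real_nonzero_dense_finite[OF this cB nB, of "\<lambda>_. 0" \<sigma>] \<sigma>
    obtain x :: "nat \<Rightarrow> real" where x: "(\<lambda>i. of_real (x i)) \<in> polydisc (Suc N) \<sigma>"
      "\<forall>H\<in>B. H (\<lambda>i. of_real (x i)) \<noteq> 0" by auto
    have eq: "(\<lambda>i. complex_of_real (x i))(0 := 0) = (\<lambda>i. of_real ((x(0 := 0)) i))" by auto
    show ?thesis
    proof (rule that[of "x(0 := 0)"])
      show "(x(0 := 0)) N \<noteq> 0" using x(2) by (auto simp: B_def N_def)
      show "G F (\<lambda>i. of_real ((x(0 := 0)) i)) \<noteq> 0" if "F \<in> A1" for F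
      proof -
        have "G F ((\<lambda>i. complex_of_real (x i))(0 := 0)) \<noteq> 0" using x(2) that by (auto simp: B_def)
        then show ?thesis unfolding eq .
      qed
    qed (use x(1) \<sigma> in \<open>auto simp: polydisc_def\<close>)
  qed
  define L where "L z = (\<lambda>i. if i < N then z i + z N * of_real (v i) else if i = N then z N * of_real (v N) else (0::complex))" for z
  \<comment> \<open>Solves \<open>\<tau> + \<tau> * \<sigma> = \<sigma>\<close>. As the entries of
    \<open>v\<close> are below \<open>\<sigma>\<close>, the linear change \<open>L\<close> then maps
    the polydisc of radius \<open>\<tau>\<close> into that of radius
    \<open>\<sigma>\<close>.\<close>
  define \<tau> where "\<tau> = \<sigma> / (1 + \<sigma>)"
  have \<tau>: "\<tau> > 0" "\<tau> * (1 + \<sigma>) = \<sigma>" "\<tau> < 1" using \<sigma> by (auto simp: \<tau>_def)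
  have Lp: "L z \<in> polydisc (Suc N) \<sigma>" if z: "z \<in> polydisc (Suc N) \<tau>" for z
    unfolding polydisc_def
  proof (intro CollectI allI impI)
    fix i assume i: "i < Suc N"
    have zN: "norm (z N) < \<tau>" using z by (auto simp: polydisc_def)
    have *: "norm (z N * of_real (v i)) \<le> \<tau> * \<sigma>"
      unfolding norm_mult using zN v(3)[OF i] \<tau> by (intro mult_mono) auto
    show "norm (L z i) < \<sigma>"
    proof (cases "i < N")
      case True
      have "norm (z i + z N * of_real (v i)) \<le> norm (z i) + norm (z N * of_real (v i))" by (rule norm_triangle_ineq)
      also have "\<dots> < \<tau> + \<tau> * \<sigma>" using z i * by (intro add_less_le_mono) (auto simp: polydisc_def)
      also have "\<dots> = \<sigma>" using \<tau>(2) by (simp add: algebra_simps)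
      finally show ?thesis using True by (simp add: L_def)
    next
      case False
      have "\<tau> * \<sigma> < 1 * \<sigma>" using \<tau> \<sigma> by (intro mult_strict_right_mono) auto
      then show ?thesis using False * i by (auto simp: L_def less_Suc_eq)
    qed
  qed
  have Gl: "rhol (Suc N) \<tau> (\<lambda>z. G F (L z))" if "F \<in> A1" for F
  proof (rule rhol_compose[OF G(1)[OF that] Lp])
    show "continuous_on UNIV L"
    proof (rule continuous_on_coordinatewise_then_product)
      show "continuous_on UNIV (\<lambda>z. L z i)" for i
        unfolding L_def by (cases "i < N"; cases "i = N") (auto intro!: continuous_intros)
    qed
    show "\<exists>a' v'. \<forall>\<zeta>. L (cline a w \<zeta>) = cline a' v' \<zeta>" for a w
      by (intro exI[of _ "L a"] exI[of _ "L w"]) (auto simp: cline_def L_def algebra_simps)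
    show "\<forall>i<Suc N. L z i = L z' i" if "\<forall>i<Suc N. z i = z' i" for z z'
      using that by (auto simp: L_def)
    show "L (\<lambda>i. cnj (z i)) = (\<lambda>i. cnj (L z i))" for z by (auto simp: L_def)
  qed
  define B where "B = (\<lambda>F z. G F (L z)) ` A1"
  have B: "finite B" "\<And>H. H \<in> B \<Longrightarrow> rhol (Suc N) \<tau> H" using finA1 Gl by (auto simp: B_def)
  define f where "f z = (\<Prod>H\<in>B. H z)" for z
  have f: "rhol (Suc N) \<tau> f" unfolding f_def using B by (intro rhol_prod) auto
  \<comment> \<open>On the new last axis each function becomes holomorphic in one variable and is
    non-zero at parameter \<open>1\<close>, so a possible zero at the origin is isolated.\<close>
  have "\<forall>\<^sub>F w in at 0. \<forall>H\<in>B. H ((\<lambda>_. 0)(N := w)) \<noteq> 0"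
  proof (intro eventually_ball_finite[OF B(1)] ballI)
    fix H assume "H \<in> B"
    then obtain F where F: "F \<in> A1" "H = (\<lambda>z. G F (L z))" by (auto simp: B_def)
    define cv where "cv = (\<lambda>i. complex_of_real (v i))"
    define \<Omega> where "\<Omega> = {\<zeta>. cline (\<lambda>_. 0) cv \<zeta> \<in> polydisc (Suc N) \<sigma>}"
    have \<Omega>: "open \<Omega>" "convex \<Omega>" unfolding \<Omega>_def by (simp_all add: polydisc_cline_convex)
    have m: "0 \<in> \<Omega>" "1 \<in> \<Omega>" using \<sigma> v(3) by (auto simp: \<Omega>_def cline_def polydisc_def cv_def)
    have "\<forall>\<^sub>F w in at 0. G F (cline (\<lambda>_. 0) cv w) \<noteq> 0"
    proof (rule holomorphic_eventually_nonzero[OF _ \<Omega>(1) convex_connected[OF \<Omega>(2)] m])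
      show "(\<lambda>w. G F (cline (\<lambda>_. 0) cv w)) holomorphic_on \<Omega>"
        unfolding \<Omega>_def by (rule cholD(2)[OF rhol_chol[OF G(1)[OF F(1)]]])
      show "G F (cline (\<lambda>_. 0) cv 1) \<noteq> 0" using Gv[OF F(1)] by (simp add: cline_def cv_def)
    qed
    moreover have "\<forall>\<^sub>F w in at 0. w \<in> \<Omega>"
      using m(1) \<Omega>(1) by (intro eventually_at_in_open') auto
    ultimately show "\<forall>\<^sub>F w in at 0. H ((\<lambda>_. 0)(N := w)) \<noteq> 0"
    proof eventually_elim
      case (elim w)
      have "G F (cline (\<lambda>_. 0) cv w) = G F (L ((\<lambda>_. 0)(N := w)))"
        by (rule cholD(3)[OF rhol_chol[OF G(1)[OF F(1)]]])
           (use elim in \<open>auto simp: \<Omega>_def L_def cline_def cv_def less_Suc_eq\<close>)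
      then show ?case using elim F by simp
    qed
  qed
  then obtain d where d: "d > 0" "\<And>w. w \<noteq> 0 \<Longrightarrow> norm w < d \<Longrightarrow> \<forall>H\<in>B. H ((\<lambda>_. 0)(N := w)) \<noteq> 0"
    unfolding eventually_at by auto
  \<comment> \<open>Half of both bounds puts the circle strictly inside the polydisc and inside the
    punctured disc in which no function of \<open>B\<close> vanishes over the origin.\<close>
  define r where "r = min d \<tau> / 2"
  have r: "0 < r" "r < \<tau>" "r < d" using d \<tau> by (auto simp: r_def min_def)
  obtain e0 where e0: "e0 > 0" "\<And>z w. z \<in> polydisc N e0 \<Longrightarrow> norm w = r \<Longrightarrow> f (z(N := w)) \<noteq> 0"
  proof (rule chol_nonzero_tube[OF rhol_chol[OF f] r(2)])
    show "f ((\<lambda>_. 0)(N := w)) \<noteq> 0" if "norm w = r" for w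
      using d(2)[of w] that r B(1) by (force simp: f_def)
  qed blast
  define e where "e = min e0 \<tau>"
  have e: "e > 0" "e \<le> \<tau>" "e \<le> e0" using e0 \<tau> by (auto simp: e_def)
  have nz: "f (z(N := w)) \<noteq> 0" if "z \<in> polydisc N e" "norm w = r" for z w
    using e0(2) that polydisc_mono[OF e(3)] by blast
  define R where "R z = {w. norm w < r \<and> f (z(N := w)) = 0}" for z
  obtain s where s: "\<And>k. rhol N e (s k)" "\<And>z. z \<in> polydisc N e \<Longrightarrow> finite (R z)"
    "\<And>z k. z \<in> polydisc N e \<Longrightarrow> s k z = (\<Sum>p\<in>R z. of_int (zorder (\<lambda>w. f (z(N := w))) p) * p ^ k)"
    "\<And>z p. z \<in> polydisc N e \<Longrightarrow> p \<in> R z \<Longrightarrow> zorder (\<lambda>w. f (z(N := w))) p > 0"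
  proof (rule power_sums_rhol[OF f r(1,2) e(2)])
    show "f (z(N := w)) \<noteq> 0" if "z \<in> polydisc N e" "norm w = r" for z w using nz[OF that] .
    fix s
    assume "\<And>k. rhol N e (s k)" "\<And>z. z \<in> polydisc N e \<Longrightarrow> finite {w. norm w < r \<and> f (z(N := w)) = 0}"
      "\<And>z k. z \<in> polydisc N e \<Longrightarrow> s k z = (\<Sum>p\<in>{w. norm w < r \<and> f (z(N := w)) = 0}. of_int (zorder (\<lambda>w. f (z(N := w))) p) * p ^ k)"
      "\<And>z p. z \<in> polydisc N e \<Longrightarrow> p \<in> {w. norm w < r \<and> f (z(N := w)) = 0} \<Longrightarrow> zorder (\<lambda>w. f (z(N := w))) p > 0"
    then show thesis by (rule that[of s, unfolded R_def])
  qed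
  \<comment> \<open>The power sum of order zero counts roots with multiplicity. By continuity it
    stays below \<open>b\<close> near the origin, so there are at most \<open>dd\<close> distinct
    roots and Hankel determinants of size up to \<open>dd\<close> determine their number.\<close>
  define b where "b = norm (s 0 (\<lambda>_. 0)) + 1"
  have "(\<lambda>_. 0) \<in> polydisc N e" using e by (simp add: polydisc_def)
  then have "\<exists>e1>0. \<forall>z. (\<forall>i<N. norm (z i) < e1) \<longrightarrow> z \<in> polydisc N e \<and> s 0 z \<in> ball 0 b"
    using chol_box[OF rhol_chol[OF s(1)[of 0]], of "\<lambda>_. 0" "ball 0 b"] unfolding b_def
    by (metis open_ball mem_ball_0 less_add_one diff_zero)
  then obtain e1 where e1: "e1 > 0"
    "\<And>z. \<forall>i<N. norm (z i) < e1 \<Longrightarrow> z \<in> polydisc N e \<and> s 0 z \<in> ball 0 b" by blast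
  have sub1: "z \<in> polydisc N e" "norm (s 0 z) < b" if "z \<in> polydisc N e1" for z
    using e1(2)[of z] that by (auto simp: polydisc_def)
  define dd where "dd = nat \<lceil>b\<rceil>"
  have cardR: "card (R z) \<le> dd" if z: "z \<in> polydisc N e1" for z
  proof -
    define S where "S = (\<Sum>p\<in>R z. zorder (\<lambda>w. f (z(N := w))) p)"
    have "s 0 z = of_int S" using s(3)[OF sub1(1)[OF z], of 0] by (simp add: S_def)
    moreover have "int (card (R z)) \<le> S"
    proof -
      have "(\<Sum>p\<in>R z. 1) \<le> S" unfolding S_def
        by (rule sum_mono) (use s(4)[OF sub1(1)[OF z]] in force)
      then show ?thesis by simp
    qed
    ultimately have "real_of_int (int (card (R z))) \<le> real_of_int S" "norm (s 0 z) = \<bar>real_of_int S\<bar>"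
      by (simp_all only: of_int_le_iff norm_of_int)
    then have "real (card (R z)) < b" using sub1(2)[OF z] by simp
    then have "real (card (R z)) \<le> real dd" unfolding dd_def using real_nat_ceiling_ge[of b] by linarith
    then show ?thesis by (simp only: of_nat_le_iff)
  qed
  \<comment> \<open>These determinants take the part of discriminants: they are holomorphic in the
    base point, and their vanishing depends on the number of distinct roots over it.\<close>
  define \<Delta> where "\<Delta> j z = Determinant.det (Matrix.mat j j (\<lambda>(a, b). s (a + b) z))" for j z
  have e1e: "rhol N (min e1 e) (\<Delta> j)" for j
    unfolding \<Delta>_def by (intro rhol_det_hankel rhol_mono[OF s(1)]) auto
  define e2 where "e2 = min e1 e"
  have e2: "e2 > 0" "polydisc N e2 \<subseteq> polydisc N e1" using e1 e by (auto simp: e2_def intro!: polydisc_mono)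
  have "finite (\<Delta> ` {..dd})" "\<And>F. F \<in> \<Delta> ` {..dd} \<Longrightarrow> rhol (Suc n) e2 F"
    using e1e by (auto simp: e2_def N_def)
  \<comment> \<open>The induction hypothesis is applied to the determinants, not to functions of
    \<open>A\<close>: along the resulting base curve each \<open>\<Delta> j\<close> is identically
    zero or nowhere zero.\<close>
  from Suc.IH[OF this e2(1)] obtain \<delta>1 where \<delta>1: "\<delta>1 > 0" and IH: "\<forall>x0::nat\<Rightarrow>real. 0 < x0 0 \<and> (\<forall>i<Suc n. \<bar>x0 i\<bar> < \<delta>1) \<longrightarrow>
    (\<exists>x::real\<Rightarrow>nat\<Rightarrow>real. (\<forall>i. continuous_on {0<..<\<delta>1} (\<lambda>t. x t i)) \<and> (\<forall>i<Suc n. x (x0 0) i = x0 i) \<and>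
       (\<forall>t\<in>{0<..<\<delta>1}. x t 0 = t \<and> (\<forall>i<Suc n. \<bar>x t i\<bar> < e2)) \<and>
       (\<forall>F\<in>\<Delta> ` {..dd}. (\<forall>t\<in>{0<..<\<delta>1}. F (\<lambda>i. of_real (x t i)) = 0) \<or> (\<forall>t\<in>{0<..<\<delta>1}. F (\<lambda>i. of_real (x t i)) \<noteq> 0)))"
    by blast
  \<comment> \<open>\<open>C\<close> bounds the new coordinates of a point by the old ones: the last
    coordinate is divided by \<open>v N\<close>, and the others are changed by at most
    \<open>\<sigma> / \<bar>v N\<bar>\<close> times it.\<close>
  define C where "C = 1 + (1 + \<sigma>) / \<bar>v N\<bar>"
  have C: "C \<ge> 1" using \<sigma> by (simp add: C_def)
  define \<delta> where "\<delta> = min \<delta>1 r / C"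
  have \<delta>: "\<delta> > 0" "\<delta> * C \<le> \<delta>1" "\<delta> * C \<le> r" using C \<delta>1 r by (auto simp: \<delta>_def)
  have \<delta>\<delta>1: "\<delta> \<le> \<delta>1" using \<delta> mult_left_mono[OF C, of \<delta>] by linarith
  show ?case
  proof (intro exI[of _ \<delta>] conjI allI impI \<delta>(1))
    fix x0 :: "nat \<Rightarrow> real" assume x0: "0 < x0 0 \<and> (\<forall>i<Suc (Suc n). \<bar>x0 i\<bar> < \<delta>)"
    \<comment> \<open>\<open>y0\<close> and \<open>yN\<close> are the coordinates of
      \<open>x0\<close> with respect to the new axes, that is, the preimage of \<open>x0\<close>
      under \<open>L\<close>.\<close>
    define yN where "yN = x0 N / v N"
    define y0 where "y0 i = x0 i - yN * v i" for i
    have "\<bar>x0 N\<bar> < \<delta>" using x0 by (auto simp: N_def)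
    then have yNb: "\<bar>yN\<bar> < \<delta> / \<bar>v N\<bar>" unfolding yN_def abs_divide using v(2) by (intro divide_strict_right_mono) auto
    have "\<delta> / \<bar>v N\<bar> \<le> \<delta> * C" using \<delta>(1) \<sigma> v(2) by (simp add: C_def field_simps)
    then have yN: "\<bar>yN\<bar> < r" using yNb \<delta>(3) by linarith
    have y0: "\<bar>y0 i\<bar> < \<delta>1" if "i < N" for i
    proof -
      have "\<bar>yN * v i\<bar> \<le> \<delta> / \<bar>v N\<bar> * \<sigma>"
        unfolding abs_mult using yNb v(3)[of i] that \<delta>(1) by (intro mult_mono) auto
      moreover have "\<bar>x0 i\<bar> < \<delta>" using x0 that by (auto simp: N_def)
      ultimately have "\<bar>y0 i\<bar> < \<delta> + \<delta> / \<bar>v N\<bar> * \<sigma>" unfolding y0_def by linarith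
      also have "\<dots> \<le> \<delta> * C" using \<delta>(1) \<sigma> v(2) by (simp add: C_def field_simps)
      finally show ?thesis using \<delta>(2) by linarith
    qed
    have y00: "y0 0 = x0 0" using v(1) by (simp add: y0_def)
    have "0 < y0 0 \<and> (\<forall>i<Suc n. \<bar>y0 i\<bar> < \<delta>1)" using y00 x0 y0 by (simp add: N_def)
    from IH[rule_format, OF this] obtain Y :: "real \<Rightarrow> nat \<Rightarrow> real" where Yc: "\<forall>i. continuous_on {0<..<\<delta>1} (\<lambda>t. Y t i)"
      and Y0: "\<forall>i<Suc n. Y (y0 0) i = y0 i"
      and Yt: "\<forall>t\<in>{0<..<\<delta>1}. Y t 0 = t \<and> (\<forall>i<Suc n. \<bar>Y t i\<bar> < e2)"
      and Y\<Delta>: "\<forall>F\<in>\<Delta> ` {..dd}. (\<forall>t\<in>{0<..<\<delta>1}. F (\<lambda>i. of_real (Y t i)) = 0) \<or> (\<forall>t\<in>{0<..<\<delta>1}. F (\<lambda>i. of_real (Y t i)) \<noteq> 0)"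
      by blast
    note Yc = Yc[rule_format] and Y0 = Y0[folded N_def, unfolded y00, rule_format] and Yt = Yt[folded N_def, rule_format]
    have Yp1: "(\<lambda>i. of_real (Y t i)) \<in> polydisc N e1" if "t \<in> {0<..<\<delta>1}" for t
      using Yt[OF that] by (auto simp: polydisc_def e2_def)
    have Yp: "(\<lambda>i. of_real (Y t i)) \<in> polydisc N e" if "t \<in> {0<..<\<delta>1}" for t
      using sub1(1)[OF Yp1[OF that]] .
    have t0: "x0 0 \<in> {0<..<\<delta>1}" using x0 \<delta>\<delta>1 by (auto simp: abs_less_iff)
    \<comment> \<open>With the larger count as size, the determinant would vanish over the point
      with fewer roots and not over the other, against the choice of the base curve.\<close>
    have lt: "\<not> card (R (\<lambda>i. of_real (Y t i))) < card (R (\<lambda>i. of_real (Y t' i)))"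
      if t: "t \<in> {0<..<\<delta>1}" and t': "t' \<in> {0<..<\<delta>1}" for t t'
    proof
      define j where "j = card (R (\<lambda>i. of_real (Y t' i)))"
      assume "card (R (\<lambda>i. of_real (Y t i))) < card (R (\<lambda>i. of_real (Y t' i)))"
      then have "\<Delta> j (\<lambda>i. of_real (Y t i)) = 0"
        unfolding \<Delta>_def j_def
        using s(3)[OF Yp[OF t]] s(2)[OF Yp[OF t]] by (intro hankel_det_eq_0) auto
      moreover have "\<Delta> j (\<lambda>i. of_real (Y t' i)) \<noteq> 0"
        unfolding \<Delta>_def
      proof (rule hankel_det_neq_0[OF _ _ _ s(3)[OF Yp[OF t']]])
        fix p assume "p \<in> R (\<lambda>i. of_real (Y t' i))"
        from s(4)[OF Yp[OF t'] this]
        show "complex_of_int (zorder (\<lambda>w. f ((\<lambda>i. of_real (Y t' i))(N := w))) p) \<noteq> 0" by simp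
      qed (use s(2)[OF Yp[OF t']] in \<open>simp_all add: j_def\<close>)
      moreover have "j \<le> dd" unfolding j_def by (rule cardR[OF Yp1[OF t']])
      ultimately show False using bspec[OF Y\<Delta>, of "\<Delta> j"] t t' by auto
    qed
    define m where "m = card (R (\<lambda>i. of_real (Y (x0 0) i)))"
    have "\<exists>z::real\<Rightarrow>real. continuous_on {0<..<\<delta>1} z \<and> z (x0 0) = yN \<and> (\<forall>t\<in>{0<..<\<delta>1}. \<bar>z t\<bar> < r) \<and>
     (\<forall>H\<in>B. (\<forall>t\<in>{0<..<\<delta>1}. H (\<lambda>i. of_real (((Y t)(N := z t)) i)) = 0) \<or>
             (\<forall>t\<in>{0<..<\<delta>1}. H (\<lambda>i. of_real (((Y t)(N := z t)) i)) \<noteq> 0))"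
    proof (rule rhol_root_section[OF B r(1,2) e(2), where m = m])
      fix t assume t: "t \<in> {0<..<\<delta>1}"
      show "finite {w. norm w < r \<and> (\<Prod>H\<in>B. H ((\<lambda>i. of_real (Y t i))(N := w))) = 0}"
        using s(2)[OF Yp[OF t]] by (simp add: R_def f_def)
      show "card {w. norm w < r \<and> (\<Prod>H\<in>B. H ((\<lambda>i. of_real (Y t i))(N := w))) = 0} = m"
        using lt[OF t t0] lt[OF t0 t] by (simp add: R_def f_def m_def)
    qed (use nz Yc Yp t0 yN in \<open>auto simp: f_def\<close>)
    then obtain z :: "real \<Rightarrow> real" where zc: "continuous_on {0<..<\<delta>1} z" and z0: "z (x0 0) = yN"
      and zb: "\<And>t. t \<in> {0<..<\<delta>1} \<Longrightarrow> \<bar>z t\<bar> < r"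
      and zB: "\<And>H. H \<in> B \<Longrightarrow> (\<forall>t\<in>{0<..<\<delta>1}. H (\<lambda>i. of_real (((Y t)(N := z t)) i)) = 0) \<or>
             (\<forall>t\<in>{0<..<\<delta>1}. H (\<lambda>i. of_real (((Y t)(N := z t)) i)) \<noteq> 0)" by blast
    define x where "x t = (\<lambda>i. if i < N then Y t i + z t * v i else if i = N then z t * v N else 0)" for t
    have xL: "(\<lambda>i. complex_of_real (x t i)) = L (\<lambda>i. of_real (((Y t)(N := z t)) i))" for t
      by (auto simp: x_def L_def)
    have xp: "(\<lambda>i. complex_of_real (x t i)) \<in> polydisc (Suc N) \<sigma>" if "t \<in> {0<..<\<delta>1}" for t
      unfolding xL using Yp[OF that] zb[OF that] r e by (intro Lp) (auto simp: polydisc_def less_Suc_eq)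
    have sub: "{0<..<\<delta>} \<subseteq> {0<..<\<delta>1}" using \<delta>\<delta>1 by auto
    have x00: "x t 0 = t" if "t \<in> {0<..<\<delta>1}" for t using Yt[OF that] v(1) by (simp add: x_def N_def)
    show "\<exists>x::real\<Rightarrow>nat\<Rightarrow>real. (\<forall>i. continuous_on {0<..<\<delta>} (\<lambda>t. x t i)) \<and> (\<forall>i<Suc (Suc n). x (x0 0) i = x0 i) \<and>
       (\<forall>t\<in>{0<..<\<delta>}. x t 0 = t \<and> (\<forall>i<Suc (Suc n). \<bar>x t i\<bar> < \<rho>)) \<and>
       (\<forall>F\<in>A. (\<forall>t\<in>{0<..<\<delta>}. F (\<lambda>i. of_real (x t i)) = 0) \<or> (\<forall>t\<in>{0<..<\<delta>}. F (\<lambda>i. of_real (x t i)) \<noteq> 0))"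
    proof (intro exI[of _ x] conjI allI impI ballI)
      fix i
      have "continuous_on {0<..<\<delta>1} (\<lambda>t. x t i)"
        unfolding x_def using Yc[of i] zc by (cases "i < N"; cases "i = N") (auto intro!: continuous_intros)
      then show "continuous_on {0<..<\<delta>} (\<lambda>t. x t i)" using sub by (rule continuous_on_subset)
    next
      fix i assume "i < Suc (Suc n)"
      then show "x (x0 0) i = x0 i"
        using v(2) Y0[of i] by (auto simp: x_def z0 y0_def yN_def N_def less_Suc_eq)
    next
      fix t assume t: "t \<in> {0<..<\<delta>}"
      then show "x t 0 = t" using x00 sub by blast
      fix i assume "i < Suc (Suc n)"
      then show "\<bar>x t i\<bar> < \<rho>" using xp[of t] t \<delta>\<delta>1 \<sigma> by (force simp: polydisc_def N_def)
    next
      fix F assume F: "F \<in> A"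
      show "(\<forall>t\<in>{0<..<\<delta>}. F (\<lambda>i. of_real (x t i)) = 0) \<or> (\<forall>t\<in>{0<..<\<delta>}. F (\<lambda>i. of_real (x t i)) \<noteq> 0)"
      proof (cases "F \<in> A1")
        case False
        then show ?thesis using F xp sub by (auto simp: A1_def)
      next
        case True
        \<comment> \<open>Along the curve \<open>t > 0\<close>, so restoring the factor
          \<open>t ^ k F\<close> does not alter whether \<open>F\<close> vanishes.\<close>
        have FG: "F (\<lambda>i. of_real (x t i)) = of_real t ^ k F * G F (L (\<lambda>i. of_real (((Y t)(N := z t)) i)))"
          if "t \<in> {0<..<\<delta>1}" for t
          using G(2)[OF True xp[OF that]] x00[OF that] unfolding xL by simp
        have "(\<lambda>z. G F (L z)) \<in> B" using True by (auto simp: B_def)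
        from zB[OF this] show ?thesis using FG sub by auto
      qed
    qed
  qed
qed

section \<open>Bounded subanalytic sets\<close>

lemma Rn_iff: "x \<in> Rn n \<longleftrightarrow> (\<forall>i\<ge>n. x i = 0)"
  by (simp add: topspace_Euclidean_space)

section \<open>Convergent power series in finitely many variables\<close>

definition mi :: "nat \<Rightarrow> (nat \<Rightarrow> nat) set" where
  "mi n = {\<alpha>. \<forall>i\<ge>n. \<alpha> i = 0}"

definition mnm :: "nat \<Rightarrow> vec \<Rightarrow> (nat \<Rightarrow> nat) \<Rightarrow> real" where
  "mnm n y \<alpha> = (\<Prod>i<n. y i ^ \<alpha> i)"

lemma real_analytic_at_alt:
  "real_analytic_at n f a \<longleftrightarrow> (\<exists>c r. r > 0 \<and> (\<forall>x\<in>nbd n a r (Rn n).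
     ((\<lambda>\<alpha>. c \<alpha> * mnm n (\<lambda>i. x i - a i) \<alpha>) has_sum f x) (mi n)))"
  by (simp add: real_analytic_at_def mi_def mnm_def)

lemma has_sum_finite_support:
  fixes f :: "'a \<Rightarrow> real"
  assumes "finite B" "B \<subseteq> A" "\<And>x. x \<in> A - B \<Longrightarrow> f x = 0" "s = sum f B"
  shows "(f has_sum s) A"
proof -
  have "(f has_sum s) B" using assms by (simp add: has_sum_finite)
  then show ?thesis using assms has_sum_cong_neutral[of A B f f s] by auto
qed

lemma analytic_const: "real_analytic_at n (\<lambda>x. k) a"
  unfolding real_analytic_at_alt
proof (intro exI[of _ "\<lambda>\<alpha>. if \<alpha> = (\<lambda>_. 0) then k else 0"] exI[of _ "1::real"] conjI ballI)
  fix x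
  show "((\<lambda>\<alpha>. (if \<alpha> = (\<lambda>_. 0) then k else 0) * mnm n (\<lambda>i. x i - a i) \<alpha>) has_sum k) (mi n)"
    by (rule has_sum_finite_support[of "{\<lambda>_. 0}"]) (auto simp: mi_def mnm_def)
qed auto

lemma analytic_coord:
  assumes "j < n" shows "real_analytic_at n (\<lambda>x. x j) a"
  unfolding real_analytic_at_alt
proof (intro exI[of _ "\<lambda>\<alpha>. if \<alpha> = (\<lambda>_. 0) then a j else if \<alpha> = (\<lambda>i. if i = j then 1 else 0) then 1 else 0"]
    exI[of _ "1::real"] conjI ballI)
  fix x
  define E :: "nat \<Rightarrow> nat" where "E = (\<lambda>i. if i = j then 1 else 0)"
  have "E j \<noteq> 0" by (simp add: E_def)
  then have ne: "E \<noteq> (\<lambda>_. 0)" by metis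
  have "mnm n (\<lambda>i. x i - a i) E = (\<Prod>i<n. if i = j then x i - a i else 1)"
    unfolding mnm_def E_def by (intro prod.cong) auto
  then have m: "mnm n (\<lambda>i. x i - a i) E = x j - a j" using assms by (simp add: prod.delta)
  have "((\<lambda>\<alpha>. (if \<alpha> = (\<lambda>_. 0) then a j else if \<alpha> = E then 1 else 0) * mnm n (\<lambda>i. x i - a i) \<alpha>) has_sum x j) (mi n)"
    by (rule has_sum_finite_support[of "{\<lambda>_. 0, E}"])
       (use assms ne m in \<open>auto simp: mi_def E_def[abs_def], auto simp: mnm_def\<close>)
  then show "((\<lambda>\<alpha>. (if \<alpha> = (\<lambda>_. 0) then a j else if \<alpha> = (\<lambda>i. if i = j then 1 else 0) then 1 else 0) *
      mnm n (\<lambda>i. x i - a i) \<alpha>) has_sum x j) (mi n)" unfolding E_def .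
qed auto

lemma nbd_mono: "r \<le> s \<Longrightarrow> nbd n a r A \<subseteq> nbd n a s A"
  by (auto simp: nbd_def)

lemma analytic_add:
  assumes "real_analytic_at n f a" "real_analytic_at n g a"
  shows "real_analytic_at n (\<lambda>x. f x + g x) a"
proof -
  obtain c r where c: "r > 0" "\<And>x. x \<in> nbd n a r (Rn n) \<Longrightarrow> ((\<lambda>\<alpha>. c \<alpha> * mnm n (\<lambda>i. x i - a i) \<alpha>) has_sum f x) (mi n)"
    using assms(1) unfolding real_analytic_at_alt by blast
  obtain d s where d: "s > 0" "\<And>x. x \<in> nbd n a s (Rn n) \<Longrightarrow> ((\<lambda>\<alpha>. d \<alpha> * mnm n (\<lambda>i. x i - a i) \<alpha>) has_sum g x) (mi n)"
    using assms(2) unfolding real_analytic_at_alt by blast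
  show ?thesis
    unfolding real_analytic_at_alt
  proof (intro exI[of _ "\<lambda>\<alpha>. c \<alpha> + d \<alpha>"] exI[of _ "min r s"] conjI ballI)
    fix x assume "x \<in> nbd n a (min r s) (Rn n)"
    then have "x \<in> nbd n a r (Rn n)" "x \<in> nbd n a s (Rn n)" by (auto simp: nbd_def)
    from has_sum_add[OF c(2)[OF this(1)] d(2)[OF this(2)]]
    show "((\<lambda>\<alpha>. (c \<alpha> + d \<alpha>) * mnm n (\<lambda>i. x i - a i) \<alpha>) has_sum f x + g x) (mi n)"
      by (simp add: algebra_simps)
  qed (use c d in auto)
qed

text \<open>Unconditional summability of reals is absolute, so the product family is summable and
  the iterated sum computes it.\<close>

lemma has_sum_times_real:
  fixes u :: "'a \<Rightarrow> real" and v :: "'b \<Rightarrow> real"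
  assumes u: "(u has_sum s) A" and v: "(v has_sum t) B"
  shows "((\<lambda>(x, y). u x * v y) has_sum s * t) (A \<times> B)"
proof (rule has_sum_SigmaI)
  show "((\<lambda>y. case (x, y) of (x, y) \<Rightarrow> u x * v y) has_sum u x * t) B" for x
    using has_sum_cmult_right[OF v, of "u x"] by simp
  show "((\<lambda>x. u x * t) has_sum s * t) A" using has_sum_cmult_left[OF u] .
  have au: "(\<lambda>x. norm (u x)) summable_on A" 
    using u summable_on_iff_abs_summable_on_real[of u A] unfolding summable_on_def by blast
  have av: "(\<lambda>x. norm (v x)) summable_on B" 
    using v summable_on_iff_abs_summable_on_real[of v B] unfolding summable_on_def by blast
  have "(\<lambda>p. norm ((\<lambda>(x, y). u x * v y) p)) summable_on A \<times> B"
    unfolding Infinite_Sum.abs_summable_on_Sigma_iff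
  proof (intro conjI ballI)
    show "(\<lambda>y. norm ((\<lambda>(x, y). u x * v y) (x, y))) summable_on B" for x
      using summable_on_cmult_right[OF av, of "norm (u x)"] by (simp add: norm_mult abs_mult)
    have "(\<Sum>\<^sub>\<infinity>y\<in>B. norm (u x * v y)) = norm (u x) * (\<Sum>\<^sub>\<infinity>y\<in>B. norm (v y))" for x
      by (simp add: abs_mult infsum_cmult_right')
    moreover have "(\<lambda>x. norm (u x) * (\<Sum>\<^sub>\<infinity>y\<in>B. norm (v y))) summable_on A"
      using summable_on_cmult_left[OF au] .
    moreover have "0 \<le> (\<Sum>\<^sub>\<infinity>y\<in>B. norm (v y))" by (rule infsum_nonneg) simp
    ultimately show "(\<lambda>x. norm (\<Sum>\<^sub>\<infinity>y\<in>B. norm ((\<lambda>(x, y). u x * v y) (x, y)))) summable_on A"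
      by (simp add: abs_mult)
  qed
  then show "(\<lambda>(x, y). u x * v y) summable_on A \<times> B" by (rule Infinite_Sum.abs_summable_summable)
qed

lemma mnm_add: "mnm n y (\<lambda>i. \<alpha> i + \<beta> i) = mnm n y \<alpha> * mnm n y \<beta>"
  by (simp add: mnm_def power_add prod.distrib)

text \<open>Cauchy product: pairs of exponents are grouped by their sum. Each fibre
  \<open>T \<gamma>\<close> is finite, so the new coefficients are finite sums, and unconditional
  summation allows the regrouping.\<close>

lemma analytic_mult:
  assumes "real_analytic_at n f a" "real_analytic_at n g a"
  shows "real_analytic_at n (\<lambda>x. f x * g x) a"
proof -
  obtain c r where c: "r > 0" "\<And>x. x \<in> nbd n a r (Rn n) \<Longrightarrow> ((\<lambda>\<alpha>. c \<alpha> * mnm n (\<lambda>i. x i - a i) \<alpha>) has_sum f x) (mi n)"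
    using assms(1) unfolding real_analytic_at_alt by blast
  obtain d s where d: "s > 0" "\<And>x. x \<in> nbd n a s (Rn n) \<Longrightarrow> ((\<lambda>\<alpha>. d \<alpha> * mnm n (\<lambda>i. x i - a i) \<alpha>) has_sum g x) (mi n)"
    using assms(2) unfolding real_analytic_at_alt by blast
  define T where "T \<gamma> = {p \<in> mi n \<times> mi n. (\<lambda>i. fst p i + snd p i) = \<gamma>}" for \<gamma> :: "nat \<Rightarrow> nat"
  have fin: "finite (T \<gamma>)" if "\<gamma> \<in> mi n" for \<gamma>
  proof -
    define D where "D = {\<alpha>::nat\<Rightarrow>nat. \<forall>i. (i \<in> {..<n} \<longrightarrow> \<alpha> i \<in> {..Max (\<gamma> ` {..<n})}) \<and> (i \<notin> {..<n} \<longrightarrow> \<alpha> i = 0)}"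
    have "finite D" unfolding D_def by (intro finite_set_of_finite_funs) auto
    moreover have "T \<gamma> \<subseteq> D \<times> D"
    proof
      fix p assume p: "p \<in> T \<gamma>"
      have le: "fst p i \<le> \<gamma> i" "snd p i \<le> \<gamma> i" for i using p by (auto simp: T_def)
      have mx: "\<gamma> i \<le> Max (\<gamma> ` {..<n})" if "i < n" for i using that by (intro Max_ge) auto
      have "fst p i \<le> Max (\<gamma> ` {..<n})" "snd p i \<le> Max (\<gamma> ` {..<n})" if "i < n" for i
        using order_trans[OF le(1) mx[OF that]] order_trans[OF le(2) mx[OF that]] .
      moreover have "fst p i = 0" "snd p i = 0" if "\<not> i < n" for i
        using p that by (auto simp: T_def mi_def)
      ultimately have "fst p \<in> D" "snd p \<in> D" by (simp_all add: D_def)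
      then show "p \<in> D \<times> D" by (simp add: mem_Times_iff)
    qed
    ultimately show ?thesis using finite_subset by blast
  qed
  show ?thesis
    unfolding real_analytic_at_alt
  proof (intro exI[of _ "\<lambda>\<gamma>. \<Sum>p\<in>T \<gamma>. c (fst p) * d (snd p)"] exI[of _ "min r s"] conjI ballI)
    fix x assume "x \<in> nbd n a (min r s) (Rn n)"
    then have x: "x \<in> nbd n a r (Rn n)" "x \<in> nbd n a s (Rn n)" by (auto simp: nbd_def)
    define m where "m = mnm n (\<lambda>i. x i - a i)"
    define h where "h p = (c (fst p) * m (fst p)) * (d (snd p) * m (snd p))" for p
    have "(h has_sum f x * g x) (mi n \<times> mi n)"
      using has_sum_times_real[OF c(2)[OF x(1)] d(2)[OF x(2)]] by (simp add: h_def[abs_def] m_def case_prod_unfold)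
    also have "(h has_sum f x * g x) (mi n \<times> mi n) \<longleftrightarrow> ((\<lambda>q. h (snd q)) has_sum f x * g x) (Sigma (mi n) T)"
      by (rule has_sum_reindex_bij_witness[where i = snd and j = "\<lambda>p. (\<lambda>i. fst p i + snd p i, p)"])
         (auto simp: T_def mi_def)
    finally have "((\<lambda>\<gamma>. \<Sum>p\<in>T \<gamma>. h p) has_sum f x * g x) (mi n)"
      by (rule has_sum_SigmaD) (use fin in \<open>auto intro: has_sum_finite\<close>)
    moreover have "(\<Sum>p\<in>T \<gamma>. h p) = (\<Sum>p\<in>T \<gamma>. c (fst p) * d (snd p)) * m \<gamma>" for \<gamma>
      unfolding sum_distrib_right
    proof (rule sum.cong)
      fix p assume "p \<in> T \<gamma>"
      then have "m \<gamma> = m (fst p) * m (snd p)" unfolding m_def mnm_add[symmetric] by (auto simp: T_def)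
      then show "h p = c (fst p) * d (snd p) * m \<gamma>" by (simp add: h_def)
    qed simp
    ultimately show "((\<lambda>\<gamma>. (\<Sum>p\<in>T \<gamma>. c (fst p) * d (snd p)) * mnm n (\<lambda>i. x i - a i) \<gamma>) has_sum f x * g x) (mi n)"
      by (simp add: m_def)
  qed (use c d in auto)
qed

text \<open>Projections, permutations, shifts and repetitions of coordinates are all of this form,
  so one notion serves for every rearrangement of variables.\<close>

definition sel :: "nat \<Rightarrow> (nat \<Rightarrow> nat) \<Rightarrow> vec \<Rightarrow> vec" where
  "sel n \<sigma> x = (\<lambda>i. if i < n then x (\<sigma> i) else 0)"

lemma sel_Rn [simp]: "sel n \<sigma> x \<in> Rn n"
  by (simp add: Rn_iff sel_def)

lemma edist_sel:
  assumes "inj_on \<sigma> {..<n}" "\<sigma> ` {..<n} \<subseteq> {..<N}"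
  shows "edist n (sel n \<sigma> x) (sel n \<sigma> a) \<le> edist N x a"
proof -
  have "(\<Sum>i<n. (x (\<sigma> i) - a (\<sigma> i))\<^sup>2) = (\<Sum>j\<in>\<sigma> ` {..<n}. (x j - a j)\<^sup>2)"
    using assms(1) by (simp add: sum.reindex)
  also have "\<dots> \<le> (\<Sum>j<N. (x j - a j)\<^sup>2)" by (rule sum_mono2) (use assms(2) in auto)
  finally show ?thesis by (simp add: edist_def L2_set_def sel_def)
qed

text \<open>As \<open>\<sigma>\<close> is injective, a power series in the selected variables is a
  power series in all variables whose exponents vanish off the image of \<open>\<sigma>\<close>;
  \<open>res\<close> and \<open>ext\<close> translate between the exponents.\<close>

lemma analytic_reindex:
  assumes \<sigma>: "inj_on \<sigma> {..<n}" "\<sigma> ` {..<n} \<subseteq> {..<N}"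
    and h: "real_analytic_at n h (sel n \<sigma> a)"
  shows "real_analytic_at N (\<lambda>x. h (sel n \<sigma> x)) a"
proof -
  obtain c r where c: "r > 0" "\<And>x. x \<in> nbd n (sel n \<sigma> a) r (Rn n) \<Longrightarrow>
      ((\<lambda>\<alpha>. c \<alpha> * mnm n (\<lambda>i. x i - sel n \<sigma> a i) \<alpha>) has_sum h x) (mi n)"
    using h unfolding real_analytic_at_alt by blast
  define B where "B = {\<beta> \<in> mi N. \<forall>j. j \<notin> \<sigma> ` {..<n} \<longrightarrow> \<beta> j = 0}"
  define res where "res \<beta> = (\<lambda>i. if i < n then \<beta> (\<sigma> i) else (0::nat))" for \<beta> :: "nat \<Rightarrow> nat"
  define ext where "ext \<alpha> = (\<lambda>j. if j \<in> \<sigma> ` {..<n} then \<alpha> (inv_into {..<n} \<sigma> j) else (0::nat))" for \<alpha> :: "nat \<Rightarrow> nat"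
  show ?thesis
    unfolding real_analytic_at_alt
  proof (intro exI[of _ "\<lambda>\<beta>. if \<beta> \<in> B then c (res \<beta>) else 0"] exI[of _ r] conjI ballI)
    fix x assume x: "x \<in> nbd N a r (Rn N)"
    then have "sel n \<sigma> x \<in> nbd n (sel n \<sigma> a) r (Rn n)"
      using edist_sel[OF \<sigma>, of x a] by (auto simp: nbd_def)
    from c(2)[OF this]
    have "((\<lambda>\<alpha>. c \<alpha> * mnm n (\<lambda>i. sel n \<sigma> x i - sel n \<sigma> a i) \<alpha>) has_sum h (sel n \<sigma> x)) (mi n)" .
    also have "?this \<longleftrightarrow> ((\<lambda>\<beta>. c (res \<beta>) * mnm N (\<lambda>i. x i - a i) \<beta>) has_sum h (sel n \<sigma> x)) B"
    proof (rule has_sum_reindex_bij_witness[where i = res and j = ext])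
      fix \<alpha> assume \<alpha>: "\<alpha> \<in> mi n"
      show re: "res (ext \<alpha>) = \<alpha>"
        using \<alpha> \<sigma>(1) by (auto simp: res_def ext_def mi_def inv_into_f_f)
      show "ext \<alpha> \<in> B" using \<sigma>(2) by (auto simp: B_def ext_def mi_def)
      have "mnm N (\<lambda>i. x i - a i) (ext \<alpha>) = (\<Prod>j\<in>\<sigma> ` {..<n}. (x j - a j) ^ ext \<alpha> j)"
        unfolding mnm_def by (rule prod.mono_neutral_right) (use \<sigma>(2) in \<open>auto simp: ext_def\<close>)
      also have "\<dots> = (\<Prod>i<n. (x (\<sigma> i) - a (\<sigma> i)) ^ ext \<alpha> (\<sigma> i))"
        using \<sigma>(1) by (simp add: prod.reindex)
      also have "\<dots> = mnm n (\<lambda>i. sel n \<sigma> x i - sel n \<sigma> a i) \<alpha>"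
        unfolding mnm_def using \<sigma>(1) by (intro prod.cong) (auto simp: sel_def ext_def inv_into_f_f)
      finally show "c (res (ext \<alpha>)) * mnm N (\<lambda>i. x i - a i) (ext \<alpha>) =
          c \<alpha> * mnm n (\<lambda>i. sel n \<sigma> x i - sel n \<sigma> a i) \<alpha>" by (simp add: re)
    next
      fix \<beta> assume \<beta>: "\<beta> \<in> B"
      show "ext (res \<beta>) = \<beta>"
      proof
        fix j show "ext (res \<beta>) j = \<beta> j"
        proof (cases "j \<in> \<sigma> ` {..<n}")
          case True
          then obtain i where "i < n" "j = \<sigma> i" by auto
          then show ?thesis using \<sigma>(1) by (simp add: res_def ext_def inv_into_f_f)
        next
          case False
          then show ?thesis using \<beta> by (simp add: ext_def B_def)
        qed
      qed
      show "res \<beta> \<in> mi n" by (simp add: res_def mi_def)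
    qed auto
    also have "\<dots> \<longleftrightarrow> ((\<lambda>\<beta>. (if \<beta> \<in> B then c (res \<beta>) else 0) * mnm N (\<lambda>i. x i - a i) \<beta>) has_sum h (sel n \<sigma> x)) (mi N)"
      by (rule has_sum_cong_neutral) (auto simp: B_def)
    finally show "((\<lambda>\<beta>. (if \<beta> \<in> B then c (res \<beta>) else 0) * mnm N (\<lambda>i. x i - a i) \<beta>) has_sum h (sel n \<sigma> x)) (mi N)" .
  qed (use c in auto)
qed

section \<open>Semianalytic sets and their finite unions and intersections\<close>

definition analytic :: "nat \<Rightarrow> (vec \<Rightarrow> real) \<Rightarrow> bool" where
  "analytic n h \<longleftrightarrow> (\<forall>a. real_analytic_at n h a)"

lemma analytic_intros:
  "analytic n (\<lambda>x. k)"
  "j < n \<Longrightarrow> analytic n (\<lambda>x. x j)"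
  "analytic n f \<Longrightarrow> analytic n g \<Longrightarrow> analytic n (\<lambda>x. f x + g x)"
  "analytic n f \<Longrightarrow> analytic n g \<Longrightarrow> analytic n (\<lambda>x. f x * g x)"
  by (simp_all add: analytic_def analytic_const analytic_coord analytic_add analytic_mult)

lemma analytic_diff: "analytic n f \<Longrightarrow> analytic n g \<Longrightarrow> analytic n (\<lambda>x. f x - g x)"
  using analytic_intros(3)[OF _ analytic_intros(4)[OF analytic_intros(1)[of n "-1"]], of f g] by simp

lemma analytic_sum: "(\<And>i. i \<in> I \<Longrightarrow> analytic n (f i)) \<Longrightarrow> analytic n (\<lambda>x. \<Sum>i\<in>I. f i x)"
  by (induction I rule: infinite_finite_induct) (auto intro: analytic_intros)

text \<open>The description of \<open>S\<close> over one fixed set \<open>U\<close>. It passes to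
  subsets of \<open>U\<close>, so two sets can be compared over a common neighbourhood.\<close>

definition local_semi :: "nat \<Rightarrow> vec set \<Rightarrow> vec set \<Rightarrow> bool" where
  "local_semi n U S \<longleftrightarrow> (\<exists>\<D>. finite \<D> \<and>
     (\<forall>(E, P)\<in>\<D>. finite E \<and> finite P \<and> (\<forall>h\<in>E \<union> P. \<forall>x\<in>U. real_analytic_at n h x)) \<and>
     S \<inter> U = (\<Union>(E, P)\<in>\<D>. {x \<in> U. (\<forall>h\<in>E. h x = 0) \<and> (\<forall>h\<in>P. h x > 0)}))"

lemma semianalytic_alt:
  "semianalytic n S \<longleftrightarrow> S \<subseteq> Rn n \<and>
     (\<forall>a\<in>Rn n. \<exists>U. openin (Euclidean_space n) U \<and> a \<in> U \<and> local_semi n U S)"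
  by (simp add: semianalytic_def local_semi_def)

lemma local_semi_subset:
  assumes "local_semi n U S" "V \<subseteq> U" shows "local_semi n V S"
proof -
  obtain \<D> where \<D>: "finite \<D>" "\<forall>(E, P)\<in>\<D>. finite E \<and> finite P \<and> (\<forall>h\<in>E \<union> P. \<forall>x\<in>U. real_analytic_at n h x)"
    "S \<inter> U = (\<Union>(E, P)\<in>\<D>. {x \<in> U. (\<forall>h\<in>E. h x = 0) \<and> (\<forall>h\<in>P. h x > 0)})"
    using assms(1) unfolding local_semi_def by blast
  have "S \<inter> V = (S \<inter> U) \<inter> V" using assms(2) by blast
  also have "\<dots> = (\<Union>(E, P)\<in>\<D>. {x \<in> V. (\<forall>h\<in>E. h x = 0) \<and> (\<forall>h\<in>P. h x > 0)})"
    unfolding \<D>(3) using assms(2) by auto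
  finally show ?thesis unfolding local_semi_def using \<D>(1,2) assms(2) by (intro exI[of _ \<D>]) fastforce
qed

lemma local_semi_Un:
  assumes "local_semi n U S" "local_semi n U T" shows "local_semi n U (S \<union> T)"
proof -
  obtain \<D> where \<D>: "finite \<D>" "\<forall>(E, P)\<in>\<D>. finite E \<and> finite P \<and> (\<forall>h\<in>E \<union> P. \<forall>x\<in>U. real_analytic_at n h x)"
    "S \<inter> U = (\<Union>(E, P)\<in>\<D>. {x \<in> U. (\<forall>h\<in>E. h x = 0) \<and> (\<forall>h\<in>P. h x > 0)})"
    using assms(1) unfolding local_semi_def by blast
  obtain \<D>' where \<D>': "finite \<D>'" "\<forall>(E, P)\<in>\<D>'. finite E \<and> finite P \<and> (\<forall>h\<in>E \<union> P. \<forall>x\<in>U. real_analytic_at n h x)"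
    "T \<inter> U = (\<Union>(E, P)\<in>\<D>'. {x \<in> U. (\<forall>h\<in>E. h x = 0) \<and> (\<forall>h\<in>P. h x > 0)})"
    using assms(2) unfolding local_semi_def by blast
  have "(S \<union> T) \<inter> U = (\<Union>(E, P)\<in>\<D> \<union> \<D>'. {x \<in> U. (\<forall>h\<in>E. h x = 0) \<and> (\<forall>h\<in>P. h x > 0)})"
    unfolding Int_Un_distrib2 \<D>(3) \<D>'(3) by blast
  moreover have "finite (\<D> \<union> \<D>')" using \<D>(1) \<D>'(1) by simp
  moreover have "\<forall>(E, P)\<in>\<D> \<union> \<D>'. finite E \<and> finite P \<and> (\<forall>h\<in>E \<union> P. \<forall>x\<in>U. real_analytic_at n h x)"
    using \<D>(2) \<D>'(2) by (simp only: ball_Un)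
  ultimately show ?thesis unfolding local_semi_def by (intro exI[of _ "\<D> \<union> \<D>'"] conjI)
qed

lemma local_semi_Int:
  assumes "local_semi n U S" "local_semi n U T" shows "local_semi n U (S \<inter> T)"
proof -
  obtain \<D> where \<D>: "finite \<D>" "\<forall>(E, P)\<in>\<D>. finite E \<and> finite P \<and> (\<forall>h\<in>E \<union> P. \<forall>x\<in>U. real_analytic_at n h x)"
    "S \<inter> U = (\<Union>(E, P)\<in>\<D>. {x \<in> U. (\<forall>h\<in>E. h x = 0) \<and> (\<forall>h\<in>P. h x > 0)})"
    using assms(1) unfolding local_semi_def by blast
  obtain \<D>' where \<D>': "finite \<D>'" "\<forall>(E, P)\<in>\<D>'. finite E \<and> finite P \<and> (\<forall>h\<in>E \<union> P. \<forall>x\<in>U. real_analytic_at n h x)"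
    "T \<inter> U = (\<Union>(E, P)\<in>\<D>'. {x \<in> U. (\<forall>h\<in>E. h x = 0) \<and> (\<forall>h\<in>P. h x > 0)})"
    using assms(2) unfolding local_semi_def by blast
  define \<E> where "\<E> = (\<lambda>((E, P), (E', P')). (E \<union> E', P \<union> P')) ` (\<D> \<times> \<D>')"
  have "(S \<inter> T) \<inter> U = (S \<inter> U) \<inter> (T \<inter> U)" by blast
  also have "\<dots> = (\<Union>(E, P)\<in>\<E>. {x \<in> U. (\<forall>h\<in>E. h x = 0) \<and> (\<forall>h\<in>P. h x > 0)})"
    unfolding \<D>(3) \<D>'(3) \<E>_def by (auto simp: ball_Un split: prod.splits)
  finally show ?thesis
    unfolding local_semi_def using \<D>(1,2) \<D>'(1,2)
    by (intro exI[of _ \<E>]) (auto simp: \<E>_def split: prod.splits)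
qed

lemma semianalytic_Un_Int:
  assumes "semianalytic n S" "semianalytic n T"
  shows "semianalytic n (S \<union> T)" "semianalytic n (S \<inter> T)"
proof -
  have loc: "\<exists>U. openin (Euclidean_space n) U \<and> a \<in> U \<and> local_semi n U S \<and> local_semi n U T" if a: "a \<in> Rn n" for a
  proof -
    obtain U where U: "openin (Euclidean_space n) U" "a \<in> U" "local_semi n U S"
      using assms(1) a unfolding semianalytic_alt by blast
    obtain V where V: "openin (Euclidean_space n) V" "a \<in> V" "local_semi n V T"
      using assms(2) a unfolding semianalytic_alt by blast
    show ?thesis
      using U V local_semi_subset[OF U(3), of "U \<inter> V"] local_semi_subset[OF V(3), of "U \<inter> V"]
      by (intro exI[of _ "U \<inter> V"]) auto
  qed
  show "semianalytic n (S \<union> T)" "semianalytic n (S \<inter> T)"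
    using assms loc local_semi_Un local_semi_Int unfolding semianalytic_alt by (meson Un_least le_infI1)+
qed

lemma semianalytic_basic:
  assumes "finite E" "finite P" "\<And>h. h \<in> E \<union> P \<Longrightarrow> analytic n h"
  shows "semianalytic n {x \<in> Rn n. (\<forall>h\<in>E. h x = 0) \<and> (\<forall>h\<in>P. h x > 0)}"
proof -
  have "local_semi n (Rn n) {x \<in> Rn n. (\<forall>h\<in>E. h x = 0) \<and> (\<forall>h\<in>P. h x > 0)}"
    unfolding local_semi_def using assms by (intro exI[of _ "{(E, P)}"]) (auto simp: analytic_def)
  then show ?thesis unfolding semianalytic_alt by (auto intro!: exI[of _ "Rn n"])
qed

lemma semianalytic_zero: "analytic n h \<Longrightarrow> semianalytic n {x \<in> Rn n. h x = 0}"
  using semianalytic_basic[of "{h}" "{}" n] by simp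

lemma semianalytic_pos: "analytic n h \<Longrightarrow> semianalytic n {x \<in> Rn n. h x > 0}"
  using semianalytic_basic[of "{}" "{h}" n] by simp

lemma semianalytic_nonneg:
  assumes "analytic n h" shows "semianalytic n {x \<in> Rn n. h x \<ge> 0}"
proof -
  have "{x \<in> Rn n. h x \<ge> 0} = {x \<in> Rn n. h x = 0} \<union> {x \<in> Rn n. h x > 0}" by auto
  moreover have "semianalytic n ({x \<in> Rn n. h x = 0} \<union> {x \<in> Rn n. h x > 0})"
    by (intro semianalytic_Un_Int(1) semianalytic_zero semianalytic_pos assms)
  ultimately show ?thesis by simp
qed

lemma semianalytic_UNIV: "semianalytic n (Rn n)"
  using semianalytic_basic[of "{}" "{}" n] by simp

lemma semianalytic_Ball:
  assumes "finite I" "\<And>i. i \<in> I \<Longrightarrow> semianalytic n {x \<in> Rn n. Q i x}"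
  shows "semianalytic n {x \<in> Rn n. \<forall>i\<in>I. Q i x}"
  using assms
proof (induction I)
  case empty then show ?case by (simp add: semianalytic_UNIV)
next
  case (insert i I)
  have "{x \<in> Rn n. \<forall>i\<in>insert i I. Q i x} = {x \<in> Rn n. Q i x} \<inter> {x \<in> Rn n. \<forall>i\<in>I. Q i x}" by auto
  moreover have "semianalytic n ({x \<in> Rn n. Q i x} \<inter> {x \<in> Rn n. \<forall>i\<in>I. Q i x})"
    using insert by (intro semianalytic_Un_Int(2)) auto
  ultimately show ?case by simp
qed

lemma continuous_map_sel:
  "continuous_map (Euclidean_space N) (Euclidean_space n) (sel n \<sigma>)"
proof -
  have "continuous_map (Euclidean_space N) euclideanreal (\<lambda>x. x (\<sigma> i))" for i
    unfolding Euclidean_space_def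
    by (intro continuous_map_from_subtopology continuous_map_product_projection) simp
  then show ?thesis
    using continuous_map_componentwise_Euclidean_space[of "Euclidean_space N" n "\<lambda>x i. x (\<sigma> i)"]
    by (simp add: sel_def[abs_def])
qed

lemma semianalytic_sel:
  assumes \<sigma>: "inj_on \<sigma> {..<n}" "\<sigma> ` {..<n} \<subseteq> {..<N}" and S: "semianalytic n S"
  shows "semianalytic N {x \<in> Rn N. sel n \<sigma> x \<in> S}"
  unfolding semianalytic_alt
proof (intro conjI ballI)
  fix a assume a: "a \<in> Rn N"
  obtain U where U: "openin (Euclidean_space n) U" "sel n \<sigma> a \<in> U" "local_semi n U S"
    using S sel_Rn unfolding semianalytic_alt by blast
  define V where "V = {x \<in> Rn N. sel n \<sigma> x \<in> U}"
  have "openin (Euclidean_space N) V"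
    unfolding V_def by (rule openin_continuous_map_preimage[OF continuous_map_sel U(1)])
  moreover have "local_semi N V {x \<in> Rn N. sel n \<sigma> x \<in> S}"
  proof -
    obtain \<D> where \<D>: "finite \<D>" "\<forall>(E, P)\<in>\<D>. finite E \<and> finite P \<and> (\<forall>h\<in>E \<union> P. \<forall>x\<in>U. real_analytic_at n h x)"
      "S \<inter> U = (\<Union>(E, P)\<in>\<D>. {x \<in> U. (\<forall>h\<in>E. h x = 0) \<and> (\<forall>h\<in>P. h x > 0)})"
      using U(3) unfolding local_semi_def by blast
    define pb where "pb h = (\<lambda>x. h (sel n \<sigma> x))" for h :: "vec \<Rightarrow> real"
    define \<E> where "\<E> = (\<lambda>(E, P). (pb ` E, pb ` P)) ` \<D>"
    have mem: "x \<in> {x \<in> Rn N. sel n \<sigma> x \<in> S} \<inter> V \<longleftrightarrow>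
        x \<in> (\<Union>(E, P)\<in>\<E>. {x \<in> V. (\<forall>h\<in>E. h x = 0) \<and> (\<forall>h\<in>P. h x > 0)})" for x
    proof -
      have "x \<in> {x \<in> Rn N. sel n \<sigma> x \<in> S} \<inter> V \<longleftrightarrow> x \<in> Rn N \<and> sel n \<sigma> x \<in> S \<inter> U"
        by (auto simp: V_def)
      also have "\<dots> \<longleftrightarrow> x \<in> (\<Union>(E, P)\<in>\<E>. {x \<in> V. (\<forall>h\<in>E. h x = 0) \<and> (\<forall>h\<in>P. h x > 0)})"
        unfolding \<D>(3) \<E>_def by (auto simp: V_def pb_def case_prod_unfold)
      finally show ?thesis .
    qed
    have an: "\<forall>(E, P)\<in>\<E>. finite E \<and> finite P \<and> (\<forall>h\<in>E \<union> P. \<forall>x\<in>V. real_analytic_at N h x)"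
      using \<D>(2) analytic_reindex[OF \<sigma>] by (fastforce simp: \<E>_def V_def pb_def)
    have "finite \<E>" using \<D>(1) by (simp add: \<E>_def)
    then show ?thesis
      unfolding local_semi_def by (intro exI[of _ \<E>] conjI an Set.set_eqI mem)
  qed
  ultimately show "\<exists>V. openin (Euclidean_space N) V \<and> a \<in> V \<and> local_semi N V {x \<in> Rn N. sel n \<sigma> x \<in> S}"
    using a U(2) by (intro exI[of _ V] conjI) (auto simp: V_def)
qed auto

text \<open>\<open>Rn m\<close> is literally a subset of \<open>Rn N\<close>, so the set itself does
  not change; the additional coordinates are cut out by the equations
  \<open>x i = 0\<close>.\<close>

lemma semianalytic_mono:
  assumes "semianalytic m A" "m \<le> N" shows "semianalytic N A"
proof -
  have sub: "A \<subseteq> Rn m" using assms(1) by (simp add: semianalytic_alt)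
  have "A = {x \<in> Rn N. sel m id x \<in> A} \<inter> {x \<in> Rn N. \<forall>i\<in>{m..<N}. x i = 0}" (is "_ = ?R")
  proof (intro Set.set_eqI)
    fix x
    have "sel m id x = x" if "x \<in> Rn m" using that by (auto simp: sel_def Rn_iff)
    moreover have "x \<in> Rn m \<longleftrightarrow> x \<in> Rn N \<and> (\<forall>i\<in>{m..<N}. x i = 0)"
      using assms(2) by (auto simp: Rn_iff)
    ultimately show "x \<in> A \<longleftrightarrow> x \<in> ?R" using sub by auto
  qed
  also have "semianalytic N \<dots>"
    using assms by (intro semianalytic_Un_Int semianalytic_sel semianalytic_Ball semianalytic_zero analytic_intros) auto
  finally show ?thesis .
qed

text \<open>Bounded subanalytic sets as projections of a single bounded semianalytic set, without
  localization. For bounded sets this agrees with \<open>globally_subanalytic\<close>, see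
  \<open>globally_subanalytic_iff_bsub\<close>.\<close>

definition bsub :: "nat \<Rightarrow> vec set \<Rightarrow> bool" where
  "bsub n S \<longleftrightarrow> (\<exists>p A. semianalytic (n + p) A \<and> ebounded (n + p) A \<and> S = proj n ` A)"

definition Box :: "nat \<Rightarrow> real \<Rightarrow> vec set" where
  "Box n R = {x \<in> Rn n. \<forall>i<n. \<bar>x i\<bar> < R}"

text \<open>A condition that cuts out a bounded subanalytic set in every box. Polynomial conditions
  on the whole space qualify, so formulas are assembled first and boundedness is supplied once, by
  the box.\<close>

definition dfn :: "nat \<Rightarrow> (vec \<Rightarrow> bool) \<Rightarrow> bool" where
  "dfn n Q \<longleftrightarrow> (\<forall>R. bsub n {x \<in> Box n R. Q x})"

lemma proj_eq_sel: "proj n = sel n id"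
  by (intro ext) (simp add: proj_def sel_def)

lemma proj_id: "x \<in> Rn n \<Longrightarrow> proj n x = x"
  by (auto simp: proj_def Rn_iff)

lemma ebounded_iff_Box:
  assumes "A \<subseteq> Rn n" shows "ebounded n A \<longleftrightarrow> (\<exists>R. A \<subseteq> Box n R)"
proof
  assume "ebounded n A"
  then obtain r where r: "\<And>x. x \<in> A \<Longrightarrow> edist n x origin \<le> r" by (auto simp: ebounded_def)
  have "\<bar>x i\<bar> < r + 1" if "x \<in> A" "i < n" for x i
  proof -
    have "\<bar>x i\<bar> \<le> L2_set (\<lambda>i. \<bar>x i\<bar>) {..<n}" using that by (intro member_le_L2_set) auto
    also have "\<dots> = edist n x origin" by (simp add: edist_def L2_set_def)
    finally show ?thesis using r[OF that(1)] by linarith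
  qed
  then show "\<exists>R. A \<subseteq> Box n R" using assms by (intro exI[of _ "r + 1"]) (auto simp: Box_def)
next
  assume "\<exists>R. A \<subseteq> Box n R"
  then obtain R where R: "A \<subseteq> Box n R" by blast
  have "edist n x origin \<le> real n * R" if "x \<in> A" for x
  proof -
    have "edist n x origin \<le> (\<Sum>i<n. \<bar>x i\<bar>)" unfolding edist_def by (rule order_trans[OF L2_set_le_sum_abs]) simp
    also have "\<dots> \<le> (\<Sum>i<n. R)" by (rule sum_mono) (use that R in \<open>auto simp: Box_def intro: less_imp_le\<close>)
    finally show ?thesis by simp
  qed
  then show "ebounded n A" by (auto simp: ebounded_def)
qed

lemma bsub_iff:
  "bsub n S \<longleftrightarrow> (\<exists>p A R. semianalytic (n + p) A \<and> A \<subseteq> Box (n + p) R \<and> S = proj n ` A)"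
proof -
  have "ebounded k A \<longleftrightarrow> (\<exists>R. A \<subseteq> Box k R)" if "semianalytic k A" for k A
    using that by (intro ebounded_iff_Box) (simp add: semianalytic_alt)
  then show ?thesis unfolding bsub_def by blast
qed

lemma bsub_Box:
  assumes "bsub n S" obtains R where "S \<subseteq> Box n R"
proof -
  obtain p A R where A: "A \<subseteq> Box (n + p) R" "S = proj n ` A" using assms unfolding bsub_iff by blast
  then have "S \<subseteq> Box n R" by (force simp: Box_def proj_def Rn_iff)
  then show ?thesis by (rule that)
qed

lemma bsub_Rn: "bsub n S \<Longrightarrow> S \<subseteq> Rn n"
  by (erule bsub_Box) (auto simp: Box_def)

lemma semianalytic_Box: "semianalytic n (Box n R)"
proof -
  have "Box n R = {x \<in> Rn n. \<forall>i\<in>{..<n}. R - x i > 0} \<inter> {x \<in> Rn n. \<forall>i\<in>{..<n}. R + x i > 0}"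
    by (auto simp: Box_def abs_less_iff) force+
  also have "semianalytic n \<dots>"
    by (intro semianalytic_Un_Int(2) semianalytic_Ball semianalytic_pos analytic_diff analytic_intros) auto
  finally show ?thesis .
qed

lemma bsub_semianalytic: "semianalytic n A \<Longrightarrow> A \<subseteq> Box n R \<Longrightarrow> bsub n A"
proof -
  assume A: "semianalytic n A" "A \<subseteq> Box n R"
  have "A = proj n ` A" using A(2) by (force simp: Box_def proj_id image_iff)
  then show ?thesis unfolding bsub_iff using A by (intro exI[of _ 0] exI[of _ A] exI[of _ R]) auto
qed

lemma dfn_semianalytic:
  assumes "semianalytic n {x \<in> Rn n. Q x}" shows "dfn n Q"
  unfolding dfn_def
proof
  fix R
  have "{x \<in> Box n R. Q x} = Box n R \<inter> {x \<in> Rn n. Q x}" by (auto simp: Box_def)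
  moreover have "semianalytic n (Box n R \<inter> {x \<in> Rn n. Q x})"
    by (intro semianalytic_Un_Int(2) semianalytic_Box assms)
  ultimately show "bsub n {x \<in> Box n R. Q x}" by (intro bsub_semianalytic[of _ _ R]) auto
qed

lemma dfn_zero: "analytic n h \<Longrightarrow> dfn n (\<lambda>x. h x = 0)"
  by (intro dfn_semianalytic semianalytic_zero)

lemma dfn_pos: "analytic n h \<Longrightarrow> dfn n (\<lambda>x. h x > 0)"
  by (intro dfn_semianalytic semianalytic_pos)

lemma dfn_nonneg: "analytic n h \<Longrightarrow> dfn n (\<lambda>x. h x \<ge> 0)"
  by (intro dfn_semianalytic semianalytic_nonneg)

lemma dfn_eq: "analytic n h \<Longrightarrow> analytic n g \<Longrightarrow> dfn n (\<lambda>x. h x = g x)"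
  using dfn_zero[OF analytic_diff, of n h g] by simp

lemma dfn_True: "dfn n (\<lambda>x. True)"
  using dfn_zero[OF analytic_intros(1)[of n 0]] by simp

lemma bsub_Un:
  assumes "bsub n S" "bsub n T" shows "bsub n (S \<union> T)"
proof -
  obtain p A R where A: "semianalytic (n + p) A" "A \<subseteq> Box (n + p) R" "S = proj n ` A"
    using assms(1) unfolding bsub_iff by blast
  obtain q B R' where B: "semianalytic (n + q) B" "B \<subseteq> Box (n + q) R'" "T = proj n ` B"
    using assms(2) unfolding bsub_iff by blast
  have "semianalytic (n + (p + q)) (A \<union> B)"
    by (intro semianalytic_Un_Int(1) semianalytic_mono[OF A(1)] semianalytic_mono[OF B(1)]) auto
  \<comment> \<open>The value \<open>1\<close> takes care of the padding coordinates: they are zero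
    and must satisfy a strict bound, while \<open>R\<close> and \<open>R'\<close> need not be
    positive.\<close>
  moreover have "\<bar>x i\<bar> < max 1 (max R R')" if "x \<in> A \<union> B" for x i
  proof -
    have *: "\<bar>x i\<bar> < max 1 r" if "x \<in> Box k r" for k r
      using that by (cases "i < k") (auto simp: Box_def Rn_iff less_max_iff_disj)
    show ?thesis using that A(2) B(2) *[of "n + p" R] *[of "n + q" R'] by (auto simp: less_max_iff_disj)
  qed
  then have "A \<union> B \<subseteq> Box (n + (p + q)) (max 1 (max R R'))"
    using \<open>semianalytic (n + (p + q)) (A \<union> B)\<close> by (auto simp: Box_def semianalytic_def)
  ultimately show ?thesis unfolding bsub_iff A(3) B(3) image_Un[symmetric] by blast
qed

text \<open>Fibre product: the first \<open>n\<close> coordinates are shared and the hidden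
  coordinates of \<open>A\<close> and \<open>B\<close> are kept apart, \<open>\<sigma>\<close>
  skipping the block that belongs to \<open>A\<close>.\<close>

lemma bsub_Int:
  assumes "bsub n S" "bsub n T" shows "bsub n (S \<inter> T)"
proof -
  obtain p A R where A: "semianalytic (n + p) A" "A \<subseteq> Box (n + p) R" "S = proj n ` A"
    using assms(1) unfolding bsub_iff by blast
  obtain q B R' where B: "semianalytic (n + q) B" "B \<subseteq> Box (n + q) R'" "T = proj n ` B"
    using assms(2) unfolding bsub_iff by blast
  define \<sigma> where "\<sigma> i = (if i < n then i else i + p)" for i
  define M where "M = n + (p + q)"
  define C where "C = {x \<in> Rn M. sel (n + p) id x \<in> A} \<inter> {x \<in> Rn M. sel (n + q) \<sigma> x \<in> B}"
  have "semianalytic M C"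
    unfolding C_def
    by (intro semianalytic_Un_Int(2) semianalytic_sel A B) (auto simp: M_def \<sigma>_def inj_on_def split: if_splits)
  moreover have "C \<subseteq> Box M (max R R')"
  proof
    fix x assume x: "x \<in> C"
    have "\<bar>x i\<bar> < max R R'" if "i < M" for i
    proof (cases "i < n + p")
      case True
      have "\<bar>sel (n + p) id x i\<bar> < R" using x A(2) True by (auto simp: C_def Box_def)
      then show ?thesis using True by (simp add: sel_def)
    next
      case False
      then have i: "\<sigma> (i - p) = i" "i - p < n + q" using that by (auto simp: \<sigma>_def M_def)
      have "\<bar>sel (n + q) \<sigma> x (i - p)\<bar> < R'" using x B(2) i by (auto simp: C_def Box_def)
      then show ?thesis using i by (simp add: sel_def)
    qed
    then show "x \<in> Box M (max R R')" using x by (auto simp: Box_def C_def)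
  qed
  moreover have "S \<inter> T = proj n ` C"
  proof
    show "proj n ` C \<subseteq> S \<inter> T"
    proof
      fix y assume "y \<in> proj n ` C"
      then obtain x where x: "x \<in> C" "y = proj n x" by blast
      have "y = proj n (sel (n + p) id x)" "y = proj n (sel (n + q) \<sigma> x)"
        unfolding x(2) by (auto simp: proj_def sel_def \<sigma>_def)
      moreover have "sel (n + p) id x \<in> A" "sel (n + q) \<sigma> x \<in> B" using x(1) by (simp_all add: C_def)
      ultimately show "y \<in> S \<inter> T" unfolding A(3) B(3) by blast
    qed
    show "S \<inter> T \<subseteq> proj n ` C"
    proof
      fix y assume "y \<in> S \<inter> T"
      then obtain a b where ab: "a \<in> A" "b \<in> B" "y = proj n a" "proj n a = proj n b"
        by (auto simp: A(3) B(3))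
      have R: "a \<in> Rn (n + p)" "b \<in> Rn (n + q)" using ab A(2) B(2) by (auto simp: Box_def)
      have eq: "a i = b i" if "i < n" for i using fun_cong[OF ab(4), of i] that by (simp add: proj_def)
      define x where "x = (\<lambda>i. if i < n + p then a i else b (i - p))"
      have "sel (n + p) id x = a" using R by (auto simp: sel_def x_def Rn_iff)
      moreover have "sel (n + q) \<sigma> x = b" using R eq by (auto simp: sel_def x_def \<sigma>_def Rn_iff)
      moreover have "x \<in> Rn M" using R by (auto simp: Rn_iff x_def M_def)
      ultimately have "x \<in> C" using ab by (simp add: C_def)
      moreover have "y = proj n x" unfolding ab(3) by (auto simp: proj_def x_def)
      ultimately show "y \<in> proj n ` C" by blast
    qed
  qed
  ultimately show ?thesis unfolding bsub_iff M_def by blast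
qed

lemma dfn_conj:
  assumes "dfn n Q" "dfn n Q'" shows "dfn n (\<lambda>x. Q x \<and> Q' x)"
  unfolding dfn_def
proof
  fix R
  have "{x \<in> Box n R. Q x \<and> Q' x} = {x \<in> Box n R. Q x} \<inter> {x \<in> Box n R. Q' x}" by auto
  moreover have "bsub n ({x \<in> Box n R. Q x} \<inter> {x \<in> Box n R. Q' x})"
    using assms by (intro bsub_Int) (simp_all add: dfn_def)
  ultimately show "bsub n {x \<in> Box n R. Q x \<and> Q' x}" by simp
qed

lemma dfn_Ball:
  assumes "finite I" "\<And>i. i \<in> I \<Longrightarrow> dfn n (Q i)" shows "dfn n (\<lambda>x. \<forall>i\<in>I. Q i x)"
  using assms by (induction I) (auto intro: dfn_True dfn_conj)

lemma bsub_proj: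
  assumes "bsub (n + k) S" shows "bsub n (proj n ` S)"
proof -
  obtain p A R where A: "semianalytic (n + k + p) A" "A \<subseteq> Box (n + k + p) R" "S = proj (n + k) ` A"
    using assms unfolding bsub_iff by blast
  have "proj n ` S = proj n ` A" unfolding A(3) image_image by (auto simp: proj_def intro!: image_cong)
  then show ?thesis
    unfolding bsub_iff using A(1,2) by (intro exI[of _ "k + p"] exI[of _ A] exI[of _ R]) (simp add: add.assoc)
qed

text \<open>\<open>\<sigma>\<close> may repeat coordinates, so the preimage is not a mere
  reindexing. A point of \<open>A\<close> in fresh coordinates is tied to \<open>x\<close> by the
  equations \<open>z (n + i) = z (\<sigma> i)\<close> and then projected away.\<close>

lemma dfn_sel:
  assumes S: "bsub k S" and \<sigma>: "\<And>i. i < k \<Longrightarrow> \<sigma> i < n"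
  shows "dfn n (\<lambda>x. sel k \<sigma> x \<in> S)"
  unfolding dfn_def
proof
  fix R
  obtain p A R' where A: "semianalytic (k + p) A" "A \<subseteq> Box (k + p) R'" "S = proj k ` A"
    using S unfolding bsub_iff by blast
  define M where "M = n + (k + p)"
  define C where "C = {z \<in> Rn M. sel n id z \<in> Box n R} \<inter> {z \<in> Rn M. sel (k + p) (\<lambda>i. n + i) z \<in> A} \<inter>
     {z \<in> Rn M. \<forall>i\<in>{..<k}. z (n + i) - z (\<sigma> i) = 0}"
  have "semianalytic M C"
    unfolding C_def
    by (intro semianalytic_Un_Int(2) semianalytic_sel A semianalytic_Box semianalytic_Ball semianalytic_zero
         analytic_diff analytic_intros) (use \<sigma> in \<open>auto simp: M_def inj_on_def intro: trans_less_add1\<close>)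
  moreover have "C \<subseteq> Box M (max R R')"
  proof
    fix z assume z: "z \<in> C"
    have "\<bar>z i\<bar> < max R R'" if "i < M" for i
    proof (cases "i < n")
      case True
      have "\<bar>sel n id z i\<bar> < R" using z True by (auto simp: C_def Box_def)
      then show ?thesis using True by (simp add: sel_def)
    next
      case False
      then have "i - n < k + p" using that by (auto simp: M_def)
      then have "\<bar>sel (k + p) (\<lambda>i. n + i) z (i - n)\<bar> < R'" using z A(2) by (auto simp: C_def Box_def)
      then show ?thesis using \<open>i - n < k + p\<close> False by (simp add: sel_def)
    qed
    then show "z \<in> Box M (max R R')" using z by (auto simp: Box_def C_def)
  qed
  moreover have "{x \<in> Box n R. sel k \<sigma> x \<in> S} = proj n ` C"
  proof
    show "proj n ` C \<subseteq> {x \<in> Box n R. sel k \<sigma> x \<in> S}"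
    proof
      fix y assume "y \<in> proj n ` C"
      then obtain z where z: "z \<in> C" "y = proj n z" by blast
      have "y \<in> Box n R" using z by (simp add: proj_eq_sel C_def)
      moreover have "sel k \<sigma> y = proj k (sel (k + p) (\<lambda>i. n + i) z)"
        using z \<sigma> by (auto simp: sel_def proj_def C_def)
      moreover have "sel (k + p) (\<lambda>i. n + i) z \<in> A" using z by (simp add: C_def)
      ultimately show "y \<in> {x \<in> Box n R. sel k \<sigma> x \<in> S}" by (simp add: A(3))
    qed
    show "{x \<in> Box n R. sel k \<sigma> x \<in> S} \<subseteq> proj n ` C"
    proof
      fix x assume "x \<in> {x \<in> Box n R. sel k \<sigma> x \<in> S}"
      then obtain a where x: "x \<in> Box n R" and a: "a \<in> A" "sel k \<sigma> x = proj k a" by (auto simp: A(3))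
      have R: "a \<in> Rn (k + p)" "x \<in> Rn n" using a A(2) x by (auto simp: Box_def)
      define z where "z = (\<lambda>i. if i < n then x i else a (i - n))"
      have "sel n id z = x" using R by (auto simp: sel_def z_def Rn_iff)
      moreover have "sel (k + p) (\<lambda>i. n + i) z = a" using R by (auto simp: sel_def z_def Rn_iff)
      moreover have "z \<in> Rn M" using R by (auto simp: Rn_iff z_def M_def)
      moreover have "z (n + i) = z (\<sigma> i)" if "i < k" for i
        using fun_cong[OF a(2), of i] that \<sigma> by (simp add: sel_def proj_def z_def)
      ultimately have "z \<in> C" using a x by (simp add: C_def)
      moreover have "x = proj n z" using \<open>sel n id z = x\<close> by (simp add: proj_eq_sel)
      ultimately show "x \<in> proj n ` C" by blast
    qed
  qed
  ultimately show "bsub n {x \<in> Box n R. sel k \<sigma> x \<in> S}" unfolding bsub_iff M_def by blast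
qed

lemma bsub_empty: "bsub n {}"
proof -
  have "dfn n (\<lambda>x. (1::real) = 0)" by (intro dfn_zero analytic_intros)
  then show ?thesis by (simp add: dfn_def)
qed

lemma bsub_dfn:
  assumes "bsub n S" "dfn n Q" shows "bsub n {x \<in> S. Q x}"
proof -
  obtain R where R: "S \<subseteq> Box n R" using bsub_Box[OF assms(1)] .
  have "bsub n (S \<inter> {x \<in> Box n R. Q x})" using assms bsub_Int unfolding dfn_def by blast
  moreover have "S \<inter> {x \<in> Box n R. Q x} = {x \<in> S. Q x}" using R by blast
  ultimately show ?thesis by simp
qed

section \<open>Compactification of Euclidean space\<close>

definition cmpt :: "vec \<Rightarrow> vec" where
  "cmpt x = (\<lambda>i. x i / sqrt (1 + (x i)\<^sup>2))"

text \<open>Squaring removes the root and the sign condition selects the correct branch, so the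
  graph of the compactification is described by polynomials.\<close>

lemma compactification_iff:
  fixes x y :: real
  shows "y = x / sqrt (1 + x\<^sup>2) \<longleftrightarrow> y\<^sup>2 * (1 + x\<^sup>2) = x\<^sup>2 \<and> 0 \<le> y * x"
proof
  have p: "1 + x\<^sup>2 > 0" by (simp add: add_pos_nonneg)
  assume y: "y = x / sqrt (1 + x\<^sup>2)"
  then show "y\<^sup>2 * (1 + x\<^sup>2) = x\<^sup>2 \<and> 0 \<le> y * x"
    using p by (simp add: power_divide less_imp_le)
next
  have p: "1 + x\<^sup>2 > 0" by (simp add: add_pos_nonneg)
  define w where "w = x / sqrt (1 + x\<^sup>2)"
  assume a: "y\<^sup>2 * (1 + x\<^sup>2) = x\<^sup>2 \<and> 0 \<le> y * x"
  then have "y\<^sup>2 = x\<^sup>2 / (1 + x\<^sup>2)" using p by (simp add: field_simps)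
  also have "\<dots> = w\<^sup>2" using p by (simp add: w_def power_divide less_imp_le)
  finally have "y = w \<or> y = - w" by (simp add: power2_eq_iff)
  moreover have "w * x \<ge> 0" using p by (simp add: w_def)
  moreover have "w = 0 \<longleftrightarrow> x = 0" using p by (simp add: w_def)
  ultimately show "y = x / sqrt (1 + x\<^sup>2)"
    using a by (auto simp: w_def[symmetric] zero_le_mult_iff)
qed

lemma cmpt_abs_less: "\<bar>cmpt x i\<bar> < 1"
proof -
  have p: "0 < 1 + (x i)\<^sup>2" by (simp add: add_pos_nonneg)
  have "\<bar>x i\<bar> = sqrt ((x i)\<^sup>2)" by simp
  also have "\<dots> < sqrt (1 + (x i)\<^sup>2)" by (rule real_sqrt_less_mono) simp
  finally have "\<bar>x i\<bar> / sqrt (1 + (x i)\<^sup>2) < 1" using p by simp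
  then show ?thesis by (simp add: cmpt_def)
qed

lemma cmpt_Rn: "x \<in> Rn n \<Longrightarrow> cmpt x \<in> Rn n"
  by (simp add: Rn_iff cmpt_def)

lemma dfn_compactification:
  fixes n :: nat
  assumes "\<And>i. i < n \<Longrightarrow> f i < N \<and> g i < N"
  shows "dfn N (\<lambda>z. \<forall>i\<in>{..<n}. z (f i) = z (g i) / sqrt (1 + (z (g i))\<^sup>2))"
proof -
  have "dfn N (\<lambda>z. \<forall>i\<in>{..<n}. (z (f i) * z (f i)) * (1 + z (g i) * z (g i)) = z (g i) * z (g i) \<and> 0 \<le> z (f i) * z (g i))"
    by (intro dfn_Ball dfn_conj dfn_eq dfn_nonneg analytic_intros) (simp_all add: assms)
  then show ?thesis unfolding compactification_iff by (simp add: power2_eq_square)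
qed

lemma bsub_cmpt:
  assumes "bsub n S" shows "bsub n (cmpt ` S)"
proof -
  obtain R where R: "S \<subseteq> Box n R" using bsub_Box[OF assms] .
  define C where "C = {z \<in> Box (n + n) (max R 1). sel n (\<lambda>i. n + i) z \<in> S \<and>
     (\<forall>i\<in>{..<n}. z i = z (n + i) / sqrt (1 + (z (n + i))\<^sup>2))}"
  have "dfn (n + n) (\<lambda>z. sel n (\<lambda>i. n + i) z \<in> S \<and>
     (\<forall>i\<in>{..<n}. z i = z (n + i) / sqrt (1 + (z (n + i))\<^sup>2)))"
    by (intro dfn_conj dfn_sel assms dfn_compactification[where f = "\<lambda>i. i"]) auto
  then have "bsub (n + n) C" by (simp add: dfn_def C_def)
  then have "bsub n (proj n ` C)" by (rule bsub_proj)
  moreover have "proj n ` C = cmpt ` S"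
  proof
    show "proj n ` C \<subseteq> cmpt ` S"
    proof
      fix y assume "y \<in> proj n ` C"
      then obtain z where z: "z \<in> C" "y = proj n z" by blast
      have "y = cmpt (sel n (\<lambda>i. n + i) z)" using z by (auto simp: C_def cmpt_def sel_def proj_def)
      then show "y \<in> cmpt ` S" using z by (auto simp: C_def)
    qed
    show "cmpt ` S \<subseteq> proj n ` C"
    proof
      fix y assume "y \<in> cmpt ` S"
      then obtain x where x: "x \<in> S" "y = cmpt x" by blast
      have xR: "x \<in> Rn n" "\<And>i. i < n \<Longrightarrow> \<bar>x i\<bar> < R" using x R by (auto simp: Box_def)
      define z where "z = join n y x"
      have "sel n (\<lambda>i. n + i) z = x" using xR by (auto simp: sel_def z_def join_def Rn_iff)
      moreover have "z \<in> Box (n + n) (max R 1)"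
        using xR cmpt_abs_less[of x] x by (auto simp: Box_def z_def join_def Rn_iff less_max_iff_disj)
      ultimately have "z \<in> C" using x by (auto simp: C_def z_def join_def cmpt_def)
      moreover have "y = proj n z" using cmpt_Rn[OF xR(1)] x by (auto simp: z_def proj_def join_def Rn_iff)
      ultimately show "y \<in> proj n ` C" by blast
    qed
  qed
  ultimately show ?thesis by simp
qed

text \<open>Each entry of \<open>cmpt x\<close> is the sine of the arcus tangens of the
  corresponding entry of \<open>x\<close>, and the sine is injective between \<open>- pi / 2\<close>
  and \<open>pi / 2\<close>.\<close>

lemma cmpt_inj: "cmpt x = cmpt y \<Longrightarrow> x = y"
proof
  fix i assume "cmpt x = cmpt y"
  then have "x i / sqrt (1 + (x i)\<^sup>2) = y i / sqrt (1 + (y i)\<^sup>2)" by (simp add: cmpt_def fun_eq_iff)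
  then have "tan (arctan (x i)) = tan (arctan (y i))"
    by (metis sin_arctan arctan_lbound arctan_ubound less_imp_le sin_inj_pi)
  then show "x i = y i" by (simp only: tan_arctan)
qed

lemma bsub_of_cmpt:
  assumes S: "bsub n (cmpt ` S)" and R: "S \<subseteq> Box n R" shows "bsub n S"
proof -
  define C where "C = {z \<in> Box (n + n) (max R 1). sel n (\<lambda>i. n + i) z \<in> cmpt ` S \<and>
     (\<forall>i\<in>{..<n}. z (n + i) = z i / sqrt (1 + (z i)\<^sup>2))}"
  have "dfn (n + n) (\<lambda>z. sel n (\<lambda>i. n + i) z \<in> cmpt ` S \<and>
     (\<forall>i\<in>{..<n}. z (n + i) = z i / sqrt (1 + (z i)\<^sup>2)))"
    by (intro dfn_conj dfn_sel S dfn_compactification[where g = "\<lambda>i. i"]) auto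
  then have "bsub (n + n) C" by (simp add: dfn_def C_def)
  then have "bsub n (proj n ` C)" by (rule bsub_proj)
  moreover have "proj n ` C = S"
  proof
    show "proj n ` C \<subseteq> S"
    proof
      fix y assume "y \<in> proj n ` C"
      then obtain z where z: "z \<in> C" "y = proj n z" by blast
      have "sel n (\<lambda>i. n + i) z = cmpt y" using z by (auto simp: C_def cmpt_def sel_def proj_def)
      then have "cmpt y \<in> cmpt ` S" using z by (auto simp: C_def)
      then show "y \<in> S" using cmpt_inj by auto
    qed
    show "S \<subseteq> proj n ` C"
    proof
      fix x assume x: "x \<in> S"
      have xR: "x \<in> Rn n" "\<And>i. i < n \<Longrightarrow> \<bar>x i\<bar> < R" using x R by (auto simp: Box_def)
      define z where "z = join n x (cmpt x)"
      have "sel n (\<lambda>i. n + i) z = cmpt x" using cmpt_Rn[OF xR(1)] by (auto simp: sel_def z_def join_def Rn_iff)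
      moreover have "z \<in> Box (n + n) (max R 1)"
        using xR cmpt_abs_less[of x] cmpt_Rn[OF xR(1)] by (auto simp: Box_def z_def join_def Rn_iff less_max_iff_disj)
      ultimately have "z \<in> C" using x by (auto simp: C_def z_def join_def cmpt_def)
      moreover have "x = proj n z" using xR by (auto simp: z_def proj_def join_def Rn_iff)
      ultimately show "x \<in> proj n ` C" by blast
    qed
  qed
  ultimately show ?thesis by simp
qed

lemma bsub_Union:
  assumes "finite I" "\<And>i. i \<in> I \<Longrightarrow> bsub n (S i)" shows "bsub n (\<Union>i\<in>I. S i)"
  using assms by (induction I) (auto intro: bsub_empty bsub_Un)

lemma closed_box_eq_PiE:
  "{x \<in> Rn n. \<forall>i<n. \<bar>x i\<bar> \<le> R} = PiE UNIV (\<lambda>i. if i < n then {-R..R} else {0::real})"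
proof (intro Set.set_eqI iffI)
  fix x assume "x \<in> {x \<in> Rn n. \<forall>i<n. \<bar>x i\<bar> \<le> R}"
  then have x: "\<And>i. i \<ge> n \<Longrightarrow> x i = 0" "\<And>i. i < n \<Longrightarrow> \<bar>x i\<bar> \<le> R" by (auto simp: Rn_iff)
  have "x i \<in> (if i < n then {-R..R} else {0::real})" for i
    using x(1)[of i] x(2)[of i] by (cases "i < n") (auto simp: abs_le_iff)
  then show "x \<in> PiE UNIV (\<lambda>i. if i < n then {-R..R} else {0::real})" by blast
next
  fix x assume "x \<in> PiE UNIV (\<lambda>i. if i < n then {-R..R} else {0::real})"
  then have x: "x i \<in> (if i < n then {-R..R} else {0::real})" for i by blast
  have "x i = 0" if "i \<ge> n" for i using x[of i] that by simp
  moreover have "\<bar>x i\<bar> \<le> R" if "i < n" for i using x[of i] that by (simp add: abs_le_iff)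
  ultimately show "x \<in> {x \<in> Rn n. \<forall>i<n. \<bar>x i\<bar> \<le> R}" by (simp add: Rn_iff)
qed

lemma compactin_closed_box:
  "compactin (powertop_real UNIV) {x \<in> Rn n. \<forall>i<n. \<bar>x i\<bar> \<le> R}"
  unfolding closed_box_eq_PiE compactin_PiE by simp

text \<open>The closed cube is compact, so finitely many of the local descriptions suffice. They are
  taken at all points of the closed cube, which for a compactified set includes the points at
  infinity.\<close>

lemma subanalytic_imp_bsub:
  assumes S: "subanalytic n S" and bd: "\<And>x i. x \<in> S \<Longrightarrow> i < n \<Longrightarrow> \<bar>x i\<bar> \<le> 1"
  shows "bsub n S"
proof -
  define K where "K = {x \<in> Rn n. \<forall>i<n. \<bar>x i\<bar> \<le> 1}"
  have "compactin (Euclidean_space n) K"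
    using compactin_closed_box[of n 1]
    unfolding Euclidean_space_def compactin_subtopology K_def by (auto simp: Rn_iff)
  have "\<exists>U. openin (Euclidean_space n) U \<and> a \<in> U \<and> bsub n (S \<inter> U)" if a: "a \<in> Rn n" for a
  proof -
    obtain U p A where "openin (Euclidean_space n) U" "a \<in> U"
      "semianalytic (n + p) A" "ebounded (n + p) A" "S \<inter> U = proj n ` A"
      using S a unfolding subanalytic_def by meson
    then show ?thesis unfolding bsub_def by blast
  qed
  then have "\<forall>a\<in>Rn n. \<exists>U. openin (Euclidean_space n) U \<and> a \<in> U \<and> bsub n (S \<inter> U)" by blast
  from bchoice[OF this] obtain U where
    U: "\<And>a. a \<in> Rn n \<Longrightarrow> openin (Euclidean_space n) (U a) \<and> a \<in> U a \<and> bsub n (S \<inter> U a)" by blast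
  have "\<And>V. V \<in> U ` K \<Longrightarrow> openin (Euclidean_space n) V" "K \<subseteq> \<Union>(U ` K)"
    using U by (auto simp: K_def)
  from compactinD[OF \<open>compactin (Euclidean_space n) K\<close> this]
  obtain F where F: "finite F" "F \<subseteq> U ` K" "K \<subseteq> \<Union>F" by blast
  have "S \<subseteq> K" using S bd by (auto simp: K_def subanalytic_def)
  then have "S = (\<Union>V\<in>F. S \<inter> V)" using F(3) by blast
  moreover have "bsub n (\<Union>V\<in>F. S \<inter> V)"
    using F U by (intro bsub_Union) (auto simp: K_def)
  ultimately show ?thesis by simp
qed

text \<open>On a box both \<open>cmpt\<close> and its inverse have graphs given by polynomial
  conditions, so a bounded set can be moved to the compactification and back as a projection of a
  bounded set.\<close>

lemma globally_subanalytic_iff_bsub: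
  assumes "S \<subseteq> Box n R" shows "globally_subanalytic n S \<longleftrightarrow> bsub n S"
proof
  assume "globally_subanalytic n S"
  then have "subanalytic n (cmpt ` S)" by (simp add: globally_subanalytic_def cmpt_def[abs_def])
  then have "bsub n (cmpt ` S)"
    by (rule subanalytic_imp_bsub) (use cmpt_abs_less in \<open>auto intro: less_imp_le\<close>)
  then show "bsub n S" using assms by (rule bsub_of_cmpt)
next
  assume "bsub n S"
  then have b: "bsub n (cmpt ` S)" by (rule bsub_cmpt)
  then have "subanalytic n (cmpt ` S)"
    using bsub_Rn[OF b] unfolding subanalytic_def
    by (intro conjI ballI exI[of _ "Rn n"]) (auto simp: bsub_def Int_absorb2)
  then show "globally_subanalytic n S"
    using bsub_Rn[OF \<open>bsub n S\<close>] by (simp add: globally_subanalytic_def cmpt_def[abs_def])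
qed

section \<open>Bounded subanalytic maps\<close>

lemma sel_apply: "sel n \<sigma> x i = (if i < n then x (\<sigma> i) else 0)"
  by (simp add: sel_def)

lemma single_0 [simp]: "single t 0 = t"
  by (simp add: single_def)

lemma join_eq_iff: "z = join n x y \<longleftrightarrow> (\<forall>i<n. z i = x i) \<and> (\<forall>i. z (n + i) = y i)"
proof
  assume r: "(\<forall>i<n. z i = x i) \<and> (\<forall>i. z (n + i) = y i)"
  show "z = join n x y"
  proof
    fix i show "z i = join n x y i"
      using r[THEN conjunct2, rule_format, of "i - n"] r[THEN conjunct1] by (cases "i < n") (auto simp: join_def)
  qed
qed (auto simp: join_def)

lemma join_Rn: "y \<in> Rn m \<Longrightarrow> join n x y \<in> Rn (n + m)"
  by (auto simp: Rn_iff join_def)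

lemma single_Rn [simp]: "single t \<in> Rn (Suc 0)"
  by (simp add: Rn_iff single_def)

lemma Rn_eqI: "x \<in> Rn n \<Longrightarrow> y \<in> Rn n \<Longrightarrow> (\<And>i. i < n \<Longrightarrow> x i = y i) \<Longrightarrow> x = y"
proof
  fix i assume "x \<in> Rn n" "y \<in> Rn n" "\<And>i. i < n \<Longrightarrow> x i = y i"
  then show "x i = y i" by (cases "i < n") (auto simp: Rn_iff)
qed

lemma Rn1_eq_single: "x \<in> Rn (Suc 0) \<Longrightarrow> x = single (x 0)"
  by (auto simp: Rn_iff single_def fun_eq_iff)

lemma eq_single_iff: "x \<in> Rn (Suc 0) \<Longrightarrow> x = single t \<longleftrightarrow> x 0 = t"
  by (auto simp: Rn_iff single_def fun_eq_iff)

lemma mem_graph: "z \<in> graph n h D \<longleftrightarrow> (\<exists>x\<in>D. (\<forall>i<n. z i = x i) \<and> (\<forall>i. z (n + i) = h x i))"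
  by (auto simp: graph_def image_iff join_eq_iff)

text \<open>The working form of \<open>subanalytic_map\<close> for bounded graphs: composition and
  pairing of maps reduce to intersections and projections of bounded sets.\<close>

definition bmap :: "nat \<Rightarrow> vec set \<Rightarrow> nat \<Rightarrow> (vec \<Rightarrow> vec) \<Rightarrow> bool" where
  "bmap n D m h \<longleftrightarrow> D \<subseteq> Rn n \<and> h ` D \<subseteq> Rn m \<and>
     continuous_map (subtopology (Euclidean_space n) D) (Euclidean_space m) h \<and> bsub (n + m) (graph n h D)"

lemma bmap_dom:
  assumes "bmap n D m h" shows "bsub n D"
proof -
  have "proj n ` graph n h D = D"
  proof -
    have "proj n (join n x (h x)) = x" if "x \<in> D" for x
      using assms that by (intro ext) (auto simp: bmap_def proj_def join_def Rn_iff subset_iff)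
    then show ?thesis by (force simp: graph_def image_image)
  qed
  moreover have "bsub n (proj n ` graph n h D)" using assms by (intro bsub_proj[of n m]) (simp add: bmap_def)
  ultimately show ?thesis by simp
qed

lemma bmap_cong:
  assumes "bmap n D m h" "\<And>x. x \<in> D \<Longrightarrow> h x = g x" shows "bmap n D m g"
proof -
  have "graph n g D = graph n h D" using assms(2) by (auto simp: graph_def image_iff)
  moreover have "g ` D = h ` D" using assms(2) by (auto simp: image_iff)
  moreover have "continuous_map (subtopology (Euclidean_space n) D) (Euclidean_space m) g"
    by (rule continuous_map_eq[of _ _ h]) (use assms in \<open>auto simp: bmap_def\<close>)
  ultimately show ?thesis using assms(1) by (simp add: bmap_def)
qed

lemma bmap_restrict:
  assumes h: "bmap n D m h" and D': "bsub n D'" "D' \<subseteq> D" shows "bmap n D' m h"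
proof -
  have DR: "D \<subseteq> Rn n" using h by (simp add: bmap_def)
  have eq: "graph n h D' = {z \<in> graph n h D. sel n id z \<in> D'}"
  proof (intro Set.set_eqI)
    fix z
    have "sel n id z = x" if "x \<in> D" "\<forall>i<n. z i = x i" for x
      using that DR by (intro Rn_eqI[of _ n]) (auto simp: sel_apply)
    then show "z \<in> graph n h D' \<longleftrightarrow> z \<in> {z \<in> graph n h D. sel n id z \<in> D'}"
      using D'(2) by (auto simp: mem_graph)
  qed
  have "bsub (n + m) (graph n h D')"
    unfolding eq using h by (intro bsub_dfn dfn_sel D') (auto simp: bmap_def)
  moreover have "continuous_map (subtopology (Euclidean_space n) D') (Euclidean_space m) h"
    using h D'(2) continuous_map_from_subtopology_mono unfolding bmap_def by blast
  ultimately show ?thesis using h D'(2) by (auto simp: bmap_def)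
qed

text \<open>The graph of the composite is a projection of the set of triples consisting of
  \<open>x\<close>, \<open>f (h x)\<close> and \<open>h x\<close>; the intermediate value stands
  last because \<open>proj\<close> drops trailing coordinates. \<open>\<sigma>1\<close> and
  \<open>\<sigma>2\<close> pick the two pairs that must lie in the given graphs.\<close>

lemma bmap_comp:
  assumes h: "bmap n D m h" and f: "bmap m E k f" and hE: "h ` D \<subseteq> E"
  shows "bmap n D k (f \<circ> h)"
proof -
  have R: "D \<subseteq> Rn n" "h ` D \<subseteq> Rn m" "E \<subseteq> Rn m" "f ` E \<subseteq> Rn k" using h f by (auto simp: bmap_def)
  have bs: "bsub (n + m) (graph n h D)" "bsub (m + k) (graph m f E)" using h f by (auto simp: bmap_def)
  obtain R1 where R1: "graph n h D \<subseteq> Box (n + m) R1" using bsub_Box[OF bs(1)] .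
  obtain R2 where R2: "graph m f E \<subseteq> Box (m + k) R2" using bsub_Box[OF bs(2)] .
  define B where "B = max R1 R2"
  define \<sigma>1 where "\<sigma>1 i = (if i < n then i else i + k)" for i
  define \<sigma>2 where "\<sigma>2 i = (if i < m then n + k + i else n + (i - m))" for i
  define C where "C = {z \<in> Box (n + k + m) B. sel (n + m) \<sigma>1 z \<in> graph n h D \<and> sel (m + k) \<sigma>2 z \<in> graph m f E}"
  have "dfn (n + k + m) (\<lambda>z. sel (n + m) \<sigma>1 z \<in> graph n h D \<and> sel (m + k) \<sigma>2 z \<in> graph m f E)"
    by (intro dfn_conj dfn_sel bs) (auto simp: \<sigma>1_def \<sigma>2_def)
  then have "bsub (n + k + m) C" by (simp add: dfn_def C_def)
  then have "bsub (n + k) (proj (n + k) ` C)" by (rule bsub_proj)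
  moreover have "proj (n + k) ` C = graph n (f \<circ> h) D"
  proof
    show "proj (n + k) ` C \<subseteq> graph n (f \<circ> h) D"
    proof
      fix y assume "y \<in> proj (n + k) ` C"
      then obtain z where z: "z \<in> C" "y = proj (n + k) z" by blast
      obtain x where x: "x \<in> D" "\<forall>i<n. sel (n + m) \<sigma>1 z i = x i" "\<forall>i. sel (n + m) \<sigma>1 z (n + i) = h x i"
        using z by (auto simp: C_def mem_graph)
      obtain w where w: "w \<in> E" "\<forall>i<m. sel (m + k) \<sigma>2 z i = w i" "\<forall>i. sel (m + k) \<sigma>2 z (m + i) = f w i"
        using z by (auto simp: C_def mem_graph)
      have "w = h x"
      proof (rule Rn_eqI)
        show "w \<in> Rn m" "h x \<in> Rn m" using R x w by auto
        fix i assume i: "i < m"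
        have "w i = z (n + k + i)" using w(2) i by (auto simp: sel_apply \<sigma>2_def)
        also have "\<dots> = h x i" using x(3)[rule_format, of i] i by (simp add: sel_apply \<sigma>1_def add_ac)
        finally show "w i = h x i" .
      qed
      moreover have "y (n + i) = f w i" for i
      proof (cases "i < k")
        case True then show ?thesis using w(3)[rule_format, of i] z by (simp add: sel_apply \<sigma>2_def proj_def)
      next
        case False
        then show ?thesis using z R w(1) by (auto simp: proj_def Rn_iff)
      qed
      moreover have "y i = x i" if "i < n" for i
        using x(2) that z by (auto simp: sel_apply \<sigma>1_def proj_def)
      ultimately show "y \<in> graph n (f \<circ> h) D" using x(1) by (auto simp: mem_graph)
    qed
    show "graph n (f \<circ> h) D \<subseteq> proj (n + k) ` C"
    proof
      fix y assume "y \<in> graph n (f \<circ> h) D"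
      then obtain x where x: "x \<in> D" "y = join n x (f (h x))" by (auto simp: graph_def)
      have g1: "join n x (h x) \<in> graph n h D" using x by (auto simp: graph_def)
      have g2: "join m (h x) (f (h x)) \<in> graph m f E" using x hE by (auto simp: graph_def)
      have "h x \<in> E" using x hE by blast
      then have hx: "h x \<in> Rn m" "f (h x) \<in> Rn k" using R by blast+
      define z where "z = join (n + k) y (h x)"
      have zs1: "sel (n + m) \<sigma>1 z = join n x (h x)"
        using join_Rn[OF hx(1), of n x] by (intro Rn_eqI[of _ "n + m"]) (auto simp: sel_apply \<sigma>1_def z_def join_def x(2))
      have zs2: "sel (m + k) \<sigma>2 z = join m (h x) (f (h x))"
        using join_Rn[OF hx(2), of m "h x"] by (intro Rn_eqI[of _ "m + k"]) (auto simp: sel_apply \<sigma>2_def z_def join_def x(2))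
      have "\<bar>z i\<bar> < B" if i: "i < n + k + m" for i
      proof -
        consider "i < n" | "n \<le> i" "i < n + k" | "n + k \<le> i" by linarith
        then show ?thesis
        proof cases
          case 1
          have "\<bar>join n x (h x) i\<bar> < R1" using g1 R1 1 by (auto simp: Box_def)
          then show ?thesis using 1 by (auto simp: z_def join_def x(2) B_def)
        next
          case 2
          then have "\<bar>join m (h x) (f (h x)) (m + (i - n))\<bar> < R2" using g2 R2 by (auto simp: Box_def)
          moreover have "join m (h x) (f (h x)) (m + (i - n)) = f (h x) (i - n)" by (simp add: join_def)
          moreover have "z i = f (h x) (i - n)" using 2 by (simp add: z_def join_def x(2))
          ultimately show ?thesis by (simp add: B_def)
        next
          case 3
          then have "\<bar>join n x (h x) (n + (i - (n + k)))\<bar> < R1" using g1 R1 i by (auto simp: Box_def)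
          moreover have "join n x (h x) (n + (i - (n + k))) = h x (i - (n + k))" by (simp add: join_def)
          moreover have "z i = h x (i - (n + k))" using 3 by (simp add: z_def join_def)
          ultimately show ?thesis by (simp add: B_def)
        qed
      qed
      moreover have "z \<in> Rn (n + k + m)" unfolding z_def by (rule join_Rn[OF hx(1)])
      ultimately have "z \<in> C" using zs1 zs2 g1 g2 by (simp add: C_def Box_def)
      moreover have "y = proj (n + k) z"
        using join_Rn[OF hx(2), of n x] by (intro Rn_eqI[of _ "n + k"]) (auto simp: proj_def z_def join_def x(2) Rn_iff)
      ultimately show "y \<in> proj (n + k) ` C" by blast
    qed
  qed
  moreover have "continuous_map (subtopology (Euclidean_space n) D) (Euclidean_space k) (f \<circ> h)"
  proof (rule continuous_map_compose)
    show "continuous_map (subtopology (Euclidean_space n) D) (subtopology (Euclidean_space m) E) h"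
      using h hE by (auto simp: bmap_def continuous_map_in_subtopology)
    show "continuous_map (subtopology (Euclidean_space m) E) (Euclidean_space k) f" using f by (simp add: bmap_def)
  qed
  moreover have "(f \<circ> h) ` D \<subseteq> Rn k"
    unfolding image_comp[symmetric] using image_mono[OF hE, of f] R(4) by (rule subset_trans)
  ultimately show ?thesis using R(1) by (simp add: bmap_def)
qed

lemma continuous_map_Euclidean_iff:
  assumes "f ` topspace X \<subseteq> Rn n"
  shows "continuous_map X (Euclidean_space n) f \<longleftrightarrow> (\<forall>i<n. continuous_map X euclideanreal (\<lambda>x. f x i))"
proof -
  have eq: "f x = (\<lambda>i. if i < n then f x i else 0)" if "x \<in> topspace X" for x
  proof -
    have "f x \<in> Rn n" using assms that by auto
    then show ?thesis by (auto simp: Rn_iff)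
  qed
  have "continuous_map X (Euclidean_space n) f \<longleftrightarrow>
     continuous_map X (Euclidean_space n) (\<lambda>x i. if i < n then f x i else 0)"
  proof
    show "continuous_map X (Euclidean_space n) (\<lambda>x i. if i < n then f x i else 0)"
      if "continuous_map X (Euclidean_space n) f" by (rule continuous_map_eq[OF that eq])
    show "continuous_map X (Euclidean_space n) f"
      if "continuous_map X (Euclidean_space n) (\<lambda>x i. if i < n then f x i else 0)"
      by (rule continuous_map_eq[OF that eq[symmetric]])
  qed
  then show ?thesis by (simp only: continuous_map_componentwise_Euclidean_space)
qed

lemma continuous_map_Euclidean_coord:
  "continuous_map (subtopology (Euclidean_space n) D) euclideanreal (\<lambda>x. x i)"
  unfolding Euclidean_space_def
  by (intro continuous_map_from_subtopology continuous_map_product_projection) simp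

lemma bmap_pair:
  assumes u: "bmap n D m u" and v: "bmap n D k v"
  shows "bmap n D (m + k) (\<lambda>x. join m (u x) (v x))"
proof -
  have R: "D \<subseteq> Rn n" "u ` D \<subseteq> Rn m" "v ` D \<subseteq> Rn k" using u v by (auto simp: bmap_def)
  have bs: "bsub (n + m) (graph n u D)" "bsub (n + k) (graph n v D)" using u v by (auto simp: bmap_def)
  obtain R1 where R1: "graph n u D \<subseteq> Box (n + m) R1" using bsub_Box[OF bs(1)] .
  obtain R2 where R2: "graph n v D \<subseteq> Box (n + k) R2" using bsub_Box[OF bs(2)] .
  define \<sigma> where "\<sigma> i = (if i < n then i else i + m)" for i
  define C where "C = {z \<in> Box (n + (m + k)) (max R1 R2). sel (n + m) id z \<in> graph n u D \<and> sel (n + k) \<sigma> z \<in> graph n v D}"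
  have "dfn (n + (m + k)) (\<lambda>z. sel (n + m) id z \<in> graph n u D \<and> sel (n + k) \<sigma> z \<in> graph n v D)"
    by (intro dfn_conj dfn_sel bs) (auto simp: \<sigma>_def)
  then have "bsub (n + (m + k)) C" by (simp add: dfn_def C_def)
  moreover have "C = graph n (\<lambda>x. join m (u x) (v x)) D"
  proof
    show "C \<subseteq> graph n (\<lambda>x. join m (u x) (v x)) D"
    proof
      fix z assume z: "z \<in> C"
      obtain x where x: "x \<in> D" "\<forall>i<n. sel (n + m) id z i = x i" "\<forall>i. sel (n + m) id z (n + i) = u x i"
        using z by (auto simp: C_def mem_graph)
      obtain x' where x': "x' \<in> D" "\<forall>i<n. sel (n + k) \<sigma> z i = x' i" "\<forall>i. sel (n + k) \<sigma> z (n + i) = v x' i"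
        using z by (auto simp: C_def mem_graph)
      have "x' = x"
      proof (rule Rn_eqI)
        show "x' \<in> Rn n" "x \<in> Rn n" using R x x' by auto
        show "x' i = x i" if "i < n" for i using x(2) x'(2) that by (auto simp: sel_apply \<sigma>_def)
      qed
      have "z = join n x (join m (u x) (v x))"
      proof (rule Rn_eqI)
        show "z \<in> Rn (n + (m + k))" using z by (auto simp: C_def Box_def)
        show "join n x (join m (u x) (v x)) \<in> Rn (n + (m + k))" using R x by (intro join_Rn) auto
        fix i assume i: "i < n + (m + k)"
        consider "i < n" | "n \<le> i" "i < n + m" | "n + m \<le> i" by linarith
        then show "z i = join n x (join m (u x) (v x)) i"
        proof cases
          case 1 then show ?thesis using x(2) by (auto simp: sel_apply join_def)
        next
          case 2 then show ?thesis using x(3)[rule_format, of "i - n"] by (auto simp: sel_apply join_def)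
        next
          case 3
          then have "\<sigma> (i - m) = i" "i - m < n + k" "n + (i - n - m) = i - m" "\<not> i - n < m" using i by (auto simp: \<sigma>_def)
          then show ?thesis using x'(3)[rule_format, of "i - n - m"] 3 \<open>x' = x\<close> by (simp add: sel_apply join_def)
        qed
      qed
      then show "z \<in> graph n (\<lambda>x. join m (u x) (v x)) D" using x(1) by (auto simp: graph_def)
    qed
    show "graph n (\<lambda>x. join m (u x) (v x)) D \<subseteq> C"
    proof
      fix z assume "z \<in> graph n (\<lambda>x. join m (u x) (v x)) D"
      then obtain x where x: "x \<in> D" "z = join n x (join m (u x) (v x))" by (auto simp: graph_def)
      have g1: "join n x (u x) \<in> graph n u D" "join n x (v x) \<in> graph n v D" using x by (auto simp: graph_def)
      have ux: "u x \<in> Rn m" "v x \<in> Rn k" using R x by auto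
      have s1: "sel (n + m) id z = join n x (u x)"
        using join_Rn[OF ux(1), of n x] by (intro Rn_eqI[of _ "n + m"]) (auto simp: sel_apply x(2) join_def)
      have s2: "sel (n + k) \<sigma> z = join n x (v x)"
        using join_Rn[OF ux(2), of n x] by (intro Rn_eqI[of _ "n + k"]) (auto simp: sel_apply x(2) join_def \<sigma>_def)
      have "\<bar>z i\<bar> < max R1 R2" if i: "i < n + (m + k)" for i
      proof (cases "i < n + m")
        case True
        then have "\<bar>join n x (u x) i\<bar> < R1" using g1 R1 by (auto simp: Box_def)
        then show ?thesis using True fun_cong[OF s1, of i] by (simp add: sel_apply)
      next
        case False
        then have "\<bar>join n x (v x) (i - m)\<bar> < R2" using g1 R2 i by (auto simp: Box_def)
        moreover have "\<sigma> (i - m) = i" "i - m < n + k" using False i by (auto simp: \<sigma>_def)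
        ultimately show ?thesis using fun_cong[OF s2, of "i - m"] by (simp add: sel_apply)
      qed
      moreover have "z \<in> Rn (n + (m + k))" unfolding x(2) by (intro join_Rn ux)
      ultimately show "z \<in> C" using s1 s2 g1 by (simp add: C_def Box_def)
    qed
  qed
  moreover have "continuous_map (subtopology (Euclidean_space n) D) (Euclidean_space (m + k)) (\<lambda>x. join m (u x) (v x))"
  proof (subst continuous_map_Euclidean_iff)
    show "(\<lambda>x. join m (u x) (v x)) ` topspace (subtopology (Euclidean_space n) D) \<subseteq> Rn (m + k)"
      using R by (auto intro!: join_Rn)
    have cu: "\<forall>i<m. continuous_map (subtopology (Euclidean_space n) D) euclideanreal (\<lambda>x. u x i)"
      using u R by (subst continuous_map_Euclidean_iff[symmetric]) (auto simp: bmap_def)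
    have cv: "\<forall>i<k. continuous_map (subtopology (Euclidean_space n) D) euclideanreal (\<lambda>x. v x i)"
      using v R by (subst continuous_map_Euclidean_iff[symmetric]) (auto simp: bmap_def)
    show "\<forall>i<m + k. continuous_map (subtopology (Euclidean_space n) D) euclideanreal (\<lambda>x. join m (u x) (v x) i)"
    proof (intro allI impI)
      fix i assume "i < m + k"
      then show "continuous_map (subtopology (Euclidean_space n) D) euclideanreal (\<lambda>x. join m (u x) (v x) i)"
        using cu cv by (cases "i < m") (auto simp: join_def)
    qed
  qed
  ultimately show ?thesis using R by (auto simp: bmap_def intro!: join_Rn)
qed

text \<open>Any formula \<open>Q\<close> that determines the values over \<open>D\<close> yields the
  graph: it is cut out by \<open>Q\<close>, membership in \<open>D\<close> and a box large enough
  for both domain and values.\<close>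

lemma bmap_intro_dfn:
  assumes D: "bsub n D" and h: "h ` D \<subseteq> Box m R"
    and cont: "\<And>i. i < m \<Longrightarrow> continuous_map (subtopology (Euclidean_space n) D) euclideanreal (\<lambda>x. h x i)"
    and Q: "dfn (n + m) Q"
    and eq: "\<And>x y. x \<in> D \<Longrightarrow> y \<in> Rn m \<Longrightarrow> Q (join n x y) \<longleftrightarrow> y = h x"
  shows "bmap n D m h"
proof -
  have DR: "D \<subseteq> Rn n" using bsub_Rn[OF D] .
  have hR: "h ` D \<subseteq> Rn m" using h by (auto simp: Box_def)
  obtain R' where R': "D \<subseteq> Box n R'" using bsub_Box[OF D] .
  define C where "C = {z \<in> Box (n + m) (max R R'). sel n id z \<in> D \<and> Q z}"
  have "dfn (n + m) (\<lambda>z. sel n id z \<in> D \<and> Q z)" by (intro dfn_conj dfn_sel D Q) auto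
  then have "bsub (n + m) C" by (simp add: dfn_def C_def)
  moreover have "C = graph n h D"
  proof
    show "C \<subseteq> graph n h D"
    proof
      fix z assume z: "z \<in> C"
      define x where "x = sel n id z"
      define y where "y = (\<lambda>i. z (n + i))"
      have "z = join n x y" by (simp add: join_eq_iff x_def y_def sel_apply)
      moreover have "y \<in> Rn m" using z by (auto simp: C_def Box_def Rn_iff y_def)
      moreover have "x \<in> D" using z by (simp add: C_def x_def)
      ultimately show "z \<in> graph n h D" using eq[of x y] z by (auto simp: C_def graph_def)
    qed
    show "graph n h D \<subseteq> C"
    proof
      fix z assume "z \<in> graph n h D"
      then obtain x where x: "x \<in> D" "z = join n x (h x)" by (auto simp: graph_def)
      have hx: "h x \<in> Rn m" using hR x by auto
      have "sel n id z = x" using x DR by (intro Rn_eqI[of _ n]) (auto simp: sel_apply join_def)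
      moreover have "z \<in> Rn (n + m)" unfolding x(2) by (rule join_Rn[OF hx])
      moreover have "\<bar>z i\<bar> < max R R'" if "i < n + m" for i
      proof (cases "i < n")
        case True
        then show ?thesis using R' x by (auto simp: Box_def join_def less_max_iff_disj)
      next
        case False
        then have "\<bar>h x (i - n)\<bar> < R" using h x(1) that by (auto simp: Box_def)
        then show ?thesis using False by (auto simp: x(2) join_def)
      qed
      ultimately show "z \<in> C" using x eq[OF x(1) hx] by (simp add: C_def Box_def)
    qed
  qed
  moreover have "continuous_map (subtopology (Euclidean_space n) D) (Euclidean_space m) h"
    using cont hR by (subst continuous_map_Euclidean_iff) auto
  ultimately show ?thesis using DR hR by (simp add: bmap_def)
qed

lemma bmap_sel:
  assumes D: "bsub n D" and \<sigma>: "\<And>i. i < m \<Longrightarrow> \<sigma> i < n"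
  shows "bmap n D m (sel m \<sigma>)"
proof -
  obtain R where R: "D \<subseteq> Box n R" using bsub_Box[OF D] .
  show ?thesis
  proof (rule bmap_intro_dfn[OF D, where R = R and Q = "\<lambda>z. \<forall>i\<in>{..<m}. z (n + i) = z (\<sigma> i)"])
    show "sel m \<sigma> ` D \<subseteq> Box m R"
    proof
      fix y assume "y \<in> sel m \<sigma> ` D"
      then obtain x where x: "x \<in> D" "y = sel m \<sigma> x" by blast
      have "\<bar>x (\<sigma> i)\<bar> < R" if "i < m" for i using R x(1) \<sigma>[OF that] by (auto simp: Box_def)
      then show "y \<in> Box m R" using x by (auto simp: Box_def sel_apply Rn_iff)
    qed
    show "continuous_map (subtopology (Euclidean_space n) D) euclideanreal (\<lambda>x. sel m \<sigma> x i)" if "i < m" for i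
      using that continuous_map_Euclidean_coord by (simp add: sel_apply)
    show "dfn (n + m) (\<lambda>z. \<forall>i\<in>{..<m}. z (n + i) = z (\<sigma> i))"
      by (intro dfn_Ball dfn_eq analytic_intros) (use \<sigma> in \<open>auto intro: trans_less_add1\<close>)
    fix x y assume "x \<in> D" "y \<in> Rn m"
    then show "(\<forall>i\<in>{..<m}. join n x y (n + i) = join n x y (\<sigma> i)) \<longleftrightarrow> y = sel m \<sigma> x"
      using \<sigma> by (auto simp: join_def sel_apply fun_eq_iff Rn_iff)
  qed
qed

text \<open>The quotient is the solution \<open>y\<close> of the polynomial equation
  \<open>y * z b = z a\<close>. The inequalities keep it in the unit interval, hence bounded even
  where \<open>z b\<close> tends to zero.\<close>

lemma bmap_ratio:
  assumes D: "bsub n D" and ab: "a < n" "b < n"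
    and pos: "\<And>z. z \<in> D \<Longrightarrow> 0 < z b \<and> 0 \<le> z a \<and> z a \<le> z b"
  shows "bmap n D 1 (\<lambda>z. single (z a / z b))"
proof (rule bmap_intro_dfn[OF D, where R = 2 and Q = "\<lambda>z. z n * z b = z a"])
  show "(\<lambda>z. single (z a / z b)) ` D \<subseteq> Box 1 2"
  proof
    fix y assume "y \<in> (\<lambda>z. single (z a / z b)) ` D"
    then obtain z where z: "z \<in> D" "y = single (z a / z b)" by blast
    have "z a / z b \<le> 1" "0 \<le> z a / z b" using pos[OF z(1)] by auto
    then show "y \<in> Box 1 2" by (auto simp: Box_def z(2))
  qed
  show "continuous_map (subtopology (Euclidean_space n) D) euclideanreal (\<lambda>x. single (x a / x b) i)" if "i < 1" for i
    using that pos by (auto simp: single_def intro!: continuous_map_real_divide continuous_map_Euclidean_coord) fastforce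
  show "dfn (n + 1) (\<lambda>z. z n * z b = z a)"
    by (intro dfn_eq analytic_intros) (use ab in auto)
  fix x y assume x: "x \<in> D" and y: "y \<in> Rn 1"
  have "y 0 * x b = x a \<longleftrightarrow> y 0 = x a / x b" using pos[OF x] by (simp add: field_simps)
  moreover have "y = single (x a / x b) \<longleftrightarrow> y 0 = x a / x b"
  proof -
    show ?thesis by (rule eq_single_iff) (use y in simp)
  qed
  ultimately show "join n x y n * join n x y b = join n x y a \<longleftrightarrow> y = single (x a / x b)"
    using ab by (simp add: join_def)
qed

lemma edist_less_iff: "edist n x a < e \<longleftrightarrow> 0 < e \<and> (\<Sum>i<n. (x i - a i)\<^sup>2) < e\<^sup>2"
proof -
  have nn: "0 \<le> edist n x a" by (simp add: edist_def)
  have sq: "(edist n x a)\<^sup>2 = (\<Sum>i<n. (x i - a i)\<^sup>2)"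
    by (simp add: edist_def L2_set_def sum_nonneg)
  show ?thesis
    unfolding sq[symmetric]
  proof
    assume "edist n x a < e"
    then show "0 < e \<and> (edist n x a)\<^sup>2 < e\<^sup>2" using nn power_strict_mono[of "edist n x a" e 2] by auto
  next
    assume "0 < e \<and> (edist n x a)\<^sup>2 < e\<^sup>2"
    then show "edist n x a < e" using power2_less_imp_less[of "edist n x a" e] by auto
  qed
qed

lemma dfn_edist:
  assumes "n \<le> N" shows "dfn N (\<lambda>x. edist n x a < e)"
proof (cases "0 < e")
  case True
  have "dfn N (\<lambda>x. 0 < e\<^sup>2 - (\<Sum>i<n. (x i - a i) * (x i - a i)))"
    using assms by (intro dfn_pos analytic_diff analytic_sum analytic_intros) auto
  then show ?thesis using True by (simp add: edist_less_iff power2_eq_square)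
next
  case False
  have "dfn N (\<lambda>x. (1::real) = 0)" by (intro dfn_zero analytic_intros)
  then show ?thesis using False by (simp add: edist_less_iff)
qed

lemma bsub_nbd: "bsub n D \<Longrightarrow> bsub n (nbd n a e D)"
  unfolding nbd_def by (intro bsub_dfn dfn_edist order_refl)

lemma abs_coord_le_edist: "i < n \<Longrightarrow> \<bar>x i - a i\<bar> \<le> edist n x a"
proof -
  assume "i < n"
  then have "\<bar>x i - a i\<bar> \<le> L2_set (\<lambda>i. \<bar>x i - a i\<bar>) {..<n}" by (intro member_le_L2_set) auto
  also have "\<dots> = edist n x a" by (simp add: edist_def L2_set_def)
  finally show ?thesis .
qed

section \<open>One-variable tameness and germs of maps\<close>

lemma compact_closed_box: "compact {x \<in> Rn n. \<forall>i<n. \<bar>x i\<bar> \<le> R}"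
  using compactin_closed_box[of n R] by (simp add: euclidean_product_topology)

lemma openin_Euclidean_box:
  assumes U: "openin (Euclidean_space n) U" "l \<in> U"
  shows "\<exists>\<rho>>0. \<forall>y\<in>Rn n. (\<forall>i<n. \<bar>y i - l i\<bar> < \<rho>) \<longrightarrow> y \<in> U"
proof (rule ccontr)
  assume c: "\<not> ?thesis"
  have "\<exists>y. y \<in> Rn n \<and> (\<forall>i<n. \<bar>y i - l i\<bar> < 1 / real (Suc k)) \<and> y \<notin> U" for k
  proof -
    have "1 / real (Suc k) > 0" by simp
    then show ?thesis using c by blast
  qed
  then obtain y where y: "\<And>k. y k \<in> Rn n \<and> (\<forall>i<n. \<bar>y k i - l i\<bar> < 1 / real (Suc k)) \<and> y k \<notin> U" by metis
  obtain V where V: "open V" "U = V \<inter> Rn n"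
    using U(1) unfolding Euclidean_space_def by (auto simp: openin_subtopology euclidean_product_topology Rn_iff)
  have lR: "l \<in> Rn n" using U(2) V by blast
  have coord: "(\<lambda>k. y k i) \<longlonglongrightarrow> l i" for i
  proof -
    have "norm (y k i - l i) \<le> 1 / real (Suc k)" for k
      using y[of k] lR by (cases "i < n") (auto simp: Rn_iff intro: less_imp_le)
    then have "(\<lambda>k. y k i - l i) \<longlonglongrightarrow> 0"
      by (intro Lim_null_comparison[OF _ LIMSEQ_inverse_real_of_nat]) (auto simp: inverse_eq_divide)
    then show ?thesis by (simp add: LIM_zero_iff)
  qed
  have "limitin (product_topology (\<lambda>_. euclideanreal) UNIV) y l sequentially"
    unfolding limitin_componentwise using coord by simp
  then have "y \<longlonglongrightarrow> l" by (simp add: euclidean_product_topology)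
  then have "\<forall>\<^sub>F k in sequentially. y k \<in> V" using V U(2) by (intro topological_tendstoD) auto
  then obtain k where "y k \<in> V" by (auto dest: eventually_happens'[rotated])
  then show False using y[of k] V by auto
qed

text \<open>Summability at the single real point with all coordinates \<open>\<rho>\<close> is
  absolute and dominates the series on the whole complex polydisc, so the partial sums converge
  uniformly there. Real coefficients give the conjugation symmetry.\<close>

lemma real_analytic_complex_extension:
  assumes a: "a \<in> Rn n" and h: "real_analytic_at n h a"
  shows "\<exists>\<rho>>0. \<exists>F. rhol n \<rho> F \<and> (\<forall>x::nat\<Rightarrow>real. (\<forall>i<n. \<bar>x i\<bar> < \<rho>) \<longrightarrow>
     F (\<lambda>i. of_real (x i)) = of_real (h (\<lambda>i. if i < n then a i + x i else 0)))"
proof -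
  obtain c r where r: "r > 0" and c: "\<And>x. x \<in> nbd n a r (Rn n) \<Longrightarrow>
      ((\<lambda>\<alpha>. c \<alpha> * mnm n (\<lambda>i. x i - a i) \<alpha>) has_sum h x) (mi n)"
    using h unfolding real_analytic_at_alt by blast
  \<comment> \<open>Small enough for the closed cube of half-width \<open>\<rho>\<close>, corners
    included, to lie in the ball of radius \<open>r\<close>.\<close>
  define \<rho> where "\<rho> = r / real (n + 1)"
  have \<rho>: "\<rho> > 0" using r by (simp add: \<rho>_def)
  have pt: "(\<lambda>i. if i < n then a i + x i else 0) \<in> nbd n a r (Rn n)" if "\<And>i. i < n \<Longrightarrow> \<bar>x i\<bar> \<le> \<rho>" for x :: "nat \<Rightarrow> real"
  proof -
    have "edist n (\<lambda>i. if i < n then a i + x i else 0) a = L2_set x {..<n}"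
      unfolding edist_def by (rule L2_set_cong) auto
    also have "\<dots> \<le> (\<Sum>i<n. \<bar>x i\<bar>)" by (rule L2_set_le_sum_abs)
    also have "\<dots> \<le> (\<Sum>i<n. \<rho>)" by (rule sum_mono) (use that in auto)
    also have "\<dots> < r" using r by (simp add: \<rho>_def field_simps)
    finally show ?thesis by (simp add: nbd_def Rn_iff)
  qed
  have hs: "((\<lambda>\<alpha>. c \<alpha> * mnm n x \<alpha>) has_sum h (\<lambda>i. if i < n then a i + x i else 0)) (mi n)"
    if "\<And>i. i < n \<Longrightarrow> \<bar>x i\<bar> \<le> \<rho>" for x :: "nat \<Rightarrow> real"
  proof -
    have "mnm n (\<lambda>i. (if i < n then a i + x i else 0) - a i) = mnm n x"
      by (intro ext) (simp add: mnm_def)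
    moreover have "(\<lambda>i. if i < n then a i + x i else 0) \<in> nbd n a r (Rn n)" by (rule pt) (rule that)
    ultimately show ?thesis using c[of "\<lambda>i. if i < n then a i + x i else 0"] by simp
  qed
  define M where "M \<alpha> = norm (c \<alpha> * mnm n (\<lambda>_. \<rho>) \<alpha>)" for \<alpha>
  have M: "M summable_on mi n"
  proof -
    have "(\<lambda>\<alpha>. c \<alpha> * mnm n (\<lambda>_. \<rho>) \<alpha>) summable_on mi n"
      using hs[of "\<lambda>_. \<rho>"] \<rho> unfolding summable_on_def by auto
    then have "(\<lambda>\<alpha>. norm (c \<alpha> * mnm n (\<lambda>_. \<rho>) \<alpha>)) summable_on mi n"
      by (rule iffD1[OF summable_on_iff_abs_summable_on_real])
    then show ?thesis by (simp only: M_def[abs_def])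
  qed
  define T where "T \<alpha> z = of_real (c \<alpha>) * (\<Prod>i<n. z i ^ \<alpha> i)" for \<alpha> and z :: "nat \<Rightarrow> complex"
  have TM: "norm (T \<alpha> z) \<le> M \<alpha>" if "z \<in> polydisc n \<rho>" for \<alpha> z
  proof -
    have "(\<Prod>i<n. norm (z i) ^ \<alpha> i) \<le> (\<Prod>i<n. \<rho> ^ \<alpha> i)"
      by (intro prod_mono conjI power_mono) (use that in \<open>auto simp: polydisc_def intro: less_imp_le\<close>)
    moreover have "\<bar>\<Prod>i<n. \<rho> ^ \<alpha> i\<bar> = (\<Prod>i<n. \<rho> ^ \<alpha> i)" using \<rho> by (intro abs_of_nonneg prod_nonneg) auto
    ultimately show ?thesis
      by (simp add: T_def M_def norm_mult prod_norm[symmetric] norm_power mnm_def abs_mult mult_left_mono)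
  qed
  define F where "F z = (\<Sum>\<^sub>\<infinity>\<alpha>\<in>mi n. T \<alpha> z)" for z
  have ul: "uniform_limit (polydisc n \<rho>) (\<lambda>X z. \<Sum>\<alpha>\<in>X. T \<alpha> z) F (finite_subsets_at_top (mi n))"
    unfolding F_def by (rule Weierstrass_m_test_general[OF _ M]) (use TM in auto)
  have Tc: "chol n \<rho> (T \<alpha>)" for \<alpha>
  proof -
    have "chol n \<rho> (\<lambda>z. z i ^ k)" if "i < n" for i k
    proof (induction k)
      case 0 show ?case by (simp add: chol_const)
    next
      case (Suc k) show ?case using chol_mult[OF chol_coord[OF that] Suc.IH] by simp
    qed
    then show ?thesis unfolding T_def by (intro chol_mult chol_const chol_prod) auto
  qed
  have Sc: "chol n \<rho> (\<lambda>z. \<Sum>\<alpha>\<in>X. T \<alpha> z)" for X by (intro chol_sum Tc)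
  have "chol n \<rho> F"
  proof (rule cholI)
    show "continuous_on (polydisc n \<rho>) F"
      by (rule uniform_limit_theorem[OF _ ul]) (auto intro!: always_eventually cholD(1)[OF Sc])
    show "(\<lambda>\<zeta>. F (cline b v \<zeta>)) holomorphic_on {\<zeta>. cline b v \<zeta> \<in> polydisc n \<rho>}" for b v
    proof -
      define U where "U = {\<zeta>. cline b v \<zeta> \<in> polydisc n \<rho>}"
      have "open U" by (simp add: U_def)
      have "(\<lambda>\<zeta>. F (cline b v \<zeta>)) field_differentiable at \<zeta>" if \<zeta>: "\<zeta> \<in> U" for \<zeta>
      proof -
        obtain s where s: "s > 0" "cball \<zeta> s \<subseteq> U" 
          using bspec[OF \<open>open U\<close>[unfolded open_contains_cball] \<zeta>] by blast
        have ul2: "uniform_limit (cball \<zeta> s) (\<lambda>X \<zeta>. \<Sum>\<alpha>\<in>X. T \<alpha> (cline b v \<zeta>)) (\<lambda>\<zeta>. F (cline b v \<zeta>)) (finite_subsets_at_top (mi n))"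
          unfolding uniform_limit_iff
        proof (intro allI impI)
          fix e :: real assume "e > 0"
          then have "\<forall>\<^sub>F X in finite_subsets_at_top (mi n). \<forall>z\<in>polydisc n \<rho>. dist (\<Sum>\<alpha>\<in>X. T \<alpha> z) (F z) < e"
            using ul unfolding uniform_limit_iff by blast
          then show "\<forall>\<^sub>F X in finite_subsets_at_top (mi n). \<forall>\<zeta>\<in>cball \<zeta> s. dist (\<Sum>\<alpha>\<in>X. T \<alpha> (cline b v \<zeta>)) (F (cline b v \<zeta>)) < e"
            by eventually_elim (use s(2) in \<open>auto simp: U_def\<close>)
        qed
        have hol: "(\<lambda>\<zeta>. \<Sum>\<alpha>\<in>X. T \<alpha> (cline b v \<zeta>)) holomorphic_on U" for X
          unfolding U_def using cholD(2)[OF Sc] .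
        have "(\<lambda>\<zeta>. F (cline b v \<zeta>)) holomorphic_on ball \<zeta> s"
        proof (rule holomorphic_uniform_limit[OF _ ul2])
          show "\<forall>\<^sub>F X in finite_subsets_at_top (mi n). continuous_on (cball \<zeta> s) (\<lambda>\<zeta>. \<Sum>\<alpha>\<in>X. T \<alpha> (cline b v \<zeta>)) \<and>
              (\<lambda>\<zeta>. \<Sum>\<alpha>\<in>X. T \<alpha> (cline b v \<zeta>)) holomorphic_on ball \<zeta> s"
            by (intro always_eventually allI conjI holomorphic_on_imp_continuous_on holomorphic_on_subset[OF hol])
               (rule s(2), rule order_trans[OF ball_subset_cball s(2)])
        qed auto
        then show ?thesis using s(1) by (auto simp: holomorphic_on_open field_differentiable_def)
      qed
      then show ?thesis using \<open>open U\<close> unfolding U_def[symmetric] by (auto simp: holomorphic_on_open field_differentiable_def)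
    qed
    show "F z = F z'" if "\<forall>i<n. z i = z' i" for z z'
      unfolding F_def T_def using that by (intro infsum_cong) (auto intro!: prod.cong)
  qed
  moreover have "F (\<lambda>i. cnj (z i)) = cnj (F z)" for z
    unfolding F_def T_def infsum_cnj[symmetric] by (intro infsum_cong) simp
  ultimately have "rhol n \<rho> F" by (simp add: rhol_def)
  moreover have "F (\<lambda>i. of_real (x i)) = of_real (h (\<lambda>i. if i < n then a i + x i else 0))"
    if "\<forall>i<n. \<bar>x i\<bar> < \<rho>" for x :: "nat \<Rightarrow> real"
  proof -
    have "((\<lambda>\<alpha>. of_real (c \<alpha> * mnm n x \<alpha>) :: complex) has_sum of_real (h (\<lambda>i. if i < n then a i + x i else 0))) (mi n)"
      using that by (intro has_sum_of_real hs) (auto intro: less_imp_le)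
    then have "((\<lambda>\<alpha>. T \<alpha> (\<lambda>i. of_real (x i))) has_sum of_real (h (\<lambda>i. if i < n then a i + x i else 0))) (mi n)"
      by (simp add: T_def mnm_def)
    then show ?thesis unfolding F_def by (rule infsumI)
  qed
  ultimately show ?thesis using \<rho> by blast
qed

text \<open>Points of the semianalytic set \<open>A\<close> over parameters tending to zero
  accumulate at some \<open>l\<close> by boundedness. The complexified defining functions at
  \<open>l\<close> are fed into \<open>curve_sections\<close>; the curve through one of the points
  projects onto a whole interval of parameters.\<close>

lemma bsub_one_dim_tame:
  assumes T: "bsub 1 T" and acc: "\<And>e. e > 0 \<Longrightarrow> \<exists>t. 0 < t \<and> t < e \<and> single t \<in> T"
  shows "\<exists>\<delta>>0. \<forall>t. 0 < t \<and> t < \<delta> \<longrightarrow> single t \<in> T"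
proof -
  obtain p A R where A: "semianalytic (1 + p) A" "A \<subseteq> Box (1 + p) R" "T = proj 1 ` A"
    using T unfolding bsub_iff by blast
  define N where "N = Suc p"
  have AN: "semianalytic N A" "A \<subseteq> Box N R" "A \<subseteq> Rn N" using A by (auto simp: N_def Box_def)
  have "\<exists>x. x \<in> A \<and> 0 < x 0 \<and> x 0 < 1 / real (Suc k)" for k
  proof -
    obtain t where t: "0 < t" "t < 1 / real (Suc k)" "single t \<in> T" using acc[of "1 / real (Suc k)"] by auto
    then obtain x where x: "x \<in> A" "single t = proj 1 x" by (auto simp: A(3))
    have "x 0 = t" using fun_cong[OF x(2), of 0] by (simp add: single_def proj_def)
    then show ?thesis using x t by blast
  qed
  then obtain X where X: "\<And>k. X k \<in> A \<and> 0 < X k 0 \<and> X k 0 < 1 / real (Suc k)" by metis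
  have "X k \<in> {x \<in> Rn N. \<forall>i<N. \<bar>x i\<bar> \<le> R}" for k using X[of k] AN(2) by (auto simp: Box_def intro: less_imp_le)
  then have Xin: "\<forall>k. X k \<in> {x \<in> Rn N. \<forall>i<N. \<bar>x i\<bar> \<le> R}" ..
  obtain l \<sigma> where l: "l \<in> {x \<in> Rn N. \<forall>i<N. \<bar>x i\<bar> \<le> R}" "strict_mono \<sigma>" "(X \<circ> \<sigma>) \<longlonglongrightarrow> l"
    by (rule seq_compactE[OF compact_imp_seq_compact[OF compact_closed_box] Xin])
  have lR: "l \<in> Rn N" using l by simp
  have coord: "(\<lambda>k. X (\<sigma> k) i) \<longlonglongrightarrow> l i" for i
  proof -
    have "isCont (\<lambda>x::vec. x i) l"
      by (rule bspec[OF iffD1[OF continuous_on_eq_continuous_at[OF open_UNIV] continuous_on_product_coordinates]]) simp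
    from isCont_tendsto_compose[OF this l(3)] show ?thesis by (simp add: o_def)
  qed
  have "l 0 = 0"
  proof (rule LIMSEQ_unique[OF coord])
    have "norm (X (\<sigma> k) 0) \<le> 1 / real (Suc k)" for k
    proof -
      have "1 / real (Suc (\<sigma> k)) \<le> 1 / real (Suc k)" using seq_suble[OF l(2), of k] by (simp add: divide_simps)
      then show ?thesis using X[of "\<sigma> k"] by simp
    qed
    then show "(\<lambda>k. X (\<sigma> k) 0) \<longlonglongrightarrow> 0"
      by (intro Lim_null_comparison[OF _ LIMSEQ_inverse_real_of_nat]) (auto simp: inverse_eq_divide)
  qed
  obtain U where U: "openin (Euclidean_space N) U" "l \<in> U" "local_semi N U A"
    using AN(1) lR unfolding semianalytic_alt by blast
  obtain \<D> where \<D>: "finite \<D>" "\<forall>(E, P)\<in>\<D>. finite E \<and> finite P \<and> (\<forall>h\<in>E \<union> P. \<forall>x\<in>U. real_analytic_at N h x)"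
    "A \<inter> U = (\<Union>(E, P)\<in>\<D>. {x \<in> U. (\<forall>h\<in>E. h x = 0) \<and> (\<forall>h\<in>P. h x > 0)})"
    using U(3) unfolding local_semi_def by blast
  obtain \<rho>1 where \<rho>1: "\<rho>1 > 0" "\<And>y. y \<in> Rn N \<Longrightarrow> \<forall>i<N. \<bar>y i - l i\<bar> < \<rho>1 \<Longrightarrow> y \<in> U"
    using openin_Euclidean_box[OF U(1,2)] by blast
  have near: "\<forall>\<^sub>F k in sequentially. \<forall>i<N. \<bar>X (\<sigma> k) i - l i\<bar> < d" if "d > 0" for d
  proof -
    have "\<forall>\<^sub>F k in sequentially. \<forall>i\<in>{..<N}. \<bar>X (\<sigma> k) i - l i\<bar> < d"
    proof (intro eventually_ball_finite ballI)
      fix i show "\<forall>\<^sub>F k in sequentially. \<bar>X (\<sigma> k) i - l i\<bar> < d"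
        using tendstoD[OF coord[of i] that] by (simp add: dist_real_def)
    qed simp
    then show ?thesis by eventually_elim simp
  qed
  define bas where "bas D = {x \<in> U. (\<forall>h\<in>fst D. h x = 0) \<and> (\<forall>h\<in>snd D. h x > 0)}" for D :: "(vec \<Rightarrow> real) set \<times> (vec \<Rightarrow> real) set"
  have AU: "A \<inter> U = (\<Union>D\<in>\<D>. bas D)" unfolding \<D>(3) bas_def by (auto simp: case_prod_unfold)
  \<comment> \<open>There are finitely many basic sets, so one of them contains infinitely many
    points of the sequence, hence points arbitrarily close to \<open>l\<close>.\<close>
  have "\<exists>D\<in>\<D>. \<exists>\<^sub>F k in sequentially. X (\<sigma> k) \<in> bas D"
  proof (rule ccontr)
    assume "\<not> ?thesis"
    then have "\<forall>\<^sub>F k in sequentially. \<forall>D\<in>\<D>. X (\<sigma> k) \<notin> bas D"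
      using \<D>(1) by (intro eventually_ball_finite) (auto simp: frequently_def)
    with near[OF \<rho>1(1)] have "\<forall>\<^sub>F k in sequentially. False"
    proof eventually_elim
      case (elim k)
      have "X (\<sigma> k) \<in> A" using X by blast
      moreover have "X (\<sigma> k) \<in> U" using \<rho>1(2) elim(1) \<open>X (\<sigma> k) \<in> A\<close> AN(3) by blast
      ultimately show False using AU elim(2) by blast
    qed
    then show False by simp
  qed
  then obtain D where D: "D \<in> \<D>" "\<exists>\<^sub>F k in sequentially. X (\<sigma> k) \<in> bas D" by blast
  define \<H> where "\<H> = fst D \<union> snd D"
  have \<H>: "finite \<H>" "\<And>h. h \<in> \<H> \<Longrightarrow> real_analytic_at N h l"
    using \<D>(2) D(1) U(2) by (auto simp: \<H>_def case_prod_unfold)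
  have "\<forall>h\<in>\<H>. \<exists>q. fst q > 0 \<and> rhol N (fst q) (snd q) \<and> (\<forall>x::nat\<Rightarrow>real. (\<forall>i<N. \<bar>x i\<bar> < fst q) \<longrightarrow>
     snd q (\<lambda>i. of_real (x i)) = of_real (h (\<lambda>i. if i < N then l i + x i else 0)))"
  proof
    fix h assume "h \<in> \<H>"
    from real_analytic_complex_extension[OF lR \<H>(2)[OF this]]
    obtain \<rho> F where "\<rho> > 0" "rhol N \<rho> F" "\<forall>x::nat\<Rightarrow>real. (\<forall>i<N. \<bar>x i\<bar> < \<rho>) \<longrightarrow>
       F (\<lambda>i. of_real (x i)) = of_real (h (\<lambda>i. if i < N then l i + x i else 0))" by blast
    then show "\<exists>q. fst q > 0 \<and> rhol N (fst q) (snd q) \<and> (\<forall>x::nat\<Rightarrow>real. (\<forall>i<N. \<bar>x i\<bar> < fst q) \<longrightarrow>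
     snd q (\<lambda>i. of_real (x i)) = of_real (h (\<lambda>i. if i < N then l i + x i else 0)))"
      by (intro exI[of _ "(\<rho>, F)"]) auto
  qed
  from bchoice[OF this] obtain q where q: "\<And>h. h \<in> \<H> \<Longrightarrow> fst (q h) > 0 \<and> rhol N (fst (q h)) (snd (q h)) \<and> (\<forall>x::nat\<Rightarrow>real. (\<forall>i<N. \<bar>x i\<bar> < fst (q h)) \<longrightarrow>
     snd (q h) (\<lambda>i. of_real (x i)) = of_real (h (\<lambda>i. if i < N then l i + x i else 0)))" by blast
  define \<rho> where "\<rho> = Min (insert \<rho>1 ((fst \<circ> q) ` \<H>))"
  have fin: "finite (insert \<rho>1 ((fst \<circ> q) ` \<H>))" using \<H> by simp
  have \<rho>: "\<rho> > 0" unfolding \<rho>_def using fin q \<rho>1(1) by (subst Min_gr_iff) auto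
  have \<rho>le: "\<rho> \<le> \<rho>1" "\<And>h. h \<in> \<H> \<Longrightarrow> \<rho> \<le> fst (q h)" unfolding \<rho>_def using fin by (auto intro!: Min_le)
  define F where "F h = snd (q h)" for h
  have F: "\<And>h. h \<in> \<H> \<Longrightarrow> rhol (Suc p) \<rho> (F h)"
    using q \<rho>le rhol_mono unfolding F_def N_def by blast
  have Fh: "F h (\<lambda>i. of_real (x i)) = of_real (h (\<lambda>i. if i < N then l i + x i else 0))"
    if "h \<in> \<H>" "\<forall>i<N. \<bar>x i\<bar> < \<rho>" for h and x :: "nat \<Rightarrow> real"
    using q[OF that(1)] \<rho>le(2)[OF that(1)] that(2) unfolding F_def by (meson less_le_trans)
  have "finite (F ` \<H>)" "\<And>G. G \<in> F ` \<H> \<Longrightarrow> rhol (Suc p) \<rho> G" using \<H> F by auto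
  \<comment> \<open>The interval bound \<open>\<delta>\<close> is fixed before the starting point;
    only afterwards is a point of the sequence chosen within \<open>\<delta>\<close> of
    \<open>l\<close>.\<close>
  from curve_sections[OF this \<rho>] obtain \<delta> where \<delta>: "\<delta> > 0" and sec: "\<forall>x0::nat\<Rightarrow>real. 0 < x0 0 \<and> (\<forall>i<Suc p. \<bar>x0 i\<bar> < \<delta>) \<longrightarrow>
    (\<exists>x::real\<Rightarrow>nat\<Rightarrow>real. (\<forall>i. continuous_on {0<..<\<delta>} (\<lambda>t. x t i)) \<and> (\<forall>i<Suc p. x (x0 0) i = x0 i) \<and>
       (\<forall>t\<in>{0<..<\<delta>}. x t 0 = t \<and> (\<forall>i<Suc p. \<bar>x t i\<bar> < \<rho>)) \<and>
       (\<forall>G\<in>F ` \<H>. (\<forall>t\<in>{0<..<\<delta>}. G (\<lambda>i. of_real (x t i)) = 0) \<or> (\<forall>t\<in>{0<..<\<delta>}. G (\<lambda>i. of_real (x t i)) \<noteq> 0)))"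
    by blast
  obtain k where k: "X (\<sigma> k) \<in> bas D" "\<forall>i<N. \<bar>X (\<sigma> k) i - l i\<bar> < \<delta>"
    using frequently_eventually_conj[OF D(2) near[OF \<delta>]] by (auto dest: frequently_ex)
  define y where "y = X (\<sigma> k)"
  have yR: "y \<in> Rn N" using X AN(3) by (auto simp: y_def)
  have y0: "0 < y 0" "y 0 < \<delta>" using X[of "\<sigma> k"] k(2) \<open>l 0 = 0\<close> by (auto simp: y_def N_def)
  have "0 < (\<lambda>i. y i - l i) 0 \<and> (\<forall>i<Suc p. \<bar>(\<lambda>i. y i - l i) i\<bar> < \<delta>)"
    using y0 k(2) \<open>l 0 = 0\<close> by (auto simp: y_def N_def)
  from sec[rule_format, OF this] obtain x :: "real \<Rightarrow> nat \<Rightarrow> real"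
    where xc: "\<forall>i. continuous_on {0<..<\<delta>} (\<lambda>t. x t i)" and x0: "\<forall>i<Suc p. x (y 0 - l 0) i = y i - l i"
      and xt: "\<forall>t\<in>{0<..<\<delta>}. x t 0 = t \<and> (\<forall>i<Suc p. \<bar>x t i\<bar> < \<rho>)"
      and xF: "\<forall>G\<in>F ` \<H>. (\<forall>t\<in>{0<..<\<delta>}. G (\<lambda>i. of_real (x t i)) = 0) \<or> (\<forall>t\<in>{0<..<\<delta>}. G (\<lambda>i. of_real (x t i)) \<noteq> 0)"
    by blast
  define w where "w t = (\<lambda>i. if i < N then l i + x t i else 0)" for t
  have wy: "w (y 0) = y"
    using x0 \<open>l 0 = 0\<close> yR by (auto simp: w_def N_def Rn_iff)
  have Fw: "F h (\<lambda>i. of_real (x t i)) = of_real (h (w t))" if "h \<in> \<H>" "t \<in> {0<..<\<delta>}" for h t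
    unfolding w_def using xt that by (intro Fh) (auto simp: N_def)
  have hw: "(\<forall>t\<in>{0<..<\<delta>}. h (w t) = 0) \<or> (\<forall>t\<in>{0<..<\<delta>}. h (w t) \<noteq> 0)" if "h \<in> \<H>" for h
    using xF that Fw[OF that] by (auto simp: ball_simps)
  have hc: "continuous_on {0<..<\<delta>} (\<lambda>t. h (w t))" if h: "h \<in> \<H>" for h
  proof -
    have "continuous_on {0<..<\<delta>} (\<lambda>t. F h (\<lambda>i. of_real (x t i)))"
    proof (rule continuous_on_compose2[OF cholD(1)[OF rhol_chol[OF F[OF h]]]])
      show "continuous_on {0<..<\<delta>} (\<lambda>t i. complex_of_real (x t i))"
        using xc by (intro continuous_on_coordinatewise_then_product continuous_on_of_real) auto
    qed (use xt in \<open>auto simp: polydisc_def\<close>)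
    then have "continuous_on {0<..<\<delta>} (\<lambda>t. Re (F h (\<lambda>i. of_real (x t i))))" by (intro continuous_intros)
    then show ?thesis by (rule continuous_on_eq) (use Fw[OF h] in auto)
  qed
  have wbas: "w t \<in> bas D" if t: "t \<in> {0<..<\<delta>}" for t
  proof -
    have "w t \<in> U"
    proof (rule \<rho>1(2))
      show "w t \<in> Rn N" by (simp add: w_def Rn_iff)
      show "\<forall>i<N. \<bar>w t i - l i\<bar> < \<rho>1" using xt t \<rho>le(1) by (force simp: w_def N_def)
    qed
    moreover have "h (w t) = 0" if "h \<in> fst D" for h
    proof -
      have "h (w (y 0)) = 0" unfolding wy using k(1) that by (simp add: bas_def y_def)
      then show ?thesis using hw[of h] that t y0 by (auto simp: \<H>_def)
    qed
    moreover have "h (w t) > 0" if "h \<in> snd D" for h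
    proof -
      have pos: "h (w (y 0)) > 0" unfolding wy using k(1) that by (simp add: bas_def y_def)
      have hH: "h \<in> \<H>" using that by (simp add: \<H>_def)
      have nz: "h (w s) \<noteq> 0" if "s \<in> {0<..<\<delta>}" for s using hw[OF hH] pos y0 that by force
      \<comment> \<open>Along the curve \<open>h\<close> is continuous and has no zero, so its sign
        is locally constant and hence constant.\<close>
      have "(h (w t) > 0) = (h (w (y 0)) > 0)"
      proof (rule locally_constant_on_interval[of \<delta> "\<lambda>s. h (w s) > 0"])
        fix s assume s: "s \<in> {0<..<\<delta>}"
        have "isCont (\<lambda>s. h (w s)) s" 
          by (rule bspec[OF iffD1[OF continuous_on_eq_continuous_at[OF open_greaterThanLessThan] hc[OF hH]] s])
        then have lim: "((\<lambda>s. h (w s)) \<longlongrightarrow> h (w s)) (at s)" by (simp add: isCont_def)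
        show "\<forall>\<^sub>F u in at s. (h (w u) > 0) = (h (w s) > 0)"
        proof (cases "h (w s) > 0")
          case True then show ?thesis using order_tendstoD(1)[OF lim True] by simp
        next
          case False
          then have "h (w s) < 0" using nz[OF s] by simp
          from order_tendstoD(2)[OF lim this] show ?thesis
            by eventually_elim (use False in auto)
        qed
      qed (use t y0 in auto)
      then show ?thesis using pos by simp
    qed
    ultimately show ?thesis by (simp add: bas_def)
  qed
  have "single t \<in> T" if "0 < t" "t < \<delta>" for t
  proof -
    have t: "t \<in> {0<..<\<delta>}" using that by simp
    have "w t \<in> A" using wbas[OF t] AU D(1) by blast
    moreover have "single t = proj 1 (w t)"
      using xt t \<open>l 0 = 0\<close> by (auto simp: single_def proj_def w_def N_def)
    ultimately show ?thesis by (auto simp: A(3))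
  qed
  then show ?thesis using \<delta> by blast
qed

text \<open>Suppose every small parameter lies in \<open>T\<close>. The linear bounds confine the
  solutions of \<open>\<tau> t = c\<close> to a compact interval, so for small \<open>c\<close>
  there is a last solution, and it is small; membership in \<open>T\<close> would produce a later
  one.\<close>

lemma injective_near_zero:
  fixes \<tau> :: "real \<Rightarrow> real"
  assumes e: "e > 0" and cont: "continuous_on {0<..<e} \<tau>"
    and gr: "bsub (1 + 1) (graph 1 (\<lambda>z. single (\<tau> (z 0))) (single ` {0<..<e}))"
    and K: "K > 0" "\<And>t. t \<in> {0<..<e} \<Longrightarrow> t / K \<le> \<tau> t \<and> \<tau> t \<le> K * t"
  shows "\<exists>\<delta>>0. \<delta> \<le> e \<and> inj_on \<tau> {0<..<\<delta>}"
proof -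
  define \<Gamma> where "\<Gamma> = graph 1 (\<lambda>z. single (\<tau> (z 0))) (single ` {0<..<e})"
  have G: "z \<in> \<Gamma> \<longleftrightarrow> z \<in> Rn 2 \<and> z 0 \<in> {0<..<e} \<and> z 1 = \<tau> (z 0)" for z
  proof
    assume "z \<in> \<Gamma>"
    then obtain t where "t \<in> {0<..<e}" "z = join 1 (single t) (single (\<tau> t))"
      by (auto simp: \<Gamma>_def graph_def single_def)
    then show "z \<in> Rn 2 \<and> z 0 \<in> {0<..<e} \<and> z 1 = \<tau> (z 0)"
      by (auto simp: join_def single_def Rn_iff)
  next
    assume z: "z \<in> Rn 2 \<and> z 0 \<in> {0<..<e} \<and> z 1 = \<tau> (z 0)"
    have zi: "z i = join 1 (single (z 0)) (single (\<tau> (z 0))) i" for i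
    proof -
      consider "i = 0" | "i = 1" | "i \<ge> 2" by linarith
      then show ?thesis using z by cases (auto simp: join_def single_def Rn_iff)
    qed
    have "z = join 1 (single (z 0)) (single (\<tau> (single (z 0) 0)))" unfolding single_0 by (rule ext) (rule zi)
    then show "z \<in> \<Gamma>" unfolding \<Gamma>_def graph_def using z by blast
  qed
  define T where "T = single ` {t. 0 < t \<and> (\<exists>u. t < u \<and> u < e \<and> \<tau> u = \<tau> t)}"
  have "bsub 1 T"
  proof -
    \<comment> \<open>The coordinates are the parameter \<open>t\<close>, the common value, and the
      later parameter \<open>u\<close>; the graph is imposed on the first with the second and on the
      third with the second.\<close>
    define \<sigma>1 where "\<sigma>1 = (\<lambda>i::nat. i)"
    define \<sigma>2 where "\<sigma>2 = (\<lambda>i::nat. if i = 0 then 2 else 1::nat)"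
    define B where "B = 1 + e + K * e"
    define C where "C = {z \<in> Box (1 + 2) B. (sel (1 + 1) \<sigma>1 z \<in> \<Gamma> \<and> sel (1 + 1) \<sigma>2 z \<in> \<Gamma>) \<and> z 2 - z 0 > 0}"
    have "dfn (1 + 2) (\<lambda>z. (sel (1 + 1) \<sigma>1 z \<in> \<Gamma> \<and> sel (1 + 1) \<sigma>2 z \<in> \<Gamma>) \<and> z 2 - z 0 > 0)"
      by (intro dfn_conj dfn_sel dfn_pos analytic_diff analytic_intros gr[folded \<Gamma>_def]) (auto simp: \<sigma>1_def \<sigma>2_def)
    then have "bsub (1 + 2) C" by (simp only: dfn_def C_def)
    then have "bsub 1 (proj 1 ` C)" by (rule bsub_proj)
    moreover have "proj 1 ` C = T"
    proof
      show "proj 1 ` C \<subseteq> T"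
      proof
        fix y assume "y \<in> proj 1 ` C"
        then obtain z where z: "z \<in> C" "y = proj 1 z" by blast
        have "y = single (z 0)" using z by (auto simp: proj_def single_def)
        moreover have "0 < z 0" "z 1 = \<tau> (z 0)" "z 2 < e" "z 1 = \<tau> (z 2)" "z 0 < z 2"
          using z(1) by (auto simp: C_def G sel_def \<sigma>1_def \<sigma>2_def)
        ultimately show "y \<in> T"
          unfolding T_def by (intro image_eqI[of _ single "z 0"]) (auto intro!: exI[of _ "z 2"])
      qed
      show "T \<subseteq> proj 1 ` C"
      proof
        fix y assume "y \<in> T"
        then obtain t u where t: "0 < t" "t < u" "u < e" "\<tau> u = \<tau> t" "y = single t" by (auto simp: T_def)
        define z where "z = (\<lambda>i::nat. if i = 0 then t else if i = 1 then \<tau> t else if i = 2 then u else 0)"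
        have "0 < \<tau> t" using K(1) K(2)[of t] t by (auto intro: less_le_trans[OF divide_pos_pos])
        have "\<tau> t \<le> K * t" using K(2)[of t] t by auto
        also have "\<dots> \<le> K * e" using K(1) t by simp
        finally have "\<tau> t \<le> K * e" .
        have "0 < K * e" using K e by simp
        have "z \<in> Box (1 + 2) B"
          using t \<open>0 < \<tau> t\<close> \<open>\<tau> t \<le> K * e\<close> \<open>0 < K * e\<close> by (auto simp: Box_def Rn_iff z_def B_def)
        moreover have "sel (1 + 1) \<sigma>1 z \<in> \<Gamma>" "sel (1 + 1) \<sigma>2 z \<in> \<Gamma>"
          using t by (auto simp: G sel_def \<sigma>1_def \<sigma>2_def z_def Rn_iff)
        ultimately have "z \<in> C" using t by (simp add: C_def z_def)
        moreover have "y = proj 1 z" using t by (auto simp: proj_def single_def z_def)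
        ultimately show "y \<in> proj 1 ` C" by blast
      qed
    qed
    ultimately show ?thesis by simp
  qed
  have single_T: "single t \<in> T \<longleftrightarrow> 0 < t \<and> (\<exists>u. t < u \<and> u < e \<and> \<tau> u = \<tau> t)" for t
  proof -
    have "single t = single s \<Longrightarrow> t = s" for s by (metis single_def)
    then show ?thesis by (auto simp: T_def)
  qed
  show ?thesis
  proof (cases "\<forall>d>0. \<exists>t. 0 < t \<and> t < d \<and> single t \<in> T")
    case True
    then obtain \<delta> where \<delta>: "\<delta> > 0" "\<And>t. 0 < t \<Longrightarrow> t < \<delta> \<Longrightarrow> single t \<in> T"
      using bsub_one_dim_tame[OF \<open>bsub 1 T\<close>] by blast
    define d where "d = min \<delta> e"
    \<comment> \<open>Chosen so that \<open>K * K * t1 < d\<close>: all solutions of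
      \<open>\<tau> t = \<tau> t1\<close> are at most \<open>K * c\<close>, hence below
      \<open>d\<close>, where every parameter is in \<open>T\<close>.\<close>
    define t1 where "t1 = d / (2 * (K * K + 1))"
    have d: "d > 0" "d \<le> \<delta>" "d \<le> e" using \<delta> e by (auto simp: d_def)
    have KK: "K * K > 0" using K by simp
    have t1: "t1 > 0" "t1 < d" "K * K * t1 < d"
    proof -
      define x where "x = 2 * (K * K + 1)"
      have x: "x > 1" "K * K < x" using KK by (simp_all add: x_def)
      have tx: "x * t1 = d" unfolding t1_def x_def[symmetric] using x by simp
      show "t1 > 0" using d x unfolding t1_def x_def[symmetric] by simp
      then show "t1 < d" "K * K * t1 < d"
        using mult_strict_right_mono[OF x(1)] mult_strict_right_mono[OF x(2)] tx by fastforce+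
    qed
    have t1e: "t1 \<in> {0<..<e}" using t1 d by auto
    define c where "c = \<tau> t1"
    have c: "c \<le> K * t1" "t1 / K \<le> c" "c > 0" using K(2)[OF t1e] K(1) t1 unfolding c_def
      by (auto intro: less_le_trans[OF divide_pos_pos])
    have Kc: "K * c < d"
    proof -
      have "K * c \<le> K * (K * t1)" using c K by (intro mult_left_mono) auto
      then show ?thesis using t1 by (simp add: mult.assoc)
    qed
    have bnd: "c / K \<le> t \<and> t \<le> K * c" if "t \<in> {0<..<e}" "\<tau> t = c" for t
      using K(2)[OF that(1)] that(2) K(1) by (simp add: field_simps)
    define L where "L = {t \<in> {c / K..K * c}. \<tau> t = c}"
    have sub: "{c / K..K * c} \<subseteq> {0<..<e}"
    proof
      fix t assume "t \<in> {c / K..K * c}"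
      moreover have "0 < c / K" using c K by simp
      ultimately show "t \<in> {0<..<e}" using Kc d by auto
    qed
    have "closed L" unfolding L_def
      using continuous_closed_preimage[OF continuous_on_subset[OF cont sub], of "{c}"] by (simp add: vimage_def Int_def)
    moreover have "bounded L" by (rule bounded_subset[of "{c / K..K * c}"]) (auto simp: L_def)
    ultimately have "compact L" by (simp add: compact_eq_bounded_closed)
    moreover have "t1 \<in> L" using bnd[OF t1e] by (auto simp: L_def c_def)
    ultimately obtain m where m: "m \<in> L" "\<And>t. t \<in> L \<Longrightarrow> t \<le> m" using compact_attains_sup[of L] by blast
    have "m < \<delta>" "0 < m" using m(1) Kc d sub by (auto simp: L_def)
    then obtain u where u: "m < u" "u < e" "\<tau> u = \<tau> m" using \<delta>(2)[of m] by (auto simp: single_T)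
    have "u \<in> L" using bnd[of u] u m(1) \<open>0 < m\<close> by (auto simp: L_def)
    then show ?thesis using m(2)[of u] u(1) by simp
  next
    case False
    then obtain d where d: "d > 0" "\<And>t. 0 < t \<Longrightarrow> t < d \<Longrightarrow> single t \<notin> T" by blast
    define \<delta> where "\<delta> = min d e"
    have no: "\<tau> t \<noteq> \<tau> u" if "0 < t" "t < u" "u < \<delta>" for t u
    proof
      assume "\<tau> t = \<tau> u"
      then have "single t \<in> T" using that by (auto simp: single_T \<delta>_def)
      moreover have "t < d" using that by (simp add: \<delta>_def)
      ultimately show False using d(2)[of t] that by blast
    qed
    have "inj_on \<tau> {0<..<\<delta>}"
    proof (rule inj_onI)
      fix t u assume tu: "t \<in> {0<..<\<delta>}" "u \<in> {0<..<\<delta>}" "\<tau> t = \<tau> u"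
      show "t = u"
      proof (rule ccontr)
        assume "t \<noteq> u"
        then consider "t < u" | "u < t" by linarith
        then show False using no[of t u] no[of u t] tu by cases auto
      qed
    qed
    then show ?thesis using d e by (intro exI[of _ \<delta>]) (auto simp: \<delta>_def)
  qed
qed

section \<open>Germs of l.v.a. maps\<close>

lemma nbd_Rn: "A \<subseteq> Rn n \<Longrightarrow> nbd n a e A \<subseteq> Rn n"
  by (auto simp: nbd_def)

lemma edist_nonneg [simp]: "0 \<le> edist n x a"
  by (simp add: edist_def)

text \<open>The upper l.v.a. bound keeps the values near \<open>b\<close>, so the graph of a
  representative is bounded and its global subanalyticity can be traded for
  \<open>bsub\<close>.\<close>

lemma graph_nbd_Box:
  assumes "f ` nbd n a e X \<subseteq> Rn m" "lva_on n (nbd n a e X) a m b K f"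
  shows "\<exists>R. graph n f (nbd n a e X) \<subseteq> Box (n + m) R"
proof -
  define S where "S = (\<Sum>i<n. \<bar>a i\<bar>) + (\<Sum>i<m. \<bar>b i\<bar>)"
  have S: "\<bar>a i\<bar> \<le> S" if "i < n" for i
    using that unfolding S_def by (intro order_trans[OF member_le_sum[of i "{..<n}" "\<lambda>i. \<bar>a i\<bar>"]]) (auto intro: sum_nonneg)
  have S': "\<bar>b i\<bar> \<le> S" if "i < m" for i
    using that unfolding S_def by (intro order_trans[OF member_le_sum[of i "{..<m}" "\<lambda>i. \<bar>b i\<bar>"]]) (auto intro: sum_nonneg)
  have K: "K > 0" using assms(2) by (simp add: lva_on_def)
  define R where "R = S + \<bar>e\<bar> + K * \<bar>e\<bar> + 1"
  have "graph n f (nbd n a e X) \<subseteq> Box (n + m) R"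
  proof
    fix z assume "z \<in> graph n f (nbd n a e X)"
    then obtain x where x: "x \<in> nbd n a e X" "z = join n x (f x)" by (auto simp: graph_def)
    have ex: "edist n x a < e" using x by (simp add: nbd_def)
    have "edist m (f x) b \<le> K * edist n x a" using assms(2) x(1) by (simp add: lva_on_def)
    also have "\<dots> \<le> K * \<bar>e\<bar>" using ex K by (intro mult_left_mono) auto
    finally have fx: "edist m (f x) b \<le> K * \<bar>e\<bar>" .
    have Ke: "0 \<le> K * \<bar>e\<bar>" using K by simp
    have "\<bar>z i\<bar> < R" if "i < n + m" for i
    proof (cases "i < n")
      case True
      then show ?thesis using abs_coord_le_edist[OF True, of x a] S[OF True] ex Ke by (simp add: x(2) join_def R_def)
    next
      case False
      then have i: "i - n < m" using that by simp
      have "\<bar>f x (i - n)\<bar> \<le> K * \<bar>e\<bar> + S" using abs_coord_le_edist[OF i, of "f x" b] S'[OF i] fx by linarith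
      then show ?thesis using False by (simp add: x(2) join_def R_def)
    qed
    moreover have "z \<in> Rn (n + m)" unfolding x(2) using assms(1) x(1) by (intro join_Rn) auto
    ultimately show "z \<in> Box (n + m) R" by (simp add: Box_def)
  qed
  then show ?thesis by blast
qed

text \<open>The pieces of a cover are restricted only near the vertex; away from it they may leave
  \<open>Rn n\<close>.\<close>

definition near_Rn :: "nat \<Rightarrow> vec \<Rightarrow> vec set \<Rightarrow> bool" where
  "near_Rn n a X \<longleftrightarrow> (\<exists>e>0. nbd n a e X \<subseteq> Rn n)"

lemma near_Rn_subset: "X \<subseteq> Rn n \<Longrightarrow> near_Rn n a X"
  unfolding near_Rn_def by (intro exI[of _ 1] conjI nbd_Rn) simp_all

lemma lva_on_subset: "lva_on m D x0 m' x0' K f \<Longrightarrow> D' \<subseteq> D \<Longrightarrow> lva_on m D' x0 m' x0' K f"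
  by (auto simp: lva_on_def)

text \<open>One pair of constants serves every smaller radius: cutting the graph by a ball is a
  polynomial condition on its first \<open>n\<close> coordinates. Later arguments can therefore
  shrink the radius at will.\<close>

lemma lva_germE:
  assumes f: "lva_germ n X a m Y b f" and X: "near_Rn n a X"
  obtains e K where "e > 0" "K > 0" "\<forall>e'. 0 < e' \<longrightarrow> e' \<le> e \<longrightarrow>
    bmap n (nbd n a e' X) m f \<and> f ` nbd n a e' X \<subseteq> Y \<and> lva_on n (nbd n a e' X) a m b K f"
proof -
  obtain e1 K where e1: "e1 > 0" "subanalytic_map n (nbd n a e1 X) m Y f" "lva_on n (nbd n a e1 X) a m b K f"
    using f unfolding lva_germ_def by blast
  obtain e2 where e2: "e2 > 0" "nbd n a e2 X \<subseteq> Rn n" using X unfolding near_Rn_def by blast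
  define e where "e = min e1 e2"
  have e: "e > 0" using e1 e2 by (simp add: e_def)
  have K: "K > 0" using e1(3) by (simp add: lva_on_def)
  have gs: "globally_subanalytic (n + m) (graph n f (nbd n a e1 X))" using e1(2) by (simp add: subanalytic_map_def)
  have fR: "f ` nbd n a e1 X \<subseteq> Rn m"
  proof
    fix y assume "y \<in> f ` nbd n a e1 X"
    then obtain x where x: "x \<in> nbd n a e1 X" "y = f x" by blast
    then have "join n x (f x) \<in> Rn (n + m)" using gs by (auto simp: globally_subanalytic_def graph_def)
    then have "join n x (f x) (n + i) = 0" if "i \<ge> m" for i using that unfolding Rn_iff by simp
    then show "y \<in> Rn m" using x by (auto simp: Rn_iff join_def)
  qed
  obtain R where R: "graph n f (nbd n a e1 X) \<subseteq> Box (n + m) R" using graph_nbd_Box[OF fR e1(3)] by blast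
  have g: "bsub (n + m) (graph n f (nbd n a e1 X))" using gs globally_subanalytic_iff_bsub[OF R] by simp
  have main: "bmap n (nbd n a e' X) m f \<and> f ` nbd n a e' X \<subseteq> Y \<and> lva_on n (nbd n a e' X) a m b K f"
    if e': "0 < e'" "e' \<le> e" for e'
  proof -
    have sub: "nbd n a e' X \<subseteq> nbd n a e1 X" "nbd n a e' X \<subseteq> nbd n a e2 X" using e' by (auto simp: nbd_def e_def)
    have ed: "edist n (join n x y) a = edist n x a" for x y
      unfolding edist_def by (rule L2_set_cong) (auto simp: join_def)
    have "graph n f (nbd n a e' X) = {z \<in> graph n f (nbd n a e1 X). edist n z a < e'}"
      using e' by (auto simp: graph_def ed nbd_def e_def)
    moreover have "bsub (n + m) {z \<in> graph n f (nbd n a e1 X). edist n z a < e'}"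
      by (intro bsub_dfn g dfn_edist) simp
    moreover have "continuous_map (subtopology (Euclidean_space n) (nbd n a e' X)) (Euclidean_space m) f"
      using e1(2) sub(1) continuous_map_from_subtopology_mono unfolding subanalytic_map_def by blast
    moreover have "f ` nbd n a e' X \<subseteq> Rn m" using image_mono[OF sub(1), of f] fR by (rule subset_trans)
    moreover have "nbd n a e' X \<subseteq> Rn n" using sub(2) e2(2) by (rule subset_trans)
    ultimately have "bmap n (nbd n a e' X) m f" unfolding bmap_def by simp
    moreover have "f ` nbd n a e' X \<subseteq> Y" using e1(2) sub(1) unfolding subanalytic_map_def by blast
    ultimately show ?thesis using lva_on_subset[OF e1(3) sub(1)] by blast
  qed
  show thesis by (rule that[OF e K]) (use main in blast)
qed

lemma lva_germI:
  assumes "e > 0" "bmap n (nbd n a e X) m f" "f ` nbd n a e X \<subseteq> Y" "lva_on n (nbd n a e X) a m b K f"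
  shows "lva_germ n X a m Y b f"
proof -
  have b: "bsub (n + m) (graph n f (nbd n a e X))" using assms(2) by (simp add: bmap_def)
  obtain R where R: "graph n f (nbd n a e X) \<subseteq> Box (n + m) R" using bsub_Box[OF b] .
  have "globally_subanalytic (n + m) (graph n f (nbd n a e X))" using globally_subanalytic_iff_bsub[OF R] b by simp
  then have "subanalytic_map n (nbd n a e X) m Y f" using assms(2,3) by (simp add: subanalytic_map_def bmap_def)
  then show ?thesis unfolding lva_germ_def using assms by blast
qed

text \<open>The upper bound of \<open>f\<close> tells how small the source must be: within radius
  \<open>e2 / K1\<close> the image stays in the neighbourhood on which \<open>g\<close> is
  controlled. The constants multiply.\<close>

lemma lva_germ_comp:
  assumes f: "lva_germ n X a m Y b f" and g: "lva_germ m Y b k Z c g"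
    and R: "near_Rn n a X" "near_Rn m b Y"
  shows "lva_germ n X a k Z c (g \<circ> f)"
proof -
  obtain e1 K1 where e1: "e1 > 0" "K1 > 0" "\<forall>e'. 0 < e' \<longrightarrow> e' \<le> e1 \<longrightarrow>
    bmap n (nbd n a e' X) m f \<and> f ` nbd n a e' X \<subseteq> Y \<and> lva_on n (nbd n a e' X) a m b K1 f"
    by (rule lva_germE[OF f R(1)])
  obtain e2 K2 where e2: "e2 > 0" "K2 > 0" "\<forall>e'. 0 < e' \<longrightarrow> e' \<le> e2 \<longrightarrow>
    bmap m (nbd m b e' Y) k g \<and> g ` nbd m b e' Y \<subseteq> Z \<and> lva_on m (nbd m b e' Y) b k c K2 g"
    by (rule lva_germE[OF g R(2)])
  define e where "e = min e1 (e2 / K1)"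
  have e: "e > 0" "e \<le> e1" "e \<le> e2 / K1" using e1 e2 by (auto simp: e_def)
  note F = e1(3)[rule_format, OF e(1,2)]
  note G = e2(3)[rule_format, OF e2(1) order_refl]
  have img: "f ` nbd n a e X \<subseteq> nbd m b e2 Y"
  proof
    fix y assume "y \<in> f ` nbd n a e X"
    then obtain x where x: "x \<in> nbd n a e X" "y = f x" by blast
    have "edist m (f x) b \<le> K1 * edist n x a" using F x by (auto simp: lva_on_def)
    also have "\<dots> < K1 * e" using x e1(2) by (simp add: nbd_def)
    also have "\<dots> \<le> e2" using e(3) e1(2) by (simp add: field_simps)
    finally show "y \<in> nbd m b e2 Y" using F x by (auto simp: nbd_def)
  qed
  show ?thesis
  proof (rule lva_germI[OF e(1)])
    show "bmap n (nbd n a e X) k (g \<circ> f)" by (rule bmap_comp[OF F[THEN conjunct1] G[THEN conjunct1] img])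
    show "(g \<circ> f) ` nbd n a e X \<subseteq> Z" unfolding image_comp[symmetric] by (rule subset_trans[OF image_mono[OF img] G[THEN conjunct2, THEN conjunct1]])
    show "lva_on n (nbd n a e X) a k c (K2 * K1) (g \<circ> f)"
      unfolding lva_on_def
    proof (intro conjI ballI)
      show "0 < K2 * K1" using e1 e2 by simp
      fix x assume x: "x \<in> nbd n a e X"
      then have fx: "f x \<in> nbd m b e2 Y" using img by blast
      have 1: "1 / K1 * edist n x a \<le> edist m (f x) b" "edist m (f x) b \<le> K1 * edist n x a"
        using F x by (auto simp: lva_on_def)
      have 2: "1 / K2 * edist m (f x) b \<le> edist k (g (f x)) c" "edist k (g (f x)) c \<le> K2 * edist m (f x) b"
        using G fx by (auto simp: lva_on_def)
      have "1 / K2 * (1 / K1 * edist n x a) \<le> 1 / K2 * edist m (f x) b"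
        using 1 e2(2) by (intro mult_left_mono) auto
      then show "1 / (K2 * K1) * edist n x a \<le> edist k ((g \<circ> f) x) c" using 2 by simp
      have "K2 * edist m (f x) b \<le> K2 * (K1 * edist n x a)" using 1 e2(2) by (intro mult_left_mono) auto
      then show "edist k ((g \<circ> f) x) c \<le> K2 * K1 * edist n x a" using 2 by simp
    qed
  qed
qed

lemma lva_germ_target:
  assumes f: "lva_germ n X a m Y b f" and R: "near_Rn n a X"
    and e0: "e0 > 0" "f ` nbd n a e0 X \<subseteq> Y'"
  shows "lva_germ n X a m Y' b f"
proof -
  obtain e1 K1 where e1: "e1 > 0" "K1 > 0" "\<forall>e'. 0 < e' \<longrightarrow> e' \<le> e1 \<longrightarrow>
    bmap n (nbd n a e' X) m f \<and> f ` nbd n a e' X \<subseteq> Y \<and> lva_on n (nbd n a e' X) a m b K1 f"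
    by (rule lva_germE[OF f R(1)])
  have "0 < min e0 e1" "min e0 e1 \<le> e1" "nbd n a (min e0 e1) X \<subseteq> nbd n a e0 X" using e0 e1 by (auto simp: nbd_def)
  then show ?thesis using e1(3)[rule_format, of "min e0 e1"] e0(2) by (intro lva_germI[of "min e0 e1"]) auto
qed

lemma lva_germ_mono: "lva_germ n X a m Y b f \<Longrightarrow> Y \<subseteq> Y' \<Longrightarrow> lva_germ n X a m Y' b f"
proof -
  assume f: "lva_germ n X a m Y b f" and Y: "Y \<subseteq> Y'"
  obtain e K where e: "e > 0" "subanalytic_map n (nbd n a e X) m Y f" "lva_on n (nbd n a e X) a m b K f"
    using f unfolding lva_germ_def by blast
  have "subanalytic_map n (nbd n a e X) m Y' f"
    using e(2) order_trans[OF _ Y] unfolding subanalytic_map_def by simp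
  then show ?thesis unfolding lva_germ_def using e by blast
qed

section \<open>Points as germs on the positive half-line\<close>

abbreviation "posline \<equiv> single ` {0<..}"

lemma nbd_posline: "nbd 1 origin e posline = single ` {0<..<e}" "nbd (Suc 0) origin e posline = single ` {0<..<e}"
  by (auto simp: nbd_def edist_def L2_set_def single_def)

lemma near_posline: "near_Rn 1 origin posline"
  by (rule near_Rn_subset) auto

lemma edist_single [simp]: "edist (Suc 0) (single t) origin = \<bar>t\<bar>"
  by (simp add: edist_def L2_set_def single_def)

lemma is_pointE:
  assumes "is_point m X x0 q"
  obtains e K where "e > 0" "K > 0" "bmap 1 (single ` {0<..<e}) m (\<lambda>z. q (z 0))"
    "\<forall>t\<in>{0<..<e}. q t \<in> X \<and> t / K \<le> edist m (q t) x0 \<and> edist m (q t) x0 \<le> K * t"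
proof -
  obtain e K where e: "e > 0" "K > 0" and H: "\<forall>e'. 0 < e' \<longrightarrow> e' \<le> e \<longrightarrow>
    bmap 1 (nbd 1 origin e' posline) m (\<lambda>z. q (z 0)) \<and> (\<lambda>z. q (z 0)) ` nbd 1 origin e' posline \<subseteq> X \<and>
    lva_on 1 (nbd 1 origin e' posline) origin m x0 K (\<lambda>z. q (z 0))"
    by (rule lva_germE[OF assms[unfolded is_point_def] near_posline])
  have bnd: "q t \<in> X \<and> t / K \<le> edist m (q t) x0 \<and> edist m (q t) x0 \<le> K * t" if "t \<in> {0<..<e}" for t
    using H[rule_format, OF e(1) order_refl] that unfolding nbd_posline by (auto simp: lva_on_def image_subset_iff)
  show thesis by (rule that[OF e]) (use bnd H[rule_format, OF e(1) order_refl] in \<open>simp_all add: nbd_posline\<close>)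
qed

lemma is_pointI:
  assumes "e > 0" "K > 0" "bmap 1 (single ` {0<..<e}) m (\<lambda>z. q (z 0))"
    "\<And>t. t \<in> {0<..<e} \<Longrightarrow> q t \<in> X \<and> t / K \<le> edist m (q t) x0 \<and> edist m (q t) x0 \<le> K * t"
  shows "is_point m X x0 q"
  unfolding is_point_def
proof (rule lva_germI[OF assms(1)])
  show "bmap 1 (nbd 1 origin e posline) m (\<lambda>z. q (z 0))" unfolding nbd_posline by (rule assms(3))
  show "(\<lambda>z. q (z 0)) ` nbd 1 origin e posline \<subseteq> X"
    unfolding nbd_posline image_image using assms(4) by (simp add: image_subset_iff)
  show "lva_on 1 (nbd 1 origin e posline) origin m x0 K (\<lambda>z. q (z 0))"
    unfolding nbd_posline lva_on_def using assms(2,4) by simp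
qed

lemma is_point_near:
  assumes "is_point m X x0 q" "e > 0"
  shows "\<forall>\<^sub>F t in at_right 0. q t \<in> nbd m x0 e X"
proof -
  obtain d K where d: "d > 0" "K > 0" "bmap 1 (single ` {0<..<d}) m (\<lambda>z. q (z 0))" "\<forall>t\<in>{0<..<d}. q t \<in> X \<and> t / K \<le> edist m (q t) x0 \<and> edist m (q t) x0 \<le> K * t"
    by (rule is_pointE[OF assms(1)])
  have "min d (e / K) > 0" using d assms by simp
  then have "\<forall>\<^sub>F t in at_right 0. t \<in> {0<..<min d (e / K)}" using eventually_at_right_real by blast
  then show ?thesis
  proof eventually_elim
    case (elim t)
    then have "K * t < e" using d by (simp add: field_simps)
    then show ?case using d(4)[rule_format, of t] elim by (auto simp: nbd_def)
  qed
qed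

lemma is_point_mono: "is_point m X x0 q \<Longrightarrow> X \<subseteq> Y \<Longrightarrow> is_point m Y x0 q"
  unfolding is_point_def by (rule lva_germ_mono)

lemma is_point_comp:
  assumes "is_point m X x0 q" "lva_germ m X x0 k Y y0 f" "near_Rn m x0 X"
  shows "is_point k Y y0 (f \<circ> q)"
  using lva_germ_comp[OF assms(1)[unfolded is_point_def] assms(2) near_posline assms(3)]
  unfolding is_point_def by (simp add: o_def)

lemma is_point_target:
  assumes "is_point m X x0 q" "\<forall>\<^sub>F t in at_right 0. q t \<in> Y"
  shows "is_point m Y x0 q"
proof -
  obtain d where d: "d > 0" "\<And>t. 0 < t \<Longrightarrow> t < d \<Longrightarrow> q t \<in> Y"
    using assms(2) unfolding eventually_at_right_field by auto
  show ?thesis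
    unfolding is_point_def
    by (rule lva_germ_target[OF assms(1)[unfolded is_point_def] near_posline d(1)]) (use d in \<open>auto simp: nbd_posline\<close>)
qed

section \<open>Cones over cubes\<close>

text \<open>Entry \<open>n\<close> is the height \<open>t\<close> and the other entries are
  \<open>t * y i\<close>, so the cube conditions on \<open>y\<close> become linear inequalities
  between entries.\<close>

lemma mem_cone_cube:
  "z \<in> germ_cone n (cube n) \<longleftrightarrow> z \<in> Rn (n + 1) \<and> z n > 0 \<and> (\<forall>i<n. 0 \<le> z i \<and> z i \<le> z n)"
proof
  assume "z \<in> germ_cone n (cube n)"
  then obtain y t where y: "y \<in> cube n" "t > 0" "z = join n (\<lambda>i. t * y i) (single t)" by (auto simp: germ_cone_def)
  have "z \<in> Rn (n + 1)" unfolding y(3) by (rule join_Rn) simp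
  moreover have "z n = t" using y by (simp add: join_def)
  moreover have "0 \<le> z i \<and> z i \<le> t" if "i < n" for i
    using y that by (auto simp: join_def cube_def mult_left_le)
  ultimately show "z \<in> Rn (n + 1) \<and> z n > 0 \<and> (\<forall>i<n. 0 \<le> z i \<and> z i \<le> z n)" using y by simp
next
  assume z: "z \<in> Rn (n + 1) \<and> z n > 0 \<and> (\<forall>i<n. 0 \<le> z i \<and> z i \<le> z n)"
  define y where "y = (\<lambda>i. if i < n then z i / z n else 0)"
  have "y \<in> cube n" using z by (auto simp: cube_def y_def Rn_iff)
  moreover have "z = join n (\<lambda>i. z n * y i) (single (z n))"
  proof (rule Rn_eqI[of _ "n + 1"])
    show "join n (\<lambda>i. z n * y i) (single (z n)) \<in> Rn (n + 1)" by (rule join_Rn) simp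
    show "z i = join n (\<lambda>i. z n * y i) (single (z n)) i" if "i < n + 1" for i
      using that z by (auto simp: join_def y_def less_Suc_eq)
  qed (use z in auto)
  ultimately show "z \<in> germ_cone n (cube n)" using z unfolding germ_cone_def by blast
qed

lemma germ_cone_mono: "A \<subseteq> B \<Longrightarrow> germ_cone n A \<subseteq> germ_cone n B"
  unfolding germ_cone_def by blast

lemma open_box_cube: "open_box n \<subseteq> cube n" "cube_boundary n \<subseteq> cube n"
  by (auto simp: open_box_def cube_boundary_def)

lemma nbd_origin_Box: "A \<subseteq> Rn n \<Longrightarrow> nbd n origin e A \<subseteq> Box n e"
proof
  fix x assume A: "A \<subseteq> Rn n" and x: "x \<in> nbd n origin e A"
  have "\<bar>x i\<bar> < e" if "i < n" for i using abs_coord_le_edist[OF that, of x origin] x by (simp add: nbd_def)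
  then show "x \<in> Box n e" using A x by (auto simp: nbd_def Box_def)
qed

lemma bsub_cone: "bsub (n + 1) (nbd (n + 1) origin e (germ_cone n (cube n)))"
proof -
  have B: "nbd (n + 1) origin e (germ_cone n (cube n)) \<subseteq> Box (n + 1) e"
    by (rule nbd_origin_Box) (auto simp: mem_cone_cube)
  have "nbd (n + 1) origin e (germ_cone n (cube n)) = {z \<in> Box (n + 1) e.
     ((z n > 0 \<and> (\<forall>i\<in>{..<n}. 0 \<le> z i \<and> 0 \<le> z n - z i)) \<and> edist (n + 1) z origin < e)}"
    using B by (auto simp: nbd_def mem_cone_cube Box_def subset_iff)
  moreover have "dfn (n + 1) (\<lambda>z. ((z n > 0 \<and> (\<forall>i\<in>{..<n}. 0 \<le> z i \<and> 0 \<le> z n - z i)) \<and> edist (n + 1) z origin < e))"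
    by (intro dfn_conj dfn_Ball dfn_pos dfn_nonneg dfn_edist analytic_diff analytic_intros) auto
  ultimately show ?thesis by (simp only: dfn_def)
qed

section \<open>Forgetting and inserting the homotopy coordinate\<close>

definition fsel :: "nat \<Rightarrow> nat \<Rightarrow> nat" where
  "fsel n i = (if i < n then i else n + 1)"

lemma forget_eq_sel: "forget n = sel (n + 1) (fsel n)"
  by (intro ext) (auto simp: forget_def sel_apply join_def single_def fsel_def)

lemma forget_apply: "i < n \<Longrightarrow> forget n z i = z i" "forget n z n = z (n + 1)"
  by (simp_all add: forget_def join_def)

lemma forget_cone:
  assumes "z \<in> germ_cone (n + 1) (cube (n + 1))" shows "forget n z \<in> germ_cone n (cube n)"
proof -
  have "forget n z \<in> Rn (n + 1)" by (simp add: forget_eq_sel)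
  then show ?thesis using assms by (simp add: mem_cone_cube forget_apply)
qed

text \<open>In the cone the forgotten coordinate is at most the height, so dropping it changes the
  norm by a bounded factor only; this is what makes \<open>forget\<close> l.v.a.\<close>

lemma edist_forget:
  assumes z: "z \<in> germ_cone (n + 1) (cube (n + 1))"
  shows "edist (n + 1) (forget n z) origin \<le> edist (n + 1 + 1) z origin"
    "edist (n + 1 + 1) z origin \<le> 2 * edist (n + 1) (forget n z) origin"
proof -
  define S where "S = (\<Sum>i<n. (z i)\<^sup>2)"
  have S: "S \<ge> 0" by (simp add: S_def sum_nonneg)
  have 1: "edist (n + 1) (forget n z) origin = sqrt (S + (z (n + 1))\<^sup>2)"
    by (simp add: edist_def L2_set_def S_def forget_apply)
  have 2: "edist (n + 1 + 1) z origin = sqrt (S + (z n)\<^sup>2 + (z (n + 1))\<^sup>2)"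
    by (simp add: edist_def L2_set_def S_def)
  have zn: "(z n)\<^sup>2 \<le> (z (n + 1))\<^sup>2" using z by (intro power_mono) (auto simp: mem_cone_cube)
  show "edist (n + 1) (forget n z) origin \<le> edist (n + 1 + 1) z origin"
    unfolding 1 2 by (rule real_sqrt_le_mono) simp
  have p: "0 \<le> (z (n + 1))\<^sup>2" by simp
  have "S + x + y \<le> 4 * (S + y)" if "x \<le> y" "0 \<le> y" for x y using that S by simp
  from this[OF zn p] have "sqrt (S + (z n)\<^sup>2 + (z (n + 1))\<^sup>2) \<le> sqrt (4 * (S + (z (n + 1))\<^sup>2))"
    by (rule real_sqrt_le_mono)
  also have "\<dots> = 2 * sqrt (S + (z (n + 1))\<^sup>2)" by (simp only: real_sqrt_mult real_sqrt_four)
  finally show "edist (n + 1 + 1) z origin \<le> 2 * edist (n + 1) (forget n z) origin" unfolding 1 2 .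
qed

lemma insert_level_apply:
  "i < n \<Longrightarrow> insert_level n s z i = z i" "insert_level n s z n = s * z n" "insert_level n s z (n + 1) = z n"
  by (simp_all add: insert_level_def join_def)

lemma forget_insert_level: "z \<in> Rn (n + 1) \<Longrightarrow> forget n (insert_level n s z) = z"
proof (rule Rn_eqI[of _ "n + 1"])
  show "forget n (insert_level n s z) \<in> Rn (n + 1)" by (simp add: forget_eq_sel)
  fix i assume "i < n + 1"
  then consider "i < n" | "i = n" by linarith
  then show "forget n (insert_level n s z) i = z i"
    using forget_apply(2)[of n "insert_level n s z"] insert_level_apply(3)[of n s z]
    by cases (simp_all add: forget_apply(1) insert_level_apply(1))
qed

text \<open>The part of the larger cone lying over \<open>C\<close>; applied to the pieces of a
  cover it gives the cover on which the homotopy is defined.\<close>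

definition pb :: "nat \<Rightarrow> vec set \<Rightarrow> vec set" where
  "pb n C = {z \<in> germ_cone (n + 1) (cube (n + 1)). forget n z \<in> C}"

lemma pb_cone: "pb n (germ_cone n (cube n)) = germ_cone (n + 1) (cube (n + 1))"
  using forget_cone by (auto simp: pb_def)

lemma nbd_pb:
  "nbd (n + 1 + 1) origin e (pb n C) =
   {z \<in> nbd (n + 1 + 1) origin e (germ_cone (n + 1) (cube (n + 1))). forget n z \<in> nbd (n + 1) origin e C}"
proof
  show "nbd (n + 1 + 1) origin e (pb n C) \<subseteq>
   {z \<in> nbd (n + 1 + 1) origin e (germ_cone (n + 1) (cube (n + 1))). forget n z \<in> nbd (n + 1) origin e C}"
  proof
    fix z assume "z \<in> nbd (n + 1 + 1) origin e (pb n C)"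
    then have z: "z \<in> germ_cone (n + 1) (cube (n + 1))" "forget n z \<in> C" "edist (n + 1 + 1) z origin < e"
      by (simp_all add: nbd_def pb_def)
    have "edist (n + 1) (forget n z) origin < e" using edist_forget(1)[OF z(1)] z(3) by (rule le_less_trans)
    then show "z \<in> {z \<in> nbd (n + 1 + 1) origin e (germ_cone (n + 1) (cube (n + 1))). forget n z \<in> nbd (n + 1) origin e C}"
      using z by (simp add: nbd_def)
  qed
qed (auto simp: nbd_def pb_def)

lemma bsub_pb:
  assumes "bsub (n + 1) (nbd (n + 1) origin e C)"
  shows "bsub (n + 1 + 1) (nbd (n + 1 + 1) origin e (pb n C))"
  unfolding nbd_pb forget_eq_sel
  by (intro bsub_dfn bsub_cone dfn_sel assms) (auto simp: fsel_def)

lemma bmap_forget: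
  assumes "bsub (n + 1 + 1) D" shows "bmap (n + 1 + 1) D (n + 1) (forget n)"
  unfolding forget_eq_sel by (intro bmap_sel assms) (auto simp: fsel_def)

lemma forget_germ:
  assumes "e > 0" "bsub (n + 1) (nbd (n + 1) origin e C)"
  shows "lva_germ (n + 1 + 1) (pb n C) origin (n + 1) C origin (forget n)"
proof (rule lva_germI[OF assms(1), where K = 2])
  show "bmap (n + 1 + 1) (nbd (n + 1 + 1) origin e (pb n C)) (n + 1) (forget n)"
    by (intro bmap_forget bsub_pb assms)
  show "forget n ` nbd (n + 1 + 1) origin e (pb n C) \<subseteq> C" by (auto simp: nbd_def pb_def)
  show "lva_on (n + 1 + 1) (nbd (n + 1 + 1) origin e (pb n C)) origin (n + 1) origin 2 (forget n)"
    unfolding lva_on_def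
  proof (intro conjI ballI)
    fix z assume "z \<in> nbd (n + 1 + 1) origin e (pb n C)"
    then have z: "z \<in> germ_cone (n + 1) (cube (n + 1))" by (auto simp: nbd_def pb_def)
    show "1 / 2 * edist (n + 1 + 1) z origin \<le> edist (n + 1) (forget n z) origin" using edist_forget(2)[OF z] by simp
    show "edist (n + 1) (forget n z) origin \<le> 2 * edist (n + 1 + 1) z origin"
      using edist_forget(1)[OF z] edist_nonneg[of "n + 1 + 1" z origin] by linarith
  qed simp
qed

lemma forget_point:
  assumes q: "cone_point (n + 1) A q" and A: "A \<subseteq> pb n C"
  shows "cone_point n C (forget n \<circ> q)"
proof -
  obtain e K where e: "e > 0" "K > 0" "bmap 1 (single ` {0<..<e}) (n + 1 + 1) (\<lambda>z. q (z 0))"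
    and H0: "\<forall>t\<in>{0<..<e}. q t \<in> A \<and> t / K \<le> edist (n + 1 + 1) (q t) origin \<and> edist (n + 1 + 1) (q t) origin \<le> K * t"
    by (rule is_pointE[OF q[unfolded cone_point_def]])
  note H = H0[rule_format]
  define D where "D = nbd (n + 1 + 1) origin (K * e + 1) (germ_cone (n + 1) (cube (n + 1)))"
  have qc: "q t \<in> germ_cone (n + 1) (cube (n + 1))" "forget n (q t) \<in> C" if "t \<in> {0<..<e}" for t
    using H[OF that] A by (auto simp: pb_def)
  have qD: "q t \<in> D" if "t \<in> {0<..<e}" for t
  proof -
    have "K * t < K * e" using that e by simp
    then show ?thesis using H[OF that] qc[OF that] by (auto simp: D_def nbd_def)
  qed
  have "bmap 1 (single ` {0<..<e}) (n + 1) (forget n \<circ> (\<lambda>z. q (z 0)))"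
    by (rule bmap_comp[OF e(3) bmap_forget[of n D]]) (use qD bsub_cone in \<open>auto simp: D_def\<close>)
  then have b: "bmap 1 (single ` {0<..<e}) (n + 1) (\<lambda>z. (forget n \<circ> q) (z 0))" by (simp add: o_def)
  show ?thesis
    unfolding cone_point_def
  proof (rule is_pointI[OF e(1) _ b, of "2 * K"])
    show "2 * K > 0" using e by simp
    fix t assume t: "t \<in> {0<..<e}"
    note E = edist_forget[OF qc(1)[OF t]] H[OF t]
    have "t / K \<le> 2 * edist (n + 1) (forget n (q t)) origin" using E by linarith
    then have "t / (2 * K) \<le> edist (n + 1) (forget n (q t)) origin" using e by (simp add: field_simps)
    moreover have "edist (n + 1) (forget n (q t)) origin \<le> 2 * K * t" using E e t mult_pos_pos[of K t] by simp
    ultimately show "(forget n \<circ> q) t \<in> C \<and> t / (2 * K) \<le> edist (n + 1) ((forget n \<circ> q) t) origin \<and>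
        edist (n + 1) ((forget n \<circ> q) t) origin \<le> 2 * K * t" using qc(2)[OF t] by simp
  qed
qed

text \<open>Cone coordinates store \<open>t * s\<close>, so the homotopy parameter along
  \<open>q\<close> is the ratio of entries \<open>n\<close> and \<open>n + 1\<close>. It varies with
  the parameter of \<open>q\<close> but does so subanalytically.\<close>

lemma ratio_point:
  assumes q: "cone_point (n + 1) A q" and A: "A \<subseteq> germ_cone (n + 1) (cube (n + 1))"
  shows "\<exists>e>0. bmap 1 (single ` {0<..<e}) 1 (\<lambda>z. single (q (z 0) n / q (z 0) (n + 1))) \<and>
     (\<forall>t\<in>{0<..<e}. q t n / q t (n + 1) \<in> {0..1})"
proof -
  obtain e K where e: "e > 0" "K > 0" "bmap 1 (single ` {0<..<e}) (n + 1 + 1) (\<lambda>z. q (z 0))"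
    and H0: "\<forall>t\<in>{0<..<e}. q t \<in> A \<and> t / K \<le> edist (n + 1 + 1) (q t) origin \<and> edist (n + 1 + 1) (q t) origin \<le> K * t"
    by (rule is_pointE[OF q[unfolded cone_point_def]])
  note H = H0[rule_format]
  define D where "D = nbd (n + 1 + 1) origin (K * e + 1) (germ_cone (n + 1) (cube (n + 1)))"
  have qc: "q t \<in> germ_cone (n + 1) (cube (n + 1))" if "t \<in> {0<..<e}" for t using H[OF that] A by auto
  have qD: "q t \<in> D" if "t \<in> {0<..<e}" for t
  proof -
    have "K * t < K * e" using that e by simp
    then show ?thesis using H[OF that] qc[OF that] by (auto simp: D_def nbd_def)
  qed
  have r: "bmap (n + 1 + 1) D 1 (\<lambda>z. single (z n / z (n + 1)))"
    by (rule bmap_ratio) (use bsub_cone[of "n + 1"] in \<open>auto simp: D_def nbd_def mem_cone_cube\<close>)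
  have "bmap 1 (single ` {0<..<e}) 1 ((\<lambda>z. single (z n / z (n + 1))) \<circ> (\<lambda>z. q (z 0)))"
    by (rule bmap_comp[OF e(3) r]) (use qD in auto)
  moreover have "q t n / q t (n + 1) \<in> {0..1}" if "t \<in> {0<..<e}" for t
    using qc[OF that] by (auto simp: mem_cone_cube)
  ultimately show ?thesis using e(1) by (auto simp: o_def)
qed

text \<open>The height \<open>\<tau>\<close> is comparable to the parameter and injective near zero,
  hence increasing. Its inverse \<open>g\<close> is subanalytic because swapping coordinates turns
  the graph of \<open>\<tau>\<close> into that of \<open>g\<close>, and \<open>q\<close> composed
  with \<open>g\<close> is normal.\<close>

lemma cone_point_normal_reparam:
  assumes q: "cone_point n A q" and A: "A \<subseteq> germ_cone n (cube n)"
  shows "\<exists>q' K. normal_point n A q' \<and> K > 0 \<and>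
     (\<forall>\<^sub>F t in at_right 0. 0 < q t n \<and> q t n \<le> K * t \<and> q' (q t n) = q t) \<and>
     filterlim (\<lambda>t. q t n) (at_right 0) (at_right 0)"
proof -
  obtain e K where e: "e > 0" "K > 0" "bmap 1 (single ` {0<..<e}) (n + 1) (\<lambda>z. q (z 0))"
    and H0: "\<forall>t\<in>{0<..<e}. q t \<in> A \<and> t / K \<le> edist (n + 1) (q t) origin \<and> edist (n + 1) (q t) origin \<le> K * t"
    by (rule is_pointE[OF q[unfolded cone_point_def]])
  note H = H0[rule_format]
  define \<tau> where "\<tau> t = q t n" for t
  \<comment> \<open>Every entry of a cone point is at most its height, so the norm is at most
    \<open>n + 1\<close> times the height; with the l.v.a. constant this gives the lower bound
    \<open>t / c\<close>.\<close>
  define c where "c = K * real (n + 1)"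
  have c: "c > 0" "K \<le> c" using e by (auto simp: c_def)
  have qc: "q t \<in> germ_cone n (cube n)" if "t \<in> {0<..<e}" for t using H[OF that] A by auto
  have \<tau>pos: "\<tau> t > 0" if "t \<in> {0<..<e}" for t using qc[OF that] by (simp add: \<tau>_def mem_cone_cube)
  have up: "\<tau> t \<le> K * t" if "t \<in> {0<..<e}" for t
    using abs_coord_le_edist[of n "n + 1" "q t" origin] H[OF that] by (auto simp: \<tau>_def)
  have lo: "t / c \<le> \<tau> t" if "t \<in> {0<..<e}" for t
  proof -
    have "edist (n + 1) (q t) origin \<le> (\<Sum>i<n + 1. \<bar>q t i\<bar>)"
      unfolding edist_def by (rule order_trans[OF L2_set_le_sum_abs]) simp
    also have "\<dots> \<le> (\<Sum>i<n + 1. \<tau> t)"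
      by (rule sum_mono) (use qc[OF that] in \<open>auto simp: \<tau>_def mem_cone_cube less_Suc_eq\<close>)
    finally have "t / K \<le> real (n + 1) * \<tau> t" using H[OF that] by simp
    then have "t / K / real (n + 1) \<le> \<tau> t" by (subst pos_divide_le_eq) (auto simp: mult.commute)
    then show ?thesis by (simp only: c_def divide_divide_eq_left)
  qed
  have bnd: "t / c \<le> \<tau> t \<and> \<tau> t \<le> c * t" if "t \<in> {0<..<e}" for t
    using lo[OF that] order_trans[OF up[OF that] mult_right_mono[OF c(2), of t]] that by auto
  have qR: "\<And>t. t \<in> {0<..<e} \<Longrightarrow> q t \<in> Rn (n + 1)" using qc by (simp add: mem_cone_cube)
  define D where "D = nbd (n + 1) origin (K * e + 1) (germ_cone n (cube n))"
  have qD: "q t \<in> D" if "t \<in> {0<..<e}" for t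
  proof -
    have "K * t < K * e" using that e by simp
    then show ?thesis using H[OF that] qc[OF that] by (auto simp: D_def nbd_def)
  qed
  have bt: "bmap 1 (single ` {0<..<e}) 1 (\<lambda>z. single (\<tau> (z 0)))"
  proof -
    have s: "bmap (n + 1) D 1 (sel 1 (\<lambda>_. n))" by (intro bmap_sel) (use bsub_cone in \<open>auto simp: D_def\<close>)
    have "bmap 1 (single ` {0<..<e}) 1 (sel 1 (\<lambda>_. n) \<circ> (\<lambda>z. q (z 0)))"
      by (rule bmap_comp[OF e(3) s]) (use qD in auto)
    then show ?thesis
      by (rule bmap_cong) (auto simp: sel_def single_def \<tau>_def)
  qed
  have cont_of_bmap: "continuous_on {0<..<d} (\<lambda>t. h (single t) i)"
    if "bmap 1 (single ` {0<..<d}) k h" "i < k" for d k h i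
  proof -
    have "continuous_map (subtopology (Euclidean_space 1) (single ` {0<..<d})) euclideanreal (\<lambda>x. h x i)"
      using that continuous_map_Euclidean_iff[of h "subtopology (Euclidean_space 1) (single ` {0<..<d})" k]
      by (auto simp: bmap_def)
    moreover have "continuous_map (top_of_set {0<..<d}) (subtopology (Euclidean_space 1) (single ` {0<..<d})) single"
    proof -
      have "continuous_map (top_of_set {0<..<d}) (Euclidean_space 1) single"
        by (subst continuous_map_Euclidean_iff) auto
      then show ?thesis by (auto simp: continuous_map_in_subtopology)
    qed
    ultimately have "continuous_map (top_of_set {0<..<d}) euclideanreal ((\<lambda>x. h x i) \<circ> single)"
      by (rule continuous_map_compose[rotated])
    then show ?thesis by (simp add: o_def)
  qed
  have cont: "continuous_on {0<..<e} \<tau>" using cont_of_bmap[OF bt, of 0] by simp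
  obtain \<delta> where \<delta>: "\<delta> > 0" "\<delta> \<le> e" "inj_on \<tau> {0<..<\<delta>}"
    using injective_near_zero[OF e(1) cont _ c(1) bnd] bt by (auto simp: bmap_def)
  have ivt: "\<exists>t\<in>{0<..<u}. \<tau> t = s" if u: "u \<in> {0<..<\<delta>}" and s: "0 < s" "s < \<tau> u" for u s
  proof -
    \<comment> \<open>At \<open>v\<close> the upper bound leaves at most half of \<open>s\<close>,
      so the intermediate value theorem between \<open>v\<close> and \<open>u\<close> reaches
      \<open>s\<close>.\<close>
    define v where "v = min (u / 2) (s / (2 * c))"
    have v: "0 < v" "v < u" "v < e" using u s c \<delta> by (auto simp: v_def min_def)
    have "\<tau> v \<le> c * v" using bnd[of v] v by auto
    also have "\<dots> \<le> c * (s / (2 * c))" using c by (intro mult_left_mono) (auto simp: v_def)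
    also have "\<dots> < s" using c s by simp
    finally have "\<tau> v < s" .
    have "continuous_on {v..u} \<tau>" by (rule continuous_on_subset[OF cont]) (use v u \<delta> in auto)
    from IVT'[of \<tau> v s u, OF _ _ _ this] obtain t where "v \<le> t" "t \<le> u" "\<tau> t = s"
      using \<open>\<tau> v < s\<close> s v by auto
    moreover have "t \<noteq> u" using \<open>\<tau> t = s\<close> s by auto
    ultimately show ?thesis using v by (intro bexI[of _ t]) auto
  qed
  \<comment> \<open>If the value at \<open>u\<close> were smaller than at the earlier
    \<open>t\<close>, it would also be attained before \<open>t\<close>, because
    \<open>\<tau>\<close> comes down to zero; that contradicts injectivity.\<close>
  have mono: "\<tau> t < \<tau> u" if tu: "0 < t" "t < u" "u < \<delta>" for t u
  proof (rule ccontr)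
    assume "\<not> \<tau> t < \<tau> u"
    moreover have "\<tau> t \<noteq> \<tau> u" using inj_onD[OF \<delta>(3), of t u] that by auto
    ultimately have "\<tau> u < \<tau> t" by simp
    moreover have "0 < \<tau> u" using \<tau>pos that \<delta> by auto
    ultimately obtain s where "s \<in> {0<..<t}" "\<tau> s = \<tau> u" using ivt[of t "\<tau> u"] tu by auto
    then show False using inj_onD[OF \<delta>(3), of s u] that by auto
  qed
  define m where "m = \<delta> / 2"
  have m: "0 < m" "m < \<delta>" "m < e" using \<delta> by (auto simp: m_def)
  define d where "d = \<tau> m"
  have d: "d > 0" using \<tau>pos m by (auto simp: d_def)
  define g where "g s = (THE t. t \<in> {0<..<m} \<and> \<tau> t = s)" for s
  have g\<tau>: "g (\<tau> t) = t" if "t \<in> {0<..<m}" for t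
    unfolding g_def
  proof (rule the_equality)
    fix t' assume "t' \<in> {0<..<m} \<and> \<tau> t' = \<tau> t"
    then show "t' = t" using inj_onD[OF \<delta>(3), of t' t] that m by auto
  qed (use that in auto)
  have gs: "g s \<in> {0<..<m} \<and> \<tau> (g s) = s" if s: "s \<in> {0<..<d}" for s
  proof -
    obtain t where "t \<in> {0<..<m}" "\<tau> t = s" using ivt[of m s] s m by (auto simp: d_def)
    then show ?thesis using g\<tau>[of t] by auto
  qed
  have gimg: "g ` {0<..<d} = {0<..<m}"
  proof
    show "{0<..<m} \<subseteq> g ` {0<..<d}"
    proof
      fix t assume t: "t \<in> {0<..<m}"
      then have "\<tau> t \<in> {0<..<d}" using mono[of t m] \<tau>pos[of t] m \<delta> by (auto simp: d_def)
      then show "t \<in> g ` {0<..<d}" using g\<tau>[OF t] by (metis imageI)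
    qed
  qed (use gs in auto)
  have gcont: "continuous_on {0<..<d} g"
  proof (rule continuous_onI_mono)
    show "open (g ` {0<..<d})" by (simp add: gimg)
    fix s s' assume s: "s \<in> {0<..<d}" "s' \<in> {0<..<d}" "s \<le> s'"
    show "g s \<le> g s'"
    proof (rule ccontr)
      assume "\<not> g s \<le> g s'"
      then have "\<tau> (g s') < \<tau> (g s)" using gs[OF s(1)] gs[OF s(2)] m by (intro mono) auto
      then show False using gs[OF s(1)] gs[OF s(2)] s by simp
    qed
  qed
  have sub: "single ` {0<..<x} = nbd 1 origin x posline" for x using nbd_posline by simp
  have bm: "bsub 1 (single ` {0<..<m})" "bsub 1 (single ` {0<..<d})"
  proof -
    have "bsub 1 (single ` {0<..<x})" for x
    proof -
      have "single ` {0<..<x} = {z \<in> Box 1 \<bar>x\<bar>. z 0 > 0 \<and> x - z 0 > 0}"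
      proof
        show "single ` {0<..<x} \<subseteq> {z \<in> Box 1 \<bar>x\<bar>. z 0 > 0 \<and> x - z 0 > 0}" by (auto simp: Box_def)
        show "{z \<in> Box 1 \<bar>x\<bar>. z 0 > 0 \<and> x - z 0 > 0} \<subseteq> single ` {0<..<x}"
        proof
          fix z assume z: "z \<in> {z \<in> Box 1 \<bar>x\<bar>. z 0 > 0 \<and> x - z 0 > 0}"
          have "z = single (z 0)" by (rule Rn1_eq_single) (use z in \<open>simp add: Box_def\<close>)
          then show "z \<in> single ` {0<..<x}" by (rule image_eqI) (use z in simp)
        qed
      qed
      moreover have "dfn 1 (\<lambda>z. z 0 > 0 \<and> x - z 0 > 0)" by (intro dfn_conj dfn_pos analytic_diff analytic_intros) auto
      ultimately show ?thesis by (simp only: dfn_def)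
    qed
    then show "bsub 1 (single ` {0<..<m})" "bsub 1 (single ` {0<..<d})" by blast+
  qed
  have bqm: "bmap 1 (single ` {0<..<m}) (n + 1) (\<lambda>z. q (z 0))" by (rule bmap_restrict[OF e(3) bm(1)]) (use m in auto)
  have btm: "bmap 1 (single ` {0<..<m}) 1 (\<lambda>z. single (\<tau> (z 0)))" by (rule bmap_restrict[OF bt bm(1)]) (use m in auto)
  define \<Gamma> where "\<Gamma> = graph 1 (\<lambda>z. single (\<tau> (z 0))) (single ` {0<..<m})"
  have \<Gamma>: "bsub (1 + 1) \<Gamma>" using btm by (simp add: bmap_def \<Gamma>_def)
  have bg: "bmap 1 (single ` {0<..<d}) 1 (\<lambda>z. single (g (z 0)))"
  proof (rule bmap_intro_dfn[OF bm(2), where R = m and Q = "\<lambda>z. sel (1 + 1) (\<lambda>i. 1 - i) z \<in> \<Gamma>"])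
    have "\<bar>g s\<bar> < m" if "s \<in> {0<..<d}" for s using gs[OF that] by auto
    then show "(\<lambda>z. single (g (z 0))) ` single ` {0<..<d} \<subseteq> Box 1 m" by (auto simp: Box_def)
    show "dfn (1 + 1) (\<lambda>z. sel (1 + 1) (\<lambda>i. 1 - i) z \<in> \<Gamma>)" by (intro dfn_sel \<Gamma>) auto
    show "continuous_map (subtopology (Euclidean_space 1) (single ` {0<..<d})) euclideanreal (\<lambda>x. single (g (x 0)) i)"
      if "i < 1" for i
    proof -
      have "continuous_map (subtopology (Euclidean_space 1) (single ` {0<..<d})) (top_of_set {0<..<d}) (\<lambda>x. x 0)"
        using continuous_map_Euclidean_coord by (auto simp: continuous_map_in_subtopology)
      moreover have "continuous_map (top_of_set {0<..<d}) euclideanreal g" using gcont by simp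
      ultimately have "continuous_map (subtopology (Euclidean_space 1) (single ` {0<..<d})) euclideanreal (g \<circ> (\<lambda>x. x 0))"
        by (rule continuous_map_compose)
      then show ?thesis using that by (simp add: o_def)
    qed
    fix x y assume x: "x \<in> single ` {0<..<d}" and y: "y \<in> Rn 1"
    obtain s where s: "s \<in> {0<..<d}" "x = single s" using x by blast
    have jR: "join 1 y x \<in> Rn (1 + 1)" unfolding s(2) by (rule join_Rn) simp
    have j: "sel (1 + 1) (\<lambda>i. 1 - i) (join 1 x y) = join 1 y x"
    proof (rule Rn_eqI[OF sel_Rn jR])
      fix i :: nat assume "i < 1 + 1"
      then consider "i = 0" | "i = 1" by linarith
      then show "sel (1 + 1) (\<lambda>i. 1 - i) (join 1 x y) i = join 1 y x i"
        by cases (simp_all add: sel_apply join_def)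
    qed
    have "join 1 y x \<in> \<Gamma> \<longleftrightarrow> (\<exists>t\<in>{0<..<m}. y 0 = t \<and> s = \<tau> t)"
    proof
      assume "join 1 y x \<in> \<Gamma>"
      then obtain t where t: "t \<in> {0<..<m}" "join 1 y x = join 1 (single t) (single (\<tau> t))"
        by (auto simp: \<Gamma>_def graph_def)
      have "y 0 = t" using fun_cong[OF t(2), of 0] by (simp add: join_def)
      moreover have "s = \<tau> t" using fun_cong[OF t(2), of 1] s by (simp add: join_def)
      ultimately show "\<exists>t\<in>{0<..<m}. y 0 = t \<and> s = \<tau> t" using t by blast
    next
      assume "\<exists>t\<in>{0<..<m}. y 0 = t \<and> s = \<tau> t"
      then obtain t where t: "t \<in> {0<..<m}" "y 0 = t" "s = \<tau> t" by blast
      then have "y = single t" using y by (simp add: eq_single_iff)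
      then have "join 1 y x = join 1 (single t) (single (\<tau> (single t 0)))" using t s by simp
      then show "join 1 y x \<in> \<Gamma>" using t unfolding \<Gamma>_def graph_def by blast
    qed
    also have "\<dots> \<longleftrightarrow> y 0 = g s" using gs[OF s(1)] g\<tau> by auto
    also have "\<dots> \<longleftrightarrow> y = single (g s)" using y by (simp add: eq_single_iff)
    finally show "sel (1 + 1) (\<lambda>i. 1 - i) (join 1 x y) \<in> \<Gamma> \<longleftrightarrow> y = single (g (x 0))" using j s by simp
  qed
  define q' where "q' s = q (g s)" for s
  have bq': "bmap 1 (single ` {0<..<d}) (n + 1) (\<lambda>z. q' (z 0))"
  proof -
    have "bmap 1 (single ` {0<..<d}) (n + 1) ((\<lambda>z. q (z 0)) \<circ> (\<lambda>z. single (g (z 0))))"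
      by (rule bmap_comp[OF bg bqm]) (use gs in auto)
    then show ?thesis by (simp add: o_def q'_def)
  qed
  have "is_point (n + 1) A origin q'"
  \<comment> \<open>The norm of \<open>q (g s)\<close> is comparable to \<open>g s\<close> with
    constant \<open>K\<close>, and \<open>g s\<close> is comparable to \<open>s\<close> with
    constant \<open>c\<close>.\<close>
  proof (rule is_pointI[OF d _ bq', of "K * c"])
    show "K * c > 0" using e c by simp
    fix s assume s: "s \<in> {0<..<d}"
    have gse: "g s \<in> {0<..<e}" using gs[OF s] m by auto
    have b: "g s / c \<le> s" "s \<le> c * g s" using bnd[OF gse] gs[OF s] by auto
    have "s / (K * c) \<le> g s / K" using b(2) e c by (simp add: field_simps)
    moreover have "K * g s \<le> K * (c * s)" using b(1) e c by (intro mult_left_mono) (auto simp: field_simps)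
    ultimately show "q' s \<in> A \<and> s / (K * c) \<le> edist (n + 1) (q' s) origin \<and> edist (n + 1) (q' s) origin \<le> K * c * s"
      using H[OF gse] unfolding q'_def by (auto simp: mult.assoc)
  qed
  moreover have "\<forall>\<^sub>F s in at_right 0. q' s n = s"
  proof -
    have "\<forall>\<^sub>F s in at_right 0. s \<in> {0<..<d}" using d eventually_at_right_real by blast
    then show ?thesis by eventually_elim (use gs in \<open>auto simp: q'_def \<tau>_def\<close>)
  qed
  ultimately have "normal_point n A q'" by (simp add: normal_point_def cone_point_def)
  moreover have ev: "\<forall>\<^sub>F t in at_right 0. 0 < q t n \<and> q t n \<le> K * t \<and> q' (q t n) = q t"
  proof -
    have "\<forall>\<^sub>F t in at_right 0. t \<in> {0<..<m}" using m eventually_at_right_real by blast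
    then show ?thesis
    proof eventually_elim
      case (elim t)
      then have "t \<in> {0<..<e}" using m by auto
      then show ?case using \<tau>pos[of t] up[of t] g\<tau>[OF elim] by (simp add: q'_def \<tau>_def)
    qed
  qed
  moreover have "filterlim (\<lambda>t. q t n) (at_right 0) (at_right 0)"
    unfolding filterlim_at
  proof
    have "((\<lambda>t. K * t) \<longlongrightarrow> K * 0) (at_right 0)" by (intro tendsto_intros)
    then have "((\<lambda>t. K * t) \<longlongrightarrow> 0) (at_right 0)" by simp
    then show "((\<lambda>t. q t n) \<longlongrightarrow> 0) (at_right 0)"
      by (rule Lim_null_comparison[rotated]) (use ev in \<open>auto elim!: eventually_mono\<close>)
    show "\<forall>\<^sub>F t in at_right 0. q t n \<in> {0<..} \<and> q t n \<noteq> 0" using ev by eventually_elim auto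
  qed
  ultimately show ?thesis using e by blast
qed

section \<open>Homotopy invariance\<close>

lemma bsub_imp_globally_subanalytic: "bsub n S \<Longrightarrow> globally_subanalytic n S"
proof -
  assume b: "bsub n S"
  obtain R where R: "S \<subseteq> Box n R" using bsub_Box[OF b] .
  show ?thesis using globally_subanalytic_iff_bsub[OF R] b by simp
qed

lemma globally_subanalytic_ebounded_imp_bsub:
  assumes "globally_subanalytic n X" "ebounded n X" shows "bsub n X"
proof -
  have "X \<subseteq> Rn n" using assms(1) by (simp add: globally_subanalytic_def)
  then obtain R where "X \<subseteq> Box n R" using assms(2) ebounded_iff_Box by blast
  then show ?thesis using assms(1) globally_subanalytic_iff_bsub by blast
qed

lemma cylinder_Rn: "cylinder m U \<subseteq> Rn (m + 1)"
  using join_Rn[of _ 1 m] by (auto simp: cylinder_def)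

text \<open>The cylinder is bounded because \<open>U\<close> and the unit interval are, the values
  because \<open>X'\<close> is; so the graph of the homotopy is bounded and its global
  subanalyticity amounts to \<open>bsub\<close>.\<close>

lemma bmap_cylinder:
  assumes H: "subanalytic_map (m + 1) (cylinder m U) m' X' H" and U: "bsub m U" and X': "bsub m' X'"
  shows "bmap (m + 1) (cylinder m U) m' H"
proof -
  obtain R where R: "U \<subseteq> Box m R" using bsub_Box[OF U] .
  obtain R' where R': "X' \<subseteq> Box m' R'" using bsub_Box[OF X'] .
  have img: "H ` cylinder m U \<subseteq> X'" using H by (simp add: subanalytic_map_def)
  have X'R: "X' \<subseteq> Rn m'" by (rule bsub_Rn[OF X'])
  define B where "B = max (max R R') 2"
  have "graph (m + 1) H (cylinder m U) \<subseteq> Box (m + 1 + m') B"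
  proof
    fix z assume "z \<in> graph (m + 1) H (cylinder m U)"
    then obtain w where w: "w \<in> cylinder m U" "z = join (m + 1) w (H w)" by (auto simp: graph_def)
    obtain x s where x: "x \<in> U" "s \<in> {0..1}" "w = join m x (single s)" using w(1) by (auto simp: cylinder_def)
    have Hw: "H w \<in> X'" using img w(1) by blast
    have "\<bar>z i\<bar> < B" if i: "i < m + 1 + m'" for i
    proof -
      consider "i < m" | "i = m" | "m + 1 \<le> i" by linarith
      then show ?thesis
      proof cases
        case 1
        have "\<bar>x i\<bar> < R" using R x(1) 1 by (auto simp: Box_def)
        then show ?thesis using 1 by (simp add: w(2) x(3) join_def B_def)
      next
        case 2
        then show ?thesis using x(2) by (auto simp: w(2) x(3) join_def B_def less_max_iff_disj)
      next
        case 3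
        have "\<bar>H w (i - (m + 1))\<bar> < R'" using R' Hw i 3 by (auto simp: Box_def)
        then show ?thesis using 3 by (simp add: w(2) join_def B_def)
      qed
    qed
    moreover have "z \<in> Rn (m + 1 + m')" unfolding w(2) by (rule join_Rn) (use Hw X'R in blast)
    ultimately show "z \<in> Box (m + 1 + m') B" by (simp add: Box_def)
  qed
  then have "bsub (m + 1 + m') (graph (m + 1) H (cylinder m U))"
    using H globally_subanalytic_iff_bsub unfolding subanalytic_map_def by blast
  moreover have "H ` cylinder m U \<subseteq> Rn m'" using img X'R by (rule subset_trans)
  moreover have "continuous_map (subtopology (Euclidean_space (m + 1)) (cylinder m U)) (Euclidean_space m') H"
    using H by (simp add: subanalytic_map_def)
  ultimately show ?thesis using cylinder_Rn unfolding bmap_def by blast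
qed

section \<open>Calculus of \<open>b\<close>-equivalence\<close>

lemma b_equiv_cong:
  assumes "b_equiv b d u v" "\<forall>\<^sub>F t in at_right 0. u t = u' t" "\<forall>\<^sub>F t in at_right 0. v t = v' t"
  shows "b_equiv b d u' v'"
proof (cases "b = \<infinity>")
  case True
  then have "\<forall>\<^sub>F t in at_right 0. u t = v t" using assms(1) by (simp add: b_equiv_def)
  then have "\<forall>\<^sub>F t in at_right 0. u' t = v' t" using assms(2,3) by eventually_elim simp
  then show ?thesis using True by (simp add: b_equiv_def)
next
  case False
  have "((\<lambda>t. d (u t) (v t) / t powr real_of_ereal b) \<longlongrightarrow> 0) (at_right 0)"
    using assms(1) False by (simp add: b_equiv_def)
  moreover have "\<forall>\<^sub>F t in at_right 0. d (u t) (v t) / t powr real_of_ereal b = d (u' t) (v' t) / t powr real_of_ereal b"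
    using assms(2,3) by eventually_elim simp
  ultimately have "((\<lambda>t. d (u' t) (v' t) / t powr real_of_ereal b) \<longlongrightarrow> 0) (at_right 0)"
    by (rule Lim_transform_eventually)
  then show ?thesis using False by (simp add: b_equiv_def)
qed

lemma b_equiv_sym:
  assumes "Metric_space X d" "b_equiv b d u v" shows "b_equiv b d v u"
proof (cases "b = \<infinity>")
  case True
  then have "\<forall>\<^sub>F t in at_right 0. u t = v t" using assms(2) by (simp add: b_equiv_def)
  then have "\<forall>\<^sub>F t in at_right 0. v t = u t" by eventually_elim simp
  then show ?thesis using True by (simp add: b_equiv_def)
next
  case False
  then show ?thesis using assms(2) Metric_space.commute[OF assms(1)] by (simp add: b_equiv_def)
qed

lemma b_equiv_trans:
  assumes m: "Metric_space X d" and uv: "b_equiv b d u v" and vw: "b_equiv b d v w"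
    and ev: "\<forall>\<^sub>F t in at_right 0. u t \<in> X" "\<forall>\<^sub>F t in at_right 0. v t \<in> X" "\<forall>\<^sub>F t in at_right 0. w t \<in> X"
  shows "b_equiv b d u w"
proof (cases "b = \<infinity>")
  case True
  then have "\<forall>\<^sub>F t in at_right 0. u t = v t" "\<forall>\<^sub>F t in at_right 0. v t = w t" using uv vw by (simp_all add: b_equiv_def)
  then have "\<forall>\<^sub>F t in at_right 0. u t = w t" by eventually_elim simp
  then show ?thesis using True by (simp add: b_equiv_def)
next
  case False
  define p where "p t = t powr real_of_ereal b" for t :: real
  have "((\<lambda>t. d (u t) (v t) / p t + d (v t) (w t) / p t) \<longlongrightarrow> 0 + 0) (at_right 0)"
    using uv vw False by (intro tendsto_add) (auto simp: b_equiv_def p_def)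
  then have lim: "((\<lambda>t. d (u t) (v t) / p t + d (v t) (w t) / p t) \<longlongrightarrow> 0) (at_right 0)" by simp
  have "((\<lambda>t. d (u t) (w t) / p t) \<longlongrightarrow> 0) (at_right 0)"
  proof (rule Lim_null_comparison[OF _ lim])
    show "\<forall>\<^sub>F t in at_right 0. norm (d (u t) (w t) / p t) \<le> d (u t) (v t) / p t + d (v t) (w t) / p t"
      using ev
    proof eventually_elim
      case (elim t)
      have "d (u t) (w t) \<le> d (u t) (v t) + d (v t) (w t)" by (rule Metric_space.triangle[OF m elim])
      moreover have "0 \<le> d (u t) (w t)" "0 \<le> p t" using Metric_space.nonneg[OF m] by (auto simp: p_def)
      ultimately show ?case by (simp add: divide_right_mono flip: add_divide_distrib)
    qed
  qed
  then show ?thesis using False by (simp add: b_equiv_def p_def)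
qed

text \<open>\<open>\<Phi>\<close> may depend on \<open>t\<close>, which is how a homotopy parameter
  varying along a point enters. For infinite \<open>b\<close> equal germs have equal images; for
  finite \<open>b\<close> the Lipschitz bound is divided by \<open>t\<close> to the power
  \<open>b\<close>.\<close>

lemma b_equiv_map:
  assumes uv: "b_equiv b d u v" and m: "Metric_space X' d'"
    and L: "b \<noteq> \<infinity> \<Longrightarrow> \<forall>\<^sub>F t in at_right 0. d' (\<Phi> t (u t)) (\<Phi> t (v t)) \<le> K * d (u t) (v t)"
  shows "b_equiv b d' (\<lambda>t. \<Phi> t (u t)) (\<lambda>t. \<Phi> t (v t))"
proof (cases "b = \<infinity>")
  case True
  then have "\<forall>\<^sub>F t in at_right 0. u t = v t" using uv by (simp add: b_equiv_def)
  then have "\<forall>\<^sub>F t in at_right 0. \<Phi> t (u t) = \<Phi> t (v t)" by eventually_elim simp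
  then show ?thesis using True by (simp add: b_equiv_def)
next
  case False
  define p where "p t = t powr real_of_ereal b" for t :: real
  have "((\<lambda>t. K * (d (u t) (v t) / p t)) \<longlongrightarrow> K * 0) (at_right 0)"
    using uv False by (intro tendsto_mult tendsto_const) (auto simp: b_equiv_def p_def)
  then have lim: "((\<lambda>t. K * (d (u t) (v t) / p t)) \<longlongrightarrow> 0) (at_right 0)" by simp
  have "((\<lambda>t. d' (\<Phi> t (u t)) (\<Phi> t (v t)) / p t) \<longlongrightarrow> 0) (at_right 0)"
  proof (rule Lim_null_comparison[OF _ lim])
    show "\<forall>\<^sub>F t in at_right 0. norm (d' (\<Phi> t (u t)) (\<Phi> t (v t)) / p t) \<le> K * (d (u t) (v t) / p t)"
      using L[OF False]
    proof eventually_elim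
      case (elim t)
      moreover have "0 \<le> d' (\<Phi> t (u t)) (\<Phi> t (v t))" "0 \<le> p t" using Metric_space.nonneg[OF m] by (auto simp: p_def)
      ultimately show ?case using divide_right_mono[OF elim, of "p t"] by simp
    qed
  qed
  then show ?thesis using False by (simp add: b_equiv_def p_def)
qed

text \<open>Since \<open>\<tau> t \<le> K * t\<close>, a quantity negligible against the power of
  \<open>\<tau> t\<close> is negligible against the same power of \<open>t\<close>; the comparison
  costs the factor \<open>K powr \<beta>\<close>.\<close>

lemma b_equiv_reparam:
  assumes uv: "b_equiv b d u v" and b: "0 < b" and \<tau>: "filterlim \<tau> (at_right 0) (at_right 0)"
    and le: "\<forall>\<^sub>F t in at_right 0. 0 < \<tau> t \<and> \<tau> t \<le> K * t"
  shows "b_equiv b d (\<lambda>t. u (\<tau> t)) (\<lambda>t. v (\<tau> t))"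
proof (cases "b = \<infinity>")
  case True
  then have "\<forall>\<^sub>F t in at_right 0. u t = v t" using uv by (simp add: b_equiv_def)
  then have "\<forall>\<^sub>F t in at_right 0. u (\<tau> t) = v (\<tau> t)" using \<tau> unfolding filterlim_iff by blast
  then show ?thesis using True by (simp add: b_equiv_def)
next
  case False
  define \<beta> where "\<beta> = real_of_ereal b"
  have \<beta>: "0 \<le> \<beta>" unfolding \<beta>_def using b by (intro real_of_ereal_pos) simp
  have "((\<lambda>t. d (u t) (v t) / t powr \<beta>) \<longlongrightarrow> 0) (at_right 0)" using uv False by (simp add: b_equiv_def \<beta>_def)
  then have "((\<lambda>t. d (u (\<tau> t)) (v (\<tau> t)) / \<tau> t powr \<beta>) \<longlongrightarrow> 0) (at_right 0)"
    by (rule filterlim_compose[OF _ \<tau>])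
  then have "((\<lambda>t. K powr \<beta> * \<bar>d (u (\<tau> t)) (v (\<tau> t)) / \<tau> t powr \<beta>\<bar>) \<longlongrightarrow> K powr \<beta> * \<bar>0\<bar>) (at_right 0)"
    by (intro tendsto_mult tendsto_const tendsto_rabs)
  then have lim: "((\<lambda>t. K powr \<beta> * \<bar>d (u (\<tau> t)) (v (\<tau> t)) / \<tau> t powr \<beta>\<bar>) \<longlongrightarrow> 0) (at_right 0)" by simp
  have pos: "\<forall>\<^sub>F t in at_right (0::real). 0 < t" by (simp add: eventually_at_right_less)
  have "((\<lambda>t. d (u (\<tau> t)) (v (\<tau> t)) / t powr \<beta>) \<longlongrightarrow> 0) (at_right 0)"
  proof (rule Lim_null_comparison[OF _ lim])
    show "\<forall>\<^sub>F t in at_right 0. norm (d (u (\<tau> t)) (v (\<tau> t)) / t powr \<beta>) \<le> K powr \<beta> * \<bar>d (u (\<tau> t)) (v (\<tau> t)) / \<tau> t powr \<beta>\<bar>"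
      using le pos
    proof eventually_elim
      case (elim t)
      define D where "D = \<bar>d (u (\<tau> t)) (v (\<tau> t))\<bar>"
      have K: "0 < K" using elim by (smt (verit) mult_nonpos_nonneg)
      have "\<tau> t powr \<beta> \<le> (K * t) powr \<beta>" using elim \<beta> by (intro powr_mono2) auto
      also have "\<dots> = K powr \<beta> * t powr \<beta>" using elim K by (simp add: powr_mult)
      finally have 1: "\<tau> t powr \<beta> \<le> K powr \<beta> * t powr \<beta>" .
      have p: "0 < \<tau> t powr \<beta>" "0 < t powr \<beta>" using elim by auto
      have "D * \<tau> t powr \<beta> \<le> D * (K powr \<beta> * t powr \<beta>)" using 1 by (rule mult_left_mono) (simp add: D_def)
      then have "D / t powr \<beta> \<le> K powr \<beta> * (D / \<tau> t powr \<beta>)" using p by (simp add: field_simps)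
      then show ?case by (simp add: D_def abs_divide)
    qed
  qed
  then show ?thesis using False by (simp add: b_equiv_def \<beta>_def)
qed

lemma cone_point_mono: "cone_point n A q \<Longrightarrow> A \<subseteq> B \<Longrightarrow> cone_point n B q"
  unfolding cone_point_def by (rule is_point_mono)

lemma normal_point_mono: "normal_point n A q \<Longrightarrow> A \<subseteq> B \<Longrightarrow> normal_point n B q"
  using cone_point_mono[of n A q B] by (simp add: normal_point_def)

abbreviation "cone_cube n \<equiv> germ_cone n (cube n)"

lemma cone_cube_Rn: "cone_cube n \<subseteq> Rn (n + 1)"
  by (auto simp: mem_cone_cube)

lemma pb_Rn: "pb n C \<subseteq> Rn (n + 1 + 1)"
  using cone_cube_Rn[of "n + 1"] by (auto simp: pb_def)

text \<open>Near the vertex a piece of the cover lies in the cone, hence in a box, so its globally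
  subanalytic neighbourhood is bounded subanalytic.\<close>

lemma weak_map_component:
  assumes "weak_map b n (cone_cube n) P F" "(C, h) \<in> F"
  shows "\<exists>e>0. bsub (n + 1) (nbd (n + 1) origin e C)" "near_Rn (n + 1) origin C"
    "lva_germ (n + 1) C origin (gdim P) (gX P) (vertex P) h"
proof -
  have "closed_subanalytic_cover n (cone_cube n) (fst ` F)" using assms(1) by (simp add: weak_map_def)
  from this[unfolded closed_subanalytic_cover_def, THEN conjunct2]
  obtain e where E: "0 < e \<and> nbd (n + 1) origin e (cone_cube n) = (\<Union>C\<in>fst ` F. nbd (n + 1) origin e C) \<and>
      (\<forall>C\<in>fst ` F. globally_subanalytic (n + 1) (nbd (n + 1) origin e C) \<and>
         closedin (subtopology (Euclidean_space (n + 1)) (nbd (n + 1) origin e (cone_cube n))) (nbd (n + 1) origin e C))" ..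
  note e = E[THEN conjunct1] E[THEN conjunct2, THEN conjunct1] E[THEN conjunct2, THEN conjunct2]
  have C: "C \<in> fst ` F" using assms(2) by force
  have "nbd (n + 1) origin e C \<subseteq> nbd (n + 1) origin e (cone_cube n)" using e(2) C by blast
  also have "\<dots> \<subseteq> Box (n + 1) e" by (rule nbd_origin_Box[OF cone_cube_Rn])
  finally have B: "nbd (n + 1) origin e C \<subseteq> Box (n + 1) e" .
  then have "bsub (n + 1) (nbd (n + 1) origin e C)" using globally_subanalytic_iff_bsub[OF B] bspec[OF e(3) C] by simp
  then show "\<exists>e>0. bsub (n + 1) (nbd (n + 1) origin e C)" using e(1) by blast
  have "nbd (n + 1) origin e C \<subseteq> Rn (n + 1)" using B by (auto simp: Box_def)
  then show "near_Rn (n + 1) origin C" unfolding near_Rn_def using e(1) by blast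
  show "lva_germ (n + 1) C origin (gdim P) (gX P) (vertex P) h" using assms by (auto simp: weak_map_def)
qed

lemma weak_map_point:
  assumes "weak_map b n (cone_cube n) P F" "(C, h) \<in> F" "cone_point n A q" "A \<subseteq> C"
  shows "is_point (gdim P) (gX P) (vertex P) (h \<circ> q)"
  by (rule is_point_comp[OF is_point_mono[OF assms(3)[unfolded cone_point_def] assms(4)]
        weak_map_component(3)[OF assms(1,2)] weak_map_component(2)[OF assms(1,2)]])

text \<open>Covering, closedness and subanalyticity all pass to preimages under
  \<open>forget\<close>. The radius can be kept because \<open>forget\<close> does not increase the
  norm.\<close>

lemma pb_cover:
  assumes "closed_subanalytic_cover n (cone_cube n) \<C>"
  shows "closed_subanalytic_cover (n + 1) (cone_cube (n + 1)) (pb n ` \<C>)"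
proof -
  define Z where "Z e = nbd (n + 1) origin e (cone_cube n)" for e
  define Z' where "Z' e = nbd (n + 1 + 1) origin e (cone_cube (n + 1))" for e
  have fin: "finite \<C>" using assms by (simp add: closed_subanalytic_cover_def)
  from assms[unfolded closed_subanalytic_cover_def, folded Z_def, THEN conjunct2]
  obtain e where E: "0 < e \<and> Z e = (\<Union>C\<in>\<C>. nbd (n + 1) origin e C) \<and>
      (\<forall>C\<in>\<C>. globally_subanalytic (n + 1) (nbd (n + 1) origin e C) \<and>
         closedin (subtopology (Euclidean_space (n + 1)) (Z e)) (nbd (n + 1) origin e C))" ..
  have e: "e > 0" "Z e = (\<Union>C\<in>\<C>. nbd (n + 1) origin e C)"
    "\<And>C. C \<in> \<C> \<Longrightarrow> globally_subanalytic (n + 1) (nbd (n + 1) origin e C)"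
    "\<And>C. C \<in> \<C> \<Longrightarrow> closedin (subtopology (Euclidean_space (n + 1)) (Z e)) (nbd (n + 1) origin e C)"
    using E by blast+
  have pbZ: "z \<in> Z' e \<Longrightarrow> forget n z \<in> Z e" for z
    using nbd_pb[of n e "cone_cube n"] unfolding pb_cone Z_def Z'_def by blast
  have bs: "bsub (n + 1) (nbd (n + 1) origin e C)" if "C \<in> \<C>" for C
  proof -
    have "nbd (n + 1) origin e C \<subseteq> Z e" using e(2) that by blast
    also have "\<dots> \<subseteq> Box (n + 1) e" unfolding Z_def by (rule nbd_origin_Box[OF cone_cube_Rn])
    finally show ?thesis using globally_subanalytic_iff_bsub e(3)[OF that] by blast
  qed
  have Z'R: "Z' e \<subseteq> Rn (n + 1 + 1)" unfolding Z'_def by (rule nbd_Rn[OF cone_cube_Rn])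
  have cont: "continuous_map (subtopology (Euclidean_space (n + 1 + 1)) (Z' e))
      (subtopology (Euclidean_space (n + 1)) (Z e)) (forget n)"
  proof -
    have "bmap (n + 1 + 1) (Z' e) (n + 1) (forget n)" unfolding Z'_def by (rule bmap_forget[OF bsub_cone])
    then show ?thesis unfolding continuous_map_in_subtopology bmap_def using pbZ by auto
  qed
  have "Z' e = (\<Union>C\<in>pb n ` \<C>. nbd (n + 1 + 1) origin e C)"
  proof
    show "Z' e \<subseteq> (\<Union>C\<in>pb n ` \<C>. nbd (n + 1 + 1) origin e C)"
    proof
      fix z assume z: "z \<in> Z' e"
      then obtain C where "C \<in> \<C>" "forget n z \<in> nbd (n + 1) origin e C" using pbZ[OF z] e(2) by blast
      then have "z \<in> nbd (n + 1 + 1) origin e (pb n C)" using z unfolding nbd_pb Z'_def by blast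
      then show "z \<in> (\<Union>C\<in>pb n ` \<C>. nbd (n + 1 + 1) origin e C)" using \<open>C \<in> \<C>\<close> by blast
    qed
    show "(\<Union>C\<in>pb n ` \<C>. nbd (n + 1 + 1) origin e C) \<subseteq> Z' e" by (auto simp: nbd_def pb_def Z'_def)
  qed
  moreover have "globally_subanalytic (n + 1 + 1) (nbd (n + 1 + 1) origin e (pb n C))" if "C \<in> \<C>" for C
    by (intro bsub_imp_globally_subanalytic bsub_pb bs that)
  moreover have "closedin (subtopology (Euclidean_space (n + 1 + 1)) (Z' e)) (nbd (n + 1 + 1) origin e (pb n C))"
    if "C \<in> \<C>" for C
  proof -
    have "nbd (n + 1 + 1) origin e (pb n C) =
      {z \<in> topspace (subtopology (Euclidean_space (n + 1 + 1)) (Z' e)). forget n z \<in> nbd (n + 1) origin e C}"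
      using Z'R unfolding nbd_pb Z'_def by auto
    then show ?thesis using closedin_continuous_map_preimage[OF cont e(4)[OF that]] by simp
  qed
  ultimately show ?thesis
    unfolding closed_subanalytic_cover_def Z'_def using fin e(1) by (intro conjI exI[of _ e]) auto
qed

section \<open>From homotopic loops to equal induced maps\<close>

lemma homotopy_class_eq:
  assumes "homotopic b n P F G" shows "homotopy_rel b n P `` {F} = homotopy_rel b n P `` {G}"
proof -
  have FG: "F \<in> MDGamma b n P" "G \<in> MDGamma b n P" using assms by (auto simp: homotopic_def)
  have eq: "equivclp (homotopic b n P) F G" using assms by (rule r_into_equivclp)
  have "equivclp (homotopic b n P) F E \<longleftrightarrow> equivclp (homotopic b n P) G E" for E
    using equivclp_trans equivclp_sym eq by metis
  then show ?thesis using FG by (auto simp: homotopy_rel_def)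
qed

text \<open>A class contains only loops, so a homotopy between the two images of each representative
  makes the unions in \<open>induced\<close> agree term by term.\<close>

lemma induced_eqI:
  assumes "\<And>F. F \<in> MDGamma b n P \<Longrightarrow> homotopic b n P' (push f F) (push g F)" "c \<in> MDpi b n P"
  shows "induced b n P' f c = induced b n P' g c"
proof -
  have "c \<subseteq> MDGamma b n P" using assms(2) by (auto simp: MDpi_def quotient_def homotopy_rel_def)
  then show ?thesis unfolding induced_def using homotopy_class_eq[OF assms(1)] by (intro SUP_cong) auto
qed

lemma MDGamma_normal:
  assumes "F \<in> MDGamma b n P" "(C, h) \<in> F" "normal_point n (C \<inter> germ_cone n (open_box n)) q"
  shows "b_equiv b (gdist P) (h \<circ> q) (basept P)"
proof -
  have "\<forall>(C, f)\<in>F. \<forall>q. normal_point n (C \<inter> germ_cone n (open_box n)) q \<longrightarrow>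
      b_equiv b (gdist P) (f \<circ> q) (basept P)" using assms(1) by (simp add: MDGamma_def)
  from bspec[OF this assms(2), unfolded prod.case] show ?thesis using assms(3) by simp
qed

lemma agreeD:
  assumes "agree b n d F G" "(C, f) \<in> F" "(C', f') \<in> G" "b \<noteq> \<infinity>" "cone_point n (C \<inter> C') q"
  shows "b_equiv b d (f \<circ> q) (f' \<circ> q)"
proof -
  note 1 = bspec[OF assms(1)[unfolded agree_def] assms(2), unfolded prod.case]
  show ?thesis using bspec[OF 1 assms(3), unfolded prod.case] assms(4,5) by simp
qed

lemma sends_to_YD:
  assumes "sends_to_Y b n W P F" "(C, f) \<in> F" "cone_point n (C \<inter> W) q"
  shows "\<exists>r. is_point (gdim P) (gY P) (vertex P) r \<and> b_equiv b (gdist P) (f \<circ> q) r"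
  using bspec[OF assms(1)[unfolded sends_to_Y_def] assms(2), unfolded prod.case] assms(3) by simp

text \<open>A common setting for both parts of the theorem: the Lipschitz bound is assumed for
  finite \<open>b\<close> only, so that infinite \<open>b\<close> admits homotopies with nothing but
  a uniform l.v.a. bound. The same \<open>K\<close> serves in both bounds.\<close>

locale pair_homotopy =
  fixes P P' :: pgerm and f g :: "vec \<Rightarrow> vec" and e K :: real and H :: "vec \<Rightarrow> vec" and b :: ereal
  assumes P: "pointed_pair P" and P': "pointed_pair P'"
    and pair_maps: "lva_pair_map P P' f" "lva_pair_map P P' g"
    and homotopy: "lva_homotopy P P' f g e K H" and b_pos: "0 < b"
    and lip: "\<And>s x y. b \<noteq> \<infinity> \<Longrightarrow> s \<in> {0..1} \<Longrightarrow> x \<in> nbd (gdim P) (vertex P) e (gX P) \<Longrightarrow>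
      y \<in> nbd (gdim P) (vertex P) e (gX P) \<Longrightarrow>
      gdist P' (level (gdim P) H s x) (level (gdim P) H s y) \<le> K * gdist P x y"
begin

abbreviation "U \<equiv> nbd (gdim P) (vertex P) e (gX P)"
abbreviation "lev \<equiv> level (gdim P) H"

lemmas hom = homotopy[unfolded lva_homotopy_def Let_def]

lemma e_pos: "e > 0"
  by (rule hom[THEN conjunct1])

lemma H_map: "subanalytic_map (gdim P + 1) (cylinder (gdim P) U) (gdim P') (gX P') H"
  by (rule hom[THEN conjunct2, THEN conjunct1])

lemma lev_0: "x \<in> U \<Longrightarrow> lev 0 x = f x"
  by (rule bspec[OF hom[THEN conjunct2, THEN conjunct2, THEN conjunct1], THEN conjunct1])

lemma lev_1: "x \<in> U \<Longrightarrow> lev 1 x = g x"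
  by (rule bspec[OF hom[THEN conjunct2, THEN conjunct2, THEN conjunct1], THEN conjunct2])

lemma lev_lva: "s \<in> {0..1} \<Longrightarrow> lva_on (gdim P) U (vertex P) (gdim P') (vertex P') K (lev s)"
  by (rule bspec[OF hom[THEN conjunct2, THEN conjunct2, THEN conjunct2, THEN conjunct1]])

lemma lev_Y:
  assumes "s \<in> {0..1}" "x \<in> U" "x \<in> gY P" shows "lev s x \<in> gY P'"
  by (rule subsetD[OF bspec[OF hom[THEN conjunct2, THEN conjunct2, THEN conjunct2, THEN conjunct2, THEN conjunct1]
        assms(1)] imageI[OF IntI[OF assms(2,3)]]])

lemma lev_base: "\<forall>\<^sub>F t in at_right 0. \<forall>s\<in>{0..1}. lev s (basept P t) = basept P' t"
  by (rule hom[THEN conjunct2, THEN conjunct2, THEN conjunct2, THEN conjunct2, THEN conjunct2])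

lemma K_pos: "K > 0"
  using lev_lva[of 0] by (simp add: lva_on_def)

lemma metric: "Metric_space (gX P) (gdist P)" "Metric_space (gX P') (gdist P')"
  using P P' by (auto simp: pointed_pair_def metric_germ_def)

lemma bsub_X: "bsub (gdim P) (gX P)" "bsub (gdim P') (gX P')"
  using P P' by (auto simp: pointed_pair_def metric_germ_def intro: globally_subanalytic_ebounded_imp_bsub)

lemma near_X: "near_Rn (gdim P) (vertex P) (gX P)"
  by (rule near_Rn_subset[OF bsub_Rn[OF bsub_X(1)]])

lemma Y_sub: "gY P \<subseteq> gX P" and Y'_sub: "gY P' \<subseteq> gX P'"
  and base: "is_point (gdim P) (gY P) (vertex P) (basept P)"
  using P P' by (auto simp: pointed_pair_def)

lemma H_bmap: "bmap (gdim P + 1) (cylinder (gdim P) U) (gdim P') H"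
  by (rule bmap_cylinder[OF H_map bsub_nbd[OF bsub_X(1)] bsub_X(2)])

lemma lev_X: "s \<in> {0..1} \<Longrightarrow> x \<in> U \<Longrightarrow> lev s x \<in> gX P'"
proof -
  assume "s \<in> {0..1}" "x \<in> U"
  then have c: "join (gdim P) x (single s) \<in> cylinder (gdim P) U" unfolding cylinder_def by blast
  have "H ` cylinder (gdim P) U \<subseteq> gX P'" using H_map by (simp add: subanalytic_map_def)
  from subsetD[OF this imageI[OF c]] show ?thesis by (simp add: level_def)
qed

text \<open>The parameter \<open>s\<close> may vary with \<open>z\<close>: as one constant is valid
  at every level, the l.v.a. bounds follow pointwise, and the map is \<open>H\<close> composed with
  the pair of \<open>u\<close> and \<open>s\<close>.\<close>

lemma lva_germ_lev:
  assumes u: "lva_germ N Z z0 (gdim P) (gX P) (vertex P) u" and Z: "near_Rn N z0 Z"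
    and e1: "e1 > 0" and s: "bmap N (nbd N z0 e1 Z) 1 (\<lambda>z. single (s z))"
    and s01: "\<And>z. z \<in> nbd N z0 e1 Z \<Longrightarrow> s z \<in> {0..1}"
  shows "lva_germ N Z z0 (gdim P') (gX P') (vertex P') (\<lambda>z. lev (s z) (u z))"
proof -
  obtain e2 K2 where e2: "e2 > 0" "K2 > 0" "\<forall>e'. 0 < e' \<longrightarrow> e' \<le> e2 \<longrightarrow>
    bmap N (nbd N z0 e' Z) (gdim P) u \<and> u ` nbd N z0 e' Z \<subseteq> gX P \<and> lva_on N (nbd N z0 e' Z) z0 (gdim P) (vertex P) K2 u"
    by (rule lva_germE[OF u Z])
  define d where "d = min (min e1 e2) (e / K2)"
  have d: "d > 0" "d \<le> e1" "d \<le> e2" "d \<le> e / K2" using e1 e2 e_pos by (auto simp: d_def)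
  define D where "D = nbd N z0 d Z"
  have D: "bmap N D (gdim P) u" "u ` D \<subseteq> gX P" "lva_on N D z0 (gdim P) (vertex P) K2 u"
    using e2(3)[rule_format, OF d(1,3)] by (auto simp: D_def)
  have sub: "D \<subseteq> nbd N z0 e1 Z" unfolding D_def by (rule nbd_mono[OF d(2)])
  have sD: "bmap N D 1 (\<lambda>z. single (s z))" by (rule bmap_restrict[OF s bmap_dom[OF D(1)] sub])
  have uU: "u z \<in> U" if z: "z \<in> D" for z
  proof -
    have "edist (gdim P) (u z) (vertex P) \<le> K2 * edist N z z0" using D(3) z by (simp add: lva_on_def)
    also have "\<dots> < K2 * d" using z e2(2) by (simp add: D_def nbd_def)
    also have "\<dots> \<le> e" using d(4) e2(2) by (simp add: field_simps)
    finally show ?thesis using D(2) z by (auto simp: nbd_def)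
  qed
  have s01D: "s z \<in> {0..1}" if "z \<in> D" for z using s01 sub that by blast
  show ?thesis
  proof (rule lva_germI[OF d(1)])
    have "bmap N D (gdim P') (H \<circ> (\<lambda>z. join (gdim P) (u z) (single (s z))))"
    proof (rule bmap_comp[OF bmap_pair[OF D(1) sD] H_bmap])
      show "(\<lambda>z. join (gdim P) (u z) (single (s z))) ` D \<subseteq> cylinder (gdim P) U"
        using uU s01D by (force simp: cylinder_def)
    qed
    then show "bmap N (nbd N z0 d Z) (gdim P') (\<lambda>z. lev (s z) (u z))" by (simp add: D_def level_def o_def)
    show "(\<lambda>z. lev (s z) (u z)) ` nbd N z0 d Z \<subseteq> gX P'"
      using uU s01D lev_X unfolding D_def[symmetric] by auto
    show "lva_on N (nbd N z0 d Z) z0 (gdim P') (vertex P') (K * K2) (\<lambda>z. lev (s z) (u z))"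
      unfolding lva_on_def D_def[symmetric]
    proof (intro conjI ballI)
      show "0 < K * K2" using K_pos e2 by simp
      fix z assume z: "z \<in> D"
      define \<rho> where "\<rho> = edist (gdim P) (u z) (vertex P)"
      define \<rho>' where "\<rho>' = edist (gdim P') (lev (s z) (u z)) (vertex P')"
      have 1: "1 / K2 * edist N z z0 \<le> \<rho>" "\<rho> \<le> K2 * edist N z z0"
        using D(3) z by (auto simp: lva_on_def \<rho>_def)
      have 2: "1 / K * \<rho> \<le> \<rho>'" "\<rho>' \<le> K * \<rho>"
        using lev_lva[OF s01D[OF z]] uU[OF z] by (auto simp: lva_on_def \<rho>_def \<rho>'_def)
      have "1 / K * (1 / K2 * edist N z z0) \<le> 1 / K * \<rho>" using 1 K_pos by (intro mult_left_mono) auto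
      then show "1 / (K * K2) * edist N z z0 \<le> edist (gdim P') (lev (s z) (u z)) (vertex P')"
        using 2 by (simp add: \<rho>'_def)
      have "K * \<rho> \<le> K * (K2 * edist N z z0)" using 1 K_pos by (intro mult_left_mono) auto
      then show "edist (gdim P') (lev (s z) (u z)) (vertex P') \<le> K * K2 * edist N z z0"
        using 2 by (simp add: \<rho>'_def)
    qed
  qed
qed

lemma is_point_lev:
  assumes "is_point (gdim P) (gX P) (vertex P) r" "d > 0"
    "bmap 1 (single ` {0<..<d}) 1 (\<lambda>z. single (s (z 0)))" "\<And>t. t \<in> {0<..<d} \<Longrightarrow> s t \<in> {0..1}"
  shows "is_point (gdim P') (gX P') (vertex P') (\<lambda>t. lev (s t) (r t))"
  unfolding is_point_def
  by (rule lva_germ_lev[OF assms(1)[unfolded is_point_def] near_posline assms(2)])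
     (use assms(3,4) in \<open>auto simp: nbd_posline\<close>)

lemma point_in_U: "is_point (gdim P) A (vertex P) r \<Longrightarrow> A \<subseteq> gX P \<Longrightarrow> \<forall>\<^sub>F t in at_right 0. r t \<in> U"
  by (rule is_point_near[OF is_point_mono e_pos])

text \<open>At each time both points are moved by the same level, but the level varies with time, so
  the Lipschitz constant has to be common to all levels.\<close>

lemma transport:
  assumes uv: "b_equiv b (gdist P) u v" and ev: "\<forall>\<^sub>F t in at_right 0. u t \<in> U" "\<forall>\<^sub>F t in at_right 0. v t \<in> U"
    "\<forall>\<^sub>F t in at_right 0. s t \<in> {0..1}"
  shows "b_equiv b (gdist P') (\<lambda>t. lev (s t) (u t)) (\<lambda>t. lev (s t) (v t))"
proof (rule b_equiv_map[OF uv metric(2)])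
  assume b: "b \<noteq> \<infinity>"
  show "\<forall>\<^sub>F t in at_right 0. gdist P' (lev (s t) (u t)) (lev (s t) (v t)) \<le> K * gdist P (u t) (v t)"
    using ev by eventually_elim (rule lip[OF b])
qed

text \<open>\<open>\<phi>\<close> stands for \<open>f\<close> or \<open>g\<close>, an end of the
  homotopy. Regarding it as the level \<open>c\<close> makes the Lipschitz bound of the homotopy
  available on the same neighbourhood \<open>U\<close> as for the track.\<close>

lemma push_MDGamma:
  assumes F: "F \<in> MDGamma b n P" and \<phi>: "lva_pair_map P P' \<phi>"
    and c: "c \<in> {0..1}" "\<And>x. x \<in> U \<Longrightarrow> lev c x = \<phi> x"
  shows "push \<phi> F \<in> MDGamma b n P'"
proof -
  have W: "weak_map b n (cone_cube n) P F" and Y: "sends_to_Y b n (germ_cone n (cube_boundary n)) P F"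
    using F by (simp_all add: MDGamma_def)
  note N = MDGamma_normal[OF F]
  have \<phi>g: "lva_germ (gdim P) (gX P) (vertex P) (gdim P') (gX P') (vertex P') \<phi>"
    using \<phi> by (simp add: lva_pair_map_def)
  have ev: "\<forall>\<^sub>F t in at_right 0. (h \<circ> q) t \<in> U" if "(C, h) \<in> F" "cone_point n A q" "A \<subseteq> C" for C h A q
    by (rule point_in_U[OF weak_map_point[OF W that] order_refl])
  have tr: "b_equiv b (gdist P') (\<phi> \<circ> u) (\<phi> \<circ> v)"
    if "b_equiv b (gdist P) u v" and u: "\<forall>\<^sub>F t in at_right 0. u t \<in> U" and v: "\<forall>\<^sub>F t in at_right 0. v t \<in> U" for u v
  proof (rule b_equiv_cong[OF transport[OF that, of "\<lambda>_. c"]])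
    show "\<forall>\<^sub>F t in at_right 0. lev c (u t) = (\<phi> \<circ> u) t" using u by eventually_elim (simp add: c(2))
    show "\<forall>\<^sub>F t in at_right 0. lev c (v t) = (\<phi> \<circ> v) t" using v by eventually_elim (simp add: c(2))
  qed (use c(1) in simp)
  have "weak_map b n (cone_cube n) P' (push \<phi> F)"
    unfolding weak_map_def
  proof (intro conjI impI)
    show "finite (push \<phi> F)" using W by (simp add: weak_map_def push_def)
    have "fst ` push \<phi> F = fst ` F" by (force simp: push_def image_iff)
    then show "closed_subanalytic_cover n (cone_cube n) (fst ` push \<phi> F)" using W by (simp add: weak_map_def)
    have "lva_germ (n + 1) C origin (gdim P') (gX P') (vertex P') (\<phi> \<circ> h)" if "(C, h) \<in> F" for C h
      by (rule lva_germ_comp[OF weak_map_component(3)[OF W that] \<phi>g weak_map_component(2)[OF W that] near_X])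
    then show "\<forall>(C, h)\<in>push \<phi> F. lva_germ (n + 1) C origin (gdim P') (gX P') (vertex P') h"
      unfolding push_def by auto
    show "agree b n (gdist P') (push \<phi> F) (push \<phi> F)"
    proof (cases "b = \<infinity>")
      case True
      then obtain h where "F = {(cone_cube n, h)}" using W by (auto simp: weak_map_def)
      then show ?thesis using True by (auto simp: agree_def push_def intro: exI[of _ 1])
    next
      case False
      have "b_equiv b (gdist P') (\<phi> \<circ> h \<circ> q) (\<phi> \<circ> h' \<circ> q)"
        if C: "(C, h) \<in> F" and C': "(C', h') \<in> F" and q: "cone_point n (C \<inter> C') q" for C h C' h' q
      proof -
        have "agree b n (gdist P) F F" using W by (simp add: weak_map_def)
        then have "b_equiv b (gdist P) (h \<circ> q) (h' \<circ> q)" by (rule agreeD[OF _ C C' False q])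
        then have "b_equiv b (gdist P') (\<phi> \<circ> (h \<circ> q)) (\<phi> \<circ> (h' \<circ> q))"
          by (rule tr) (use ev[OF C q] ev[OF C' q] in auto)
        then show ?thesis by (simp add: comp_assoc)
      qed
      then show ?thesis using False unfolding agree_def push_def by auto
    qed
    assume "b = \<infinity>"
    then obtain h where "F = {(cone_cube n, h)}" using W by (auto simp: weak_map_def)
    then show "\<exists>h. push \<phi> F = {(cone_cube n, h)}" by (auto simp: push_def)
  qed
  moreover have "sends_to_Y b n (germ_cone n (cube_boundary n)) P' (push \<phi> F)"
  proof -
    have "\<exists>r. is_point (gdim P') (gY P') (vertex P') r \<and> b_equiv b (gdist P') (\<phi> \<circ> h \<circ> q) r"
      if C: "(C, h) \<in> F" and q: "cone_point n (C \<inter> germ_cone n (cube_boundary n)) q" for C h q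
    proof -
      obtain r where r: "is_point (gdim P) (gY P) (vertex P) r" "b_equiv b (gdist P) (h \<circ> q) r"
        using sends_to_YD[OF Y C q] by blast
      have rX: "is_point (gdim P) (gX P) (vertex P) r" by (rule is_point_mono[OF r(1) Y_sub])
      obtain e' where e': "e' > 0" "\<phi> ` nbd (gdim P) (vertex P) e' (gY P) \<subseteq> gY P'"
        using \<phi> unfolding lva_pair_map_def by blast
      have \<phi>Y: "\<phi> x \<in> gY P'" if "x \<in> nbd (gdim P) (vertex P) e' (gY P)" for x
        by (rule subsetD[OF e'(2) imageI[OF that]])
      have "is_point (gdim P') (gY P') (vertex P') (\<phi> \<circ> r)"
      proof (rule is_point_target[OF is_point_comp[OF rX \<phi>g near_X]])
        show "\<forall>\<^sub>F t in at_right 0. (\<phi> \<circ> r) t \<in> gY P'"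
          using is_point_near[OF r(1) e'(1)] by (rule eventually_mono) (simp add: \<phi>Y)
      qed
      moreover have "b_equiv b (gdist P') (\<phi> \<circ> (h \<circ> q)) (\<phi> \<circ> r)"
        by (rule tr[OF r(2) ev[OF C q] point_in_U[OF rX]]) auto
      ultimately show ?thesis by (auto simp: comp_assoc)
    qed
    then show ?thesis unfolding sends_to_Y_def push_def by auto
  qed
  moreover have "b_equiv b (gdist P') (\<phi> \<circ> h \<circ> q) (basept P')"
    if C: "(C, h) \<in> F" and q: "normal_point n (C \<inter> germ_cone n (open_box n)) q" for C h q
  proof -
    have "cone_point n (C \<inter> germ_cone n (open_box n)) q" using q by (simp add: normal_point_def)
    then have "\<forall>\<^sub>F t in at_right 0. (h \<circ> q) t \<in> U" by (rule ev[OF C]) auto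
    then have "b_equiv b (gdist P') (\<phi> \<circ> (h \<circ> q)) (\<phi> \<circ> basept P)"
      by (rule tr[OF N[OF C q] _ point_in_U[OF base Y_sub]])
    then show ?thesis
      by (rule b_equiv_cong) (use \<phi> in \<open>auto simp: lva_pair_map_def comp_assoc\<close>)
  qed
  ultimately show ?thesis unfolding MDGamma_def push_def by auto
qed

text \<open>A point of the larger cone has the coordinates \<open>t * y\<close>,
  \<open>t * s\<close> and \<open>t\<close>: the quotient of the last two entries recovers
  \<open>s\<close>, and \<open>forget\<close> recovers the argument of the loop.\<close>

definition track :: "nat \<Rightarrow> wmap \<Rightarrow> wmap" where
  "track n F = (\<lambda>(C, h). (pb n C, \<lambda>z. lev (z n / z (n + 1)) (h (forget n z)))) ` F"

lemma ratio_ev: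
  assumes "cone_point (n + 1) A q" "A \<subseteq> cone_cube (n + 1)"
  shows "\<forall>\<^sub>F t in at_right 0. q t n / q t (n + 1) \<in> {0..1}"
proof -
  obtain d where d: "d > 0" "\<forall>t\<in>{0<..<d}. q t n / q t (n + 1) \<in> {0..1}" using ratio_point[OF assms] by blast
  have "\<forall>\<^sub>F t in at_right 0. t \<in> {0<..<d}" using d(1) eventually_at_right_real by blast
  then show ?thesis by eventually_elim (use d(2) in blast)
qed

lemma pb_sub_cone: "pb n C \<subseteq> cone_cube (n + 1)"
  by (auto simp: pb_def)

lemma weak_map_track:
  assumes W: "weak_map b n (cone_cube n) P F"
  shows "weak_map b (n + 1) (cone_cube (n + 1)) P' (track n F)"
  unfolding weak_map_def
proof (intro conjI impI)
  show "finite (track n F)" using W by (simp add: weak_map_def track_def)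
  have "fst ` track n F = pb n ` fst ` F" by (force simp: track_def image_iff)
  then show "closed_subanalytic_cover (n + 1) (cone_cube (n + 1)) (fst ` track n F)"
    using pb_cover W by (simp add: weak_map_def)
  have "lva_germ (n + 1 + 1) (pb n C) origin (gdim P') (gX P') (vertex P')
      (\<lambda>z. lev (z n / z (n + 1)) (h (forget n z)))" if C: "(C, h) \<in> F" for C h
  proof -
    obtain d where d: "d > 0" "bsub (n + 1) (nbd (n + 1) origin d C)" using weak_map_component(1)[OF W C] by blast
    have near: "near_Rn (n + 1 + 1) origin (pb n C)" by (rule near_Rn_subset[OF pb_Rn])
    have "lva_germ (n + 1 + 1) (pb n C) origin (gdim P) (gX P) (vertex P) (h \<circ> forget n)"
      by (rule lva_germ_comp[OF forget_germ[OF d] weak_map_component(3)[OF W C] near weak_map_component(2)[OF W C]])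
    then have "lva_germ (n + 1 + 1) (pb n C) origin (gdim P') (gX P') (vertex P')
      (\<lambda>z. lev (z n / z (n + 1)) ((h \<circ> forget n) z))"
    proof (rule lva_germ_lev[OF _ near d(1)])
      show "bmap (n + 1 + 1) (nbd (n + 1 + 1) origin d (pb n C)) 1 (\<lambda>z. single (z n / z (n + 1)))"
        by (rule bmap_ratio[OF bsub_pb[OF d(2)]]) (auto simp: nbd_def pb_def mem_cone_cube)
      show "z n / z (n + 1) \<in> {0..1}" if "z \<in> nbd (n + 1 + 1) origin d (pb n C)" for z
        using that by (auto simp: nbd_def pb_def mem_cone_cube)
    qed
    then show ?thesis by simp
  qed
  then show "\<forall>(C, h)\<in>track n F. lva_germ (n + 1 + 1) C origin (gdim P') (gX P') (vertex P') h"
    unfolding track_def by auto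
  show "agree b (n + 1) (gdist P') (track n F) (track n F)"
  proof (cases "b = \<infinity>")
    case True
    then obtain h where "F = {(cone_cube n, h)}" using W by (auto simp: weak_map_def)
    then show ?thesis using True by (auto simp: agree_def track_def intro: exI[of _ 1])
  next
    case False
    have "b_equiv b (gdist P') ((\<lambda>z. lev (z n / z (n + 1)) (h (forget n z))) \<circ> q)
        ((\<lambda>z. lev (z n / z (n + 1)) (h' (forget n z))) \<circ> q)"
      if C: "(C, h) \<in> F" and C': "(C', h') \<in> F" and q: "cone_point (n + 1) (pb n C \<inter> pb n C') q" for C h C' h' q
    proof -
      have p: "cone_point n (C \<inter> C') (forget n \<circ> q)" by (rule forget_point[OF q]) (auto simp: pb_def)
      have "agree b n (gdist P) F F" using W by (simp add: weak_map_def)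
      then have "b_equiv b (gdist P) (h \<circ> (forget n \<circ> q)) (h' \<circ> (forget n \<circ> q))"
        by (rule agreeD[OF _ C C' False p])
      moreover have "\<forall>\<^sub>F t in at_right 0. (h \<circ> (forget n \<circ> q)) t \<in> U" "\<forall>\<^sub>F t in at_right 0. (h' \<circ> (forget n \<circ> q)) t \<in> U"
        using point_in_U[OF weak_map_point[OF W C p]] point_in_U[OF weak_map_point[OF W C' p]] by auto
      moreover have "\<forall>\<^sub>F t in at_right 0. q t n / q t (n + 1) \<in> {0..1}"
        by (rule ratio_ev[OF q]) (use pb_sub_cone in blast)
      ultimately have "b_equiv b (gdist P') (\<lambda>t. lev (q t n / q t (n + 1)) ((h \<circ> (forget n \<circ> q)) t))
          (\<lambda>t. lev (q t n / q t (n + 1)) ((h' \<circ> (forget n \<circ> q)) t))" by (rule transport)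
      then show ?thesis by (simp add: o_def)
    qed
    then show ?thesis using False unfolding agree_def track_def by auto
  qed
  assume "b = \<infinity>"
  then obtain h where "F = {(cone_cube n, h)}" using W by (auto simp: weak_map_def)
  then show "\<exists>h. track n F = {(cone_cube (n + 1), h)}" by (auto simp: track_def pb_cone[simplified])
qed

text \<open>After \<open>insert_level n c\<close> the quotient of the last two entries is
  \<open>c\<close> and \<open>forget\<close> returns the original point, so on the cone the
  restricted track is \<open>h\<close> followed by \<open>lev c\<close>. Different pieces are
  compared through their \<open>b\<close>-equivalence on the overlap, transported at constant
  level.\<close>

lemma agree_track_level:
  assumes W: "weak_map b n (cone_cube n) P F" and c: "c \<in> {0..1}" "\<And>x. x \<in> U \<Longrightarrow> lev c x = \<phi> x"
  shows "agree b n (gdist P') (restrict_level n c (track n F)) (push \<phi> F)"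
proof -
  define T where "T h = (\<lambda>z. lev (z n / z (n + 1)) (h (forget n z))) \<circ> insert_level n c" for h
  define R where "R C = {z \<in> cone_cube n. insert_level n c z \<in> pb n C}" for C
  have RC: "R C \<subseteq> C \<inter> cone_cube n" for C
    using forget_insert_level cone_cube_Rn by (fastforce simp: R_def pb_def)
  have T: "T h z = lev c (h z)" if "z \<in> cone_cube n" for h z
  proof -
    have "z n > 0" "z \<in> Rn (n + 1)" using that by (auto simp: mem_cone_cube)
    then show ?thesis using insert_level_apply(2,3)[of n c z] forget_insert_level[of z n c] by (simp add: T_def)
  qed
  have res: "restrict_level n c (track n F) = (\<lambda>(C, h). (R C, T h)) ` F"
    unfolding restrict_level_def track_def R_def T_def image_image by (rule image_cong) auto
  show ?thesis
  proof (cases "b = \<infinity>")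
    case True
    then obtain h where Fh: "F = {(cone_cube n, h)}" using W by (auto simp: weak_map_def)
    have h: "(cone_cube n, h) \<in> F" using Fh by simp
    obtain e2 K2 where e2: "e2 > 0" "K2 > 0" "\<forall>e'. 0 < e' \<longrightarrow> e' \<le> e2 \<longrightarrow>
        bmap (n + 1) (nbd (n + 1) origin e' (cone_cube n)) (gdim P) h \<and> h ` nbd (n + 1) origin e' (cone_cube n) \<subseteq> gX P \<and>
        lva_on (n + 1) (nbd (n + 1) origin e' (cone_cube n)) origin (gdim P) (vertex P) K2 h"
      by (rule lva_germE[OF weak_map_component(3,2)[OF W h]])
    \<comment> \<open>For infinite \<open>b\<close> equality is needed on a whole neighbourhood; the
      radius \<open>e / K2\<close> keeps \<open>h z\<close> in \<open>U\<close>, where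
      \<open>lev c\<close> and \<open>\<phi>\<close> coincide.\<close>
    define d where "d = min e2 (e / K2)"
    have d: "d > 0" "d \<le> e2" "d \<le> e / K2" using e2 e_pos by (auto simp: d_def)
    have "T h z = \<phi> (h z)" if z: "z \<in> nbd (n + 1) origin d (cone_cube n)" for z
    proof -
      note G = e2(3)[rule_format, OF d(1,2)]
      have zc: "z \<in> cone_cube n" using z by (simp add: nbd_def)
      have "edist (gdim P) (h z) (vertex P) \<le> K2 * edist (n + 1) z origin"
        using bspec[OF G[THEN conjunct2, THEN conjunct2, unfolded lva_on_def, THEN conjunct2] z] by (rule conjunct2)
      also have "\<dots> < K2 * d" using z e2(2) by (simp add: nbd_def)
      also have "\<dots> \<le> e" using d(3) e2(2) by (simp add: field_simps)
      finally have "edist (gdim P) (h z) (vertex P) < e" .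
      moreover have "h z \<in> gX P" by (rule subsetD[OF G[THEN conjunct2, THEN conjunct1] imageI[OF z]])
      ultimately have "h z \<in> U" by (simp add: nbd_def)
      then show ?thesis unfolding T[OF zc] by (rule c(2))
    qed
    then have "\<forall>z\<in>nbd (n + 1) origin d (R (cone_cube n) \<inter> cone_cube n). T h z = (\<phi> \<circ> h) z"
      by (auto simp: nbd_def)
    then show ?thesis using True d(1) unfolding res unfolding Fh push_def agree_def by auto
  next
    case False
    have "b_equiv b (gdist P') (T h \<circ> q) (\<phi> \<circ> h' \<circ> q)"
      if C: "(C, h) \<in> F" and C': "(C', h') \<in> F" and q: "cone_point n (R C \<inter> C') q" for C h C' h' q
    proof -
      have q': "cone_point n (C \<inter> C') q" by (rule cone_point_mono[OF q]) (use RC in blast)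
      have "agree b n (gdist P) F F" using W by (simp add: weak_map_def)
      then have 1: "b_equiv b (gdist P) (h \<circ> q) (h' \<circ> q)" by (rule agreeD[OF _ C C' False q'])
      have ev: "\<forall>\<^sub>F t in at_right 0. (h \<circ> q) t \<in> U" "\<forall>\<^sub>F t in at_right 0. (h' \<circ> q) t \<in> U"
        using point_in_U[OF weak_map_point[OF W C q']] point_in_U[OF weak_map_point[OF W C' q']] by auto
      have "b_equiv b (gdist P') (\<lambda>t. lev c ((h \<circ> q) t)) (\<lambda>t. lev c ((h' \<circ> q) t))"
        by (rule transport[OF 1 ev]) (use c(1) in simp)
      then show ?thesis
      proof (rule b_equiv_cong)
        show "\<forall>\<^sub>F t in at_right 0. lev c ((h \<circ> q) t) = (T h \<circ> q) t"
          using is_point_near[OF q[unfolded cone_point_def] e_pos]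
        proof eventually_elim
          case (elim t)
          then have "q t \<in> cone_cube n" using RC[of C] unfolding nbd_def by blast
          then show ?case by (simp add: T)
        qed
        show "\<forall>\<^sub>F t in at_right 0. lev c ((h' \<circ> q) t) = (\<phi> \<circ> h' \<circ> q) t"
          using ev(2) by eventually_elim (use c(2) in simp)
      qed
    qed
    then show ?thesis using False unfolding res push_def agree_def by auto
  qed
qed

text \<open>Over the open box both pieces of the loop are \<open>b\<close>-equivalent to the base
  point, first along a normal point and then, by reparametrization, along \<open>p\<close>. Every
  level sends the base point to the base point, so the track and the constant homotopy are both
  \<open>b\<close>-equivalent to the same image.\<close>

lemma relative_on_track:
  assumes F: "F \<in> MDGamma b n P"
  shows "relative_on b n P' (germ_cone n (open_box n)) (push f F) (track n F)"
proof -
  define W where "W = germ_cone n (open_box n)"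
  have wm: "weak_map b n (cone_cube n) P F"
    using F by (simp add: MDGamma_def)
  note N = MDGamma_normal[OF F, folded W_def]
  have "b_equiv b (gdist P') ((\<lambda>z. lev (z n / z (n + 1)) (h (forget n z))) \<circ> q) ((f \<circ> h') \<circ> forget n \<circ> q)"
    if C: "(C, h) \<in> F" and D: "(D, h') \<in> F" and q: "cone_point (n + 1) (pb n C \<inter> over n (W \<inter> D)) q" for C h D h' q
  proof -
    define A where "A = C \<inter> (W \<inter> D)"
    define p where "p = forget n \<circ> q"
    define s where "s t = q t n / q t (n + 1)" for t
    have p: "cone_point n A p" unfolding p_def by (rule forget_point[OF q]) (auto simp: pb_def over_def A_def)
    have s01: "\<forall>\<^sub>F t in at_right 0. s t \<in> {0..1}"
      unfolding s_def by (rule ratio_ev[OF q]) (use pb_sub_cone in blast)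
    have Ac: "A \<subseteq> cone_cube n" unfolding A_def W_def using germ_cone_mono[OF open_box_cube(1)] by blast
    from cone_point_normal_reparam[OF p Ac] obtain q' L where Q: "normal_point n A q' \<and> L > 0 \<and>
        (\<forall>\<^sub>F t in at_right 0. 0 < p t n \<and> p t n \<le> L * t \<and> q' (p t n) = p t) \<and>
        filterlim (\<lambda>t. p t n) (at_right 0) (at_right 0)" by (elim exE)
    note q' = Q[THEN conjunct1] and ev = Q[THEN conjunct2, THEN conjunct2, THEN conjunct1]
      and lim = Q[THEN conjunct2, THEN conjunct2, THEN conjunct2]
    have ev': "\<forall>\<^sub>F t in at_right 0. 0 < p t n \<and> p t n \<le> L * t" using ev by eventually_elim blast
    \<comment> \<open>The base point at time \<open>p t n\<close>, the height, instead of
      \<open>t\<close>: undoing the normalization changes the time on both sides of the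
      equivalence.\<close>
    define \<beta> where "\<beta> t = basept P (p t n)" for t
    have to_base: "b_equiv b (gdist P) (\<lambda>t. k (p t)) \<beta>" if "(E, k) \<in> F" "A \<subseteq> E \<inter> W" for E k
    proof (rule b_equiv_cong)
      show "b_equiv b (gdist P) (\<lambda>t. (k \<circ> q') (p t n)) (\<lambda>t. basept P (p t n))"
        by (rule b_equiv_reparam[OF N[OF that(1) normal_point_mono[OF q' that(2)]] b_pos lim ev'])
      show "\<forall>\<^sub>F t in at_right 0. (k \<circ> q') (p t n) = k (p t)" using ev by eventually_elim simp
    qed (simp add: \<beta>_def)
    have inU: "\<forall>\<^sub>F t in at_right 0. k (p t) \<in> U" if "(E, k) \<in> F" "A \<subseteq> E" for E k
      using point_in_U[OF weak_map_point[OF wm that(1) p that(2)] order_refl] by simp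
    have \<beta>U: "\<forall>\<^sub>F t in at_right 0. \<beta> t \<in> U"
      unfolding \<beta>_def using lim point_in_U[OF base Y_sub] unfolding filterlim_iff by blast
    have \<beta>lev: "\<forall>\<^sub>F t in at_right 0. \<forall>s\<in>{0..1}. lev s (\<beta> t) = basept P' (p t n)"
      using lim lev_base unfolding filterlim_iff \<beta>_def by blast
    have hU: "\<forall>\<^sub>F t in at_right 0. h (p t) \<in> U" by (rule inU[OF C]) (simp add: A_def)
    have h'U: "\<forall>\<^sub>F t in at_right 0. h' (p t) \<in> U" by (rule inU[OF D]) (simp add: A_def le_infI2)
    have "b_equiv b (gdist P') (\<lambda>t. lev (s t) (h (p t))) (\<lambda>t. lev (s t) (\<beta> t))"
      by (rule transport[OF to_base[OF C] hU \<beta>U s01]) (auto simp: A_def)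
    \<comment> \<open>All levels agree on \<open>\<beta>\<close>, so there the varying level
      \<open>s t\<close> may be exchanged for the constant level \<open>0\<close>.\<close>
    then have 1: "b_equiv b (gdist P') (\<lambda>t. lev (s t) (h (p t))) (\<lambda>t. lev 0 (\<beta> t))"
    proof (rule b_equiv_cong)
      show "\<forall>\<^sub>F t in at_right 0. lev (s t) (\<beta> t) = lev 0 (\<beta> t)" using \<beta>lev s01 by eventually_elim simp
    qed simp
    have "b_equiv b (gdist P') (\<lambda>t. lev 0 (h' (p t))) (\<lambda>t. lev 0 (\<beta> t))"
      by (rule transport[OF to_base[OF D] h'U \<beta>U]) (auto simp: A_def)
    then have 2: "b_equiv b (gdist P') (\<lambda>t. lev 0 (\<beta> t)) (\<lambda>t. lev 0 (h' (p t)))"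
      by (rule b_equiv_sym[OF metric(2)])
    have "b_equiv b (gdist P') (\<lambda>t. lev (s t) (h (p t))) (\<lambda>t. lev 0 (h' (p t)))"
    proof (rule b_equiv_trans[OF metric(2) 1 2])
      show "\<forall>\<^sub>F t in at_right 0. lev (s t) (h (p t)) \<in> gX P'" using s01 hU by (rule eventually_elim2) (rule lev_X)
      show "\<forall>\<^sub>F t in at_right 0. lev 0 (\<beta> t) \<in> gX P'" using \<beta>U by (rule eventually_mono) (simp add: lev_X)
      show "\<forall>\<^sub>F t in at_right 0. lev 0 (h' (p t)) \<in> gX P'" using h'U by (rule eventually_mono) (simp add: lev_X)
    qed
    then show ?thesis
    proof (rule b_equiv_cong)
      show "\<forall>\<^sub>F t in at_right 0. lev 0 (h' (p t)) = ((f \<circ> h') \<circ> forget n \<circ> q) t"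
        using h'U by eventually_elim (simp add: lev_0 p_def)
    qed (simp add: p_def s_def)
  qed
  then show ?thesis unfolding relative_on_def track_def push_def W_def by auto
qed

text \<open>The point \<open>r\<close> of \<open>Y\<close> that accompanies the loop is moved by the
  same varying levels as the loop. Each level maps \<open>Y\<close> into \<open>Y'\<close>, so the
  moved point is a point of \<open>Y'\<close>, and \<open>transport\<close> keeps it
  \<open>b\<close>-equivalent to the track.\<close>

lemma sends_to_Y_track:
  assumes F: "F \<in> MDGamma b n P"
  shows "sends_to_Y b (n + 1) (over n (germ_cone n (cube_boundary n))) P' (track n F)"
proof -
  define B where "B = germ_cone n (cube_boundary n)"
  have wm: "weak_map b n (cone_cube n) P F" and Y: "sends_to_Y b n B P F"
    using F by (simp_all add: MDGamma_def B_def)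
  have "\<exists>r. is_point (gdim P') (gY P') (vertex P') r \<and>
      b_equiv b (gdist P') ((\<lambda>z. lev (z n / z (n + 1)) (h (forget n z))) \<circ> q) r"
    if C: "(C, h) \<in> F" and q: "cone_point (n + 1) (pb n C \<inter> over n B) q" for C h q
  proof -
    have p: "cone_point n (C \<inter> B) (forget n \<circ> q)" by (rule forget_point[OF q]) (auto simp: pb_def over_def)
    obtain r where r: "is_point (gdim P) (gY P) (vertex P) r" "b_equiv b (gdist P) (h \<circ> (forget n \<circ> q)) r"
      using sends_to_YD[OF Y C p] by blast
    have rX: "is_point (gdim P) (gX P) (vertex P) r" by (rule is_point_mono[OF r(1) Y_sub])
    define s where "s t = q t n / q t (n + 1)" for t
    have sub: "pb n C \<inter> over n B \<subseteq> cone_cube (n + 1)" using pb_sub_cone by blast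
    obtain d where d: "d > 0" "bmap 1 (single ` {0<..<d}) 1 (\<lambda>z. single (s (z 0)))" "\<And>t. t \<in> {0<..<d} \<Longrightarrow> s t \<in> {0..1}"
      using ratio_point[OF q sub] unfolding s_def by blast
    have s01: "\<forall>\<^sub>F t in at_right 0. s t \<in> {0..1}" unfolding s_def by (rule ratio_ev[OF q sub])
    have "is_point (gdim P') (gY P') (vertex P') (\<lambda>t. lev (s t) (r t))"
    proof (rule is_point_target[OF is_point_lev[OF rX d]])
      show "\<forall>\<^sub>F t in at_right 0. lev (s t) (r t) \<in> gY P'"
        using s01 point_in_U[OF rX order_refl] is_point_near[OF r(1) e_pos]
      proof eventually_elim
        case (elim t)
        have "r t \<in> gY P" using elim(3) by (simp add: nbd_def)
        then show ?case by (rule lev_Y[OF elim(1,2)])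
      qed
    qed
    moreover have "\<forall>\<^sub>F t in at_right 0. (h \<circ> (forget n \<circ> q)) t \<in> U"
      using point_in_U[OF weak_map_point[OF wm C p]] by auto
    then have "b_equiv b (gdist P') (\<lambda>t. lev (s t) ((h \<circ> (forget n \<circ> q)) t)) (\<lambda>t. lev (s t) (r t))"
      using transport[OF r(2)] point_in_U[OF rX order_refl] s01 by blast
    ultimately show ?thesis by (auto simp: o_def s_def)
  qed
  then show ?thesis unfolding sends_to_Y_def track_def B_def by auto
qed

lemma homotopic_push:
  assumes F: "F \<in> MDGamma b n P"
  shows "homotopic b n P' (push f F) (push g F)"
proof -
  have W: "weak_map b n (cone_cube n) P F" using F by (simp add: MDGamma_def)
  have "weak_homotopy b n P' (push f F) (push g F) (track n F)"
    unfolding weak_homotopy_def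
    using weak_map_track[OF W] agree_track_level[OF W, of 0 f] agree_track_level[OF W, of 1 g] lev_0 lev_1 by simp
  moreover have "push f F \<in> MDGamma b n P'" "push g F \<in> MDGamma b n P'"
    using push_MDGamma[OF F pair_maps(1), of 0] push_MDGamma[OF F pair_maps(2), of 1] lev_0 lev_1 by simp_all
  ultimately show ?thesis
    unfolding homotopic_def using relative_on_track[OF F] sends_to_Y_track[OF F] by blast
qed

end

theorem proposition42:
  fixes P P' :: pgerm
  assumes "pointed_pair P" and "pointed_pair P'"
  shows "(\<forall>f g. lva_pair_map P P' f \<and> lva_pair_map P P' g \<and> lva_homotopic P P' f g \<longrightarrow>
            (\<forall>k. \<forall>c\<in>MDpi \<infinity> k P. induced \<infinity> k P' f c = induced \<infinity> k P' g c)) \<and>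
         (\<forall>f g. metrically_homotopic P P' f g \<longrightarrow>
            (\<forall>k. \<forall>b::ereal. 0 < b \<longrightarrow>
               (\<forall>c\<in>MDpi b k P. induced b k P' f c = induced b k P' g c)))"
proof (intro conjI allI impI ballI)
  fix f g k c
  assume fg: "lva_pair_map P P' f \<and> lva_pair_map P P' g \<and> lva_homotopic P P' f g" and c: "c \<in> MDpi \<infinity> k P"
  obtain e K H where H: "lva_homotopy P P' f g e K H" using fg by (auto simp: lva_homotopic_def)
  \<comment> \<open>The Lipschitz clause carries the premise \<open>b \<noteq> \<infinity>\<close>
    and holds trivially here.\<close>
  interpret pair_homotopy P P' f g e K H \<infinity>
    by unfold_locales (use assms fg H in auto)
  show "induced \<infinity> k P' f c = induced \<infinity> k P' g c" by (rule induced_eqI[OF homotopic_push c])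
next
  fix f g k and b :: ereal and c
  assume fg: "metrically_homotopic P P' f g" and b: "0 < b" and c: "c \<in> MDpi b k P"
  obtain e K H where H: "lva_homotopy P P' f g e K H"
    and L: "\<forall>s\<in>{0..1}. \<forall>x\<in>nbd (gdim P) (vertex P) e (gX P). \<forall>y\<in>nbd (gdim P) (vertex P) e (gX P).
           gdist P' (level (gdim P) H s x) (level (gdim P) H s y) \<le> K * gdist P x y"
    using fg unfolding metrically_homotopic_def by blast
  \<comment> \<open>A metric homotopy supplies one \<open>K\<close> that is at once l.v.a. and
    Lipschitz constant of every level, and \<open>b\<close> may be finite or infinite.\<close>
  interpret pair_homotopy P P' f g e K H b
    by unfold_locales (use assms fg H L b in \<open>auto simp: metrically_homotopic_def lipschitz_pair_map_def\<close>)
  show "induced b k P' f c = induced b k P' g c" by (rule induced_eqI[OF homotopic_push c])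
qed

end
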